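(* Let $T>0$ and suppose that $(B,\rho,P)\in C^1([0,T]\times\mathbb{T}^d,\mathbb{R}^d\times\mathbb{R}_+\times\mathbb{R}^d)$, with $\rho>0$, is a classical solution of the Eulerian heat equation $$\partial_tB+\nabla\cdot\left(\frac{B\otimes P-P\otimes B}{\rho}\right)=0,\quad\nabla\cdot B=0,\quad\partial_t\rho+\nabla\cdot P=0,\quad P=\nabla\cdot\left(\frac{B\otimes B}{\rho}\right).$$ Then $(B,\rho,P)$ is the unique dissipative solution on $[0,T]$ of the Eulerian heat equation with initial condition $(B_0,\rho_0)=(B(0,\cdot),\rho(0,\cdot))$.
   Context: Notation. $\mathbb{T}^d=(\mathbb{R}/\mathbb{Z})^d$ is the flat torus. Spaces $C(\cdot)'$ are duals of spaces of continuous functions, i.e. spaces of finite (vector-valued) Borel measures; continuous functions are identified with measures through their densities with respect to Lebesgue measure. $C([0,T],C(\mathbb{T}^d,\mathbb{R}^m)'_{w^*})$ denotes maps from $[0,T]$ to measures that are continuous for the weak-* topology. In coordinates (summation over repeated indices), the Eulerian heat equation reads $$\partial_tB^i+\partial_j\left(\frac{B^iP^j-P^iB^j}{\rho}\right)=0,\quad\partial_jB^j=0,\quad\partial_t\rho+\partial_jP^j=0,\quad P^i=\partial_j\left(\frac{B^iB^j}{\rho}\right).$$ Integrals with $\rho$ in the denominator. For measures $U$ (vector-valued) and $\rho$ (real-valued), $\int\frac{|U|^2}{2\rho}\in[0,+\infty]$ is the convex, one-homogeneous functional $\sup\{\int\theta\rho+\Theta\cdot U:\ (\theta,\Theta)\text{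 continuous},\ \theta+\frac12|\Theta|^2\le0\}$. Equivalently, it is $\frac12\int|u|^2\rho$ if $\rho\ge0$ and $U=\rho u$ with $u\in L^2(\rho)$, and $+\infty$ otherwise. Similarly, for a continuous field $Q$ of symmetric matrices with $Q\ge I$, $\int\frac{U^{T}QU}{2\rho}$ equals $\frac12\int u^{T}Qu\,\rho$ if $\rho\ge0$ and $U=\rho u$ with $u\in L^2(\rho)$, and $+\infty$ otherwise. When time integrals are present, these expressions are understood for measures on space-time, with $\rho(t,dx)\,dt$ as the space-time measure associated with $\rho$. Definition (dissipative solution). Fix $T>0$. A triple $(B,\rho,P)$ with $(B,\rho)\in C([0,T],C(\mathbb{T}^d,\mathbb{R}^d\times\mathbb{R})'_{w^*})$ and $P\in C([0,T]\times\mathbb{T}^d,\mathbb{R}^d)'$ is a dissipative solution of the Eulerian heat equation with initial data $(B_0,\rho_0\ge0)\in C(\mathbb{T}^d;\mathbb{R}^d\times\mathbb{R})'$ if and only if: (i) $(B(0),\rho(0))=(B_0,\rho_0)$, and $\nabla\cdot B=0$, $\partial_t\rho+\nabla\cdot P=0$ in the sense of distributions; (ii) for any $b^*,v^*\in C^1([0,T]\times\mathbb{T}^d,\mathbb{R}^d)$, the inequality $$E(t)e^{-rt}+\int_0^te^{-rt'}\left[\int_{\mathbb{T}^d}\frac{\widetilde U^{T}Q_r\widetilde U}{2\rho}(t')-R(t')\right]dt'\le E(0)<+\infty$$ holds for all $t\in[0,T]$ and all $r\ge r_0$, where $$\widetilde U=(B-\rho b^*,\,P-\rho v^* ),\qquad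 E(t)=\int_{\mathbb{T}^d}\frac{|B-\rho b^*|^2}{2\rho}(t),$$ $$Q_r=\begin{pmatrix}-\nabla v^*-(\nabla v^* )^{T}+rI_d&\nabla b^*-(\nabla b^* )^{T}\\(\nabla b^* )^{T}-\nabla b^*&2I_d\end{pmatrix},\qquad(\nabla w)_{ij}=\partial_jw_i,$$ $$R=\int_{\mathbb{T}^d}\rho\,\mathrm{L}_1+B\cdot\mathrm{L}_2+P\cdot\mathrm{L}_3,$$ $$\mathrm{L}_1=|v^*|^2+D_t^*\left(\frac{|b^*|^2}{2}\right)-(b^*\cdot\nabla)(b^*\cdot v^* ),\qquad D_t^*=\partial_t+v^*\cdot\nabla,$$ $$\mathrm{L}_2=-D_t^*b^*+(b^*\cdot\nabla)v^*,\qquad\mathrm{L}_3=-v^*+(b^*\cdot\nabla)b^*,$$ and $r_0$ is a constant depending on $b^*,v^*$, chosen so that $Q_{r_0}\ge I_{2d}$ for every $(t,x)$ (the inequality is required for every such choice of $r_0$). *)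

theory Defs
  imports "HOL-Analysis.Analysis"
begin

section \<open>Functions on the torus and on space-time\<close>

text \<open>
  The torus $\mathbb{T}^d$ is \<^typ>\<open>real^'d\<close> modulo the integer lattice, so that $d$ is the
  cardinality of the (finite, nonempty) index type.  Functions on the torus are functions on
  \<^typ>\<open>real^'d\<close> that are 1-periodic in every coordinate; functions on
  $[0,T]\times\mathbb{T}^d$ have arguments in \<^typ>\<open>real \<times> (real^'d)\<close>, and only their values at times
  in $[0,T]$ matter.  The half-open unit cell is a Borel fundamental domain and carries the measures.
\<close>

definition unit_cell :: "(real^'d) set" where
  "unit_cell = {x. \<forall>i. 0 \<le> x $ i \<and> x $ i < 1}"

definition C_torus :: "(real^'d \<Rightarrow> 'b::real_normed_vector) set" where
  "C_torus = {f. continuous_on UNIV f \<and> (\<forall>x i. f (x + axis i 1) = f x)}"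

definition C_st :: "real \<Rightarrow> (real \<times> (real^'d) \<Rightarrow> 'b::real_normed_vector) set" where
  "C_st T = {f. continuous_on ({0..T} \<times> UNIV) f \<and>
               (\<forall>t\<in>{0..T}. \<forall>x i. f (t, x + axis i 1) = f (t, x))}"

definition C1_st :: "real \<Rightarrow> (real \<times> (real^'d) \<Rightarrow> 'b::real_normed_vector) set" where
  "C1_st T = {f. f \<in> C_st T \<and>
     (\<exists>f' :: real \<times> (real^'d) \<Rightarrow> (real \<times> (real^'d)) \<Rightarrow>\<^sub>L 'b.
        continuous_on ({0..T} \<times> UNIV) f' \<and>
        (\<forall>z \<in> {0..T} \<times> UNIV.
           (f has_derivative blinfun_apply (f' z)) (at z within {0..T} \<times> UNIV)))}"

primrec Ck :: "nat \<Rightarrow> ('a::real_normed_vector \<Rightarrow> real) \<Rightarrow> bool" where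
  "Ck 0 f \<longleftrightarrow> continuous_on UNIV f"
| "Ck (Suc n) f \<longleftrightarrow> (\<forall>z. f differentiable (at z)) \<and>
                    (\<forall>v. Ck n (\<lambda>z. frechet_derivative f (at z) v))"

text \<open>Test functions in $C_c^\infty((0,T)\times\mathbb{T}^d)$.\<close>

definition test_functions :: "real \<Rightarrow> (real \<times> (real^'d) \<Rightarrow> real) set" where
  "test_functions T = {\<phi>. (\<forall>n. Ck n \<phi>) \<and> (\<forall>t x i. \<phi> (t, x + axis i 1) = \<phi> (t, x)) \<and>
     (\<exists>\<epsilon>>0. \<forall>t x. \<phi> (t, x) \<noteq> 0 \<longrightarrow> \<epsilon> \<le> t \<and> t \<le> T - \<epsilon>)}"


section \<open>Derivatives\<close>

definition dt :: "real \<Rightarrow> (real \<times> (real^'d) \<Rightarrow> 'b::real_normed_vector) \<Rightarrow> real \<times> (real^'d) \<Rightarrow> 'b" where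
  "dt T f = (\<lambda>(t, x). vector_derivative (\<lambda>s. f (s, x)) (at t within {0..T}))"

text \<open>\<open>advect a f\<close> is $(a\cdot\nabla)f$, for scalar or vector valued $f$.\<close>

definition advect :: "(real \<times> (real^'d) \<Rightarrow> real^'d) \<Rightarrow> (real \<times> (real^'d) \<Rightarrow> 'b::real_normed_vector)
    \<Rightarrow> real \<times> (real^'d) \<Rightarrow> 'b" where
  "advect a f = (\<lambda>(t, x). frechet_derivative (\<lambda>y. f (t, y)) (at x) (a (t, x)))"

definition pd :: "'d \<Rightarrow> (real \<times> (real^'d) \<Rightarrow> real) \<Rightarrow> real \<times> (real^'d) \<Rightarrow> real" where
  "pd j f = advect (\<lambda>_. axis j 1) f"

definition grad :: "(real \<times> (real^'d) \<Rightarrow> real) \<Rightarrow> real \<times> (real^'d) \<Rightarrow> real^'d" where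
  "grad f z = (\<chi> j. pd j f z)"

text \<open>The convention is $(\nabla w)_{ij}=\partial_jw_i$.\<close>

definition Jac :: "(real \<times> (real^'d) \<Rightarrow> real^'d) \<Rightarrow> real \<times> (real^'d) \<Rightarrow> real^'d^'d" where
  "Jac w z = (\<chi> i j. pd j (\<lambda>z'. w z' $ i) z)"


section \<open>Measures as elements of duals of spaces of continuous functions\<close>

text \<open>
  A measure is a bounded linear functional on a space \<open>C\<close> of continuous functions with the
  supremum norm over \<open>K\<close>.  Its values outside \<open>C\<close> are irrelevant, so two measures are
  identified when they agree on \<open>C\<close>.
\<close>

definition in_dual :: "'a set \<Rightarrow> ('a \<Rightarrow> 'b::real_normed_vector) set \<Rightarrow> (('a \<Rightarrow> 'b) \<Rightarrow> real) \<Rightarrow> bool" where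
  "in_dual K C L \<longleftrightarrow>
     (\<forall>f\<in>C. \<forall>g\<in>C. L (\<lambda>z. f z + g z) = L f + L g) \<and>
     (\<forall>c. \<forall>f\<in>C. L (\<lambda>z. c *\<^sub>R f z) = c * L f) \<and>
     (\<exists>M. \<forall>f\<in>C. \<forall>N. (\<forall>z\<in>K. norm (f z) \<le> N) \<longrightarrow> \<bar>L f\<bar> \<le> M * N)"

type_synonym ('d, 'b) torus_functional = "(real^'d \<Rightarrow> 'b) \<Rightarrow> real"
type_synonym ('d, 'b) st_functional = "(real \<times> (real^'d) \<Rightarrow> 'b) \<Rightarrow> real"

abbreviation torus_measure :: "('d::finite, 'b::real_normed_vector) torus_functional \<Rightarrow> bool" where
  "torus_measure \<equiv> in_dual UNIV C_torus"

abbreviation st_measure :: "real \<Rightarrow> ('d::finite, 'b::real_normed_vector) st_functional \<Rightarrow> bool" where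
  "st_measure T \<equiv> in_dual ({0..T} \<times> UNIV) (C_st T)"

text \<open>Continuous functions as measures, through their densities.\<close>

definition torus_density :: "(real^'d \<Rightarrow> 'b::euclidean_space) \<Rightarrow> ('d, 'b) torus_functional" where
  "torus_density f = (\<lambda>\<phi>. LINT x:unit_cell|lborel. \<phi> x \<bullet> f x)"

definition st_density :: "real \<Rightarrow> (real \<times> (real^'d) \<Rightarrow> 'b::euclidean_space) \<Rightarrow> ('d, 'b) st_functional" where
  "st_density T f = (\<lambda>\<phi>. LINT z:{0..T} \<times> unit_cell|lborel. \<phi> z \<bullet> f z)"

definition weak_star_continuous ::
    "real \<Rightarrow> (real \<Rightarrow> ('d::finite, 'b::real_normed_vector) torus_functional) \<Rightarrow> bool" where
  "weak_star_continuous T L \<longleftrightarrow> (\<forall>t\<in>{0..T}. torus_measure (L t)) \<and>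
     (\<forall>\<phi>\<in>C_torus. continuous_on {0..T} (\<lambda>t. L t \<phi>))"

text \<open>Finite nonnegative Borel measures on $[0,t]\times\mathbb{T}^d$.\<close>

definition st_borel :: "real \<Rightarrow> (real \<times> (real^'d)) measure \<Rightarrow> bool" where
  "st_borel t \<mu> \<longleftrightarrow> sets \<mu> = sets (restrict_space borel ({0..t} \<times> unit_cell)) \<and> finite_measure \<mu>"

text \<open>
  The integral of a bounded Borel field \<open>g\<close> against a space-time vector measure \<open>L\<close>: by the Riesz
  theorem \<open>L\<close> has the form $f\mu$ with $\mu$ a finite nonnegative measure and $f\in L^1(\mu)$, and
  the integral does not depend on that representation.  It is used to restrict a measure on
  $[0,T]\times\mathbb{T}^d$ to $[0,t]\times\mathbb{T}^d$.
\<close>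

definition borel_integral ::
    "real \<Rightarrow> ('d::finite, 'b::euclidean_space) st_functional \<Rightarrow> (real \<times> (real^'d) \<Rightarrow> 'b) \<Rightarrow> real" where
  "borel_integral T L g = (THE y. \<exists>\<mu> f. st_borel T \<mu> \<and> integrable \<mu> f \<and>
      (\<forall>\<phi>\<in>C_st T. L \<phi> = (\<integral>z. \<phi> z \<bullet> f z \<partial>\<mu>)) \<and> y = (\<integral>z. g z \<bullet> f z \<partial>\<mu>))"

definition integral_upto ::
    "real \<Rightarrow> real \<Rightarrow> ('d::finite, 'b::euclidean_space) st_functional \<Rightarrow> (real \<times> (real^'d) \<Rightarrow> 'b) \<Rightarrow> real" where
  "integral_upto T t L \<phi> = borel_integral T L (\<lambda>z. indicator ({0..t} \<times> UNIV) z *\<^sub>R \<phi> z)"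

text \<open>The measure $L(s,dx)\,ds$ on $[0,t]\times\mathbb{T}^d$.\<close>

definition st_lift ::
    "real \<Rightarrow> (real \<Rightarrow> ('d::finite, 'b::real_normed_vector) torus_functional) \<Rightarrow> ('d, 'b) st_functional" where
  "st_lift t L = (\<lambda>\<phi>. LINT s:{0..t}|lborel. L s (\<lambda>x. \<phi> (s, x)))"


section \<open>Integrals with the density in the denominator\<close>

text \<open>$\int\frac{|U|^2}{2\rho}$ on the torus.\<close>

definition kinetic :: "('d::finite, real) torus_functional \<Rightarrow> ('d, real^'d) torus_functional \<Rightarrow> ereal" where
  "kinetic \<rho> U = Sup {ereal (\<rho> \<theta> + U \<Theta>) | \<theta> \<Theta>.
     \<theta> \<in> C_torus \<and> \<Theta> \<in> C_torus \<and> (\<forall>x. \<theta> x + 1/2 * (norm (\<Theta> x))\<^sup>2 \<le> 0)}"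

text \<open>
  $\int\frac{U^TQU}{2\rho}$ on $[0,t]\times\mathbb{T}^d$.  The set below is a singleton if
  $\rho\ge0$ and $U=\rho u$ with $u\in L^2(\rho)$; otherwise it is empty and its infimum is $+\infty$.
\<close>

definition st_quad_energy :: "real \<Rightarrow> (real \<times> (real^'d) \<Rightarrow> 'b \<Rightarrow> 'b) \<Rightarrow>
    ('d, real) st_functional \<Rightarrow> ('d, 'b::euclidean_space) st_functional \<Rightarrow> ereal" where
  "st_quad_energy t Q \<rho> U = Inf {ereal (1/2 * (\<integral>z. u z \<bullet> Q z (u z) \<partial>\<mu>)) | \<mu> u.
     st_borel t \<mu> \<and> (\<forall>\<theta>\<in>C_st t. \<rho> \<theta> = (\<integral>z. \<theta> z \<partial>\<mu>)) \<and>
     u \<in> borel_measurable \<mu> \<and> integrable \<mu> (\<lambda>z. (norm (u z))\<^sup>2) \<and>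
     (\<forall>\<Theta>\<in>C_st t. U \<Theta> = (\<integral>z. \<Theta> z \<bullet> u z \<partial>\<mu>))}"


section \<open>Classical solutions\<close>

definition classical_solution :: "real \<Rightarrow> (real \<times> (real^'d) \<Rightarrow> real^'d) \<Rightarrow>
    (real \<times> (real^'d) \<Rightarrow> real) \<Rightarrow> (real \<times> (real^'d) \<Rightarrow> real^'d) \<Rightarrow> bool" where
  "classical_solution T B \<rho> P \<longleftrightarrow>
     B \<in> C1_st T \<and> \<rho> \<in> C1_st T \<and> P \<in> C1_st T \<and>
     (\<forall>z \<in> {0..T} \<times> UNIV. \<rho> z > 0) \<and>
     (\<forall>z \<in> {0..T} \<times> UNIV.
        (\<forall>i. dt T (\<lambda>y. B y $ i) z
             + (\<Sum>j\<in>UNIV. pd j (\<lambda>y. (B y $ i * P y $ j - P y $ i * B y $ j) / \<rho> y) z) = 0) \<and>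
        (\<Sum>j\<in>UNIV. pd j (\<lambda>y. B y $ j) z) = 0 \<and>
        dt T \<rho> z + (\<Sum>j\<in>UNIV. pd j (\<lambda>y. P y $ j) z) = 0 \<and>
        (\<forall>i. P z $ i = (\<Sum>j\<in>UNIV. pd j (\<lambda>y. B y $ i * B y $ j / \<rho> y) z)))"


section \<open>Dissipative solutions\<close>

definition energy :: "(real \<times> (real^'d) \<Rightarrow> real^'d) \<Rightarrow>
    (real \<Rightarrow> ('d, real^'d) torus_functional) \<Rightarrow> (real \<Rightarrow> ('d, real) torus_functional) \<Rightarrow> real \<Rightarrow> ereal" where
  "energy b B \<rho> t = kinetic (\<rho> t) (\<lambda>\<Theta>. B t \<Theta> - \<rho> t (\<lambda>x. b (t, x) \<bullet> \<Theta> x))"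

text \<open>$\widetilde U=(B-\rho b^*,P-\rho v^*)$, restricted to $[0,t]\times\mathbb{T}^d$.\<close>

definition U_tilde :: "real \<Rightarrow> (real \<times> (real^'d) \<Rightarrow> real^'d) \<Rightarrow> (real \<times> (real^'d) \<Rightarrow> real^'d) \<Rightarrow>
    (real \<Rightarrow> ('d, real^'d) torus_functional) \<Rightarrow> (real \<Rightarrow> ('d, real) torus_functional) \<Rightarrow>
    ('d, real^'d) st_functional \<Rightarrow> real \<Rightarrow> ('d, (real^'d) \<times> (real^'d)) st_functional" where
  "U_tilde T b v B \<rho> P t = (\<lambda>\<Theta>.
      (st_lift t B (\<lambda>z. fst (\<Theta> z)) - st_lift t \<rho> (\<lambda>z. b z \<bullet> fst (\<Theta> z)))
    + (integral_upto T t P (\<lambda>z. snd (\<Theta> z)) - st_lift t \<rho> (\<lambda>z. v z \<bullet> snd (\<Theta> z))))"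

text \<open>The block matrix $Q_r$, acting on pairs.\<close>

definition Qr :: "(real \<times> (real^'d) \<Rightarrow> real^'d) \<Rightarrow> (real \<times> (real^'d) \<Rightarrow> real^'d) \<Rightarrow> real \<Rightarrow>
    real \<times> (real^'d) \<Rightarrow> (real^'d) \<times> (real^'d) \<Rightarrow> (real^'d) \<times> (real^'d)" where
  "Qr b v r z = (\<lambda>(\<xi>, \<eta>).
     ((- Jac v z - transpose (Jac v z) + mat r) *v \<xi> + (Jac b z - transpose (Jac b z)) *v \<eta>,
      (transpose (Jac b z) - Jac b z) *v \<xi> + mat 2 *v \<eta>))"

definition Dstar :: "real \<Rightarrow> (real \<times> (real^'d) \<Rightarrow> real^'d) \<Rightarrow>
    (real \<times> (real^'d) \<Rightarrow> 'b::real_normed_vector) \<Rightarrow> real \<times> (real^'d) \<Rightarrow> 'b" where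
  "Dstar T v f z = dt T f z + advect v f z"

definition L1 :: "real \<Rightarrow> (real \<times> (real^'d) \<Rightarrow> real^'d) \<Rightarrow> (real \<times> (real^'d) \<Rightarrow> real^'d) \<Rightarrow>
    real \<times> (real^'d) \<Rightarrow> real" where
  "L1 T b v z = (norm (v z))\<^sup>2 + Dstar T v (\<lambda>y. (norm (b y))\<^sup>2 / 2) z - advect b (\<lambda>y. b y \<bullet> v y) z"

definition L2 :: "real \<Rightarrow> (real \<times> (real^'d) \<Rightarrow> real^'d) \<Rightarrow> (real \<times> (real^'d) \<Rightarrow> real^'d) \<Rightarrow>
    real \<times> (real^'d) \<Rightarrow> real^'d" where
  "L2 T b v z = - Dstar T v b z + advect b v z"

definition L3 :: "(real \<times> (real^'d) \<Rightarrow> real^'d) \<Rightarrow> (real \<times> (real^'d) \<Rightarrow> real^'d) \<Rightarrow>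
    real \<times> (real^'d) \<Rightarrow> real^'d" where
  "L3 b v z = - v z + advect b b z"

text \<open>$\int_0^te^{-rt'}R(t')\,dt'$.\<close>

definition R_term :: "real \<Rightarrow> (real \<times> (real^'d) \<Rightarrow> real^'d) \<Rightarrow> (real \<times> (real^'d) \<Rightarrow> real^'d) \<Rightarrow>
    (real \<Rightarrow> ('d, real^'d) torus_functional) \<Rightarrow> (real \<Rightarrow> ('d, real) torus_functional) \<Rightarrow>
    ('d, real^'d) st_functional \<Rightarrow> real \<Rightarrow> real \<Rightarrow> real" where
  "R_term T b v B \<rho> P r t =
      st_lift t \<rho> (\<lambda>z. exp (- r * fst z) * L1 T b v z)
    + st_lift t B (\<lambda>z. exp (- r * fst z) *\<^sub>R L2 T b v z)
    + integral_upto T t P (\<lambda>z. exp (- r * fst z) *\<^sub>R L3 b v z)"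

text \<open>
  The integrals over $[0,t]$ of the two parts of the bracket are written separately; the second one
  is finite, the first one may be $+\infty$.
\<close>

definition dissipation_inequality :: "real \<Rightarrow> (real \<times> (real^'d) \<Rightarrow> real^'d) \<Rightarrow>
    (real \<times> (real^'d) \<Rightarrow> real^'d) \<Rightarrow> (real \<Rightarrow> ('d, real^'d) torus_functional) \<Rightarrow>
    (real \<Rightarrow> ('d, real) torus_functional) \<Rightarrow> ('d, real^'d) st_functional \<Rightarrow> real \<Rightarrow> real \<Rightarrow> bool" where
  "dissipation_inequality T b v B \<rho> P r t \<longleftrightarrow>
     energy b B \<rho> t * ereal (exp (- r * t))
     + (st_quad_energy t (\<lambda>z \<zeta>. exp (- r * fst z) *\<^sub>R Qr b v r z \<zeta>)
           (st_lift t \<rho>) (U_tilde T b v B \<rho> P t)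
        - ereal (R_term T b v B \<rho> P r t))
     \<le> energy b B \<rho> 0 \<and> energy b B \<rho> 0 < \<infinity>"

definition dissipative_solution :: "real \<Rightarrow>
    ('d::finite, real^'d) torus_functional \<Rightarrow> ('d, real) torus_functional \<Rightarrow>
    (real \<Rightarrow> ('d, real^'d) torus_functional) \<Rightarrow> (real \<Rightarrow> ('d, real) torus_functional) \<Rightarrow>
    ('d, real^'d) st_functional \<Rightarrow> bool" where
  "dissipative_solution T B\<^sub>0 \<rho>\<^sub>0 B \<rho> P \<longleftrightarrow>
     torus_measure B\<^sub>0 \<and> torus_measure \<rho>\<^sub>0 \<and>
     (\<forall>\<phi>\<in>C_torus. (\<forall>x. 0 \<le> \<phi> x) \<longrightarrow> 0 \<le> \<rho>\<^sub>0 \<phi>) \<and>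
     weak_star_continuous T B \<and> weak_star_continuous T \<rho> \<and> st_measure T P \<and>
     (\<forall>\<phi>\<in>C_torus. B 0 \<phi> = B\<^sub>0 \<phi>) \<and> (\<forall>\<phi>\<in>C_torus. \<rho> 0 \<phi> = \<rho>\<^sub>0 \<phi>) \<and>
     (\<forall>\<phi>\<in>test_functions T. st_lift T B (grad \<phi>) = 0) \<and>
     (\<forall>\<phi>\<in>test_functions T. st_lift T \<rho> (dt T \<phi>) + P (grad \<phi>) = 0) \<and>
     (\<forall>b\<in>C1_st T. \<forall>v\<in>C1_st T. \<forall>r\<^sub>0.
        (\<forall>z \<in> {0..T} \<times> UNIV. \<forall>\<zeta>. \<zeta> \<bullet> \<zeta> \<le> \<zeta> \<bullet> Qr b v r\<^sub>0 z \<zeta>) \<longrightarrow>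
        (\<forall>t\<in>{0..T}. \<forall>r\<ge>r\<^sub>0. dissipation_inequality T b v B \<rho> P r t))"

end

theory Submission
  imports Defs
begin

text \<open>
  Put \<open>b = B / \<rho>\<close> and \<open>v = P / \<rho>\<close>.  After division by \<open>\<rho>\<close> a classical solution satisfies
  \<open>v = (b\<cdot>\<nabla>)b\<close> and \<open>D\<^sub>t b = (b\<cdot>\<nabla>)v\<close> with \<open>D\<^sub>t = \<partial>\<^sub>t + v\<cdot>\<nabla>\<close> (lemma \<open>classical_velocity\<close>).
  For arbitrary fields \<open>\<beta>\<close>, \<open>w\<close> and \<open>D = b - \<beta>\<close>, \<open>V = v - w\<close>, these two equations give the pointwise
  identity (lemma \<open>relative_energy_identity\<close>)

  \<open>1/2 (D,V)\<cdot>Q\<^sub>r(D,V) - (L\<^sub>1 + b\<cdot>L\<^sub>2 + v\<cdot>L\<^sub>3) = r|D|\<^sup>2/2 - D\<^sub>t(|D|\<^sup>2/2) + (b\<cdot>\<nabla>)(D\<cdot>V)\<close>.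

  \<^emph>\<open>A classical solution is dissipative.\<close>  After multiplication by \<open>\<rho> exp(-rt)\<close> the right-hand side is,
  by \<open>\<nabla>\<cdot>B = 0\<close> and the continuity equation, minus a space-time divergence.  Integration over the torus
  turns the identity into the dissipation inequality, with equality (\<open>classical_imp_dissipative\<close>).

  \<^emph>\<open>Uniqueness, first step.\<close>  Let \<open>(B',\<rho>',P')\<close> be a dissipative solution with the same initial data and
  take \<open>b\<^sup>* = b\<close>, \<open>v\<^sup>* = v\<close>.  Then \<open>L\<^sub>1\<close>, \<open>L\<^sub>2\<close>, \<open>L\<^sub>3\<close> vanish and so does the initial relative energy.  Hence the
  relative energy and the coercive quadratic term vanish for all times, which means \<open>\<rho>' \<ge> 0\<close>,
  \<open>B' = \<rho>' b\<close> and \<open>P' = \<rho>' v\<close> (\<open>zero_energy\<close>, \<open>P_eq\<close>).  The integral of a continuous field against \<open>P'\<close> up to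
  time \<open>t\<close> is defined through a representation of \<open>P'\<close> by a density with respect to a finite measure; its
  existence is the Riesz theorem (\<open>st_measure_representation\<close>), proved here by a Daniell-type
  construction of the measure.

  \<^emph>\<open>Second step.\<close>  It remains to identify \<open>\<rho>'\<close>.  The continuity equation holds against test functions that
  vanish near \<open>t = 0\<close> and \<open>t = T\<close>; functions of time alone show that the mass of \<open>\<rho>'\<close> is
  constant (\<open>mass_conserved\<close>).  The dissipation inequality for \<open>b\<^sup>* = b - exp(rt/2)(1 + \<epsilon>\<phi>)e\<close>, where \<open>e\<close> is a constant
  unit vector, becomes after the cancellations of the identity an inequality of the form
  \<open>\<epsilon>A(\<phi>) + \<epsilon>\<^sup>2C(\<phi>) \<le> 0\<close> for all small \<open>\<epsilon>\<close> of either sign.  Therefore \<open>A(\<phi>) = 0\<close>, which is the transport equation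
  \<open>\<partial>\<^sub>t\<rho>' + \<nabla>\<cdot>(\<rho>'v) = 0\<close> tested with \<open>C\<^sup>1\<close> functions up to the boundary of the time interval (\<open>transport\<close>).

  \<^emph>\<open>Third step.\<close>  The transport equation with \<open>C\<^sup>1\<close> velocity determines \<open>\<rho>'\<close> from its initial value, by
  duality.  Instead of the flow of \<open>v\<close>, an explicit scheme is run backwards: replacing \<open>g\<close> at time \<open>s + h\<close>
  by \<open>g(x + h v(s,x))\<close> at time \<open>s\<close> costs \<open>O(h\<^sup>2)\<close> and multiplies the Lipschitz constant of \<open>g\<close> by \<open>1 + O(h)\<close>
  (\<open>scheme_error\<close>, \<open>scheme_step\<close>), so that \<open>n\<close> steps of size \<open>t/n\<close> cost \<open>O(1/n)\<close>.  Density of the \<open>C\<^sup>1\<close>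
  functions in the continuous ones (\<open>C1_torus_dense\<close>) completes the argument, since the classical
  solution is transported as well, being dissipative.
\<close>

section \<open>Continuously differentiable fields on space-time\<close>

abbreviation slab :: "real \<Rightarrow> (real \<times> (real^'d)) set" where
  "slab T \<equiv> {0..T} \<times> UNIV"

text \<open>
  The derivative is kept as a function of point and direction that is continuous in the point for every
  fixed direction.  Since space-time is finite dimensional this is the same as continuity in operator
  norm (lemma \<open>C1_st_iff\<close>), and sums, products and compositions stay explicit.
\<close>

definition st_deriv :: "real \<Rightarrow> (real \<times> (real^'d) \<Rightarrow> 'b::real_normed_vector) \<Rightarrow>
    (real \<times> (real^'d) \<Rightarrow> real \<times> (real^'d) \<Rightarrow> 'b) \<Rightarrow> bool" where
  "st_deriv T f f' \<longleftrightarrow> f \<in> C_st T \<and>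
     (\<forall>z \<in> slab T. (f has_derivative f' z) (at z within slab T)) \<and>
     (\<forall>h. continuous_on (slab T) (\<lambda>z. f' z h))"

lemma C1_st_iff: "f \<in> C1_st T \<longleftrightarrow> (\<exists>f'. st_deriv T f f')"
proof
  assume "f \<in> C1_st T"
  then obtain f' :: "real \<times> (real^'a) \<Rightarrow> (real \<times> (real^'a)) \<Rightarrow>\<^sub>L 'b"
    where f: "f \<in> C_st T" and f': "continuous_on (slab T) f'"
      "\<forall>z \<in> slab T. (f has_derivative blinfun_apply (f' z)) (at z within slab T)"
    unfolding C1_st_def by auto
  have "st_deriv T f (\<lambda>z. blinfun_apply (f' z))"
    unfolding st_deriv_def using f f' by (auto intro!: continuous_intros)
  then show "\<exists>f'. st_deriv T f f'" by blast
next
  assume "\<exists>f'. st_deriv T f f'"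
  then obtain f' where f': "st_deriv T f f'" by blast
  define F where "F z = Blinfun (f' z)" for z
  have bl: "blinfun_apply (F z) = f' z" if "z \<in> slab T" for z
    unfolding F_def using f' that
    by (intro bounded_linear_Blinfun_apply) (auto simp: st_deriv_def intro: has_derivative_bounded_linear)
  have "continuous_on (slab T) F"
  proof (rule continuous_on_blinfun_componentwise)
    fix i :: "real \<times> (real^'a)"
    have "continuous_on (slab T) (\<lambda>z. f' z i)" using f' unfolding st_deriv_def by blast
    then show "continuous_on (slab T) (\<lambda>z. blinfun_apply (F z) i)"
      by (rule continuous_on_eq) (simp add: bl)
  qed
  then show "f \<in> C1_st T" unfolding C1_st_def
    using f' bl by (auto simp: st_deriv_def intro!: exI[of _ F])
qed

lemma st_derivD:
  assumes "st_deriv T f f'"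
  shows "f \<in> C_st T" "\<And>z. z \<in> slab T \<Longrightarrow> (f has_derivative f' z) (at z within slab T)"
    "\<And>h. continuous_on (slab T) (\<lambda>z. f' z h)" "f \<in> C1_st T"
    "\<And>z. z \<in> slab T \<Longrightarrow> linear (f' z)"
proof -
  show f: "f \<in> C_st T" "\<And>z. z \<in> slab T \<Longrightarrow> (f has_derivative f' z) (at z within slab T)"
    "\<And>h. continuous_on (slab T) (\<lambda>z. f' z h)"
    using assms unfolding st_deriv_def by blast+
  show "f \<in> C1_st T" using assms C1_st_iff by blast
  show "linear (f' z)" if "z \<in> slab T" for z using f(2)[OF that] by (rule has_derivative_linear)
qed

lemma st_deriv_time:
  assumes "st_deriv T f f'" "t \<in> {0..T}"
  shows "((\<lambda>s. f (s, x)) has_vector_derivative f' (t, x) (1, 0)) (at t within {0..T})"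
proof -
  have 1: "((\<lambda>s. (s, x)) has_derivative (\<lambda>h. (h, 0))) (at t within {0..T})"
    by (auto intro!: derivative_eq_intros)
  have sub: "(\<lambda>s. (s, x)) ` {0..T} \<subseteq> slab T" by auto
  have "(f has_derivative f' (t, x)) (at (t, x) within (\<lambda>s. (s, x)) ` {0..T})"
    using st_derivD(2)[OF assms(1), of "(t,x)"] assms(2) sub
    by (auto intro: has_derivative_subset)
  from diff_chain_within[OF 1 this]
  have "((\<lambda>s. f (s, x)) has_derivative (\<lambda>h. f' (t, x) (h, 0))) (at t within {0..T})"
    by (simp add: o_def)
  moreover have "f' (t, x) (h, 0) = h *\<^sub>R f' (t, x) (1, 0)" for h
  proof -
    have "linear (f' (t, x))" using st_derivD(5)[OF assms(1), of "(t,x)"] assms(2) by auto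
    then have "f' (t, x) (h *\<^sub>R (1, 0)) = h *\<^sub>R f' (t, x) (1, 0)" by (rule linear_scale)
    then show ?thesis by (simp only: scaleR_Pair scaleR_zero_right real_scaleR_def mult_1_right)
  qed
  then have "(\<lambda>h. f' (t, x) (h, 0)) = (\<lambda>h. h *\<^sub>R f' (t, x) (1, 0))" by (rule ext)
  ultimately show ?thesis by (simp only: has_vector_derivative_def)
qed

lemma st_deriv_space:
  assumes "st_deriv T f f'" "t \<in> {0..T}"
  shows "((\<lambda>y. f (t, y)) has_derivative (\<lambda>h. f' (t, x) (0, h))) (at x)"
proof -
  have 1: "((\<lambda>y. (t, y)) has_derivative (\<lambda>h. (0, h))) (at x)"
    by (auto intro!: derivative_eq_intros)
  have sub: "(\<lambda>y. (t, y)) ` UNIV \<subseteq> slab T" using assms by auto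
  have "(f has_derivative f' (t, x)) (at (t, x) within (\<lambda>y. (t, y)) ` UNIV)"
    using st_derivD(2)[OF assms(1), of "(t,x)"] assms(2) sub
    by (auto intro: has_derivative_subset)
  from diff_chain_within[OF 1 this]
  show ?thesis by (simp add: o_def)
qed

lemma dt_eq:
  assumes "T > 0" "st_deriv T f f'" "t \<in> {0..T}"
  shows "dt T f (t, x) = f' (t, x) (1, 0)"
  unfolding dt_def prod.case
  by (rule vector_derivative_within[OF _ st_deriv_time[OF assms(2,3)]])
     (use assms(1,3) in \<open>simp add: trivial_limit_within islimpt_Icc\<close>)

lemma advect_eq:
  assumes "st_deriv T f f'" "t \<in> {0..T}"
  shows "advect a f (t, x) = f' (t, x) (0, a (t, x))"
  using frechet_derivative_at[OF st_deriv_space[OF assms, of x]]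
  by (simp add: advect_def) metis

lemma pd_eq:
  assumes "st_deriv T f f'" "t \<in> {0..T}"
  shows "pd j f (t, x) = f' (t, x) (0, axis j 1)"
  unfolding pd_def by (rule advect_eq[OF assms])

lemma st_deriv_split:
  assumes "st_deriv T f f'" "t \<in> {0..T}"
  shows "f' (t, x) (s, h) = s *\<^sub>R f' (t, x) (1, 0) + f' (t, x) (0, h)"
proof -
  have l: "linear (f' (t, x))" using st_derivD(5)[OF assms(1)] assms(2) by auto
  have "(s, h) = s *\<^sub>R (1, 0) + (0, h)" by simp
  then have "f' (t, x) (s, h) = f' (t, x) (s *\<^sub>R (1, 0) + (0, h))" by simp
  then show ?thesis by (simp only: linear_add[OF l] linear_scale[OF l])
qed

text \<open>
  Translates of a periodic function have the same difference quotients.  Both the time interval and the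
  whole space determine the derivative uniquely, so equality of the partial functions passes to the
  derivatives.
\<close>

lemma st_deriv_periodic:
  assumes "T > 0" "st_deriv T f f'" "t \<in> {0..T}"
  shows "f' (t, x + axis i 1) h = f' (t, x) h"
proof -
  have p: "f (s, y + axis i 1) = f (s, y)" if "s \<in> {0..T}" for s y
    using st_derivD(1)[OF assms(2)] that by (auto simp: C_st_def)
  have "((\<lambda>s. f (s, x)) has_vector_derivative f' (t, x + axis i 1) (1, 0)) (at t within {0..T})"
    by (rule has_vector_derivative_transform[OF assms(3) _ st_deriv_time[OF assms(2,3)]])
       (simp add: p)
  then have 1: "f' (t, x + axis i 1) (1, 0) = f' (t, x) (1, 0)"
    using dt_eq[OF assms] vector_derivative_within[of t "{0..T}" "\<lambda>s. f (s, x)"] assms(1,3)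
    by (simp add: trivial_limit_within islimpt_Icc dt_def)
  have "((\<lambda>y. y + axis i 1) has_derivative (\<lambda>h. h)) (at x)"
    by (auto intro!: derivative_eq_intros)
  from diff_chain_at[OF this st_deriv_space[OF assms(2,3), of "x + axis i 1"]]
  have "((\<lambda>y. f (t, y)) has_derivative (\<lambda>h. f' (t, x + axis i 1) (0, h))) (at x)"
    by (simp add: o_def p[OF assms(3)])
  then have 2: "(\<lambda>h. f' (t, x + axis i 1) (0, h)) = (\<lambda>h. f' (t, x) (0, h))"
    using st_deriv_space[OF assms(2,3), of x] by (rule has_derivative_unique)
  obtain s k where h: "h = (s, k)" by force
  show ?thesis unfolding h
    using st_deriv_split[OF assms(2,3), of x s k] st_deriv_split[OF assms(2,3), of "x + axis i 1" s k]
      1 fun_cong[OF 2, of k] by simp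
qed

lemma C_st_const [intro]: "(\<lambda>_. c) \<in> C_st T"
  and C_st_add: "f \<in> C_st T \<Longrightarrow> g \<in> C_st T \<Longrightarrow> (\<lambda>z. f z + g z) \<in> C_st T"
  and C_st_diff: "f \<in> C_st T \<Longrightarrow> g \<in> C_st T \<Longrightarrow> (\<lambda>z. f z - g z) \<in> C_st T"
  and C_st_minus: "f \<in> C_st T \<Longrightarrow> (\<lambda>z. - f z) \<in> C_st T"
  and C_st_scaleR: "a \<in> C_st T \<Longrightarrow> f \<in> C_st T \<Longrightarrow> (\<lambda>z. a z *\<^sub>R f z) \<in> C_st T"
  and C_st_time: "continuous_on {0..T} \<kappa> \<Longrightarrow> (\<lambda>z. \<kappa> (fst z)) \<in> C_st T"
  by (auto simp: C_st_def intro!: continuous_intros continuous_on_compose2[of "{0..T}" \<kappa>])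

lemma C_st_mult: "f \<in> C_st T \<Longrightarrow> g \<in> C_st T \<Longrightarrow> (\<lambda>z. f z * g z :: real) \<in> C_st T"
  and C_st_inner: "F \<in> C_st T \<Longrightarrow> G \<in> C_st T \<Longrightarrow> (\<lambda>z. F z \<bullet> G z) \<in> C_st T"
  and C_st_norm: "F \<in> C_st T \<Longrightarrow> (\<lambda>z. norm (F z)) \<in> C_st T"
  and C_st_power: "f \<in> C_st T \<Longrightarrow> (\<lambda>z. f z ^ n :: real) \<in> C_st T"
  and C_st_Pair: "F \<in> C_st T \<Longrightarrow> H \<in> C_st T \<Longrightarrow> (\<lambda>z. (F z, H z)) \<in> C_st T"
  and C_st_fst: "K \<in> C_st T \<Longrightarrow> (\<lambda>z. fst (K z)) \<in> C_st T"
  and C_st_snd: "K \<in> C_st T \<Longrightarrow> (\<lambda>z. snd (K z)) \<in> C_st T"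
  and C_st_nth: "k \<in> C_st T \<Longrightarrow> (\<lambda>z. k z $ i) \<in> C_st T"
  for F G :: "real \<times> (real^'d) \<Rightarrow> 'b::real_inner"
  by (auto simp: C_st_def intro!: continuous_intros)

lemma C_st_bounded_linear: "bounded_linear l \<Longrightarrow> f \<in> C_st T \<Longrightarrow> (\<lambda>z. l (f z)) \<in> C_st T"
  by (auto simp: C_st_def bounded_linear.continuous_on)

lemma C_st_sum: "(\<And>i. i \<in> I \<Longrightarrow> f i \<in> C_st T) \<Longrightarrow> (\<lambda>z. \<Sum>i\<in>I. f i z) \<in> C_st T"
  by (auto simp: C_st_def intro!: continuous_intros sum.cong)

lemma C_st_vec: "(\<And>i. (\<lambda>z. f z $ i) \<in> C_st T) \<Longrightarrow> f \<in> C_st T"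
  for f :: "real \<times> (real^'d) \<Rightarrow> real^'n"
proof -
  assume *: "\<And>i. (\<lambda>z. f z $ i) \<in> C_st T"
  then have "continuous_on (slab T) (\<lambda>z. \<chi> i. f z $ i)"
    by (intro continuous_on_vec_lambda) (simp add: C_st_def)
  with * show "f \<in> C_st T" by (simp add: C_st_def vec_eq_iff)
qed

lemma C_st_cong: "f \<in> C_st T \<Longrightarrow> (\<And>z. z \<in> slab T \<Longrightarrow> g z = f z) \<Longrightarrow> g \<in> C_st T"
  by (auto simp: C_st_def cong: continuous_on_cong_simp)

lemma C_st_mono: "f \<in> C_st T \<Longrightarrow> t \<le> T \<Longrightarrow> f \<in> C_st t"
  by (auto simp: C_st_def intro: continuous_on_subset)

lemma C_st_slice: "f \<in> C_st T \<Longrightarrow> t \<in> {0..T} \<Longrightarrow> (\<lambda>x. f (t, x)) \<in> C_torus"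
  by (auto simp: C_st_def C_torus_def intro!: continuous_on_compose2[of "slab T" f] continuous_intros)

lemma C_st_of_torus: "f \<in> C_torus \<Longrightarrow> (\<lambda>z. f (snd z)) \<in> C_st T"
  by (auto simp: C_st_def C_torus_def intro!: continuous_on_compose2[of UNIV f] continuous_intros)

lemma st_deriv_C_st:
  assumes "T > 0" "st_deriv T f f'"
  shows "(\<lambda>z. f' z h) \<in> C_st T"
  using st_derivD(3)[OF assms(2)] st_deriv_periodic[OF assms] by (auto simp: C_st_def)

lemma vec_scaleR_basis: "(\<Sum>i\<in>UNIV. (x $ i) *\<^sub>R axis i 1) = (x :: real^'d)"
  using basis_expansion[of x] by (simp only: scalar_mult_eq_scaleR)

lemma linear_Pair_basis:
  fixes l :: "real \<times> (real^'d) \<Rightarrow> 'b::real_vector"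
  assumes "linear l"
  shows "l (s, x) = s *\<^sub>R l (1, 0) + (\<Sum>i\<in>UNIV. (x $ i) *\<^sub>R l (0, axis i 1))"
proof -
  have "s *\<^sub>R (1, 0) + (\<Sum>i\<in>UNIV. (x $ i) *\<^sub>R (0, axis i 1)) = (s, \<Sum>i\<in>UNIV. (x $ i) *\<^sub>R axis i (1::real))"
    by (rule prod_eqI) (simp_all add: fst_sum snd_sum)
  then have *: "(s, x) = s *\<^sub>R (1, 0) + (\<Sum>i\<in>UNIV. (x $ i) *\<^sub>R (0, axis i 1))"
    by (simp only: vec_scaleR_basis)
  show ?thesis by (subst *) (simp only: linear_add[OF assms] linear_sum[OF assms] linear_scale[OF assms])
qed

lemma st_deriv_C_st_apply:
  assumes "T > 0" "st_deriv T f f'" "a \<in> C_st T" "c \<in> C_st T"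
  shows "(\<lambda>z. f' z (a z, c z)) \<in> C_st T"
proof (rule C_st_cong)
  show "(\<lambda>z. a z *\<^sub>R f' z (1, 0) + (\<Sum>i\<in>UNIV. (c z $ i) *\<^sub>R f' z (0, axis i 1))) \<in> C_st T"
    by (rule C_st_add[OF C_st_scaleR[OF assms(3) st_deriv_C_st[OF assms(1,2)]] C_st_sum
          [OF C_st_scaleR[OF C_st_nth[OF assms(4)] st_deriv_C_st[OF assms(1,2)]]]])
qed (rule linear_Pair_basis[OF st_derivD(5)[OF assms(2)]])

lemma st_derivI:
  assumes "f \<in> C_st T" "\<And>z. z \<in> slab T \<Longrightarrow> (f has_derivative f' z) (at z within slab T)"
    "\<And>h. continuous_on (slab T) (\<lambda>z. f' z h)"
  shows "st_deriv T f f'"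
  using assms unfolding st_deriv_def by blast

lemma st_deriv_const: "st_deriv T (\<lambda>_. c) (\<lambda>_ _. 0)"
  by (rule st_derivI) (simp_all add: C_st_const)

lemma st_deriv_add:
  assumes "st_deriv T f f'" "st_deriv T g g'"
  shows "st_deriv T (\<lambda>z. f z + g z) (\<lambda>z h. f' z h + g' z h)"
  using st_derivD(1-3)[OF assms(1)] st_derivD(1-3)[OF assms(2)]
  by (intro st_derivI C_st_add has_derivative_add continuous_on_add)

lemma st_deriv_bounded_linear:
  assumes "bounded_linear l" "st_deriv T f f'"
  shows "st_deriv T (\<lambda>z. l (f z)) (\<lambda>z h. l (f' z h))"
  using st_derivD(1-3)[OF assms(2)]
  by (intro st_derivI C_st_bounded_linear[OF assms(1)] bounded_linear.has_derivative[OF assms(1)] 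
      bounded_linear.continuous_on[OF assms(1)])

lemma st_deriv_diff:
  assumes "st_deriv T f f'" "st_deriv T g g'"
  shows "st_deriv T (\<lambda>z. f z - g z) (\<lambda>z h. f' z h - g' z h)"
  using st_derivD(1-3)[OF assms(1)] st_derivD(1-3)[OF assms(2)]
  by (intro st_derivI C_st_diff has_derivative_diff continuous_on_diff)

lemma C_st_bilinear:
  assumes "bounded_bilinear p" "f \<in> C_st T" "g \<in> C_st T"
  shows "(\<lambda>z. p (f z) (g z)) \<in> C_st T"
  using assms(2,3) by (simp add: C_st_def bounded_bilinear.continuous_on[OF assms(1)])

lemma C_stD: "f \<in> C_st T \<Longrightarrow> continuous_on (slab T) f"
  by (simp add: C_st_def)

lemma st_deriv_bilinear:
  assumes "bounded_bilinear p" "st_deriv T f f'" "st_deriv T g g'"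
  shows "st_deriv T (\<lambda>z. p (f z) (g z)) (\<lambda>z h. p (f z) (g' z h) + p (f' z h) (g z))"
  using st_derivD(1-3)[OF assms(2)] st_derivD(1-3)[OF assms(3)]
    C_stD[OF st_derivD(1)[OF assms(2)]] C_stD[OF st_derivD(1)[OF assms(3)]]
  by (intro st_derivI C_st_bilinear[OF assms(1)] bounded_bilinear.FDERIV[OF assms(1)] continuous_on_add
       bounded_bilinear.continuous_on[OF assms(1)])

lemmas st_deriv_mult = st_deriv_bilinear[OF bounded_bilinear_mult]
  and st_deriv_inner = st_deriv_bilinear[OF bounded_bilinear_inner]
  and st_deriv_scaleR = st_deriv_bilinear[OF bounded_bilinear_scaleR]
  and st_deriv_nth = st_deriv_bounded_linear[OF bounded_linear_vec_nth]

lemma st_deriv_inverse: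
  fixes f :: "real \<times> (real^'d) \<Rightarrow> real"
  assumes "st_deriv T f f'" "\<forall>z\<in>slab T. f z \<noteq> 0"
  shows "st_deriv T (\<lambda>z. inverse (f z)) (\<lambda>z h. - (inverse (f z) * f' z h * inverse (f z)))"
proof (rule st_derivI)
  note f = st_derivD(1-3)[OF assms(1)]
  show "(\<lambda>z. inverse (f z)) \<in> C_st T"
    using f(1) assms(2) by (simp add: C_st_def continuous_on_inverse)
  show "((\<lambda>z. inverse (f z)) has_derivative (\<lambda>h. - (inverse (f z) * f' z h * inverse (f z))))
      (at z within slab T)" if "z \<in> slab T" for z
    using Deriv.has_derivative_inverse[OF _ f(2)[OF that]] assms(2) that by blast
  show "continuous_on (slab T) (\<lambda>z. - (inverse (f z) * f' z h * inverse (f z)))" for h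
    using f(3)[of h] C_stD[OF f(1)] assms(2)
    by (intro continuous_on_minus continuous_on_mult continuous_on_inverse) auto
qed

lemma st_deriv_time_fun:
  assumes "\<And>s. (\<kappa> has_real_derivative \<kappa>' s) (at s)" "continuous_on UNIV \<kappa>'"
  shows "st_deriv T (\<lambda>z. \<kappa> (fst z)) (\<lambda>z h. \<kappa>' (fst z) * fst h)"
proof (rule st_derivI)
  have c: "continuous_on UNIV \<kappa>"
    using assms(1) by (meson DERIV_isCont continuous_at_imp_continuous_on)
  show "(\<lambda>z. \<kappa> (fst z)) \<in> C_st T" by (rule C_st_time[OF continuous_on_subset[OF c]]) simp
  show "((\<lambda>z. \<kappa> (fst z)) has_derivative (\<lambda>h. \<kappa>' (fst z) * fst h)) (at z within slab T)"
    for z :: "real \<times> (real^'a)"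
    by (rule has_derivative_compose[OF has_derivative_fst[OF has_derivative_ident]
          assms(1)[of "fst z", unfolded has_field_derivative_def]])
  show "continuous_on (slab T) (\<lambda>z. \<kappa>' (fst z) * fst h)" for h :: "real \<times> (real^'a)"
    by (intro continuous_on_mult continuous_on_const continuous_on_compose2[OF assms(2)]
        continuous_on_fst continuous_on_id) simp
qed

lemma st_deriv_cong:
  assumes "st_deriv T f f'" "\<And>z. z \<in> slab T \<Longrightarrow> g z = f z" 
     "\<And>z h. z \<in> slab T \<Longrightarrow> g' z h = f' z h"
  shows "st_deriv T g g'"
  unfolding st_deriv_def
proof (intro conjI ballI allI)
  show "g \<in> C_st T" using C_st_cong[OF st_derivD(1)[OF assms(1)]] assms(2) by blast
  fix z :: "real \<times> (real^'a)" assume z: "z \<in> slab T"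
  have "g' z = f' z" using assms(3)[OF z] by blast
  then show "(g has_derivative g' z) (at z within slab T)"
    using has_derivative_transform[OF z assms(2) st_derivD(2)[OF assms(1) z]] by simp
next
  fix h
  show "continuous_on (slab T) (\<lambda>z. g' z h)"
    using st_derivD(3)[OF assms(1), of h] by (rule continuous_on_eq) (simp add: assms(3))
qed

text \<open>
  All spatial derivative operators are thereby expressed through one linear map, the derivative at the
  point; the remaining calculations do not refer to coordinates.
\<close>

lemma Jac_mult:
  assumes "st_deriv T w w'" "t \<in> {0..T}"
  shows "Jac w (t, x) *v h = w' (t, x) (0, h)"
proof -
  have l: "linear (w' (t, x))" using st_derivD(5)[OF assms(1)] assms(2) by auto
  have "(Jac w (t, x) *v h) $ i = w' (t, x) (0, h) $ i" for i
    using linear_Pair_basis[OF l, of 0 h]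
    by (simp add: Jac_def matrix_vector_mult_def pd_eq[OF st_deriv_nth[OF assms(1)] assms(2)]
        mult.commute)
  then show ?thesis by (simp add: vec_eq_iff)
qed

section \<open>The relative energy identity\<close>

lemma inner_transpose_mult: "x \<bullet> (transpose A *v y) = (A *v x) \<bullet> (y::real^'n)"
  by (simp add: transpose_matrix_vector inner_commute[of x] dot_lmul_matrix) (simp add: inner_commute)

lemma mat_mult_scaleR: "mat r *v x = r *\<^sub>R (x::real^'n)"
  by (simp add: vec_eq_iff matrix_vector_mult_def mat_def if_distrib if_distribR sum.delta' cong: if_cong)

lemma Qr_bilinear:
  "(\<xi>', \<eta>') \<bullet> Qr b v r z (\<xi>, \<eta>) =
     r * (\<xi>' \<bullet> \<xi>) - \<xi>' \<bullet> (Jac v z *v \<xi>) - \<xi> \<bullet> (Jac v z *v \<xi>') + \<xi>' \<bullet> (Jac b z *v \<eta>)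
     - \<eta> \<bullet> (Jac b z *v \<xi>') + \<xi> \<bullet> (Jac b z *v \<eta>') - \<eta>' \<bullet> (Jac b z *v \<xi>) + 2 * (\<eta>' \<bullet> \<eta>)"
proof -
  have "(- Jac v z) *v \<xi> = - (Jac v z *v \<xi>)"
    using matrix_vector_mult_diff_rdistrib[of 0 "Jac v z" \<xi>] by simp
  then show ?thesis
    by (simp add: Qr_def mat_mult_scaleR matrix_vector_mult_add_rdistrib matrix_vector_mult_diff_rdistrib
        inner_add_right inner_diff_right inner_transpose_mult inner_commute
        del: transpose_matrix_vector)
qed

lemma Qr_symmetric: "\<zeta>' \<bullet> Qr b v r z \<zeta> = \<zeta> \<bullet> Qr b v r z \<zeta>'"
  by (cases \<zeta>; cases \<zeta>') (simp add: Qr_bilinear inner_commute)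

lemma Qr_quadratic:
  "(\<xi>, \<eta>) \<bullet> Qr b v r z (\<xi>, \<eta>) =
     r * (\<xi> \<bullet> \<xi>) - 2 * (\<xi> \<bullet> (Jac v z *v \<xi>)) + 2 * (\<xi> \<bullet> (Jac b z *v \<eta>))
     - 2 * (\<eta> \<bullet> (Jac b z *v \<xi>)) + 2 * (\<eta> \<bullet> \<eta>)"
  by (simp add: Qr_bilinear)

lemma st_deriv_half_norm:
  assumes "st_deriv T f f'"
  shows "st_deriv T (\<lambda>z. (norm (f z))\<^sup>2 / 2) (\<lambda>z h. f z \<bullet> f' z h)"
  by (rule st_deriv_cong[OF st_deriv_bounded_linear[OF bounded_linear_mult_right[of "1/2"]
        st_deriv_inner[OF assms assms]]])
     (auto simp: power2_norm_eq_inner inner_commute)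

lemma L_eqs:
  fixes \<beta> w :: "real \<times> (real^'d) \<Rightarrow> real^'d" and x :: "real^'d"
  assumes T: "T > 0" and \<beta>: "st_deriv T \<beta> \<beta>'" and w: "st_deriv T w w'" and t: "t \<in> {0..T}"
  defines "z \<equiv> (t, x)"
  shows L1_eq: "L1 T \<beta> w z = w z \<bullet> w z + \<beta> z \<bullet> \<beta>' z (1, 0) + \<beta> z \<bullet> \<beta>' z (0, w z)
      - \<beta> z \<bullet> w' z (0, \<beta> z) - \<beta>' z (0, \<beta> z) \<bullet> w z"
    and L2_eq: "L2 T \<beta> w z = - \<beta>' z (1, 0) - \<beta>' z (0, w z) + w' z (0, \<beta> z)"
    and L3_eq: "L3 \<beta> w z = - w z + \<beta>' z (0, \<beta> z)"
  unfolding z_def L1_def L2_def L3_def Dstar_def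
    dt_eq[OF T \<beta> t] advect_eq[OF \<beta> t] advect_eq[OF w t]
    dt_eq[OF T st_deriv_half_norm[OF \<beta>] t] advect_eq[OF st_deriv_half_norm[OF \<beta>] t]
    advect_eq[OF st_deriv_inner[OF \<beta> w] t]
  by (simp_all add: power2_norm_eq_inner)

lemma linear_diff_Pair:
  assumes "linear (l :: real \<times> (real^'d) \<Rightarrow> real^'d)"
  shows "l (0, a - c) = l (0, a) - l (0, c)" "l (1, a) = l (1, 0) + l (0, a)"
  using linear_diff[OF assms, of "(0, a)" "(0, c)"] linear_add[OF assms, of "(1, 0)" "(0, a)"] by simp_all

text \<open>
  The quadratic form collects the derivatives of \<open>\<beta>\<close> and \<open>w\<close> paired twice with the differences \<open>D\<close>, \<open>V\<close>, and
  the remainder \<open>L\<^sub>1 + b\<cdot>L\<^sub>2 + v\<cdot>L\<^sub>3\<close> those paired with \<open>b\<close>, \<open>v\<close>, \<open>\<beta>\<close>, \<open>w\<close>.  After expansion everything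
  cancels except the terms in which a derivative meets \<open>D\<close> or \<open>V\<close> once: they form \<open>- D\<^sub>t(|D|\<^sup>2/2)\<close> and
  \<open>(b\<cdot>\<nabla>)(D\<cdot>V)\<close>.  The equations for \<open>b\<close> and \<open>v\<close> enter in exchanging \<open>v\<close> for \<open>(b\<cdot>\<nabla>)b\<close> and \<open>D\<^sub>t b\<close> for
  \<open>(b\<cdot>\<nabla>)v\<close>.  The identity is stated at one point \<open>z\<close>, where \<open>b'\<close> and \<open>v'\<close> are the derivatives of \<open>b\<close> and \<open>v\<close>.
\<close>

lemma relative_energy_identity:
  fixes b v \<beta> w :: "real \<times> (real^'d) \<Rightarrow> real^'d" and x :: "real^'d"
  assumes T: "T > 0" and \<beta>: "st_deriv T \<beta> \<beta>'" and w: "st_deriv T w w'" and t: "t \<in> {0..T}"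
    and b': "linear b'" and v': "linear v'"
  defines "z \<equiv> (t, x)"
  assumes vb: "v z = b' (0, b z)" and bv: "b' (1, v z) = v' (0, b z)"
  defines "D \<equiv> b z - \<beta> z" and "V \<equiv> v z - w z"
  shows "1/2 * ((D, V) \<bullet> Qr \<beta> w r z (D, V))
           - (L1 T \<beta> w z + b z \<bullet> L2 T \<beta> w z + v z \<bullet> L3 \<beta> w z)
       = r * (1/2 * (D \<bullet> D)) - D \<bullet> (b' (1, v z) - \<beta>' z (1, v z))
         + (D \<bullet> (v' (0, b z) - w' z (0, b z)) + (b' (0, b z) - \<beta>' z (0, b z)) \<bullet> V)"
proof -
  have l: "linear (\<beta>' z)" "linear (w' z)"
    using st_derivD(5)[OF \<beta>] st_derivD(5)[OF w] t by (auto simp: z_def)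
  note [simp] = linear_diff_Pair(1)[OF l(1)] linear_diff_Pair(1)[OF l(2)]
  have "(D, V) \<bullet> Qr \<beta> w r z (D, V) = r * (D \<bullet> D) - 2 * (D \<bullet> w' z (0, D)) + 2 * (D \<bullet> \<beta>' z (0, V))
     - 2 * (V \<bullet> \<beta>' z (0, D)) + 2 * (V \<bullet> V)"
    unfolding Qr_quadratic z_def Jac_mult[OF \<beta> t] Jac_mult[OF w t] ..
  then have "1/2 * ((D, V) \<bullet> Qr \<beta> w r z (D, V)) = r * (1/2 * (D \<bullet> D)) - D \<bullet> w' z (0, D) + D \<bullet> \<beta>' z (0, V)
     - V \<bullet> \<beta>' z (0, D) + V \<bullet> V" by simp
  moreover have "\<beta>' z (1, v z) = \<beta>' z (1, 0) + \<beta>' z (0, v z)"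
    using linear_diff_Pair(2)[OF l(1)] .
  ultimately show ?thesis
    unfolding L1_eq[OF T \<beta> w t, of x, folded z_def] L2_eq[OF T \<beta> w t, of x, folded z_def]
      L3_eq[OF T \<beta> w t, of x, folded z_def] bv vb[symmetric] D_def V_def
    by (simp add: inner_diff_left inner_diff_right inner_add_left inner_add_right algebra_simps inner_commute)
qed

text \<open>
  The fluxes are products of a velocity and a field, \<open>B\<otimes>B / \<rho> = b\<otimes>B\<close> and \<open>B\<otimes>P / \<rho> = b\<otimes>P\<close>.  In the
  divergence of \<open>b\<otimes>B\<close> only \<open>(B\<cdot>\<nabla>)b = \<rho>(b\<cdot>\<nabla>)b\<close> survives, and in that of \<open>b\<otimes>P - v\<otimes>B\<close> the term
  \<open>b \<nabla>\<cdot>P = - b \<partial>\<^sub>t\<rho>\<close> combines with \<open>\<partial>\<^sub>t(\<rho>b)\<close> to \<open>\<rho> \<partial>\<^sub>t b\<close>.  What remains is divided by \<open>\<rho> > 0\<close>.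
\<close>

lemma classical_velocity:
  fixes B :: "real \<times> (real^'d) \<Rightarrow> real^'d"
  assumes T: "T > 0" and cl: "classical_solution T B \<rho> P"
  obtains b v b' v' \<rho>' where
    "st_deriv T b b'" "st_deriv T v v'" "st_deriv T \<rho> \<rho>'"
    "st_deriv T B (\<lambda>z h. \<rho> z *\<^sub>R b' z h + \<rho>' z h *\<^sub>R b z)"
    "st_deriv T P (\<lambda>z h. \<rho> z *\<^sub>R v' z h + \<rho>' z h *\<^sub>R v z)"
    "\<forall>z\<in>slab T. \<rho> z > 0"
    "\<forall>z\<in>slab T. B z = \<rho> z *\<^sub>R b z"
    "\<forall>z\<in>slab T. P z = \<rho> z *\<^sub>R v z"
    "\<forall>z\<in>slab T. v z = b' z (0, b z)"
    "\<forall>z\<in>slab T. b' z (1, v z) = v' z (0, b z)"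
    "\<forall>z\<in>slab T. (\<Sum>j\<in>UNIV. pd j (\<lambda>y. B y $ j) z) = 0"
    "\<forall>z\<in>slab T. dt T \<rho> z + (\<Sum>j\<in>UNIV. pd j (\<lambda>y. P y $ j) z) = 0"
proof -
  have "B \<in> C1_st T" "P \<in> C1_st T" "\<rho> \<in> C1_st T" and pos: "z \<in> slab T \<Longrightarrow> \<rho> z > 0" for z
    using cl by (auto simp: classical_solution_def)
  then obtain B1 P1 \<rho>' where B1: "st_deriv T B B1" and P1: "st_deriv T P P1" and \<rho>: "st_deriv T \<rho> \<rho>'"
    using C1_st_iff by metis
  have nz: "\<forall>z\<in>slab T. \<rho> z \<noteq> 0"
  proof
    fix z :: "real \<times> (real^'d)" assume "z \<in> slab T"
    from pos[OF this] show "\<rho> z \<noteq> 0" by simp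
  qed
  define b where "b z = inverse (\<rho> z) *\<^sub>R B z" for z
  define v where "v z = inverse (\<rho> z) *\<^sub>R P z" for z
  obtain b' v' where b: "st_deriv T b b'" and v: "st_deriv T v v'"
    using st_deriv_scaleR[OF st_deriv_inverse[OF \<rho> nz] B1]
      st_deriv_scaleR[OF st_deriv_inverse[OF \<rho> nz] P1] unfolding b_def v_def by blast
  have Bb: "B z = \<rho> z *\<^sub>R b z" and Pv: "P z = \<rho> z *\<^sub>R v z" if "z \<in> slab T" for z
    using bspec[OF nz that] by (simp_all add: b_def v_def)
  have B: "st_deriv T B (\<lambda>z h. \<rho> z *\<^sub>R b' z h + \<rho>' z h *\<^sub>R b z)"
    by (rule st_deriv_cong[OF st_deriv_scaleR[OF \<rho> b]]) (simp_all add: Bb)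
  have P: "st_deriv T P (\<lambda>z h. \<rho> z *\<^sub>R v' z h + \<rho>' z h *\<^sub>R v z)"
    by (rule st_deriv_cong[OF st_deriv_scaleR[OF \<rho> v]]) (simp_all add: Pv)
  define B' where "B' = (\<lambda>z h. \<rho> z *\<^sub>R b' z h + \<rho>' z h *\<^sub>R b z)"
  define P' where "P' = (\<lambda>z h. \<rho> z *\<^sub>R v' z h + \<rho>' z h *\<^sub>R v z)"
  note BP = B[folded B'_def] P[folded P'_def]
  have div: "(\<Sum>j\<in>UNIV. pd j (\<lambda>y. B y $ j) z) = 0"
     "dt T \<rho> z + (\<Sum>j\<in>UNIV. pd j (\<lambda>y. P y $ j) z) = 0" if "z \<in> slab T" for z
    using cl that by (auto simp: classical_solution_def)
  have flux: "st_deriv T (\<lambda>y. (B y $ i * P y $ j - P y $ i * B y $ j) / \<rho> y)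
     (\<lambda>z h. (b z $ i * P' z h $ j + b' z h $ i * P z $ j) - (v z $ i * B' z h $ j + v' z h $ i * B z $ j))" for i j
    by (rule st_deriv_cong[OF st_deriv_diff[OF st_deriv_mult[OF st_deriv_nth[OF b] st_deriv_nth[OF BP(2)]]
            st_deriv_mult[OF st_deriv_nth[OF v] st_deriv_nth[OF BP(1)]]]])
       (simp_all add: b_def v_def divide_inverse algebra_simps)
  have stress: "st_deriv T (\<lambda>y. B y $ i * B y $ j / \<rho> y)
     (\<lambda>z h. b z $ i * B' z h $ j + b' z h $ i * B z $ j)" for i j
    by (rule st_deriv_cong[OF st_deriv_mult[OF st_deriv_nth[OF b] st_deriv_nth[OF BP(1)]]])
       (simp_all add: b_def divide_inverse algebra_simps)
  have eqs: "v z = b' z (0, b z) \<and> b' z (1, v z) = v' z (0, b z)" if z: "z \<in> slab T" for z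
  proof -
    obtain t x where zt: "z = (t, x)" and t: "t \<in> {0..T}" using z by auto
    have l: "linear (b' z)" "linear (v' z)" using st_derivD(5)[OF b z] st_derivD(5)[OF v z] .
    let ?e = "\<lambda>j. (0, axis j 1) :: real \<times> (real^'d)"
    have sum_b: "(\<Sum>j\<in>UNIV. b' z (?e j) $ i * a $ j) = b' z (0, a) $ i" for i a
      using linear_Pair_basis[OF l(1), of 0 a] by (simp add: mult.commute)
    have sum_v: "(\<Sum>j\<in>UNIV. v' z (?e j) $ i * a $ j) = v' z (0, a) $ i" for i a
      using linear_Pair_basis[OF l(2), of 0 a] by (simp add: mult.commute)
    have dB: "(\<Sum>j\<in>UNIV. B' z (?e j) $ j) = 0"
      using div(1)[OF z] by (simp add: zt pd_eq[OF st_deriv_nth[OF BP(1)] t])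
    have dP: "\<rho>' z (1, 0) + (\<Sum>j\<in>UNIV. P' z (?e j) $ j) = 0"
      using div(2)[OF z] by (simp add: zt pd_eq[OF st_deriv_nth[OF BP(2)] t] dt_eq[OF T \<rho> t])
    have lin: "b' z (0, \<rho> z *\<^sub>R a) = \<rho> z *\<^sub>R b' z (0, a)" "v' z (0, \<rho> z *\<^sub>R a) = \<rho> z *\<^sub>R v' z (0, a)" for a
      using linear_scale[OF l(1), of "\<rho> z" "(0, a)"] linear_scale[OF l(2), of "\<rho> z" "(0, a)"] by simp_all
    have "P z $ i = (\<Sum>j\<in>UNIV. pd j (\<lambda>y. B y $ i * B y $ j / \<rho> y) z)" for i
      using cl z unfolding classical_solution_def by blast
    then have "P z $ i = b z $ i * (\<Sum>j\<in>UNIV. B' z (?e j) $ j) + (\<Sum>j\<in>UNIV. b' z (?e j) $ i * B z $ j)" for i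
      by (simp add: zt pd_eq[OF stress t] sum.distrib sum_distrib_left)
    then have "P z $ i = b' z (0, B z) $ i" for i by (simp add: dB sum_b)
    then have "\<rho> z *\<^sub>R v z = \<rho> z *\<^sub>R b' z (0, b z)"
      using lin(1)[of "b z"] by (simp add: vec_eq_iff Bb[OF z] Pv[OF z])
    then have 1: "v z = b' z (0, b z)" using bspec[OF nz z] by (simp only: scaleR_cancel_left) simp
    have "dt T (\<lambda>y. B y $ i) z
             + (\<Sum>j\<in>UNIV. pd j (\<lambda>y. (B y $ i * P y $ j - P y $ i * B y $ j) / \<rho> y) z) = 0" for i
      using cl z unfolding classical_solution_def by blast
    then have "B' z (1, 0) $ i + b z $ i * (\<Sum>j\<in>UNIV. P' z (?e j) $ j) + (\<Sum>j\<in>UNIV. b' z (?e j) $ i * P z $ j)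
        - v z $ i * (\<Sum>j\<in>UNIV. B' z (?e j) $ j) - (\<Sum>j\<in>UNIV. v' z (?e j) $ i * B z $ j) = 0" for i
      unfolding zt pd_eq[OF flux t] dt_eq[OF T st_deriv_nth[OF BP(1)] t]
      by (simp add: sum.distrib sum_subtractf sum_distrib_left algebra_simps)
    then have "B' z (1, 0) $ i + b z $ i * (- \<rho>' z (1, 0)) + b' z (0, P z) $ i - v' z (0, B z) $ i = 0" for i
      using dP by (simp add: dB sum_b sum_v add_eq_0_iff2)
    then have "\<rho> z *\<^sub>R (b' z (1, 0) + b' z (0, v z)) = \<rho> z *\<^sub>R v' z (0, b z)"
      using lin(1)[of "v z"] lin(2)[of "b z"]
      by (simp add: vec_eq_iff Bb[OF z] Pv[OF z] B'_def algebra_simps) 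
    then have 2: "b' z (1, 0) + b' z (0, v z) = v' z (0, b z)" 
      using bspec[OF nz z] by (simp only: scaleR_cancel_left) simp
    then show ?thesis using 1 linear_diff_Pair(2)[OF l(1), of "v z"] by simp
  qed
  show ?thesis
    by (rule that[OF b v \<rho> B P]) (use pos Bb Pv eqs div in blast)+
qed

section \<open>Integration over the torus\<close>

lemma unit_cell_borel [measurable, simp]: "unit_cell \<in> sets (borel :: (real^'d) measure)"
  unfolding unit_cell_def by measurable

lemma unit_cell_subset: "(unit_cell :: (real^'d) set) \<subseteq> cbox 0 1"
  by (simp add: unit_cell_def mem_box_cart subset_eq less_imp_le)

lemma slab_cell_borel [measurable, simp]: "{a..b} \<times> unit_cell \<in> sets (borel :: (real \<times> (real^'d)) measure)"
  by (simp add: borel_Times)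

lemma set_integrable_cell:
  assumes "continuous_on UNIV (f :: real^'d \<Rightarrow> real)"
  shows "set_integrable lborel unit_cell f"
proof -
  have "set_integrable lborel (cbox 0 1) f" unfolding set_integrable_def
    by (intro borel_integrable_compact compact_cbox continuous_on_subset[OF assms]) simp
  then show ?thesis by (rule set_integrable_subset) (simp_all add: unit_cell_subset)
qed

lemma set_integrable_slab_cell:
  assumes "continuous_on ({a..b} \<times> UNIV) (g :: real \<times> (real^'d) \<Rightarrow> real)"
  shows "set_integrable lborel ({a..b} \<times> unit_cell) g"
proof -
  have "set_integrable lborel ({a..b} \<times> cbox 0 1) g" unfolding set_integrable_def
    by (intro borel_integrable_compact compact_Times compact_Icc compact_cbox continuous_on_subset[OF assms]) auto
  then show ?thesis by (rule set_integrable_subset) (use unit_cell_subset in auto)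
qed

lemma
  assumes "continuous_on ({a..b} \<times> UNIV) (g :: real \<times> (real^'d) \<Rightarrow> real)"
  shows Fubini_slab: "(LINT z:{a..b} \<times> unit_cell|lborel. g z)
           = (LINT s:{a..b}|lborel. LINT x:unit_cell|lborel. g (s, x))"
    and Fubini_slab': "(LINT z:{a..b} \<times> unit_cell|lborel. g z)
           = (LINT x:unit_cell|lborel. LINT s:{a..b}|lborel. g (s, x))"
proof -
  let ?f = "\<lambda>z. indicator ({a..b} \<times> unit_cell) z *\<^sub>R g z"
  have i: "integrable (lborel \<Otimes>\<^sub>M lborel) ?f"
    using set_integrable_slab_cell[OF assms] unfolding set_integrable_def lborel_prod .
  have eq: "(\<integral>x. ?f (s, x) \<partial>lborel) = indicator {a..b} s *\<^sub>R (LINT x:unit_cell|lborel. g (s, x))" for s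
    unfolding set_lebesgue_integral_def by (cases "s \<in> {a..b}") (auto simp: indicator_def)
  have eq': "(\<integral>s. ?f (s, x) \<partial>lborel) = indicator unit_cell x *\<^sub>R (LINT s:{a..b}|lborel. g (s, x))" for x
    unfolding set_lebesgue_integral_def by (cases "x \<in> unit_cell") (auto simp: indicator_def)
  show "(LINT z:{a..b} \<times> unit_cell|lborel. g z)
           = (LINT s:{a..b}|lborel. LINT x:unit_cell|lborel. g (s, x))"
    using lborel_pair.integral_fst'[OF i] unfolding eq unfolding set_lebesgue_integral_def lborel_prod ..
  have "(\<integral>x. (\<integral>s. ?f (s, x) \<partial>lborel) \<partial>lborel) = integral\<^sup>L (lborel \<Otimes>\<^sub>M lborel) ?f"
    using lborel_pair.integral_snd[of "\<lambda>s x. ?f (s, x)"] i by (simp add: case_prod_unfold)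
  then show "(LINT z:{a..b} \<times> unit_cell|lborel. g z)
           = (LINT x:unit_cell|lborel. LINT s:{a..b}|lborel. g (s, x))"
    unfolding eq' unfolding set_lebesgue_integral_def lborel_prod ..
qed

lemma integral_shift:
  fixes f :: "'a::euclidean_space \<Rightarrow> real"
  assumes [measurable]: "f \<in> borel_measurable borel"
  shows "(\<integral>x. f (c + x) \<partial>lborel) = (\<integral>x. f x \<partial>lborel)"
proof -
  have "(\<integral>x. f x \<partial>lborel) = (\<integral>x. f x \<partial>distr lborel borel ((+) c))"
    by (simp only: lborel_distr_plus)
  also have "\<dots> = (\<integral>x. f (c + x) \<partial>lborel)" by (rule integral_distr) simp_all
  finally show ?thesis ..
qed

text \<open>
  A half-open fundamental cell translated by \<open>s\<close> in one coordinate direction falls into two pieces that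
  are rearranged into the cell by the periods.
\<close>

lemma cell_integral_shift:
  fixes f :: "real^'d \<Rightarrow> real"
  assumes f: "f \<in> C_torus" and s: "0 \<le> s" "s \<le> 1"
  shows "(LINT x:unit_cell|lborel. f (x + s *\<^sub>R axis j 1)) = (LINT x:unit_cell|lborel. f x)"
proof -
  have c: "continuous_on UNIV f" and p: "f (x + axis j 1) = f x" for x
    using f by (auto simp: C_torus_def)
  have [measurable]: "f \<in> borel_measurable borel" using c by (rule borel_measurable_continuous_onI)
  let ?e = "axis j 1 :: real^'d"
  \<comment> \<open>The translated cell meets the cell in \<open>A\<close>; the rest, moved back by one period, is \<open>C\<close>.\<close>
  define A where "A = {x \<in> unit_cell. x $ j \<ge> s}"
  define C where "C = {x \<in> unit_cell. x $ j < s}"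
  have [measurable]: "A \<in> sets borel" "C \<in> sets borel" unfolding A_def C_def by measurable
  have iA: "set_integrable lborel A f"
    by (rule set_integrable_subset[OF set_integrable_cell[OF c]]) (auto simp: A_def)
  have iC: "set_integrable lborel C f"
    by (rule set_integrable_subset[OF set_integrable_cell[OF c]]) (auto simp: C_def)
  have ind: "indicator unit_cell x * f (s *\<^sub>R ?e + x) = indicator A (s *\<^sub>R ?e + x) * f (s *\<^sub>R ?e + x)
        + indicator C ((s - 1) *\<^sub>R ?e + x) * f ((s - 1) *\<^sub>R ?e + x)" for x
  proof -
    have "f (s *\<^sub>R ?e + x) = f ((s - 1) *\<^sub>R ?e + x)"
      using p[of "(s - 1) *\<^sub>R ?e + x"] by (simp add: algebra_simps)
    moreover have "indicator unit_cell x = (indicator A (s *\<^sub>R ?e + x) + indicator C ((s - 1) *\<^sub>R ?e + x) :: real)"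
    proof -
      have co: "(r *\<^sub>R ?e + x) $ i = (if i = j then r + x $ j else x $ i)" for r i by (simp add: axis_def)
      have 1: "s *\<^sub>R ?e + x \<in> A \<longleftrightarrow> (\<forall>i. i \<noteq> j \<longrightarrow> 0 \<le> x $ i \<and> x $ i < 1) \<and> 0 \<le> x $ j \<and> s + x $ j < 1"
        unfolding A_def unit_cell_def mem_Collect_eq co using s by (auto split: if_splits)
      have 2: "(s - 1) *\<^sub>R ?e + x \<in> C \<longleftrightarrow> (\<forall>i. i \<noteq> j \<longrightarrow> 0 \<le> x $ i \<and> x $ i < 1) \<and> 1 \<le> s + x $ j \<and> x $ j < 1"
        unfolding C_def unit_cell_def mem_Collect_eq co using s by (auto split: if_splits)
      have 3: "x \<in> unit_cell \<longleftrightarrow> (\<forall>i. i \<noteq> j \<longrightarrow> 0 \<le> x $ i \<and> x $ i < 1) \<and> 0 \<le> x $ j \<and> x $ j < 1"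
        unfolding unit_cell_def mem_Collect_eq by auto
      show ?thesis unfolding indicator_def 1 2 3 using s by auto
    qed
    ultimately show ?thesis by (simp add: algebra_simps)
  qed
  have shA: "integrable lborel (\<lambda>x. indicator A (c + x) * f (c + x))" for c
  proof -
    have "integrable (distr lborel borel ((+) c)) (\<lambda>x. indicator A x * f x)"
      using iA by (simp add: lborel_distr_plus set_integrable_def)
    then show ?thesis by (subst (asm) integrable_distr_eq) simp_all
  qed
  have shC: "integrable lborel (\<lambda>x. indicator C (c + x) * f (c + x))" for c
  proof -
    have "integrable (distr lborel borel ((+) c)) (\<lambda>x. indicator C x * f x)"
      using iC by (simp add: lborel_distr_plus set_integrable_def)
    then show ?thesis by (subst (asm) integrable_distr_eq) simp_all
  qed
  have "(LINT x:unit_cell|lborel. f (x + s *\<^sub>R ?e))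
      = (\<integral>x. indicator A (s *\<^sub>R ?e + x) * f (s *\<^sub>R ?e + x)
        + indicator C ((s - 1) *\<^sub>R ?e + x) * f ((s - 1) *\<^sub>R ?e + x) \<partial>lborel)"
    unfolding set_lebesgue_integral_def ind[symmetric] by (simp add: add.commute)
  also have "\<dots> = (\<integral>x. indicator A x * f x \<partial>lborel) + (\<integral>x. indicator C x * f x \<partial>lborel)"
    by (subst Bochner_Integration.integral_add[OF shA shC])
       (simp add: integral_shift[of "\<lambda>x. indicator A x * f x"] integral_shift[of "\<lambda>x. indicator C x * f x"])
  also have "\<dots> = (\<integral>x. indicator A x * f x + indicator C x * f x \<partial>lborel)"
    using iA iC by (simp add: set_integrable_def)
  also have "\<dots> = (LINT x:unit_cell|lborel. f x)"
    unfolding set_lebesgue_integral_def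
    by (intro Bochner_Integration.integral_cong refl) (auto simp: A_def C_def indicator_def)
  finally show ?thesis .
qed

text \<open>
  The average of \<open>\<partial>\<^sub>jF(x + s e\<^sub>j)\<close> over \<open>s \<in> [0,1]\<close> is \<open>F(x + e\<^sub>j) - F(x) = 0\<close> for every \<open>x\<close>, whereas by translation
  invariance the integral over \<open>x\<close> of each translate is the same.  Exchanging the two integrals gives
  the claim without an iterated integral over the coordinates.
\<close>

lemma cell_integral_pd_zero:
  fixes F :: "real \<times> (real^'d) \<Rightarrow> real"
  assumes T: "T > 0" and F: "st_deriv T F F'" and t: "t \<in> {0..T}"
  shows "(LINT x:unit_cell|lborel. F' (t, x) (0, axis j 1)) = 0"
proof -
  let ?e = "axis j 1 :: real^'d"
  define g where "g x = F' (t, x) (0, ?e)" for x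
  have g: "g \<in> C_torus" unfolding g_def using C_st_slice[OF st_deriv_C_st[OF T F] t] .
  then have gc: "continuous_on UNIV g" by (simp add: C_torus_def)
  have cont: "continuous_on ({0..1} \<times> UNIV) (\<lambda>z. g (snd z + fst z *\<^sub>R ?e))"
    by (intro continuous_on_compose2[OF gc] continuous_intros) auto
  have "(LINT x:unit_cell|lborel. g x) = (LINT s:{0..1::real}|lborel. LINT x:unit_cell|lborel. g x)"
    by (simp add: set_lebesgue_integral_def)
  also have "\<dots> = (LINT s:{0..1::real}|lborel. LINT x:unit_cell|lborel. g (x + s *\<^sub>R ?e))"
    by (rule set_lebesgue_integral_cong) (auto simp: cell_integral_shift[OF g])
  also have "\<dots> = (LINT x:unit_cell|lborel. LINT s:{0..1::real}|lborel. g (x + s *\<^sub>R ?e))"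
    using Fubini_slab[OF cont] Fubini_slab'[OF cont] by simp
  also have "\<dots> = (LINT x:(unit_cell::(real^'d) set)|lborel. 0)"
  proof (rule set_lebesgue_integral_cong, simp, intro allI impI)
    fix x :: "real^'d"
    have "((\<lambda>s. F (t, x + s *\<^sub>R ?e)) has_vector_derivative g (x + s *\<^sub>R ?e)) (at s within {0..1})" for s
    proof -
      have "((\<lambda>s. x + s *\<^sub>R ?e) has_derivative (\<lambda>h. h *\<^sub>R ?e)) (at s within {0..1})"
        by (auto intro!: derivative_eq_intros)
      from has_derivative_compose[OF this st_deriv_space[OF F t, of "x + s *\<^sub>R ?e"]]
      have "((\<lambda>s. F (t, x + s *\<^sub>R ?e)) has_derivative (\<lambda>h. F' (t, x + s *\<^sub>R ?e) (0, h *\<^sub>R ?e))) (at s within {0..1})" .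
      moreover have "F' (t, x + s *\<^sub>R ?e) (0, h *\<^sub>R ?e) = h *\<^sub>R g (x + s *\<^sub>R ?e)" for h
      proof -
        have "linear (F' (t, x + s *\<^sub>R ?e))" using st_derivD(5)[OF F] t by auto
        from linear_scale[OF this, of h "(0, ?e)"] show ?thesis by (simp add: g_def)
      qed
      ultimately show ?thesis by (simp add: has_vector_derivative_def)
    qed
    then have "(LINT s:{0..1}|lborel. g (x + s *\<^sub>R ?e)) = F (t, x + 1 *\<^sub>R ?e) - F (t, x + 0 *\<^sub>R ?e)"
      unfolding set_lebesgue_integral_def
      by (intro integral_FTC_Icc) (auto intro!: continuous_intros continuous_on_compose2[OF gc])
    also have "\<dots> = 0" using st_derivD(1)[OF F] t by (simp add: C_st_def)
    finally show "(LINT s:{0..1}|lborel. g (x + s *\<^sub>R ?e)) = 0" .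
  qed
  finally show ?thesis by (simp add: g_def set_lebesgue_integral_def)
qed

lemma cell_integral_FTC:
  fixes F :: "real \<times> (real^'d) \<Rightarrow> real"
  assumes T: "T > 0" and F: "st_deriv T F F'" and t: "t \<in> {0..T}"
  shows "(LINT s:{0..t}|lborel. LINT x:unit_cell|lborel. F' (s, x) (1, 0))
      = (LINT x:unit_cell|lborel. F (t, x)) - (LINT x:unit_cell|lborel. F (0, x))"
proof -
  have cont: "continuous_on ({0..t} \<times> UNIV) (\<lambda>z. F' z (1, 0))"
    by (rule continuous_on_subset[OF st_derivD(3)[OF F]]) (use t in auto)
  have "(LINT s:{0..t}|lborel. F' (s, x) (1, 0)) = F (t, x) - F (0, x)" for x
    unfolding set_lebesgue_integral_def
  proof (rule integral_FTC_Icc)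
    show "((\<lambda>s. F (s, x)) has_vector_derivative F' (s, x) (1, 0)) (at s within {0..t})"
      if "0 \<le> s" "s \<le> t" for s
      using st_deriv_time[OF F, of s x] that t
      by (auto intro: has_vector_derivative_within_subset)
    show "continuous_on {0..t} (\<lambda>s. F' (s, x) (1, 0))"
      by (rule continuous_on_compose2[OF cont]) (auto intro!: continuous_intros)
  qed (use t in auto)
  then have "(LINT s:{0..t}|lborel. LINT x:unit_cell|lborel. F' (s, x) (1, 0))
       = (LINT x:unit_cell|lborel. F (t, x) - F (0, x))"
    using Fubini_slab[OF cont] Fubini_slab'[OF cont] by simp
  also have "\<dots> = (LINT x:unit_cell|lborel. F (t, x)) - (LINT x:unit_cell|lborel. F (0, x))"
    using C_st_slice[OF st_derivD(1)[OF F]] t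
    by (intro set_integral_diff set_integrable_cell) (auto simp: C_torus_def)
  finally show ?thesis .
qed

section \<open>Densities as measures\<close>

abbreviation cell_integral :: "(real^'d \<Rightarrow> real) \<Rightarrow> real" where
  "cell_integral g \<equiv> (LINT x:unit_cell|lborel. g x)"

abbreviation slab_integral :: "real \<Rightarrow> (real \<times> (real^'d) \<Rightarrow> real) \<Rightarrow> real" where
  "slab_integral t g \<equiv> (LINT z:{0..t} \<times> unit_cell|lborel. g z)"

lemma periodic_int_shift:
  fixes f :: "real^'d \<Rightarrow> 'b"
  assumes p: "\<And>x i. f (x + axis i 1) = f x"
  shows "f (x + (\<Sum>i\<in>I. of_int (n i) *\<^sub>R axis i 1)) = f x"
proof (induction I arbitrary: x rule: infinite_finite_induct)
  case (insert i I)
  have nat: "f (y + real k *\<^sub>R axis i 1) = f y" for y k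
  proof (induction k)
    case (Suc k)
    have "y + real (Suc k) *\<^sub>R axis i 1 = (y + real k *\<^sub>R axis i 1) + axis i 1"
      by (simp add: algebra_simps)
    then have "f (y + real (Suc k) *\<^sub>R axis i 1) = f ((y + real k *\<^sub>R axis i 1) + axis i 1)" by (rule arg_cong)
    also have "\<dots> = f y" using p[of "y + real k *\<^sub>R axis i 1"] Suc by (rule trans)
    finally show ?case .
  qed simp
  have int: "f (y + of_int m *\<^sub>R axis i 1) = f y" for y m
  proof (cases "m \<ge> 0")
    case True
    then show ?thesis using nat[of y "nat m"] by simp
  next
    case False
    then show ?thesis using nat[of "y + of_int m *\<^sub>R axis i 1" "nat (- m)"] by simp
  qed
  have "x + (\<Sum>i\<in>insert i I. of_int (n i) *\<^sub>R axis i 1)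
      = (x + of_int (n i) *\<^sub>R axis i 1) + (\<Sum>i\<in>I. of_int (n i) *\<^sub>R axis i 1)"
    using insert by (simp add: add.assoc)
  then have "f (x + (\<Sum>i\<in>insert i I. of_int (n i) *\<^sub>R axis i 1))
      = f ((x + of_int (n i) *\<^sub>R axis i 1) + (\<Sum>i\<in>I. of_int (n i) *\<^sub>R axis i 1))" by (rule arg_cong)
  also have "\<dots> = f x" using insert.IH[of "x + of_int (n i) *\<^sub>R axis i 1"] int by (rule trans)
  finally show ?case .
qed simp_all

definition cell_rep :: "real^'d \<Rightarrow> real^'d" where
  "cell_rep x = (\<chi> i. frac (x $ i))"

lemma cell_rep_in: "cell_rep x \<in> unit_cell"
  by (simp add: cell_rep_def unit_cell_def frac_lt_1)

text \<open>
  Every periodic function is determined by its values on the fundamental cell; this carries compactness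
  of the closed cell over to functions on the whole space.
\<close>

lemma periodic_cell_rep:
  fixes f :: "real^'d \<Rightarrow> 'b"
  assumes "\<And>x i. f (x + axis i 1) = f x"
  shows "f (cell_rep x) = f x"
proof -
  have "x = cell_rep x + (\<Sum>i\<in>UNIV. of_int \<lfloor>x $ i\<rfloor> *\<^sub>R axis i 1)"
    using vec_scaleR_basis[of "\<chi> i. of_int \<lfloor>x $ i\<rfloor>"] by (simp add: cell_rep_def vec_eq_iff frac_def)
  then have "f x = f (cell_rep x + (\<Sum>i\<in>UNIV. of_int \<lfloor>x $ i\<rfloor> *\<^sub>R axis i 1))" by (rule arg_cong)
  also have "\<dots> = f (cell_rep x)" 
    using periodic_int_shift[where f = f and I = UNIV and n = "\<lambda>i. \<lfloor>x $ i\<rfloor>", OF assms] .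
  finally show ?thesis ..
qed

lemma C_st_bounded:
  assumes f: "f \<in> C_st T"
  obtains K where "K > 0" "\<And>z. z \<in> slab T \<Longrightarrow> norm (f z) \<le> K"
proof -
  have "compact (f ` ({0..T} \<times> cbox 0 1))"
    by (intro compact_continuous_image continuous_on_subset[OF C_stD[OF f]] compact_Times) auto
  then have "\<exists>K>0. \<forall>y\<in>f ` ({0..T} \<times> cbox 0 1). norm y \<le> K"
    using compact_imp_bounded bounded_pos by metis
  then obtain K where K: "K > 0" "\<And>z. z \<in> {0..T} \<times> cbox 0 1 \<Longrightarrow> norm (f z) \<le> K"
    by (elim exE conjE) (rule that, assumption, erule bspec, erule imageI)
  have "norm (f z) \<le> K" if zT: "z \<in> slab T" for z
  proof -
    obtain t x where z: "z = (t, x)" and t: "t \<in> {0..T}" using zT by auto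
    have "f (t, cell_rep x) = f (t, x)"
      using periodic_cell_rep[of "\<lambda>x. f (t, x)" x] f t by (simp add: C_st_def)
    moreover have "(t, cell_rep x) \<in> {0..T} \<times> cbox 0 1"
      using cell_rep_in[of x] unit_cell_subset t by auto
    ultimately show ?thesis using K(2)[of "(t, cell_rep x)"] by (simp add: z)
  qed
  then show ?thesis using K(1) that by blast
qed

lemma slab_integrable: "g \<in> C_st T \<Longrightarrow> t \<le> T \<Longrightarrow> set_integrable lborel ({0..t} \<times> unit_cell) g"
  for g :: "real \<times> (real^'d) \<Rightarrow> real"
  using set_integrable_slab_cell C_stD C_st_mono by blast

lemma cell_integrable: "g \<in> C_torus \<Longrightarrow> set_integrable lborel unit_cell g"
  for g :: "real^'d \<Rightarrow> real"
  by (simp add: set_integrable_cell C_torus_def)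

lemma C_torus_inner: "f \<in> C_torus \<Longrightarrow> g \<in> C_torus \<Longrightarrow> (\<lambda>x. f x \<bullet> g x) \<in> C_torus"
  and C_torus_norm: "f \<in> C_torus \<Longrightarrow> (\<lambda>x. norm (f x)) \<in> C_torus"
  and C_torus_add: "f \<in> C_torus \<Longrightarrow> g \<in> C_torus \<Longrightarrow> (\<lambda>x. f x + g x) \<in> C_torus"
  and C_torus_scaleR: "a \<in> C_torus \<Longrightarrow> f \<in> C_torus \<Longrightarrow> (\<lambda>x. a x *\<^sub>R f x) \<in> C_torus"
  and C_torus_const: "(\<lambda>_. c) \<in> C_torus"
  for f g :: "real^'d \<Rightarrow> 'b::euclidean_space"
  by (auto simp: C_torus_def intro!: continuous_intros)

lemma in_dual_density:
  fixes f :: "'a \<Rightarrow> 'b::euclidean_space" and S :: "'a set"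
  assumes "S \<in> sets M" "S \<subseteq> K" "C \<noteq> {}"
    and int: "\<And>\<phi>. \<phi> \<in> C \<Longrightarrow> set_integrable M S (\<lambda>x. \<phi> x \<bullet> f x)"
    and n: "set_integrable M S (\<lambda>x. norm (f x))"
  shows "in_dual K C (\<lambda>\<phi>. LINT x:S|M. \<phi> x \<bullet> f x)"
  unfolding in_dual_def
proof (intro conjI ballI allI impI exI)
  show "(LINT x:S|M. (\<phi> x + \<psi> x) \<bullet> f x) = (LINT x:S|M. \<phi> x \<bullet> f x) + (LINT x:S|M. \<psi> x \<bullet> f x)"
    if "\<phi> \<in> C" "\<psi> \<in> C" for \<phi> \<psi>
    using set_integral_add(2)[OF int[OF that(1)] int[OF that(2)]] by (simp add: inner_add_left)
  show "(LINT x:S|M. (c *\<^sub>R \<phi> x) \<bullet> f x) = c * (LINT x:S|M. \<phi> x \<bullet> f x)" for c \<phi>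
    by simp
  fix \<phi> N assume \<phi>: "\<phi> \<in> C" and N: "\<forall>z\<in>K. norm (\<phi> z) \<le> N"
  have "\<bar>LINT x:S|M. \<phi> x \<bullet> f x\<bar> \<le> (LINT x:S|M. \<bar>\<phi> x \<bullet> f x\<bar>)"
    using set_integral_norm_bound[OF int[OF \<phi>]] by simp
  also have "\<dots> \<le> (LINT x:S|M. norm (f x) * N)"
  proof (rule set_integral_mono)
    show "set_integrable M S (\<lambda>x. \<bar>\<phi> x \<bullet> f x\<bar>)" using set_integrable_abs[OF int[OF \<phi>]] .
    show "set_integrable M S (\<lambda>x. norm (f x) * N)" using n by simp
    fix x assume "x \<in> S"
    then have "norm (\<phi> x) \<le> N" using N assms(2) by auto
    then show "\<bar>\<phi> x \<bullet> f x\<bar> \<le> norm (f x) * N"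
      by (metis Cauchy_Schwarz_ineq2 mult.commute mult_left_mono norm_ge_zero order_trans)
  qed
  finally show "\<bar>LINT x:S|M. \<phi> x \<bullet> f x\<bar> \<le> (LINT x:S|M. norm (f x)) * N" by simp
qed

lemma torus_measure_density:
  assumes "f \<in> C_torus"
  shows "torus_measure (torus_density f)"
  unfolding torus_density_def
  by (rule in_dual_density) (auto intro: cell_integrable C_torus_inner C_torus_norm assms C_torus_const)

lemma st_measure_density:
  assumes "f \<in> C_st T"
  shows "st_measure T (st_density T f)"
  unfolding st_density_def
  by (rule in_dual_density) (auto intro: slab_integrable C_st_inner C_st_norm assms C_st_const)

lemma st_lift_density:
  fixes f :: "real \<times> (real^'d) \<Rightarrow> 'b::euclidean_space"
  assumes "f \<in> C_st T" "t \<in> {0..T}" "\<phi> \<in> C_st t"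
  shows "st_lift t (\<lambda>s. torus_density (\<lambda>x. f (s, x))) \<phi> = slab_integral t (\<lambda>z. \<phi> z \<bullet> f z)"
  unfolding st_lift_def torus_density_def
  by (rule Fubini_slab[symmetric], rule C_stD, rule C_st_inner) (use assms C_st_mono in auto)

section \<open>Restriction of a measure to an initial time interval\<close>

lemma C_st_measurable:
  fixes f :: "real \<times> (real^'d) \<Rightarrow> 'b::euclidean_space"
  assumes "f \<in> C_st T" "st_borel T \<mu>"
  shows "f \<in> borel_measurable \<mu>"
proof -
  have "f \<in> borel_measurable (restrict_space borel ({0..T} \<times> unit_cell))"
    by (rule borel_measurable_continuous_on_restrict[OF continuous_on_subset[OF C_stD[OF assms(1)]]]) auto
  moreover have "sets \<mu> = sets (restrict_space borel ({0..T} \<times> unit_cell))"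
    using assms(2) by (simp add: st_borel_def)
  ultimately show ?thesis using measurable_cong_sets by blast
qed

lemma st_borel_space: "st_borel T \<mu> \<Longrightarrow> space \<mu> = {0..T} \<times> unit_cell"
  using sets_eq_imp_space_eq[of \<mu> "restrict_space borel ({0..T} \<times> unit_cell)"]
  by (simp add: st_borel_def space_restrict_space)

text \<open>
  The integral over \<open>[0,t]\<close> is defined through any representation \<open>f \<mu>\<close> of the functional.  It is a limit of
  values of the functional on continuous functions and hence independent of the representation, so that
  every representation computes it.
\<close>

lemma integral_upto_eq:
  fixes f \<phi> :: "real \<times> (real^'d) \<Rightarrow> 'b::euclidean_space"
  assumes t: "t \<in> {0..T}" and \<mu>: "st_borel T \<mu>" "integrable \<mu> f"
    and L: "\<And>\<phi>. \<phi> \<in> C_st T \<Longrightarrow> L \<phi> = (\<integral>z. \<phi> z \<bullet> f z \<partial>\<mu>)" and \<phi>: "\<phi> \<in> C_st t"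
  shows "integral_upto T t L \<phi> = (\<integral>z. (indicator ({0..t} \<times> UNIV) z *\<^sub>R \<phi> z) \<bullet> f z \<partial>\<mu>)"
proof -
  \<comment> \<open>Cut-offs decreasing to the indicator of \<open>[0,t]\<close>; after time \<open>t\<close> the field is frozen, to remain continuous.\<close>
  define k where "k n s = max 0 (1 - real n * max 0 (s - t))" for n s
  define \<psi> where "\<psi> n z = k n (fst z) *\<^sub>R \<phi> (min (fst z) t, snd z)" for n z
  let ?g = "\<lambda>z. indicator ({0..t} \<times> UNIV) z *\<^sub>R \<phi> z"
  have \<psi>: "\<psi> n \<in> C_st T" for n
  proof -
    have "continuous_on (slab T) (\<lambda>z. \<phi> (min (fst z) t, snd z))"
      by (rule continuous_on_compose2[OF C_stD[OF \<phi>]]) (use t in \<open>auto intro!: continuous_intros\<close>)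
    then have "(\<lambda>z. \<phi> (min (fst z) t, snd z)) \<in> C_st T"
      using \<phi> t by (auto simp: C_st_def min_def)
    moreover have "(\<lambda>z :: real \<times> (real^'d). k n (fst z)) \<in> C_st T"
      unfolding k_def by (rule C_st_time) (intro continuous_intros)
    ultimately show ?thesis unfolding \<psi>_def by (intro C_st_scaleR)
  qed
  have lim: "(\<lambda>n. \<psi> n z) \<longlonglongrightarrow> ?g z" if z: "z \<in> slab T" for z
  proof (cases "fst z \<le> t")
    case True
    then have "\<psi> n z = ?g z" for n
      using z by (auto simp: \<psi>_def k_def indicator_def)
    then show ?thesis by simp
  next
    case False
    then obtain N :: nat where N: "1 < real N * (fst z - t)"
      using reals_Archimedean3[of "fst z - t"] by auto
    have "\<psi> n z = ?g z" if "n \<ge> N" for n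
    proof -
      have "real N * (fst z - t) \<le> real n * (fst z - t)"
        using that False by (intro mult_right_mono) auto
      then have "1 < real n * (fst z - t)" using N by linarith
      then have "k n (fst z) = 0" using False by (simp add: k_def max_def)
      then show ?thesis using False by (simp add: \<psi>_def indicator_def mem_Times_iff)
    qed
    then show ?thesis by (intro tendsto_eventually eventually_sequentiallyI[of N])
  qed
  obtain K where K: "K > 0" "\<And>z. z \<in> slab t \<Longrightarrow> norm (\<phi> z) \<le> K"
    using C_st_bounded[OF \<phi>] by blast
  have bound: "norm (\<psi> n z) \<le> K" if z: "z \<in> slab T" for n z
  proof -
    have "norm (\<phi> (min (fst z) t, snd z)) \<le> K" using K(2) z t by (auto simp: min_def)
    moreover have "0 \<le> k n (fst z)" "k n (fst z) \<le> 1" by (auto simp: k_def)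
    ultimately show ?thesis
      using mult_mono[of "k n (fst z)" 1 "norm (\<phi> (min (fst z) t, snd z))" K] by (simp add: \<psi>_def)
  qed
  have conv: "(\<lambda>n. L (\<psi> n)) \<longlonglongrightarrow> (\<integral>z. ?g z \<bullet> f z \<partial>\<mu>)"
    if \<mu>: "st_borel T \<mu>" "integrable \<mu> f" and L: "\<forall>\<phi>\<in>C_st T. L \<phi> = (\<integral>z. \<phi> z \<bullet> f z \<partial>\<mu>)"
    for \<mu> and f :: "real \<times> (real^'d) \<Rightarrow> 'b"
  proof -
    have sp: "space \<mu> \<subseteq> slab T" using st_borel_space[OF \<mu>(1)] by auto
    have [measurable]: "\<psi> n \<in> borel_measurable \<mu>" for n using C_st_measurable[OF \<psi> \<mu>(1)] .
    have [measurable]: "f \<in> borel_measurable \<mu>" using \<mu>(2) by simp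
    have [measurable]: "?g \<in> borel_measurable \<mu>"
      by (rule borel_measurable_LIMSEQ_metric[of \<psi>]) (use lim sp in auto)
    have "(\<lambda>n. \<integral>z. \<psi> n z \<bullet> f z \<partial>\<mu>) \<longlonglongrightarrow> (\<integral>z. ?g z \<bullet> f z \<partial>\<mu>)"
    proof (rule integral_dominated_convergence[where w = "\<lambda>z. K * norm (f z)"])
      show "integrable \<mu> (\<lambda>z. K * norm (f z))" using \<mu>(2) by simp
      show "AE z in \<mu>. (\<lambda>n. \<psi> n z \<bullet> f z) \<longlonglongrightarrow> ?g z \<bullet> f z"
        by (rule AE_I2, rule tendsto_inner[OF lim tendsto_const]) (use sp in auto)
      show "AE z in \<mu>. norm (\<psi> n z \<bullet> f z) \<le> K * norm (f z)" for n
      proof (rule AE_I2)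
        fix z assume "z \<in> space \<mu>"
        then have "norm (\<psi> n z) \<le> K" using bound sp by blast
        then show "norm (\<psi> n z \<bullet> f z) \<le> K * norm (f z)"
          using Cauchy_Schwarz_ineq2[of "\<psi> n z" "f z"] mult_right_mono[of "norm (\<psi> n z)" K "norm (f z)"]
          by simp
      qed
    qed measurable
    then show ?thesis using L \<psi> by simp
  qed
  show ?thesis unfolding integral_upto_def borel_integral_def
  proof (rule the_equality)
    show "\<exists>\<mu>' f'. st_borel T \<mu>' \<and> integrable \<mu>' f' \<and> (\<forall>\<phi>\<in>C_st T. L \<phi> = (\<integral>z. \<phi> z \<bullet> f' z \<partial>\<mu>'))
        \<and> (\<integral>z. ?g z \<bullet> f z \<partial>\<mu>) = (\<integral>z. ?g z \<bullet> f' z \<partial>\<mu>')"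
      using \<mu> L by blast
    fix y assume "\<exists>\<mu>' f'. st_borel T \<mu>' \<and> integrable \<mu>' f' \<and> (\<forall>\<phi>\<in>C_st T. L \<phi> = (\<integral>z. \<phi> z \<bullet> f' z \<partial>\<mu>'))
        \<and> y = (\<integral>z. ?g z \<bullet> f' z \<partial>\<mu>')"
    then show "y = (\<integral>z. ?g z \<bullet> f z \<partial>\<mu>)"
      using conv conv[OF \<mu>] L LIMSEQ_unique by blast
  qed
qed

lemma st_borel_lborel: 
  fixes t :: real
  shows "st_borel t (restrict_space lborel ({0..t} \<times> (unit_cell :: (real^'d) set)))"
proof -
  have "emeasure lborel ({0..t} \<times> (unit_cell :: (real^'d) set)) \<le> emeasure lborel (cbox (0, 0) (t, 1) :: (real \<times> (real^'d)) set)"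
  proof (rule emeasure_mono)
    show "{0..t} \<times> (unit_cell :: (real^'d) set) \<subseteq> cbox (0, 0) (t, 1)"
      unfolding cbox_Pair_eq using unit_cell_subset by auto
  qed simp
  also have "\<dots> < \<infinity>" by (rule emeasure_lborel_cbox_finite)
  finally have f: "emeasure lborel ({0..t} \<times> (unit_cell :: (real^'d) set)) < \<infinity>" .
  show ?thesis unfolding st_borel_def
  proof
    show "sets (restrict_space lborel ({0..t} \<times> unit_cell :: (real \<times> (real^'d)) set)) = sets (restrict_space borel ({0..t} \<times> unit_cell))"
      by (rule sets_restrict_space_cong) simp
    show "finite_measure (restrict_space lborel ({0..t} \<times> unit_cell :: (real \<times> (real^'d)) set))"
      by (rule finite_measureI) (use f in \<open>simp add: space_restrict_space emeasure_restrict_space\<close>)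
  qed
qed

lemma integral_upto_density:
  fixes f \<phi> :: "real \<times> (real^'d) \<Rightarrow> 'b::euclidean_space"
  assumes t: "t \<in> {0..T}" and f: "f \<in> C_st T" and \<phi>: "\<phi> \<in> C_st t"
  shows "integral_upto T t (st_density T f) \<phi> = slab_integral t (\<lambda>z. \<phi> z \<bullet> f z)"
proof -
  let ?S = "{0..T} \<times> (unit_cell :: (real^'d) set)"
  let ?\<mu> = "restrict_space lborel ?S"
  have S: "?S \<inter> space lborel \<in> sets lborel" by simp
  have "set_integrable lborel ?S (\<lambda>z. norm (f z))"
    by (rule slab_integrable[OF C_st_norm[OF f]]) simp
  then have "integrable ?\<mu> (\<lambda>z. norm (f z))"
    by (simp add: integrable_restrict_space[OF S] set_integrable_def)
  then have "integrable ?\<mu> f"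
    by (rule Bochner_Integration.integrable_bound) (simp_all add: C_st_measurable[OF f st_borel_lborel])
  then have "integral_upto T t (st_density T f) \<phi>
      = (\<integral>z. (indicator ({0..t} \<times> UNIV) z *\<^sub>R \<phi> z) \<bullet> f z \<partial>?\<mu>)"
    by (intro integral_upto_eq t \<phi> st_borel_lborel)
       (simp_all add: st_density_def integral_restrict_space[OF S] set_lebesgue_integral_def)
  also have "\<dots> = slab_integral t (\<lambda>z. \<phi> z \<bullet> f z)"
    unfolding integral_restrict_space[OF S] set_lebesgue_integral_def
    by (intro Bochner_Integration.integral_cong refl) (use t in \<open>auto simp: indicator_def\<close>)
  finally show ?thesis .
qed

section \<open>Balance laws and energies of densities\<close>

text \<open>
  Integrated form of \<open>\<partial>\<^sub>tF + \<nabla>\<cdot>G\<close>: the flux has no boundary contribution on the torus.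
\<close>

lemma balance_law:
  fixes F :: "real \<times> (real^'d) \<Rightarrow> real" and G :: "real \<times> (real^'d) \<Rightarrow> real^'d"
  assumes T: "T > 0" and F: "st_deriv T F F'" and G: "st_deriv T G G'" and t: "t \<in> {0..T}"
  shows "slab_integral t (\<lambda>z. F' z (1, 0) + (\<Sum>j\<in>UNIV. G' z (0, axis j 1) $ j))
      = cell_integral (\<lambda>x. F (t, x)) - cell_integral (\<lambda>x. F (0, x))"
proof -
  have F'C: "(\<lambda>z. F' z (1, 0)) \<in> C_st T" using st_deriv_C_st[OF T F] .
  have G'C: "(\<lambda>z. G' z (0, axis j 1) $ j) \<in> C_st T" for j using C_st_nth[OF st_deriv_C_st[OF T G]] .
  have "(\<lambda>z. F' z (1, 0) + (\<Sum>j\<in>UNIV. G' z (0, axis j 1) $ j)) \<in> C_st T"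
    by (rule C_st_add[OF F'C C_st_sum[OF G'C]])
  then have "(\<lambda>z. F' z (1, 0) + (\<Sum>j\<in>UNIV. G' z (0, axis j 1) $ j)) \<in> C_st t" 
    by (rule C_st_mono) (use t in auto)
  then have "slab_integral t (\<lambda>z. F' z (1, 0) + (\<Sum>j\<in>UNIV. G' z (0, axis j 1) $ j))
     = (LINT s:{0..t}|lborel. cell_integral (\<lambda>x. F' (s, x) (1, 0) + (\<Sum>j\<in>UNIV. G' (s, x) (0, axis j 1) $ j)))"
    by (intro Fubini_slab C_stD)
  also have "\<dots> = (LINT s:{0..t}|lborel. cell_integral (\<lambda>x. F' (s, x) (1, 0)))"
  proof (rule set_lebesgue_integral_cong, simp, intro allI impI)
    fix s assume "s \<in> {0..t}"
    then have s: "s \<in> {0..T}" using t by auto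
    have i: "set_integrable lborel unit_cell (\<lambda>x. G' (s, x) (0, axis j 1) $ j)" for j
      by (rule cell_integrable[OF C_st_slice[OF G'C s]])
    have "cell_integral (\<lambda>x. F' (s, x) (1, 0) + (\<Sum>j\<in>UNIV. G' (s, x) (0, axis j 1) $ j))
       = cell_integral (\<lambda>x. F' (s, x) (1, 0)) + cell_integral (\<lambda>x. (\<Sum>j\<in>UNIV. G' (s, x) (0, axis j 1) $ j))"
      by (intro set_integral_add cell_integrable C_st_slice[OF F'C s] C_st_slice[OF C_st_sum[OF G'C] s])
    also have "cell_integral (\<lambda>x. (\<Sum>j\<in>UNIV. G' (s, x) (0, axis j 1) $ j))
       = (\<Sum>j\<in>UNIV. cell_integral (\<lambda>x. G' (s, x) (0, axis j 1) $ j))"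
      unfolding set_lebesgue_integral_def scaleR_sum_right
      by (intro Bochner_Integration.integral_sum) (use i in \<open>simp add: set_integrable_def\<close>)
    also have "\<dots> = 0" using cell_integral_pd_zero[OF T st_deriv_nth[OF G] s] by simp
    finally show "cell_integral (\<lambda>x. F' (s, x) (1, 0) + (\<Sum>j\<in>UNIV. G' (s, x) (0, axis j 1) $ j))
      = cell_integral (\<lambda>x. F' (s, x) (1, 0))" by simp
  qed
  also have "\<dots> = cell_integral (\<lambda>x. F (t, x)) - cell_integral (\<lambda>x. F (0, x))"
    by (rule cell_integral_FTC[OF T F t])
  finally show ?thesis .
qed

lemma slab_integral_add: "f \<in> C_st t \<Longrightarrow> g \<in> C_st t \<Longrightarrow>
    slab_integral t (\<lambda>z. f z + g z) = slab_integral t f + slab_integral t g"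
  and slab_integral_diff: "f \<in> C_st t \<Longrightarrow> g \<in> C_st t \<Longrightarrow>
    slab_integral t (\<lambda>z. f z - g z) = slab_integral t f - slab_integral t g"
  by (simp_all add: slab_integrable set_integral_add set_integral_diff)

lemma slab_integral_cong: "(\<And>z. z \<in> slab t \<Longrightarrow> f z = g z) \<Longrightarrow> slab_integral t f = slab_integral t g"
  by (rule set_lebesgue_integral_cong) auto

lemma cell_integral_cong: "(\<And>x. f x = g x) \<Longrightarrow> cell_integral f = cell_integral g"
  by simp

lemma in_dual_add: "in_dual K C L \<Longrightarrow> f \<in> C \<Longrightarrow> g \<in> C \<Longrightarrow> L (\<lambda>z. f z + g z) = L f + L g"
  and in_dual_scale: "in_dual K C L \<Longrightarrow> f \<in> C \<Longrightarrow> L (\<lambda>z. c *\<^sub>R f z) = c * L f"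
  and in_dual_bound: "in_dual K C L \<Longrightarrow> \<exists>M. \<forall>f\<in>C. \<forall>N. (\<forall>z\<in>K. norm (f z) \<le> N) \<longrightarrow> \<bar>L f\<bar> \<le> M * N"
  by (auto simp: in_dual_def)

lemma torus_measure_add: "torus_measure L \<Longrightarrow> f \<in> C_torus \<Longrightarrow> g \<in> C_torus \<Longrightarrow> L (\<lambda>z. f z + g z) = L f + L g"
  using in_dual_add by blast

lemma torus_measure_cmult: "torus_measure L \<Longrightarrow> f \<in> C_torus \<Longrightarrow> L (\<lambda>z. c * f z :: real) = c * L f"
  using in_dual_scale[of UNIV C_torus L f c] by simp

lemma C_torus_minus: "f \<in> C_torus \<Longrightarrow> (\<lambda>z. - f z) \<in> C_torus"
  and C_torus_diff: "f \<in> C_torus \<Longrightarrow> g \<in> C_torus \<Longrightarrow> (\<lambda>z. f z - g z) \<in> C_torus"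
  and C_torus_mult: "a \<in> C_torus \<Longrightarrow> c \<in> C_torus \<Longrightarrow> (\<lambda>z. a z * c z :: real) \<in> C_torus"
  by (auto simp: C_torus_def intro!: continuous_intros)

lemma torus_measure_diff: 
  assumes "torus_measure L" "f \<in> C_torus" "g \<in> C_torus" shows "L (\<lambda>z. f z - g z) = L f - L g"
proof -
  have "L (\<lambda>z. f z - g z) + L g = L (\<lambda>z. (f z - g z) + g z)"
    by (rule in_dual_add[OF assms(1) C_torus_diff[OF assms(2,3)] assms(3), symmetric])
  then show ?thesis by simp
qed

abbreviation nonneg_measure :: "('d::finite, real) torus_functional \<Rightarrow> bool" where
  "nonneg_measure \<rho> \<equiv> (\<forall>\<phi>\<in>C_torus. (\<forall>x. 0 \<le> \<phi> x) \<longrightarrow> 0 \<le> \<rho> \<phi>)"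

lemma nonneg_measure_mono:
  assumes "torus_measure \<rho>" "nonneg_measure \<rho>" "f \<in> C_torus" "g \<in> C_torus" "\<And>x. f x \<le> g x"
  shows "\<rho> f \<le> \<rho> g"
proof -
  have "0 \<le> \<rho> (\<lambda>x. g x - f x)" using assms(2,5) C_torus_diff[OF assms(4,3)] by simp
  then show ?thesis using torus_measure_diff[OF assms(1,4,3)] by simp
qed

text \<open>
  For \<open>U = \<rho>D\<close> the defining supremum is bounded pointwise by \<open>\<theta> + D\<cdot>\<Theta> \<le> D\<cdot>\<Theta> - |\<Theta>|\<^sup>2/2 \<le> |D|\<^sup>2/2\<close>, and it is
  attained at \<open>\<Theta> = D\<close> because \<open>D\<close> is continuous.
\<close>

lemma kinetic_eq:
  fixes D :: "real^'d \<Rightarrow> real^'d"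
  assumes \<rho>: "torus_measure \<rho>" "nonneg_measure \<rho>" and D: "D \<in> C_torus"
    and U: "\<And>\<Theta>. \<Theta> \<in> C_torus \<Longrightarrow> U \<Theta> = \<rho> (\<lambda>x. D x \<bullet> \<Theta> x)"
  shows "kinetic \<rho> U = ereal (\<rho> (\<lambda>x. 1/2 * (D x \<bullet> D x)))"
  unfolding kinetic_def
proof (rule antisym)
  have DD: "(\<lambda>x. 1/2 * (D x \<bullet> D x)) \<in> C_torus" by (intro C_torus_mult C_torus_inner D C_torus_const)
  show "Sup {ereal (\<rho> \<theta> + U \<Theta>) | \<theta> \<Theta>. \<theta> \<in> C_torus \<and> \<Theta> \<in> C_torus \<and>
      (\<forall>x. \<theta> x + 1/2 * (norm (\<Theta> x))\<^sup>2 \<le> 0)} \<le> ereal (\<rho> (\<lambda>x. 1/2 * (D x \<bullet> D x)))"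
  proof (rule Sup_least, clarify)
    fix \<theta> and \<Theta> :: "real^'d \<Rightarrow> real^'d"
    assume th: "\<theta> \<in> C_torus" "\<Theta> \<in> C_torus" "\<forall>x. \<theta> x + 1/2 * (norm (\<Theta> x))\<^sup>2 \<le> 0"
    have "\<rho> \<theta> + U \<Theta> = \<rho> (\<lambda>x. \<theta> x + D x \<bullet> \<Theta> x)"
      by (simp add: U[OF th(2)] torus_measure_add[OF \<rho>(1) th(1) C_torus_inner[OF D th(2)]])
    also have "\<dots> \<le> \<rho> (\<lambda>x. 1/2 * (D x \<bullet> D x))"
    proof (rule nonneg_measure_mono[OF \<rho> C_torus_add[OF th(1) C_torus_inner[OF D th(2)]] DD])
      fix x
      have "0 \<le> (D x - \<Theta> x) \<bullet> (D x - \<Theta> x)" by simp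
      then have "D x \<bullet> \<Theta> x \<le> 1/2 * (D x \<bullet> D x) + 1/2 * (norm (\<Theta> x))\<^sup>2"
        by (simp add: inner_diff_left inner_diff_right power2_norm_eq_inner inner_commute)
      then show "\<theta> x + D x \<bullet> \<Theta> x \<le> 1/2 * (D x \<bullet> D x)" using th(3)[rule_format, of x] by linarith
    qed
    finally show "ereal (\<rho> \<theta> + U \<Theta>) \<le> ereal (\<rho> (\<lambda>x. 1/2 * (D x \<bullet> D x)))" by simp
  qed
  have "\<rho> (\<lambda>x. 1/2 * (D x \<bullet> D x)) = \<rho> (\<lambda>x. (-1/2) * (D x \<bullet> D x)) + U D"
    unfolding U[OF D] torus_measure_cmult[OF \<rho>(1) C_torus_inner[OF D D], of "1/2"]
      torus_measure_cmult[OF \<rho>(1) C_torus_inner[OF D D], of "- 1/2"] by simp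
  moreover have "(\<lambda>x. (-1/2) * (D x \<bullet> D x)) \<in> C_torus" by (intro C_torus_mult C_torus_inner D C_torus_const)
  ultimately show "ereal (\<rho> (\<lambda>x. 1/2 * (D x \<bullet> D x))) \<le> Sup {ereal (\<rho> \<theta> + U \<Theta>) | \<theta> \<Theta>. \<theta> \<in> C_torus \<and> \<Theta> \<in> C_torus \<and>
      (\<forall>x. \<theta> x + 1/2 * (norm (\<Theta> x))\<^sup>2 \<le> 0)}"
    using D by (intro Sup_upper CollectI exI[of _ "\<lambda>x. (-1/2) * (D x \<bullet> D x)"] exI[of _ D])
       (auto simp: power2_norm_eq_inner)
qed

lemma energy_eq:
  fixes b \<beta> :: "real \<times> (real^'d) \<Rightarrow> real^'d"
  assumes \<rho>: "torus_measure (\<rho> t)" "nonneg_measure (\<rho> t)" and b: "b \<in> C_st T" and \<beta>: "\<beta> \<in> C_st T"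
    and t: "t \<in> {0..T}" and B: "\<And>\<Theta>. \<Theta> \<in> C_torus \<Longrightarrow> B t \<Theta> = \<rho> t (\<lambda>x. b (t, x) \<bullet> \<Theta> x)"
  shows "energy \<beta> B \<rho> t
    = ereal (\<rho> t (\<lambda>x. 1/2 * ((b (t, x) - \<beta> (t, x)) \<bullet> (b (t, x) - \<beta> (t, x)))))"
  unfolding energy_def
proof (rule kinetic_eq[OF \<rho>])
  show "(\<lambda>x. b (t, x) - \<beta> (t, x)) \<in> C_torus" by (rule C_st_slice[OF C_st_diff[OF b \<beta>] t])
  show "B t \<Theta> - \<rho> t (\<lambda>x. \<beta> (t, x) \<bullet> \<Theta> x) = \<rho> t (\<lambda>x. (b (t, x) - \<beta> (t, x)) \<bullet> \<Theta> x)"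
    if \<Theta>: "\<Theta> \<in> C_torus" for \<Theta>
    using torus_measure_diff[OF \<rho>(1) C_torus_inner[OF C_st_slice[OF b t] \<Theta>]
        C_torus_inner[OF C_st_slice[OF \<beta> t] \<Theta>]]
    by (simp add: B[OF \<Theta>] inner_diff_left)
qed

text \<open>
  The weighted Lebesgue measure \<open>\<rho> dx dt\<close> with the field \<open>u\<close> is admissible in the infimum.  Only this
  inequality matters for the dissipation inequality, in which the quadratic term is on the smaller side.
\<close>

lemma st_quad_energy_density_le:
  fixes u :: "real \<times> (real^'d) \<Rightarrow> 'b::euclidean_space"
  assumes \<rho>: "\<rho> \<in> C_st t" "\<And>z. z \<in> slab t \<Longrightarrow> \<rho> z \<ge> 0" and u: "u \<in> C_st t"
    and Q: "(\<lambda>z. u z \<bullet> Q z (u z)) \<in> C_st t"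
    and L: "\<And>\<theta>. \<theta> \<in> C_st t \<Longrightarrow> L \<theta> = slab_integral t (\<lambda>z. \<rho> z * \<theta> z)"
    and U: "\<And>\<Theta>. \<Theta> \<in> C_st t \<Longrightarrow> U \<Theta> = slab_integral t (\<lambda>z. \<rho> z * (\<Theta> z \<bullet> u z))"
  shows "st_quad_energy t Q L U \<le> ereal (1/2 * slab_integral t (\<lambda>z. \<rho> z * (u z \<bullet> Q z (u z))))"
proof -
  let ?S = "{0..t} \<times> (unit_cell :: (real^'d) set)"
  define M where "M = restrict_space lborel ?S"
  define \<mu> where "\<mu> = density M (\<lambda>z. ennreal (\<rho> z))"
  have S: "?S \<inter> space lborel \<in> sets lborel" by simp
  have M: "st_borel t M" unfolding M_def by (rule st_borel_lborel)
  have sp: "space M \<subseteq> slab t" using st_borel_space[OF M] by auto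
  have m: "g \<in> borel_measurable M" if "g \<in> C_st t" for g :: "real \<times> (real^'d) \<Rightarrow> 'c::euclidean_space"
    using C_st_measurable[OF that M] .
  have pos: "AE z in M. 0 \<le> \<rho> z" using sp \<rho>(2) by (intro AE_I2) auto
  have iM: "integrable M g" "integral\<^sup>L M g = slab_integral t g" if "g \<in> C_st t" for g
    using slab_integrable[OF that, of t] unfolding M_def
    by (simp_all add: integrable_restrict_space[OF S] integral_restrict_space[OF S]
        set_integrable_def set_lebesgue_integral_def)
  have i\<mu>: "integrable \<mu> g" "integral\<^sup>L \<mu> g = slab_integral t (\<lambda>z. \<rho> z * g z)" if g: "g \<in> C_st t" for g
    unfolding \<mu>_def
    using integrable_density[OF m[OF g] m[OF \<rho>(1)] pos] integral_density[OF m[OF g] m[OF \<rho>(1)] pos]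
      iM[OF C_st_mult[OF \<rho>(1) g]] by simp_all
  have \<mu>: "st_borel t \<mu>" unfolding st_borel_def
  proof
    show "sets \<mu> = sets (restrict_space borel ?S)" using M by (simp add: \<mu>_def st_borel_def)
    have "emeasure \<mu> (space \<mu>) = (\<integral>\<^sup>+z. ennreal (\<rho> z) \<partial>M)"
      unfolding \<mu>_def using m[OF \<rho>(1)] by (subst emeasure_density) (auto intro!: nn_integral_cong)
    also have "\<dots> < \<infinity>" using nn_integral_eq_integral[OF iM(1)[OF \<rho>(1)] pos] by simp
    finally show "finite_measure \<mu>" by (intro finite_measureI) simp
  qed
  show ?thesis unfolding st_quad_energy_def
  proof (rule Inf_lower, rule CollectI, intro exI conjI ballI)
    show "st_borel t \<mu>" by fact
    show "L \<theta> = (\<integral>z. \<theta> z \<partial>\<mu>)" if "\<theta> \<in> C_st t" for \<theta> using that by (simp add: L i\<mu>)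
    show "u \<in> borel_measurable \<mu>" using C_st_measurable[OF u \<mu>] .
    show "integrable \<mu> (\<lambda>z. (norm (u z))\<^sup>2)" by (intro i\<mu> C_st_power C_st_norm u)
    show "U \<Theta> = (\<integral>z. \<Theta> z \<bullet> u z \<partial>\<mu>)" if "\<Theta> \<in> C_st t" for \<Theta>
      using that by (simp add: U i\<mu> C_st_inner u)
    show "ereal (1/2 * slab_integral t (\<lambda>z. \<rho> z * (u z \<bullet> Q z (u z))))
       = ereal (1/2 * (\<integral>z. u z \<bullet> Q z (u z) \<partial>\<mu>))"
      by (simp add: i\<mu>(2)[OF Q])
  qed
qed

section \<open>Classical solutions are dissipative\<close>

lemma cell_integral_continuous:
  fixes g :: "real \<times> (real^'d) \<Rightarrow> real"
  assumes g: "g \<in> C_st T"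
  shows "continuous_on {0..T} (\<lambda>t. cell_integral (\<lambda>x. g (t, x)))"
proof (rule continuous_on_sequentiallyI)
  fix u :: "nat \<Rightarrow> real" and a
  assume u: "\<forall>n. u n \<in> {0..T}" and a: "a \<in> {0..T}" and lim: "u \<longlonglongrightarrow> a"
  obtain K where K: "K > 0" "\<And>z. z \<in> slab T \<Longrightarrow> norm (g z) \<le> K" using C_st_bounded[OF g] by blast
  have int: "set_integrable lborel unit_cell (\<lambda>x. g (s, x))" if "s \<in> {0..T}" for s
    by (rule cell_integrable[OF C_st_slice[OF g that]])
  have K_int: "set_integrable lborel unit_cell (\<lambda>x::real^'d. K)"
    by (rule cell_integrable[OF C_torus_const])
  show "(\<lambda>n. cell_integral (\<lambda>x. g (u n, x))) \<longlonglongrightarrow> cell_integral (\<lambda>x. g (a, x))"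
    unfolding set_lebesgue_integral_def
  proof (rule integral_dominated_convergence[where w = "\<lambda>x. indicator unit_cell x *\<^sub>R K"])
    show "(\<lambda>x. indicator unit_cell x *\<^sub>R g (a, x)) \<in> borel_measurable lborel"
      using int[OF a] by (auto simp: set_integrable_def)
    show "(\<lambda>x. indicator unit_cell x *\<^sub>R g (u n, x)) \<in> borel_measurable lborel" for n
      using int[OF u[rule_format]] by (auto simp: set_integrable_def)
    show "integrable lborel (\<lambda>x::real^'d. indicator unit_cell x *\<^sub>R K)"
      using K_int unfolding set_integrable_def .
    show "AE x in lborel. (\<lambda>n. indicator unit_cell x *\<^sub>R g (u n, x)) \<longlonglongrightarrow> indicator unit_cell x *\<^sub>R g (a, x)"
    proof (rule AE_I2)
      fix x :: "real^'d"
      have "(\<lambda>n. (u n, x)) \<longlonglongrightarrow> (a, x)" using lim by (intro tendsto_intros)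
      then have "(\<lambda>n. g (u n, x)) \<longlonglongrightarrow> g (a, x)"
        by (rule continuous_on_tendsto_compose[OF C_stD[OF g]]) (use u a in auto)
      then show "(\<lambda>n. indicator unit_cell x *\<^sub>R g (u n, x)) \<longlonglongrightarrow> indicator unit_cell x *\<^sub>R g (a, x)"
        by (rule tendsto_scaleR[OF tendsto_const])
    qed
    show "AE x in lborel. norm (indicator unit_cell x *\<^sub>R g (u n, x)) \<le> indicator unit_cell x *\<^sub>R K" for n
      using K(2) u by (intro AE_I2) (auto simp: indicator_def)
  qed
qed

lemma weak_star_continuous_density:
  fixes f :: "real \<times> (real^'d) \<Rightarrow> 'b::euclidean_space"
  assumes f: "f \<in> C_st T"
  shows "weak_star_continuous T (\<lambda>t. torus_density (\<lambda>x. f (t, x)))"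
  unfolding weak_star_continuous_def
proof (intro conjI ballI)
  show "torus_measure (torus_density (\<lambda>x. f (t, x)))" if "t \<in> {0..T}" for t
    by (rule torus_measure_density[OF C_st_slice[OF f that]])
  show "continuous_on {0..T} (\<lambda>t. torus_density (\<lambda>x. f (t, x)) \<phi>)" if "\<phi> \<in> C_torus" for \<phi>
    using cell_integral_continuous[OF C_st_inner[OF C_st_of_torus[OF that] f]]
    by (simp add: torus_density_def)
qed

lemma nonneg_measure_density:
  assumes "\<And>x. 0 \<le> f x"
  shows "nonneg_measure (torus_density f)"
  unfolding torus_density_def set_lebesgue_integral_def
  using assms by (auto intro!: integral_nonneg)

lemma test_function_deriv:
  fixes \<phi> :: "real \<times> (real^'d) \<Rightarrow> real"
  assumes "\<phi> \<in> test_functions T"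
  shows "st_deriv T \<phi> (\<lambda>z. frechet_derivative \<phi> (at z))"
proof (rule st_derivI)
  have "Ck (Suc 0) \<phi>" and p: "\<phi> (t, x + axis i 1) = \<phi> (t, x)" for t x i
    using assms by (auto simp: test_functions_def simp del: Ck.simps)
  then have d: "\<phi> differentiable (at z)" and c: "continuous_on UNIV (\<lambda>z. frechet_derivative \<phi> (at z) v)" for z v
    unfolding Ck.simps by blast+
  have D: "(\<phi> has_derivative frechet_derivative \<phi> (at z)) (at z)" for z
    using d frechet_derivative_works by blast
  show "(\<phi> has_derivative frechet_derivative \<phi> (at z)) (at z within slab T)" for z
    using D has_derivative_at_withinI by blast
  show "continuous_on (slab T) (\<lambda>z. frechet_derivative \<phi> (at z) h)" for h
    using c continuous_on_subset by blast
  have "continuous_on UNIV \<phi>"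
    using D has_derivative_continuous continuous_at_imp_continuous_on by blast
  then have "continuous_on (slab T) \<phi>" by (rule continuous_on_subset) simp
  then show "\<phi> \<in> C_st T" using p by (simp add: C_st_def)
qed

lemma grad_eq:
  assumes "st_deriv T \<phi> \<phi>'" "t \<in> {0..T}"
  shows "grad \<phi> (t, x) = (\<chi> j. \<phi>' (t, x) (0, axis j 1))"
  by (simp add: grad_def pd_eq[OF assms])

lemma grad_C_st:
  assumes "T > 0" "st_deriv T \<phi> \<phi>'"
  shows "grad \<phi> \<in> C_st T"
  by (rule C_st_vec, rule C_st_cong[OF st_deriv_C_st[OF assms]]) (auto simp: grad_eq[OF assms(2)])

lemma L_C_st:
  fixes \<beta> w :: "real \<times> (real^'d) \<Rightarrow> real^'d"
  assumes T: "T > 0" and \<beta>: "st_deriv T \<beta> \<beta>'" and w: "st_deriv T w w'"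
  shows "L1 T \<beta> w \<in> C_st T" "L2 T \<beta> w \<in> C_st T" "L3 \<beta> w \<in> C_st T"
proof -
  note C = st_derivD(1)[OF \<beta>] st_derivD(1)[OF w] st_deriv_C_st_apply[OF T \<beta>] st_deriv_C_st_apply[OF T w] C_st_const
  have "(\<lambda>z. w z \<bullet> w z + \<beta> z \<bullet> \<beta>' z (1, 0) + \<beta> z \<bullet> \<beta>' z (0, w z)
      - \<beta> z \<bullet> w' z (0, \<beta> z) - \<beta>' z (0, \<beta> z) \<bullet> w z) \<in> C_st T"
    by (intro C_st_add C_st_diff C_st_inner C)
  then show "L1 T \<beta> w \<in> C_st T"
    by (rule C_st_cong) (auto simp only: L1_eq[OF T \<beta> w] mem_Times_iff split_paired_all fst_conv)
  have "(\<lambda>z. - \<beta>' z (1, 0) - \<beta>' z (0, w z) + w' z (0, \<beta> z)) \<in> C_st T"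
    by (intro C_st_add C_st_diff C_st_minus C)
  then show "L2 T \<beta> w \<in> C_st T"
    by (rule C_st_cong) (auto simp only: L2_eq[OF T \<beta> w] mem_Times_iff split_paired_all fst_conv)
  have "(\<lambda>z. - w z + \<beta>' z (0, \<beta> z)) \<in> C_st T"
    by (intro C_st_add C_st_diff C_st_minus C)
  then show "L3 \<beta> w \<in> C_st T"
    by (rule C_st_cong) (auto simp only: L3_eq[OF T \<beta> w] mem_Times_iff split_paired_all fst_conv)
qed

lemma Qr_inner_C_st:
  fixes \<beta> w :: "real \<times> (real^'d) \<Rightarrow> real^'d"
  assumes T: "T > 0" and \<beta>: "st_deriv T \<beta> \<beta>'" and w: "st_deriv T w w'"
    and C: "\<xi> \<in> C_st T" "\<eta> \<in> C_st T" "\<xi>' \<in> C_st T" "\<eta>' \<in> C_st T"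
  shows "(\<lambda>z. (\<xi>' z, \<eta>' z) \<bullet> Qr \<beta> w r z (\<xi> z, \<eta> z)) \<in> C_st T"
proof (rule C_st_cong)
  note CC = C st_deriv_C_st_apply[OF T \<beta>] st_deriv_C_st_apply[OF T w] C_st_const
  show "(\<lambda>z. r * (\<xi>' z \<bullet> \<xi> z) - \<xi>' z \<bullet> w' z (0, \<xi> z) - \<xi> z \<bullet> w' z (0, \<xi>' z) + \<xi>' z \<bullet> \<beta>' z (0, \<eta> z)
     - \<eta> z \<bullet> \<beta>' z (0, \<xi>' z) + \<xi> z \<bullet> \<beta>' z (0, \<eta>' z) - \<eta>' z \<bullet> \<beta>' z (0, \<xi> z) + 2 * (\<eta>' z \<bullet> \<eta> z)) \<in> C_st T"
    by (intro C_st_add C_st_diff C_st_inner C_st_mult CC)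
  fix z :: "real \<times> (real^'d)" assume "z \<in> slab T"
  then obtain t x where z: "z = (t, x)" "t \<in> {0..T}" by auto
  show "(\<xi>' z, \<eta>' z) \<bullet> Qr \<beta> w r z (\<xi> z, \<eta> z) =
     r * (\<xi>' z \<bullet> \<xi> z) - \<xi>' z \<bullet> w' z (0, \<xi> z) - \<xi> z \<bullet> w' z (0, \<xi>' z) + \<xi>' z \<bullet> \<beta>' z (0, \<eta> z)
     - \<eta> z \<bullet> \<beta>' z (0, \<xi>' z) + \<xi> z \<bullet> \<beta>' z (0, \<eta>' z) - \<eta>' z \<bullet> \<beta>' z (0, \<xi> z) + 2 * (\<eta>' z \<bullet> \<eta> z)"
    unfolding Qr_bilinear z(1) Jac_mult[OF \<beta> z(2)] Jac_mult[OF w z(2)] ..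
qed

lemma linear_sum_basis:
  fixes l :: "real \<times> (real^'d) \<Rightarrow> real"
  assumes "linear l"
  shows "(\<Sum>j\<in>UNIV. l (0, axis j 1) * a $ j) = l (0, a)"
  using linear_Pair_basis[OF assms, of 0 a] by (simp add: mult.commute)

lemma divergence_product:
  fixes G :: "real \<times> (real^'d) \<Rightarrow> real^'d"
  assumes \<phi>: "st_deriv T \<phi> \<phi>'" and G: "st_deriv T G G'" and z: "z \<in> slab T"
  shows "(\<Sum>j\<in>UNIV. (\<phi> z *\<^sub>R G' z (0, axis j 1) + \<phi>' z (0, axis j 1) *\<^sub>R G z) $ j)
     = \<phi> z * (\<Sum>j\<in>UNIV. pd j (\<lambda>y. G y $ j) z) + \<phi>' z (0, G z)"
proof -
  obtain t x where tx: "z = (t, x)" "t \<in> {0..T}" using z by auto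
  show ?thesis
    using linear_sum_basis[OF st_derivD(5)[OF \<phi> z], of "G z"]
    by (simp add: tx(1) pd_eq[OF st_deriv_nth[OF G] tx(2)] sum.distrib sum_distrib_left)
qed

lemma slab_integral_minus: "slab_integral t (\<lambda>z. - f z) = - slab_integral t f"
  by (simp add: set_lebesgue_integral_def)

text \<open>
  The balance law is applied to the energy density \<open>exp(-rt) \<rho> e\<close>, \<open>e = |D|\<^sup>2/2\<close>, with flux
  \<open>exp(-rt)(e P - (D\<cdot>V) B)\<close>.  By the continuity equation and \<open>\<nabla>\<cdot>B = 0\<close>, its density is
  \<open>exp(-rt) \<rho> (D\<^sub>t e - r e - (b\<cdot>\<nabla>)(D\<cdot>V))\<close>, which is the negative of the integrand of the dissipation
  inequality.
\<close>

theorem classical_imp_dissipative: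
  fixes B :: "real \<times> (real^'d) \<Rightarrow> real^'d"
  assumes T: "T > 0" and cl: "classical_solution T B \<rho> P"
  shows "dissipative_solution T
           (torus_density (\<lambda>x. B (0, x))) (torus_density (\<lambda>x. \<rho> (0, x)))
           (\<lambda>t. torus_density (\<lambda>x. B (t, x))) (\<lambda>t. torus_density (\<lambda>x. \<rho> (t, x)))
           (st_density T P)"
proof -
  obtain b v b' v' \<rho>' where b: "st_deriv T b b'" and v: "st_deriv T v v'" and \<rho>: "st_deriv T \<rho> \<rho>'"
    and B0: "st_deriv T B (\<lambda>z h. \<rho> z *\<^sub>R b' z h + \<rho>' z h *\<^sub>R b z)"
    and P0: "st_deriv T P (\<lambda>z h. \<rho> z *\<^sub>R v' z h + \<rho>' z h *\<^sub>R v z)"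
    and pos_all: "\<forall>z\<in>slab T. \<rho> z > 0"
    and Bb_all: "\<forall>z\<in>slab T. B z = \<rho> z *\<^sub>R b z"
    and Pv_all: "\<forall>z\<in>slab T. P z = \<rho> z *\<^sub>R v z"
    and vb_all: "\<forall>z\<in>slab T. v z = b' z (0, b z)"
    and bv_all: "\<forall>z\<in>slab T. b' z (1, v z) = v' z (0, b z)"
    and divB_all: "\<forall>z\<in>slab T. (\<Sum>j\<in>UNIV. pd j (\<lambda>y. B y $ j) z) = 0"
    and divP_all: "\<forall>z\<in>slab T. dt T \<rho> z + (\<Sum>j\<in>UNIV. pd j (\<lambda>y. P y $ j) z) = 0"
    by (rule classical_velocity[OF T cl])
  note pos = bspec[OF pos_all] and Bb = bspec[OF Bb_all] and Pv = bspec[OF Pv_all] and vb = bspec[OF vb_all]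
    and bv = bspec[OF bv_all] and divB = bspec[OF divB_all] and divP = bspec[OF divP_all]
  obtain B' P' where B: "st_deriv T B B'" and P: "st_deriv T P P'" using B0 P0 by blast
  note BC = st_derivD(1)[OF B] and PC = st_derivD(1)[OF P] and \<rho>C = st_derivD(1)[OF \<rho>]
    and bC = st_derivD(1)[OF b] and vC = st_derivD(1)[OF v]
  have T0: "0 \<in> {0..T}" and TT: "T \<in> {0..T}" using T by auto
  have tm: "torus_measure (torus_density (\<lambda>x. \<rho> (t, x)))" if "t \<in> {0..T}" for t
    by (rule torus_measure_density[OF C_st_slice[OF \<rho>C that]])
  have nn: "nonneg_measure (torus_density (\<lambda>x. \<rho> (t, x)))" if "t \<in> {0..T}" for t
    by (rule nonneg_measure_density) (use pos[of "(t, _)"] that in \<open>simp add: less_imp_le\<close>)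
  have div_free: "st_lift T (\<lambda>t. torus_density (\<lambda>x. B (t, x))) (grad \<phi>) = 0" if test: "\<phi> \<in> test_functions T" for \<phi>
  proof -
    obtain \<phi>' where \<phi>: "st_deriv T \<phi> \<phi>'" using test_function_deriv[OF test] by blast
    have "st_lift T (\<lambda>t. torus_density (\<lambda>x. B (t, x))) (grad \<phi>) = slab_integral T (\<lambda>z. grad \<phi> z \<bullet> B z)"
      by (rule st_lift_density[OF BC TT grad_C_st[OF T \<phi>]])
    also have "\<dots> = slab_integral T (\<lambda>z. (\<lambda>_ _. 0 :: real) z (1::real, 0::real^'d)
        + (\<Sum>j\<in>UNIV. (\<phi> z *\<^sub>R B' z (0, axis j 1) + \<phi>' z (0, axis j 1) *\<^sub>R B z) $ j))"
    proof (rule slab_integral_cong)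
      fix z :: "real \<times> (real^'d)" assume z: "z \<in> slab T"
      show "grad \<phi> z \<bullet> B z = (\<lambda>_ _. 0 :: real) z (1::real, 0::real^'d)
        + (\<Sum>j\<in>UNIV. (\<phi> z *\<^sub>R B' z (0, axis j 1) + \<phi>' z (0, axis j 1) *\<^sub>R B z) $ j)"
        unfolding divergence_product[OF \<phi> B z] divB[OF z]
        using z linear_sum_basis[OF st_derivD(5)[OF \<phi> z], of "B z"]
        by (cases z) (simp add: grad_eq[OF \<phi>] inner_vec_def)
    qed
    also have "\<dots> = 0"
      by (subst balance_law[OF T st_deriv_const[of T 0] st_deriv_scaleR[OF \<phi> B] TT]) simp
    finally show ?thesis .
  qed
  have continuity: "st_lift T (\<lambda>t. torus_density (\<lambda>x. \<rho> (t, x))) (dt T \<phi>) + st_density T P (grad \<phi>) = 0"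
    if test: "\<phi> \<in> test_functions T" for \<phi>
  proof -
    obtain \<phi>' where \<phi>: "st_deriv T \<phi> \<phi>'" using test_function_deriv[OF test] by blast
    have dt\<phi>: "dt T \<phi> \<in> C_st T"
      by (rule C_st_cong[OF st_deriv_C_st[OF T \<phi>, of "(1, 0)"]]) (auto simp: dt_eq[OF T \<phi>])
    have "st_lift T (\<lambda>t. torus_density (\<lambda>x. \<rho> (t, x))) (dt T \<phi>) + st_density T P (grad \<phi>)
      = slab_integral T (\<lambda>z. dt T \<phi> z \<bullet> \<rho> z) + slab_integral T (\<lambda>z. grad \<phi> z \<bullet> P z)"
      using st_lift_density[OF \<rho>C TT dt\<phi>] by (simp add: st_density_def)
    also have "\<dots> = slab_integral T (\<lambda>z. dt T \<phi> z \<bullet> \<rho> z + grad \<phi> z \<bullet> P z)"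
      by (intro slab_integral_add[symmetric] C_st_inner dt\<phi> \<rho>C PC grad_C_st[OF T \<phi>])
    also have "\<dots> = slab_integral T (\<lambda>z. (\<phi> z * \<rho>' z (1, 0) + \<phi>' z (1, 0) * \<rho> z)
        + (\<Sum>j\<in>UNIV. (\<phi> z *\<^sub>R P' z (0, axis j 1) + \<phi>' z (0, axis j 1) *\<^sub>R P z) $ j))"
    proof (rule slab_integral_cong)
      fix z :: "real \<times> (real^'d)" assume z: "z \<in> slab T"
      then have "\<phi> z * (\<rho>' z (1, 0) + (\<Sum>j\<in>UNIV. pd j (\<lambda>y. P y $ j) z)) = 0"
        using divP[OF z] by (cases z) (simp add: dt_eq[OF T \<rho>])
      then show "dt T \<phi> z \<bullet> \<rho> z + grad \<phi> z \<bullet> P z = (\<phi> z * \<rho>' z (1, 0) + \<phi>' z (1, 0) * \<rho> z)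
        + (\<Sum>j\<in>UNIV. (\<phi> z *\<^sub>R P' z (0, axis j 1) + \<phi>' z (0, axis j 1) *\<^sub>R P z) $ j)"
        unfolding divergence_product[OF \<phi> P z]
        using z linear_sum_basis[OF st_derivD(5)[OF \<phi> z], of "P z"]
        by (cases z) (simp add: grad_eq[OF \<phi>] dt_eq[OF T \<phi>] inner_vec_def distrib_left)
    qed
    also have "\<dots> = 0"
    proof -
      have "\<exists>\<epsilon>>0. \<forall>t x. \<phi> (t, x) \<noteq> 0 \<longrightarrow> \<epsilon> \<le> t \<and> t \<le> T - \<epsilon>" using test by (simp add: test_functions_def)
      then have "\<phi> (T, x) = 0" "\<phi> (0, x) = 0" for x by fastforce+
      then show ?thesis
        by (subst balance_law[OF T st_deriv_mult[OF \<phi> \<rho>] st_deriv_scaleR[OF \<phi> P] TT]) simp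
    qed
    finally show ?thesis .
  qed
  have dissipation: "dissipation_inequality T \<beta> w (\<lambda>t. torus_density (\<lambda>x. B (t, x)))
      (\<lambda>t. torus_density (\<lambda>x. \<rho> (t, x))) (st_density T P) r t"
    if "\<beta> \<in> C1_st T" "w \<in> C1_st T" and t: "t \<in> {0..T}" for \<beta> w r t
  proof -
    obtain \<beta>' w' where \<beta>: "st_deriv T \<beta> \<beta>'" and w: "st_deriv T w w'" 
      using \<open>\<beta> \<in> C1_st T\<close> \<open>w \<in> C1_st T\<close> C1_st_iff by metis
    have tT: "t \<le> T" and t0: "0 \<le> t" using t by auto
    note Ct = C_st_mono[OF _ tT]
    note \<beta>C = st_derivD(1)[OF \<beta>] and wC = st_derivD(1)[OF w]
    define D where "D z = b z - \<beta> z" for z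
    define V where "V z = v z - w z" for z
    define D' where "D' z h = b' z h - \<beta>' z h" for z h
    define V' where "V' z h = v' z h - w' z h" for z h
    have D: "st_deriv T D D'" and V: "st_deriv T V V'"
      unfolding D_def V_def D'_def V'_def by (rule st_deriv_diff b v \<beta> w)+
    note DC = st_derivD(1)[OF D] and VC = st_derivD(1)[OF V]
    define e where "e z = 1/2 * (D z \<bullet> D z)" for z
    have e: "st_deriv T e (\<lambda>z h. D z \<bullet> D' z h)"
      by (rule st_deriv_cong[OF st_deriv_half_norm[OF D]]) (simp_all add: e_def power2_norm_eq_inner)
    have \<zeta>: "st_deriv T (\<lambda>z. D z \<bullet> V z) (\<lambda>z h. D z \<bullet> V' z h + D' z h \<bullet> V z)"
      by (rule st_deriv_inner[OF D V])
    define k where "k z = exp (- r * fst z)" for z :: "real \<times> (real^'d)"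
    have k: "st_deriv T k (\<lambda>z h. (- r * exp (- r * fst z)) * fst h)"
      unfolding k_def by (rule st_deriv_time_fun) (auto intro!: derivative_eq_intros continuous_intros)
    note kC = st_derivD(1)[OF k]
    define S where "S z = L1 T \<beta> w z + b z \<bullet> L2 T \<beta> w z + v z \<bullet> L3 \<beta> w z" for z
    define q where "q z = (D z, V z) \<bullet> Qr \<beta> w r z (D z, V z)" for z
    note LC = L_C_st[OF T \<beta> w]
    have qC: "q \<in> C_st T" unfolding q_def by (rule Qr_inner_C_st[OF T \<beta> w DC VC DC VC])
    have SC: "S \<in> C_st T" unfolding S_def by (intro C_st_add C_st_inner LC bC vC)
    \<comment> \<open>The weighted energy density and its flux.\<close>
    note F = st_deriv_mult[OF k st_deriv_mult[OF \<rho> e]]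
    note G0 = st_deriv_diff[OF st_deriv_scaleR[OF e P] st_deriv_scaleR[OF \<zeta> B]]
    note G = st_deriv_scaleR[OF k G0]
    have "slab_integral t (\<lambda>z. \<rho> z * (k z * (1/2 * q z - S z)))
       = - (cell_integral (\<lambda>x. k (t, x) * (\<rho> (t, x) * e (t, x))) - cell_integral (\<lambda>x. k (0, x) * (\<rho> (0, x) * e (0, x))))"
      unfolding balance_law[OF T F G t, symmetric] slab_integral_minus[symmetric]
      proof (rule slab_integral_cong)
        fix z :: "real \<times> (real^'d)" assume "z \<in> slab t"
        then have z: "z \<in> slab T" using tT by auto
        then obtain s x where sx: "z = (s, x)" "s \<in> {0..T}" by auto
        have l: "linear (b' z)" "linear (v' z)" "linear (\<beta>' z)" "linear (w' z)" "linear (\<rho>' z)"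
          using st_derivD(5) z b v \<beta> w \<rho> by blast+
        have id: "1/2 * q z - S z = r * e z - D z \<bullet> D' z (1, v z) + (D z \<bullet> V' z (0, b z) + D' z (0, b z) \<bullet> V z)"
          using relative_energy_identity[OF T \<beta> w sx(2) l(1,2), of v x b r] vb[OF z] bv[OF z]
          unfolding q_def S_def e_def D_def V_def D'_def V'_def sx(1) by simp
        have dP: "(\<Sum>j\<in>UNIV. pd j (\<lambda>y. P y $ j) z) = - \<rho>' z (1, 0)"
          using divP[OF z] unfolding sx(1) dt_eq[OF T \<rho> sx(2)] by linarith
        have lin: "D z \<bullet> D' z (0, \<rho> z *\<^sub>R a) = \<rho> z * (D z \<bullet> D' z (0, a))"
           "D z \<bullet> V' z (0, \<rho> z *\<^sub>R a) + D' z (0, \<rho> z *\<^sub>R a) \<bullet> V z = \<rho> z * (D z \<bullet> V' z (0, a) + D' z (0, a) \<bullet> V z)"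
           "D z \<bullet> D' z (1, a) = D z \<bullet> D' z (1, 0) + D z \<bullet> D' z (0, a)" for a
          using linear_scale[OF st_derivD(5)[OF D z], of "\<rho> z" "(0, a)"]
            linear_scale[OF st_derivD(5)[OF V z], of "\<rho> z" "(0, a)"]
            linear_diff_Pair(2)[OF st_derivD(5)[OF D z], of a]
          by (simp_all add: inner_add_right distrib_left)
        have flux: "(\<Sum>j\<in>UNIV. (e z *\<^sub>R P' z (0, axis j 1) + (D z \<bullet> D' z (0, axis j 1)) *\<^sub>R P z -
             ((D z \<bullet> V z) *\<^sub>R B' z (0, axis j 1) + (D z \<bullet> V' z (0, axis j 1) + D' z (0, axis j 1) \<bullet> V z) *\<^sub>R B z)) $ j)
          = e z * (- \<rho>' z (1, 0)) + \<rho> z * (D z \<bullet> D' z (0, v z))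
            - \<rho> z * (D z \<bullet> V' z (0, b z) + D' z (0, b z) \<bullet> V z)"
          using divergence_product[OF e P z] divergence_product[OF \<zeta> B z]
          unfolding divB[OF z] dP
          by (simp add: sum_subtractf, simp add: Pv[OF z] Bb[OF z] lin(1)) (use lin(2)[of "b z"] in linarith)
        show "\<rho> z * (k z * (1/2 * q z - S z)) =
           - (k z * (\<rho> z * (D z \<bullet> D' z (1, 0)) + \<rho>' z (1, 0) * e z)
               + - r * exp (- r * fst z) * fst (1, 0) * (\<rho> z * e z) +
             (\<Sum>j\<in>UNIV. (k z *\<^sub>R
                  (e z *\<^sub>R P' z (0, axis j 1) + (D z \<bullet> D' z (0, axis j 1)) *\<^sub>R P z -
                   ((D z \<bullet> V z) *\<^sub>R B' z (0, axis j 1) +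
                    (D z \<bullet> V' z (0, axis j 1) + D' z (0, axis j 1) \<bullet> V z) *\<^sub>R B z)) +
                  (- r * exp (- r * fst z) * fst (0, axis j 1)) *\<^sub>R
                  (e z *\<^sub>R P z - (D z \<bullet> V z) *\<^sub>R B z)) $ j))"
        proof -
          have flux_k: "(\<Sum>j\<in>UNIV. (k z *\<^sub>R
                  (e z *\<^sub>R P' z (0, axis j 1) + (D z \<bullet> D' z (0, axis j 1)) *\<^sub>R P z -
                   ((D z \<bullet> V z) *\<^sub>R B' z (0, axis j 1) +
                    (D z \<bullet> V' z (0, axis j 1) + D' z (0, axis j 1) \<bullet> V z) *\<^sub>R B z)) +
                  (- r * exp (- r * fst z) * fst (0, axis j 1)) *\<^sub>R
                  (e z *\<^sub>R P z - (D z \<bullet> V z) *\<^sub>R B z)) $ j)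
             = k z * (e z * (- \<rho>' z (1, 0)) + \<rho> z * (D z \<bullet> D' z (0, v z))
                - \<rho> z * (D z \<bullet> V' z (0, b z) + D' z (0, b z) \<bullet> V z))"
            unfolding flux[symmetric] sum_distrib_left by (rule sum.cong) simp_all
          have "exp (- r * fst z) = k z" by (simp add: k_def)
          then show ?thesis unfolding flux_k id lin(3)[of "v z"] by (simp add: algebra_simps)
        qed
      qed
    then have balance: "cell_integral (\<lambda>x. k (t, x) * (\<rho> (t, x) * e (t, x))) + slab_integral t (\<lambda>z. \<rho> z * (k z * (1/2 * q z - S z)))
       = cell_integral (\<lambda>x. k (0, x) * (\<rho> (0, x) * e (0, x)))" by simp
    have en: "energy \<beta> (\<lambda>t. torus_density (\<lambda>x. B (t, x))) (\<lambda>t. torus_density (\<lambda>x. \<rho> (t, x))) s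
        = ereal (cell_integral (\<lambda>x. \<rho> (s, x) * e (s, x)))" if s: "s \<in> {0..T}" for s
    proof (subst energy_eq[where \<rho> = "\<lambda>t. torus_density (\<lambda>x. \<rho> (t, x))" and t = s, OF tm[OF s] nn[OF s] bC \<beta>C s])
      show "torus_density (\<lambda>x. B (s, x)) \<Theta> = torus_density (\<lambda>x. \<rho> (s, x)) (\<lambda>x. b (s, x) \<bullet> \<Theta> x)" for \<Theta>
        unfolding torus_density_def
        by (rule cell_integral_cong) (use Bb[of "(s, _)"] s in \<open>simp add: inner_commute mult.commute\<close>)
    qed (simp add: torus_density_def e_def D_def mult.commute)
    have quad: "st_quad_energy t (\<lambda>z \<zeta>. exp (- r * fst z) *\<^sub>R Qr \<beta> w r z \<zeta>)
           (st_lift t (\<lambda>t. torus_density (\<lambda>x. \<rho> (t, x)))) (U_tilde T \<beta> w (\<lambda>t. torus_density (\<lambda>x. B (t, x)))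
              (\<lambda>t. torus_density (\<lambda>x. \<rho> (t, x))) (st_density T P) t)
        \<le> ereal (1/2 * slab_integral t (\<lambda>z. \<rho> z * ((D z, V z) \<bullet> (exp (- r * fst z) *\<^sub>R Qr \<beta> w r z (D z, V z)))))"
    proof (rule st_quad_energy_density_le)
      show "\<rho> \<in> C_st t" by (rule Ct[OF \<rho>C])
      show "\<rho> z \<ge> 0" if "z \<in> slab t" for z using pos[of z] that tT by (auto simp: less_imp_le)
      show "(\<lambda>z. (D z, V z)) \<in> C_st t" by (intro C_st_Pair Ct DC VC)
      have "(\<lambda>z. k z * q z) \<in> C_st t" by (intro Ct C_st_mult kC qC)
      then show "(\<lambda>z. (D z, V z) \<bullet> (exp (- r * fst z) *\<^sub>R Qr \<beta> w r z (D z, V z))) \<in> C_st t"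
        by (simp add: k_def q_def)
      show "st_lift t (\<lambda>t. torus_density (\<lambda>x. \<rho> (t, x))) \<theta> = slab_integral t (\<lambda>z. \<rho> z * \<theta> z)" if "\<theta> \<in> C_st t" for \<theta>
        using st_lift_density[OF \<rho>C t that] by (simp add: mult.commute)
      fix \<Theta> :: "real \<times> (real^'d) \<Rightarrow> (real^'d) \<times> (real^'d)" assume \<Theta>: "\<Theta> \<in> C_st t"
      note CC = C_st_fst[OF \<Theta>] C_st_snd[OF \<Theta>] Ct[OF BC] Ct[OF PC] Ct[OF \<rho>C] Ct[OF \<beta>C] Ct[OF wC]
      have 1: "(\<lambda>z. \<beta> z \<bullet> fst (\<Theta> z)) \<in> C_st t" "(\<lambda>z. w z \<bullet> snd (\<Theta> z)) \<in> C_st t" by (intro C_st_inner CC)+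
      have "U_tilde T \<beta> w (\<lambda>t. torus_density (\<lambda>x. B (t, x))) (\<lambda>t. torus_density (\<lambda>x. \<rho> (t, x))) (st_density T P) t \<Theta>
        = (slab_integral t (\<lambda>z. fst (\<Theta> z) \<bullet> B z) - slab_integral t (\<lambda>z. (\<beta> z \<bullet> fst (\<Theta> z)) * \<rho> z))
        + (slab_integral t (\<lambda>z. snd (\<Theta> z) \<bullet> P z) - slab_integral t (\<lambda>z. (w z \<bullet> snd (\<Theta> z)) * \<rho> z))"
        unfolding U_tilde_def
        by (simp add: st_lift_density[OF BC t CC(1)] st_lift_density[OF \<rho>C t 1(1)] st_lift_density[OF \<rho>C t 1(2)]
            integral_upto_density[OF t PC CC(2)])
      also have "\<dots> = slab_integral t (\<lambda>z. (fst (\<Theta> z) \<bullet> B z - (\<beta> z \<bullet> fst (\<Theta> z)) * \<rho> z)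
          + (snd (\<Theta> z) \<bullet> P z - (w z \<bullet> snd (\<Theta> z)) * \<rho> z))"
        by (subst slab_integral_add, intro C_st_diff C_st_inner C_st_mult CC, intro C_st_diff C_st_inner C_st_mult CC)
           (intro arg_cong2[of _ _ _ _ "(+)"] slab_integral_diff[symmetric] C_st_inner C_st_mult CC)
      also have "\<dots> = slab_integral t (\<lambda>z. \<rho> z * (\<Theta> z \<bullet> (D z, V z)))"
      proof (rule slab_integral_cong)
        fix z :: "real \<times> (real^'d)" assume "z \<in> slab t"
        then have z: "z \<in> slab T" using tT by auto
        show "(fst (\<Theta> z) \<bullet> B z - (\<beta> z \<bullet> fst (\<Theta> z)) * \<rho> z) + (snd (\<Theta> z) \<bullet> P z - (w z \<bullet> snd (\<Theta> z)) * \<rho> z)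
            = \<rho> z * (\<Theta> z \<bullet> (D z, V z))"
          by (simp add: Bb[OF z] Pv[OF z] D_def V_def inner_prod_def inner_diff_right inner_commute algebra_simps)
      qed
      finally show "U_tilde T \<beta> w (\<lambda>t. torus_density (\<lambda>x. B (t, x))) (\<lambda>t. torus_density (\<lambda>x. \<rho> (t, x))) (st_density T P) t \<Theta>
         = slab_integral t (\<lambda>z. \<rho> z * (\<Theta> z \<bullet> (D z, V z)))" .
    qed
    have R: "R_term T \<beta> w (\<lambda>t. torus_density (\<lambda>x. B (t, x))) (\<lambda>t. torus_density (\<lambda>x. \<rho> (t, x))) (st_density T P) r t
        = slab_integral t (\<lambda>z. \<rho> z * (k z * S z))"
    proof -
      have C: "(\<lambda>z. k z * L1 T \<beta> w z) \<in> C_st t" "(\<lambda>z. k z *\<^sub>R L2 T \<beta> w z) \<in> C_st t" "(\<lambda>z. k z *\<^sub>R L3 \<beta> w z) \<in> C_st t"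
        by (intro C_st_mult C_st_scaleR Ct kC LC)+
      have "R_term T \<beta> w (\<lambda>t. torus_density (\<lambda>x. B (t, x))) (\<lambda>t. torus_density (\<lambda>x. \<rho> (t, x))) (st_density T P) r t
        = slab_integral t (\<lambda>z. (k z * L1 T \<beta> w z) \<bullet> \<rho> z) + slab_integral t (\<lambda>z. (k z *\<^sub>R L2 T \<beta> w z) \<bullet> B z)
          + slab_integral t (\<lambda>z. (k z *\<^sub>R L3 \<beta> w z) \<bullet> P z)"
        unfolding R_term_def k_def[symmetric]
        by (simp only: st_lift_density[OF \<rho>C t C(1)] st_lift_density[OF BC t C(2)] integral_upto_density[OF t PC C(3)])
      also have "\<dots> = slab_integral t (\<lambda>z. (k z * L1 T \<beta> w z) \<bullet> \<rho> z + (k z *\<^sub>R L2 T \<beta> w z) \<bullet> B z + (k z *\<^sub>R L3 \<beta> w z) \<bullet> P z)"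
        by (subst slab_integral_add, intro C_st_add C_st_inner C Ct[OF \<rho>C] Ct[OF BC], intro C_st_inner C Ct[OF PC])
           (intro arg_cong2[of _ _ _ _ "(+)"] slab_integral_add[symmetric] C_st_inner C Ct[OF \<rho>C] Ct[OF BC] refl)
      also have "\<dots> = slab_integral t (\<lambda>z. \<rho> z * (k z * S z))"
      proof (rule slab_integral_cong)
        fix z :: "real \<times> (real^'d)" assume "z \<in> slab t"
        then have z: "z \<in> slab T" using tT by auto
        show "(k z * L1 T \<beta> w z) \<bullet> \<rho> z + (k z *\<^sub>R L2 T \<beta> w z) \<bullet> B z + (k z *\<^sub>R L3 \<beta> w z) \<bullet> P z = \<rho> z * (k z * S z)"
          by (simp add: Bb[OF z] Pv[OF z] S_def inner_commute algebra_simps)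
      qed
      finally show ?thesis .
    qed
    have "1/2 * slab_integral t (\<lambda>z. \<rho> z * (k z * q z)) - slab_integral t (\<lambda>z. \<rho> z * (k z * S z))
        = slab_integral t (\<lambda>z. 1/2 * (\<rho> z * (k z * q z)) - \<rho> z * (k z * S z))"
      by (subst slab_integral_diff) (intro C_st_mult C_st_const Ct \<rho>C kC qC SC | simp)+
    also have "\<dots> = slab_integral t (\<lambda>z. \<rho> z * (k z * (1/2 * q z - S z)))"
      by (rule slab_integral_cong) (simp add: algebra_simps)
    finally have comb: "1/2 * slab_integral t (\<lambda>z. \<rho> z * (k z * q z)) - slab_integral t (\<lambda>z. \<rho> z * (k z * S z))
        = slab_integral t (\<lambda>z. \<rho> z * (k z * (1/2 * q z - S z)))" .
    have kt: "cell_integral (\<lambda>x. k (s, x) * (\<rho> (s, x) * e (s, x))) = cell_integral (\<lambda>x. \<rho> (s, x) * e (s, x)) * exp (- r * s)" for s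
      by (simp add: k_def mult.commute)
    show ?thesis unfolding dissipation_inequality_def en[OF t] en[OF T0] R
    proof
      let ?Q = "st_quad_energy t (\<lambda>z \<zeta>. exp (- r * fst z) *\<^sub>R Qr \<beta> w r z \<zeta>)
           (st_lift t (\<lambda>t. torus_density (\<lambda>x. \<rho> (t, x)))) (U_tilde T \<beta> w (\<lambda>t. torus_density (\<lambda>x. B (t, x)))
              (\<lambda>t. torus_density (\<lambda>x. \<rho> (t, x))) (st_density T P) t)"
      have "ereal (cell_integral (\<lambda>x. \<rho> (t, x) * e (t, x))) * ereal (exp (- r * t)) + (?Q - ereal (slab_integral t (\<lambda>z. \<rho> z * (k z * S z))))
         \<le> ereal (cell_integral (\<lambda>x. \<rho> (t, x) * e (t, x))) * ereal (exp (- r * t)) + 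
           (ereal (1/2 * slab_integral t (\<lambda>z. \<rho> z * (k z * q z))) - ereal (slab_integral t (\<lambda>z. \<rho> z * (k z * S z))))"
        using quad by (intro add_left_mono ereal_minus_mono) (simp_all add: k_def q_def)
      also have "\<dots> = ereal (cell_integral (\<lambda>x. \<rho> (0, x) * e (0, x)))"
        using balance comb by (simp add: kt)
      finally show "ereal (cell_integral (\<lambda>x. \<rho> (t, x) * e (t, x))) * ereal (exp (- r * t)) + (?Q - ereal (slab_integral t (\<lambda>z. \<rho> z * (k z * S z))))
          \<le> ereal (cell_integral (\<lambda>x. \<rho> (0, x) * e (0, x)))" .
    qed simp
  qed
  show ?thesis unfolding dissipative_solution_def
    using torus_measure_density[OF C_st_slice[OF BC T0]] tm[OF T0] nn[OF T0]
      weak_star_continuous_density[OF BC] weak_star_continuous_density[OF \<rho>C] st_measure_density[OF PC]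
      div_free continuity dissipation by auto
qed

section \<open>The measure of a positive functional\<close>

text \<open>
  An algebra of functions closed under positive parts, with a positive functional \<open>I\<close>.  The
  assumption \<open>Dini\<close> is the only trace of compactness: a series of nonnegative functions of \<open>C\<close> that exceeds
  \<open>1\<close> everywhere does so after finitely many terms.  It allows \<open>X\<close> to be the half-open fundamental cell, which is not compact.
  \<open>I\<close> is constrained on nonnegative functions alone, so that the positive part of a
  signed functional, defined by a supremum, fits.
\<close>

locale positive_functional =
  fixes X :: "'a set" and C :: "('a \<Rightarrow> real) set" and I :: "('a \<Rightarrow> real) \<Rightarrow> real"
  assumes const: "\<And>c. (\<lambda>_. c) \<in> C"
    and add: "\<And>f g. f \<in> C \<Longrightarrow> g \<in> C \<Longrightarrow> (\<lambda>x. f x + g x) \<in> C"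
    and mult: "\<And>f g. f \<in> C \<Longrightarrow> g \<in> C \<Longrightarrow> (\<lambda>x. f x * g x) \<in> C"
    and pos_part: "\<And>f. f \<in> C \<Longrightarrow> (\<lambda>x. max 0 (f x)) \<in> C"
    and bounded: "\<And>f. f \<in> C \<Longrightarrow> \<exists>K. \<forall>x\<in>X. f x \<le> K"
    and Dini: "\<And>f. (\<And>n. f n \<in> C) \<Longrightarrow> (\<And>n x. x \<in> X \<Longrightarrow> 0 \<le> f n x) \<Longrightarrow>
        (\<And>x. x \<in> X \<Longrightarrow> \<exists>n. 1 < (\<Sum>i<n. f i x)) \<Longrightarrow> \<exists>n. \<forall>x\<in>X. 1 \<le> (\<Sum>i<n::nat. f i x)"
    and I_add: "\<And>f g. f \<in> C \<Longrightarrow> g \<in> C \<Longrightarrow> (\<And>x. x \<in> X \<Longrightarrow> 0 \<le> f x) \<Longrightarrow> (\<And>x. x \<in> X \<Longrightarrow> 0 \<le> g x) \<Longrightarrow>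
        I (\<lambda>x. f x + g x) = I f + I g"
    and I_nonneg: "\<And>f. f \<in> C \<Longrightarrow> (\<And>x. x \<in> X \<Longrightarrow> 0 \<le> f x) \<Longrightarrow> 0 \<le> I f"
    and I_cmult: "\<And>f c. f \<in> C \<Longrightarrow> (\<And>x. x \<in> X \<Longrightarrow> 0 \<le> f x) \<Longrightarrow> 0 \<le> c \<Longrightarrow> I (\<lambda>x. c * f x) = c * I f"
begin

definition Cp where "Cp = {f \<in> C. \<forall>x\<in>X. 0 \<le> f x}"

lemma CpI: "f \<in> C \<Longrightarrow> (\<And>x. x \<in> X \<Longrightarrow> 0 \<le> f x) \<Longrightarrow> f \<in> Cp"
  and Cp_C: "f \<in> Cp \<Longrightarrow> f \<in> C" and Cp_nonneg: "f \<in> Cp \<Longrightarrow> x \<in> X \<Longrightarrow> 0 \<le> f x"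
  by (auto simp: Cp_def)

lemma I_add_Cp: "f \<in> Cp \<Longrightarrow> g \<in> Cp \<Longrightarrow> I (\<lambda>x. f x + g x) = I f + I g"
  by (rule I_add) (auto simp: Cp_def)

lemma I_nonneg_Cp: "f \<in> Cp \<Longrightarrow> 0 \<le> I f"
  by (rule I_nonneg) (auto simp: Cp_def)

lemma cmult: "f \<in> C \<Longrightarrow> (\<lambda>x. c * f x) \<in> C" using mult[OF const] by simp

lemma diff: "f \<in> C \<Longrightarrow> g \<in> C \<Longrightarrow> (\<lambda>x. f x - g x) \<in> C"
  using add[of f "\<lambda>x. (-1) * g x"] cmult[of g "-1"] by simp

lemma I0: "I (\<lambda>x. 0) = 0" using I_cmult[of "\<lambda>_. 0" 0] const by simp

lemma I_mono:
  assumes "f \<in> C" "g \<in> C" "\<And>x. x \<in> X \<Longrightarrow> 0 \<le> f x" "\<And>x. x \<in> X \<Longrightarrow> f x \<le> g x"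
  shows "I f \<le> I g"
  using I_add[of f "\<lambda>x. g x - f x"] I_nonneg[of "\<lambda>x. g x - f x"] assms diff[of g f] by simp

lemma I_diff:
  assumes "f \<in> C" "g \<in> C" "\<And>x. x \<in> X \<Longrightarrow> 0 \<le> f x" "\<And>x. x \<in> X \<Longrightarrow> f x \<le> g x"
  shows "I (\<lambda>x. g x - f x) = I g - I f"
  using I_add[of f "\<lambda>x. g x - f x"] assms diff[of g f] by simp

lemma sum_in: "(\<And>i. i < n \<Longrightarrow> f i \<in> C) \<Longrightarrow> (\<lambda>x. \<Sum>i<n::nat. f i x) \<in> C"
  by (induction n) (auto simp: const intro!: add)

lemma I_sum: "(\<And>i. i < n \<Longrightarrow> f i \<in> Cp) \<Longrightarrow> I (\<lambda>x. \<Sum>i<n::nat. f i x) = (\<Sum>i<n. I (f i))"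
proof (induction n)
  case (Suc n)
  have f: "f i \<in> Cp" if "i < Suc n" for i using Suc.prems that .
  have "I (\<lambda>x. (\<Sum>i<n. f i x) + f n x) = I (\<lambda>x. \<Sum>i<n. f i x) + I (f n)"
    by (rule I_add) (auto intro!: sum_in sum_nonneg Cp_C[OF f] Cp_nonneg[OF f])
  then show ?case using Suc.IH f by simp
qed (simp add: I0)

text \<open>
  Sets are covered by countable sums of functions, so that additivity of \<open>I\<close> applies to the covers
  themselves.
\<close>

definition outer :: "'a set \<Rightarrow> ennreal" where
  "outer A = (INF F \<in> {F. (\<forall>n. F n \<in> Cp) \<and> (\<forall>x\<in>A. 1 \<le> (\<Sum>n. ennreal (F n x)))}. \<Sum>n. ennreal (I (F n)))"

lemma outer_le:
  assumes "\<And>n. F n \<in> Cp" "\<And>x. x \<in> A \<Longrightarrow> 1 \<le> (\<Sum>n. ennreal (F n x))"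
  shows "outer A \<le> (\<Sum>n. ennreal (I (F n)))"
  unfolding outer_def using assms by (intro INF_lower) auto

lemma outer_le2:
  assumes F: "\<And>n k. F n k \<in> Cp" and A: "\<And>x. x \<in> A \<Longrightarrow> 1 \<le> (\<Sum>n. \<Sum>k. ennreal (F n k x))"
  shows "outer A \<le> (\<Sum>n. \<Sum>k. ennreal (I (F n k)))"
proof -
  let ?F = "\<lambda>i. case_prod F (prod_decode i)"
  have "outer A \<le> (\<Sum>i. ennreal (I (?F i)))"
  proof (rule outer_le)
    show "?F i \<in> Cp" for i using F by (simp add: case_prod_unfold)
    fix x assume "x \<in> A"
    have "(\<Sum>i. (\<lambda>p. ennreal (case_prod F p x)) (prod_decode i)) = (\<Sum>n. \<Sum>k. ennreal (F n k x))"
      by (rule suminf_ennreal_2dimen) simp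
    then show "1 \<le> (\<Sum>i. ennreal (?F i x))" using A[OF \<open>x \<in> A\<close>] by simp
  qed
  also have "(\<Sum>i. (\<lambda>p. ennreal (I (case_prod F p))) (prod_decode i)) = (\<Sum>n. \<Sum>k. ennreal (I (F n k)))"
    by (rule suminf_ennreal_2dimen) simp
  finally show ?thesis .
qed

lemma outer_le_single:
  assumes "\<psi> \<in> Cp" "\<And>x. x \<in> A \<Longrightarrow> 1 \<le> \<psi> x"
  shows "outer A \<le> ennreal (I \<psi>)"
proof -
  let ?F = "\<lambda>n. if n = 0 then \<psi> else (\<lambda>_. 0)"
  have s: "(\<Sum>n::nat. if n = 0 then c else 0) = (c :: ennreal)" for c
    by (subst suminf_finite[of "{0}"]) auto
  have "outer A \<le> (\<Sum>n. ennreal (I (?F n)))"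
  proof (rule outer_le)
    show "?F n \<in> Cp" for n :: nat using assms(1) const by (auto intro: CpI)
    fix x assume "x \<in> A"
    then have "1 \<le> ennreal (\<psi> x)" using assms(2) by simp
    moreover have "(\<Sum>n::nat. ennreal (?F n x)) = (\<Sum>n::nat. if n = 0 then ennreal (\<psi> x) else 0)"
      by (rule suminf_cong) simp
    ultimately show "1 \<le> (\<Sum>n::nat. ennreal (?F n x))" by (simp only: s)
  qed
  also have "(\<Sum>n::nat. ennreal (I (?F n))) = (\<Sum>n::nat. if n = 0 then ennreal (I \<psi>) else 0)"
    by (rule suminf_cong) (simp add: I0)
  also have "\<dots> = ennreal (I \<psi>)" by (rule s)
  finally show ?thesis .
qed

lemma outer_close:
  assumes "outer A < c"
  obtains F where "\<And>n. F n \<in> Cp" "\<And>x. x \<in> A \<Longrightarrow> 1 \<le> (\<Sum>n. ennreal (F n x))" "(\<Sum>n. ennreal (I (F n))) < c"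
  using assms unfolding outer_def INF_less_iff by auto

lemma outer_mono: "A \<subseteq> A' \<Longrightarrow> outer A \<le> outer A'"
  unfolding outer_def by (intro INF_superset_mono) auto

lemma outer_empty: "outer {} = 0"
  using outer_le_single[of "\<lambda>_. 0" "{}"] const by (simp add: CpI I0)

lemma eps_series: "e > 0 \<Longrightarrow> (\<Sum>n. ennreal (e * (1/2) ^ Suc n)) = ennreal e"
  using sums_mult[OF power_half_series, of e] by (intro suminf_ennreal_eq) auto

lemma outer_measure_space: "outer_measure_space (Pow X) outer"
  unfolding outer_measure_space_def positive_def increasing_def countably_subadditive_def
proof (intro conjI allI impI ballI outer_empty)
  show "outer A \<le> outer A'" if "A \<subseteq> A'" for A A' using that by (rule outer_mono)
  fix A :: "nat \<Rightarrow> 'a set"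
  show "outer (\<Union>i. A i) \<le> (\<Sum>i. outer (A i))"
  proof (rule ennreal_le_epsilon)
    fix e :: real assume e: "0 < e" and fin: "(\<Sum>n. outer (A n)) < top"
    have "\<forall>n. \<exists>F. (\<forall>k. F k \<in> Cp) \<and> (\<forall>x\<in>A n. 1 \<le> (\<Sum>k. ennreal (F k x)))
        \<and> (\<Sum>k. ennreal (I (F k))) < outer (A n) + ennreal (e * (1/2) ^ Suc n)"
    proof
      fix n
      have "outer (A n) < top" using ennreal_suminf_lessD[OF fin] .
      then have "outer (A n) < outer (A n) + ennreal (e * (1/2) ^ Suc n)" using e by (simp add: less_top)
      then obtain F where "\<And>k. F k \<in> Cp" "\<And>x. x \<in> A n \<Longrightarrow> 1 \<le> (\<Sum>k. ennreal (F k x))"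
         "(\<Sum>k. ennreal (I (F k))) < outer (A n) + ennreal (e * (1/2) ^ Suc n)" by (rule outer_close) blast
      then show "\<exists>F. (\<forall>k. F k \<in> Cp) \<and> (\<forall>x\<in>A n. 1 \<le> (\<Sum>k. ennreal (F k x)))
        \<and> (\<Sum>k. ennreal (I (F k))) < outer (A n) + ennreal (e * (1/2) ^ Suc n)" by blast
    qed
    then obtain F where F: "\<And>n k. F n k \<in> Cp" "\<And>n x. x \<in> A n \<Longrightarrow> 1 \<le> (\<Sum>k. ennreal (F n k x))"
        "\<And>n. (\<Sum>k. ennreal (I (F n k))) < outer (A n) + ennreal (e * (1/2) ^ Suc n)" by metis
    have "outer (\<Union>i. A i) \<le> (\<Sum>n. \<Sum>k. ennreal (I (F n k)))"
    proof (rule outer_le2[OF F(1)])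
      fix x assume "x \<in> (\<Union>i. A i)"
      then obtain n where "x \<in> A n" by auto
      then have "1 \<le> (\<Sum>k. ennreal (F n k x))" by (rule F(2))
      also have "\<dots> = (\<Sum>m\<in>{n}. \<Sum>k. ennreal (F m k x))" by simp
      also have "\<dots> \<le> (\<Sum>n. \<Sum>k. ennreal (F n k x))" by (rule sum_le_suminf) auto
      finally show "1 \<le> (\<Sum>n. \<Sum>k. ennreal (F n k x))" .
    qed
    also have "\<dots> \<le> (\<Sum>n. outer (A n) + ennreal (e * (1/2) ^ Suc n))"
      by (intro suminf_le allI less_imp_le[OF F(3)]) auto
    also have "\<dots> = (\<Sum>n. outer (A n)) + (\<Sum>n. ennreal (e * (1/2) ^ Suc n))"
      by (intro suminf_add[symmetric]) auto
    also have "\<dots> = (\<Sum>n. outer (A n)) + ennreal e" by (simp only: eps_series[OF e])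
    finally show "outer (\<Union>i. A i) \<le> (\<Sum>n. outer (A n)) + ennreal e" .
  qed
qed

text \<open>
  A function \<open>g\<close> of the algebra yields functions \<open>h k\<close> with values in \<open>[0,1]\<close> that increase to the indicator
  of \<open>E = {g > 0}\<close>.  A cover \<open>f n\<close> of \<open>A\<close> splits into \<open>f n * h k\<close>, whose increments in \<open>k\<close> cover \<open>A \<inter> E\<close>, and
  \<open>f n * (1 - h k)\<close>, which covers \<open>A - E\<close> for every \<open>k\<close>.  Choosing \<open>k\<close> large, depending on \<open>n\<close>, the two parts cost together
  hardly more than the cover itself.
\<close>

lemma superlevel_measurable:
  assumes g: "g \<in> C"
  shows "{x \<in> X. 0 < g x} \<in> lambda_system X (Pow X) outer"
  unfolding lambda_system_def
proof (intro CollectI conjI ballI)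
  let ?E = "{x \<in> X. 0 < g x}"
  show "?E \<in> Pow X" by auto
  fix A assume A: "A \<in> Pow X"
  define h where "h k x = 1 - max 0 (1 - real k * max 0 (g x))" for k x
  have hC: "h k \<in> C" for k
    unfolding h_def by (intro diff const pos_part cmult g)
  have h01: "0 \<le> h k x" "h k x \<le> 1" for k x by (auto simp: h_def)
  have hmono: "h k x \<le> h (Suc k) x" for k x
    unfolding h_def by (auto simp: algebra_simps max_def)
  have h0: "h 0 x = 0" for x by (simp add: h_def)
  have hE: "(\<lambda>k. h k x) \<longlonglongrightarrow> 1" if xE: "x \<in> ?E" for x
  proof -
    obtain N :: nat where N: "1 < real N * g x" using reals_Archimedean3[of "g x"] xE by auto
    have "h k x = 1" if k: "k \<ge> N" for k
    proof -
      have "real N * g x \<le> real k * g x" using k \<open>x \<in> ?E\<close> by (intro mult_right_mono) auto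
      then have "1 < real k * g x" using N by linarith
      then show ?thesis using xE by (auto simp: h_def max_def)
    qed
    then show ?thesis by (intro tendsto_eventually eventually_sequentiallyI[of N])
  qed
  have hnE: "h k x = 0" if "x \<in> X - ?E" for k x using that by (auto simp: h_def)
  have "outer (?E \<inter> A) + outer ((X - ?E) \<inter> A) \<le> outer A"
  proof (rule ennreal_le_epsilon)
    fix e :: real assume e: "0 < e" and fin: "outer A < top"
    have e2: "e / 2 > 0" using e by simp
    have "outer A < outer A + ennreal (e/2)" using fin e2 by (simp add: less_top)
    then obtain f where f: "\<And>n. f n \<in> Cp" "\<And>x. x \<in> A \<Longrightarrow> 1 \<le> (\<Sum>n. ennreal (f n x))"
      "(\<Sum>n. ennreal (I (f n))) < outer A + ennreal (e/2)" by (rule outer_close) blast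
    have fh: "(\<lambda>x. f n x * h k x) \<in> Cp" "(\<lambda>x. f n x * (h (Suc k) x - h k x)) \<in> Cp"
        "(\<lambda>x. f n x * (1 - h k x)) \<in> Cp" for n k
      using f(1)[of n] hC h01 hmono
      by (auto intro!: CpI mult diff const mult_nonneg_nonneg simp: Cp_C Cp_nonneg)
    have Ifh: "I (\<lambda>x. f n x * h k x) + I (\<lambda>x. f n x * (1 - h k x)) = I (f n)" for n k
      using I_add_Cp[OF fh(1) fh(3), of n k n k] by (simp add: distrib_left[symmetric])
    \<comment> \<open>The increments telescope because \<open>h 0 = 0\<close>.\<close>
    have part: "(\<Sum>k<m. I (\<lambda>x. f n x * (h (Suc k) x - h k x))) = I (\<lambda>x. f n x * h m x)" for n m
    proof -
      have "(\<Sum>k<m. f n x * (h (Suc k) x - h k x)) = f n x * h m x" for x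
        using sum_lessThan_telescope[of "\<lambda>k. h k x" m] by (simp add: sum_distrib_left[symmetric] h0)
      then show ?thesis using I_sum[of m "\<lambda>k x. f n x * (h (Suc k) x - h k x)"] fh by simp
    qed
    have le: "I (\<lambda>x. f n x * h m x) \<le> I (f n)" for n m
      using Ifh[of n m] I_nonneg_Cp[OF fh(3)[of n m]] by linarith
    have nn: "0 \<le> I (\<lambda>x. f n x * (h (Suc k) x - h k x))" for n k
      by (rule I_nonneg_Cp[OF fh(2)])
    define s where "s n = (\<Sum>k. I (\<lambda>x. f n x * (h (Suc k) x - h k x)))" for n
    have summ: "summable (\<lambda>k. I (\<lambda>x. f n x * (h (Suc k) x - h k x)))" for n
      by (rule summableI_nonneg_bounded[where x = "I (f n)"]) (use nn part le in auto)
    have slim: "(\<lambda>m. I (\<lambda>x. f n x * h m x)) \<longlonglongrightarrow> s n" for n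
      using summable_LIMSEQ[OF summ[of n]] by (simp add: part s_def)
    have "\<forall>n. \<exists>k. s n < I (\<lambda>x. f n x * h k x) + e/2 * (1/2) ^ Suc n"
    proof
      fix n
      have "\<forall>\<^sub>F k in sequentially. s n - e/2 * (1/2) ^ Suc n < I (\<lambda>x. f n x * h k x)"
        by (rule order_tendstoD(1)[OF slim]) (use e in simp)
      then show "\<exists>k. s n < I (\<lambda>x. f n x * h k x) + e/2 * (1/2) ^ Suc n"
        using eventually_happens' sequentially_bot by (fastforce simp: algebra_simps)
    qed
    then obtain k where k: "\<And>n. s n < I (\<lambda>x. f n x * h (k n) x) + e/2 * (1/2) ^ Suc n" by metis
    have s0: "0 \<le> s n" for n unfolding s_def by (rule suminf_nonneg[OF summ nn])
    have 1: "outer (?E \<inter> A) \<le> (\<Sum>n. ennreal (s n))"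
    proof -
      have "outer (?E \<inter> A) \<le> (\<Sum>n. \<Sum>k. ennreal (I (\<lambda>x. f n x * (h (Suc k) x - h k x))))"
      proof (rule outer_le2[OF fh(2)])
        fix x assume x: "x \<in> ?E \<inter> A"
        then have xX: "x \<in> X" by auto
        have "(\<Sum>k. ennreal (f n x * (h (Suc k) x - h k x))) = ennreal (f n x)" for n
        proof (rule suminf_ennreal_eq)
          show "0 \<le> f n x * (h (Suc k) x - h k x)" for k using fh(2) xX by (auto simp: Cp_def)
          have "(\<lambda>k. h (Suc k) x - h k x) sums (1 - h 0 x)" by (rule telescope_sums[OF hE]) (use x in auto)
          then show "(\<lambda>k. f n x * (h (Suc k) x - h k x)) sums f n x"
            using sums_mult[of _ _ "f n x"] by (fastforce simp: h0)
        qed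
        then show "1 \<le> (\<Sum>n. \<Sum>k. ennreal (f n x * (h (Suc k) x - h k x)))" using f(2) x by simp
      qed
      also have "\<dots> = (\<Sum>n. ennreal (s n))"
        unfolding s_def using nn summ by (intro suminf_cong suminf_ennreal_eq summable_sums)
      finally show ?thesis .
    qed
    have 2: "outer ((X - ?E) \<inter> A) \<le> (\<Sum>n. ennreal (I (\<lambda>x. f n x * (1 - h (k n) x))))"
      by (rule outer_le[OF fh(3)]) (use f(2) hnE in auto)
    have "outer (?E \<inter> A) + outer ((X - ?E) \<inter> A) \<le> (\<Sum>n. ennreal (s n)) + (\<Sum>n. ennreal (I (\<lambda>x. f n x * (1 - h (k n) x))))"
      using 1 2 by (rule add_mono)
    also have "\<dots> = (\<Sum>n. ennreal (s n) + ennreal (I (\<lambda>x. f n x * (1 - h (k n) x))))"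
      by (intro suminf_add) auto
    also have "\<dots> \<le> (\<Sum>n. ennreal (I (f n)) + ennreal (e/2 * (1/2) ^ Suc n))"
    proof (intro suminf_le allI)
      fix n
      have n1: "0 \<le> I (\<lambda>x. f n x * (1 - h (k n) x))" by (rule I_nonneg_Cp[OF fh(3)])
      have n2: "0 \<le> I (f n)" by (rule I_nonneg_Cp[OF f(1)])
      have n3: "0 \<le> e/2 * (1/2) ^ Suc n" using e by simp
      have "s n + I (\<lambda>x. f n x * (1 - h (k n) x)) \<le> I (f n) + e/2 * (1/2) ^ Suc n"
        using k[of n] Ifh[of n "k n"] by linarith
      then show "ennreal (s n) + ennreal (I (\<lambda>x. f n x * (1 - h (k n) x))) \<le> ennreal (I (f n)) + ennreal (e/2 * (1/2) ^ Suc n)"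
        using s0[of n] n1 n2 n3 by (simp add: ennreal_plus[symmetric] del: ennreal_plus)
    qed auto
    also have "\<dots> = (\<Sum>n. ennreal (I (f n))) + (\<Sum>n. ennreal (e/2 * (1/2) ^ Suc n))"
      by (intro suminf_add[symmetric]) auto
    also have "\<dots> \<le> (outer A + ennreal (e/2)) + ennreal (e/2)"
      unfolding eps_series[OF e2] by (intro add_right_mono less_imp_le f(3))
    also have "\<dots> = outer A + ennreal e" using e by (simp add: add.assoc ennreal_plus[symmetric] del: ennreal_plus)
    finally show "outer (?E \<inter> A) + outer ((X - ?E) \<inter> A) \<le> outer A + ennreal e" .
  qed
  moreover have "outer A \<le> outer (?E \<inter> A) + outer ((X - ?E) \<inter> A)"
  proof -
    have "subadditive (Pow X) outer"
      using outer_measure_space ring_of_sets.countably_subadditive_subadditive[OF ring_of_sets_Pow]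
      unfolding outer_measure_space_def by blast
    then have "outer ((?E \<inter> A) \<union> ((X - ?E) \<inter> A)) \<le> outer (?E \<inter> A) + outer ((X - ?E) \<inter> A)"
      by (rule subadditiveD) auto
    moreover have "(?E \<inter> A) \<union> ((X - ?E) \<inter> A) = A" using A by auto
    ultimately show ?thesis by simp
  qed
  ultimately show "outer (?E \<inter> A) + outer ((X - ?E) \<inter> A) = outer A" by (rule antisym)
qed

definition generators :: "'a set set" where "generators = {{x \<in> X. 0 < g x} | g. g \<in> C}"

definition riesz :: "'a measure" where "riesz = measure_of X generators outer"

lemma generators_Pow: "generators \<subseteq> Pow X" by (auto simp: generators_def)

lemma space_riesz: "space riesz = X" and sets_riesz: "sets riesz = sigma_sets X generators"
  unfolding riesz_def using generators_Pow by (simp_all add: space_measure_of sets_measure_of)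

lemma emeasure_riesz: "A \<in> sets riesz \<Longrightarrow> emeasure riesz A = outer A"
proof -
  have "measure_space X (lambda_system X (Pow X) outer) outer"
    by (rule sigma_algebra.caratheodory_lemma[OF sigma_algebra_Pow outer_measure_space])
  moreover from this have "sigma_algebra X (lambda_system X (Pow X) outer)" by (simp add: measure_space_def)
  then have "sigma_sets X generators \<subseteq> lambda_system X (Pow X) outer"
    by (rule sigma_algebra.sigma_sets_subset) (use superlevel_measurable in \<open>auto simp: generators_def\<close>)
  ultimately have "measure_space X (sigma_sets X generators) outer"
    using sigma_algebra_sigma_sets[OF generators_Pow] by (blast intro: measure_down)
  then show "A \<in> sets riesz \<Longrightarrow> emeasure riesz A = outer A"
    using emeasure_measure_of[OF riesz_def generators_Pow, of A]
    by (simp add: measure_space_def sets_riesz)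
qed

lemma C_measurable: "g \<in> C \<Longrightarrow> g \<in> borel_measurable riesz"
  unfolding borel_measurable_iff_greater
proof
  fix a assume g: "g \<in> C"
  have "{x \<in> X. 0 < g x - a} \<in> generators" 
    unfolding generators_def by (intro CollectI exI[of _ "\<lambda>x. g x - a"] conjI refl diff g const)
  then show "{w \<in> space riesz. a < g w} \<in> sets riesz" by (simp add: space_riesz sets_riesz)
qed

text \<open>
  The estimate from below is where compactness enters: a countable cover of the whole space, slightly
  enlarged, contains a finite one, to which monotonicity and additivity of \<open>I\<close> apply.
\<close>

lemma total_mass: "emeasure riesz X = ennreal (I (\<lambda>_. 1))"
proof -
  have X: "X \<in> sets riesz" using sets.top[of riesz] by (simp add: space_riesz)
  have "outer X \<le> ennreal (I (\<lambda>_. 1))" by (rule outer_le_single) (auto intro: CpI const)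
  moreover have "ennreal (I (\<lambda>_. 1)) \<le> outer X"
  proof (rule ennreal_le_epsilon)
    fix e :: real assume e: "0 < e" and fin: "outer X < top"
    have e2: "e / 2 > 0" using e by simp
    have "outer X < outer X + ennreal (e/2)" using fin e2 by (simp add: less_top)
    then obtain f where f: "\<And>n. f n \<in> Cp" "\<And>x. x \<in> X \<Longrightarrow> 1 \<le> (\<Sum>n. ennreal (f n x))"
      and fe: "(\<Sum>n. ennreal (I (f n))) < outer X + ennreal (e/2)" by (rule outer_close) blast
    have "outer X + ennreal (e/2) < top" using fin by (simp add: less_top[symmetric])
    with fe have "(\<Sum>n. ennreal (I (f n))) < top" by (rule order_less_trans)
    then obtain S where S: "(\<Sum>n. ennreal (I (f n))) = ennreal S" "0 \<le> S"
      by (cases "(\<Sum>n. ennreal (I (f n)))") auto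
    have If: "0 \<le> I (f n)" for n by (rule I_nonneg_Cp[OF f(1)])
    \<comment> \<open>The cover only attains \<open>1\<close>; a factor \<open>1 + \<delta>\<close> makes its partial sums exceed \<open>1\<close>, and \<open>S + 1\<close> avoids division by zero.\<close>
    define \<delta> where "\<delta> = e / (2 * (S + 1))"
    have \<delta>: "\<delta> > 0" "\<delta> * S \<le> e / 2" using e S(2) by (auto simp: \<delta>_def field_simps)
    have "\<exists>n. \<forall>x\<in>X. 1 \<le> (\<Sum>i<n. (1 + \<delta>) * f i x)"
    proof (rule Dini)
      show "(\<lambda>x. (1 + \<delta>) * f n x) \<in> C" for n using f(1) by (intro cmult Cp_C)
      show "0 \<le> (1 + \<delta>) * f n x" if "x \<in> X" for n x using f(1) that \<delta> by (simp add: Cp_nonneg)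
      fix x assume x: "x \<in> X"
      show "\<exists>n. 1 < (\<Sum>i<n. (1 + \<delta>) * f i x)"
      proof (rule ccontr)
        assume *: "\<not> ?thesis"
        have le: "(\<Sum>i<n. f i x) \<le> 1 / (1 + \<delta>)" for n
        proof -
          have "(1 + \<delta>) * (\<Sum>i<n. f i x) \<le> 1" unfolding sum_distrib_left using * by (meson not_less)
          then show ?thesis using \<delta>(1) by (simp add: field_simps)
        qed
        have "(\<Sum>n. ennreal (f n x)) \<le> ennreal (1 / (1 + \<delta>))"
        proof (rule suminf_le_const)
          show "(\<Sum>i<n. ennreal (f i x)) \<le> ennreal (1 / (1 + \<delta>))" for n
            using ennreal_leI[OF le[of n]] f(1) x by (simp add: sum_ennreal Cp_nonneg)
        qed simp
        also have "\<dots> < 1" using \<delta>(1) by (simp add: ennreal_less_one_iff)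
        finally show False using f(2)[OF x] by simp
      qed
    qed
    then obtain n where n: "\<And>x. x \<in> X \<Longrightarrow> 1 \<le> (\<Sum>i<n. (1 + \<delta>) * f i x)" by blast
    have "I (\<lambda>_. 1) \<le> I (\<lambda>x. \<Sum>i<n. (1 + \<delta>) * f i x)"
      using n f(1) by (intro I_mono const sum_in cmult Cp_C) auto
    also have "\<dots> = (\<Sum>i<n. (1 + \<delta>) * I (f i))"
      using f(1) \<delta> I_sum[of n "\<lambda>i x. (1 + \<delta>) * f i x"]
      by (simp add: CpI cmult Cp_C Cp_nonneg I_cmult)
    also have "\<dots> = (1 + \<delta>) * (\<Sum>i<n. I (f i))" by (simp add: sum_distrib_left)
    also have "\<dots> \<le> (1 + \<delta>) * S"
    proof (rule mult_left_mono)
      have "(\<Sum>i<n. ennreal (I (f i))) \<le> (\<Sum>n. ennreal (I (f n)))" by (rule sum_le_suminf) auto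
      then show "(\<Sum>i<n. I (f i)) \<le> S" using S If by (simp add: sum_ennreal)
    qed (use \<delta> in simp)
    also have "\<dots> \<le> S + e / 2" using \<delta>(2) by (simp add: algebra_simps)
    finally have "ennreal (I (\<lambda>_. 1)) \<le> ennreal S + ennreal (e / 2)"
      using S(2) e by (simp add: ennreal_plus[symmetric] del: ennreal_plus)
    also have "\<dots> \<le> (outer X + ennreal (e / 2)) + ennreal (e / 2)"
      using fe S(1) by (intro add_right_mono) (simp add: less_imp_le)
    also have "\<dots> = outer X + ennreal e" using e by (simp add: add.assoc ennreal_plus[symmetric] del: ennreal_plus)
    finally show "ennreal (I (\<lambda>_. 1)) \<le> outer X + ennreal e" .
  qed
  ultimately show ?thesis unfolding emeasure_riesz[OF X] by (rule antisym)
qed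

lemma finite_riesz: "finite_measure riesz"
  by (rule finite_measureI) (simp add: space_riesz total_mass)

lemma C_integrable:
  assumes g: "g \<in> C"
  shows "integrable riesz g"
proof -
  obtain K where K: "\<And>x. x \<in> X \<Longrightarrow> g x \<le> K" using bounded[OF g] by blast
  obtain K' where K': "\<And>x. x \<in> X \<Longrightarrow> (-1) * g x \<le> K'" using bounded[OF cmult[OF g]] by blast
  have "norm (g x) \<le> max K K'" if "x \<in> X" for x using K[OF that] K'[OF that] by auto
  then show ?thesis
    by (intro finite_measure.integrable_const_bound[OF finite_riesz, of _ "max K K'"] AE_I2 C_measurable g)
       (simp add: space_riesz)
qed

text \<open>
  The function is cut into horizontal layers of height \<open>e\<close>.  Each layer \<open>\<psi> k\<close>, scaled to values in \<open>[0,1]\<close>, equals \<open>1\<close>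
  where \<open>g\<close> exceeds the layer and is thus a one-term cover of that set.
\<close>

lemma integral_riesz_le:
  assumes g: "g \<in> Cp"
  shows "integral\<^sup>L riesz g \<le> I g"
proof (rule field_le_epsilon)
  fix e0 :: real assume e0: "0 < e0"
  interpret finite_measure riesz by (rule finite_riesz)
  define m where "m = measure riesz X"
  define e where "e = e0 / (m + 1)"
  have m0: "0 \<le> m" by (simp add: m_def)
  have e: "e > 0" "e * m \<le> e0" using e0 m0 by (auto simp: e_def field_simps)
  note gC = Cp_C[OF g]
  obtain K where K: "\<And>x. x \<in> X \<Longrightarrow> g x \<le> K" using bounded[OF gC] by blast
  obtain N :: nat where N: "K < real N * e" using reals_Archimedean3[OF e(1)] by auto
  define q where "q k x = max 0 (g x - real k * e)" for k x
  define \<psi> where "\<psi> k x = (1 / e) * (q k x - q (Suc k) x)" for k x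
  define E where "E k = {x \<in> X. real (Suc k) * e \<le> g x}" for k
  have qC: "q k \<in> C" for k unfolding q_def by (intro pos_part diff gC const)
  have \<psi>C: "\<psi> k \<in> C" for k unfolding \<psi>_def by (intro cmult diff qC)
  have q1: "q (Suc k) x \<le> q k x" "q k x - q (Suc k) x \<le> e" for k x
    using e(1) by (auto simp: q_def algebra_simps max_def)
  have \<psi>0: "0 \<le> \<psi> k x" and \<psi>1: "\<psi> k x \<le> 1" for k x
    using q1[of k x] e(1) by (auto simp: \<psi>_def field_simps)
  have \<psi>E: "\<psi> k x = 1" if "x \<in> E k" for k x
    using that e(1) by (auto simp: \<psi>_def q_def E_def max_def field_simps)
  have EM: "E k \<in> sets riesz" for k
  proof -
    have "{w \<in> space riesz. real (Suc k) * e \<le> g w} \<in> sets riesz" 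
      using C_measurable[OF gC] by measurable
    then show ?thesis by (simp add: E_def space_riesz)
  qed
  have mE: "measure riesz (E k) \<le> I (\<psi> k)" for k
  proof -
    have "emeasure riesz (E k) \<le> ennreal (I (\<psi> k))"
      unfolding emeasure_riesz[OF EM] by (rule outer_le_single) (auto intro: CpI \<psi>C \<psi>0 simp: \<psi>E)
    then show ?thesis using I_nonneg[OF \<psi>C \<psi>0] by (simp add: emeasure_eq_measure)
  qed
  have tele: "(\<Sum>k<n. e * \<psi> k x) = q 0 x - q n x" for n x
    using e(1) sum_lessThan_telescope'[of "\<lambda>k. q k x" n] by (simp add: \<psi>_def)
  \<comment> \<open>Shifted by one layer, since \<open>\<psi> (Suc k)\<close> is supported where \<open>\<psi> k\<close> has reached its maximum.\<close>
  have pw: "g x \<le> e + (\<Sum>k<N. e * indicator (E k) x)" if x: "x \<in> X" for x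
  proof -
    have "\<psi> (Suc k) x \<le> indicator (E k) x" for k
    proof (cases "x \<in> E k")
      case False
      then have "g x < real (Suc k) * e" using x by (auto simp: E_def)
      then have "q (Suc k) x = 0" "q (Suc (Suc k)) x = 0" using e(1) by (auto simp: q_def algebra_simps)
      then show ?thesis by (simp add: \<psi>_def)
    qed (simp add: \<psi>1)
    then have "(\<Sum>k<N. e * \<psi> (Suc k) x) \<le> (\<Sum>k<N. e * indicator (E k) x)"
      using e(1) by (intro sum_mono mult_left_mono) auto
    moreover have "(\<Sum>k<N. e * \<psi> (Suc k) x) = q 1 x - q (Suc N) x"
      using e(1) by (simp add: \<psi>_def sum_lessThan_telescope'[of "\<lambda>k. q (Suc k) x"])
    moreover have "q (Suc N) x = 0" using K[OF x] N e(1) by (auto simp: q_def algebra_simps)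
    moreover have "g x - e \<le> q 1 x" by (simp add: q_def)
    ultimately show ?thesis by linarith
  qed
  have "integral\<^sup>L riesz g \<le> (\<integral>x. e + (\<Sum>k<N. e * indicator (E k) x) \<partial>riesz)"
  proof (rule integral_mono[OF C_integrable[OF gC]])
    show "integrable riesz (\<lambda>x. e + (\<Sum>k<N. e * indicator (E k) x))"
      by (intro Bochner_Integration.integrable_add integrable_const Bochner_Integration.integrable_sum
          integrable_mult_right integrable_real_indicator EM) (simp add: emeasure_eq_measure)
  qed (simp add: pw space_riesz del: sum_mult_indicator)
  also have "\<dots> = e * m + (\<Sum>k<N. e * measure riesz (E k))"
  proof -
    have i: "integrable riesz (\<lambda>x. e * indicator (E k) x)" for k
      by (intro integrable_mult_right integrable_real_indicator EM) (simp add: emeasure_eq_measure)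
    have "(\<integral>x. e + (\<Sum>k<N. e * indicator (E k) x) \<partial>riesz)
        = (\<integral>x. e \<partial>riesz) + (\<Sum>k<N. \<integral>x. e * indicator (E k) x \<partial>riesz)"
      using i by (simp only: Bochner_Integration.integral_add integrable_const Bochner_Integration.integrable_sum
          Bochner_Integration.integral_sum)
    moreover have "E k \<inter> X = E k" for k by (auto simp: E_def)
    ultimately show ?thesis using EM by (simp add: space_riesz m_def mult.commute)
  qed
  also have "\<dots> \<le> e * m + (\<Sum>k<N. e * I (\<psi> k))"
    using mE e(1) by (intro add_left_mono sum_mono mult_left_mono) auto
  also have "(\<Sum>k<N. e * I (\<psi> k)) = I (\<lambda>x. \<Sum>k<N. e * \<psi> k x)"
    using I_sum[of N "\<lambda>k x. e * \<psi> k x"] e(1) \<psi>C \<psi>0 by (simp add: CpI cmult I_cmult)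
  also have "\<dots> \<le> I g"
  proof (rule I_mono[OF sum_in gC])
    show "0 \<le> (\<Sum>k<N. e * \<psi> k x)" for x using \<psi>0 e(1) by (simp add: sum_nonneg)
    show "(\<Sum>k<N. e * \<psi> k x) \<le> g x" if "x \<in> X" for x
      unfolding tele using Cp_nonneg[OF g that] by (simp add: q_def)
  qed (intro cmult \<psi>C)
  finally show "integral\<^sup>L riesz g \<le> I g + e0" using e(2) by linarith
qed

text \<open>
  The opposite inequality is the first one for \<open>K - g\<close>, \<open>K\<close> an upper bound of \<open>g\<close>, since the total masses agree.
\<close>

theorem integral_riesz:
  assumes g: "g \<in> Cp"
  shows "integral\<^sup>L riesz g = I g"
proof (rule antisym[OF integral_riesz_le[OF g]])
  interpret finite_measure riesz by (rule finite_riesz)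
  note gC = Cp_C[OF g]
  obtain K0 where K0: "\<And>x. x \<in> X \<Longrightarrow> g x \<le> K0" using bounded[OF gC] by blast
  define K where "K = max 0 K0"
  have K: "0 \<le> K" "\<And>x. x \<in> X \<Longrightarrow> g x \<le> K" using K0 by (auto simp: K_def le_max_iff_disj)
  have "(\<integral>x. K - g x \<partial>riesz) \<le> I (\<lambda>x. K - g x)"
    by (rule integral_riesz_le, rule CpI[OF diff[OF const gC]]) (simp add: K)
  also have "\<dots> = I (\<lambda>x. K) - I g" by (rule I_diff[OF gC const]) (auto simp: K Cp_nonneg[OF g])
  also have "I (\<lambda>x. K) = K * I (\<lambda>x. 1)" using I_cmult[OF const[of 1], of K] K(1) by simp
  finally have 1: "(\<integral>x. K - g x \<partial>riesz) \<le> K * I (\<lambda>x. 1) - I g" .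
  have "measure riesz X = I (\<lambda>_. 1)"
    using total_mass I_nonneg[OF const[of 1]] by (simp add: measure_def)
  then have "(\<integral>x. K - g x \<partial>riesz) = K * I (\<lambda>x. 1) - integral\<^sup>L riesz g"
    using C_integrable[OF gC] by (simp add: space_riesz)
  then show "I g \<le> integral\<^sup>L riesz g" using 1 by linarith
qed

end

section \<open>Positive functionals on continuous space-time functions\<close>

lemma slab_representative:
  fixes f :: "real \<times> (real^'d) \<Rightarrow> 'b::real_normed_vector"
  assumes "f \<in> C_st T" "z \<in> slab T"
  shows "f (fst z, cell_rep (snd z)) = f z" "(fst z, cell_rep (snd z)) \<in> {0..T} \<times> unit_cell"
  using periodic_cell_rep[of "\<lambda>x. f (fst z, x)" "snd z"] assms cell_rep_in[of "snd z"]
  by (auto simp: C_st_def)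

lemma C_st_max: "f \<in> C_st T \<Longrightarrow> (\<lambda>z. max 0 (f z :: real)) \<in> C_st T"
  and C_st_min: "f \<in> C_st T \<Longrightarrow> g \<in> C_st T \<Longrightarrow> (\<lambda>z. min (f z) (g z :: real)) \<in> C_st T"
  by (auto simp: C_st_def intro!: continuous_on_max continuous_on_min continuous_on_const)

text \<open>
  Points of the cell violating the conclusion accumulate in the closed cell, and the limit point has a
  representative in the half-open cell with the same values.
\<close>

lemma C_st_Dini:
  fixes f :: "nat \<Rightarrow> real \<times> (real^'d) \<Rightarrow> real"
  assumes f: "\<And>n. f n \<in> C_st T" and nn: "\<And>n z. z \<in> {0..T} \<times> unit_cell \<Longrightarrow> 0 \<le> f n z"
    and gt: "\<And>z. z \<in> {0..T} \<times> unit_cell \<Longrightarrow> \<exists>n. 1 < (\<Sum>i<n. f i z)"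
  shows "\<exists>n. \<forall>z\<in>{0..T} \<times> unit_cell. 1 \<le> (\<Sum>i<n. f i z)"
proof (rule ccontr)
  assume "\<not> ?thesis"
  then have "\<forall>n. \<exists>z. z \<in> {0..T} \<times> unit_cell \<and> (\<Sum>i<n. f i z) < 1" by (meson not_le)
  then obtain z where z: "\<And>n. z n \<in> {0..T} \<times> unit_cell" "\<And>n. (\<Sum>i<n. f i (z n)) < 1" by metis
  let ?K = "{0..T} \<times> (cbox 0 1 :: (real^'d) set)"
  have "compact ?K" by (intro compact_Times compact_Icc compact_cbox)
  moreover have zK: "\<forall>n. z n \<in> ?K" using z(1) unit_cell_subset by (metis mem_Times_iff subsetD)
  ultimately obtain l r where l: "l \<in> ?K" and r: "strict_mono (r :: nat \<Rightarrow> nat)" and lim: "(z \<circ> r) \<longlonglongrightarrow> l"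
    unfolding compact_def by metis
  have lT: "l \<in> slab T" using l by auto
  obtain m where "1 < (\<Sum>i<m. f i (fst l, cell_rep (snd l)))"
    using gt[of "(fst l, cell_rep (snd l))"] cell_rep_in lT by force
  then have m: "1 < (\<Sum>i<m. f i l)" using slab_representative(1)[OF f lT] by simp
  have "continuous_on (slab T) (\<lambda>z. \<Sum>i<m. f i z)" by (rule C_stD[OF C_st_sum[OF f]])
  then have "(\<lambda>n. \<Sum>i<m. f i ((z \<circ> r) n)) \<longlonglongrightarrow> (\<Sum>i<m. f i l)"
    by (rule continuous_on_tendsto_compose[OF _ lim lT]) (use z(1) in \<open>auto simp: mem_Times_iff\<close>)
  then have "\<forall>\<^sub>F n in sequentially. 1 < (\<Sum>i<m. f i ((z \<circ> r) n))" using m by (rule order_tendstoD(1))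
  moreover have "\<forall>\<^sub>F n in sequentially. m \<le> n" by (rule eventually_ge_at_top)
  ultimately have "\<forall>\<^sub>F n in sequentially. 1 < (\<Sum>i<m. f i ((z \<circ> r) n)) \<and> m \<le> n" by (rule eventually_conj)
  then obtain n where n: "1 < (\<Sum>i<m. f i (z (r n)))" "m \<le> n"
    using eventually_happens' sequentially_bot by fastforce
  have "(\<Sum>i<m. f i (z (r n))) \<le> (\<Sum>i<r n. f i (z (r n)))"
    using n(2) seq_suble[OF r, of n] nn[OF z(1)] by (intro sum_mono2) auto
  then show False using n(1) z(2)[of "r n"] by linarith
qed

lemma C_st_positive_functional:
  fixes I :: "(real \<times> (real^'d) \<Rightarrow> real) \<Rightarrow> real"
  assumes add: "\<And>f g. f \<in> C_st T \<Longrightarrow> g \<in> C_st T \<Longrightarrow> \<forall>z\<in>slab T. 0 \<le> f z \<Longrightarrow> \<forall>z\<in>slab T. 0 \<le> g z \<Longrightarrow>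
        I (\<lambda>z. f z + g z) = I f + I g"
    and nonneg: "\<And>f. f \<in> C_st T \<Longrightarrow> \<forall>z\<in>slab T. 0 \<le> f z \<Longrightarrow> 0 \<le> I f"
    and cmult: "\<And>f c. f \<in> C_st T \<Longrightarrow> \<forall>z\<in>slab T. 0 \<le> f z \<Longrightarrow> 0 \<le> c \<Longrightarrow> I (\<lambda>z. c * f z) = c * I f"
  shows "positive_functional ({0..T} \<times> unit_cell) (C_st T) I"
proof
  have ext: "\<forall>z\<in>slab T. 0 \<le> f z" if "f \<in> C_st T" "\<And>z. z \<in> {0..T} \<times> unit_cell \<Longrightarrow> 0 \<le> f z"
    for f :: "real \<times> (real^'d) \<Rightarrow> real"
    using slab_representative[OF that(1)] that(2) by metis
  show "I (\<lambda>x. f x + g x) = I f + I g"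
    if "f \<in> C_st T" "g \<in> C_st T" "\<And>x. x \<in> {0..T} \<times> unit_cell \<Longrightarrow> 0 \<le> f x"
      "\<And>x. x \<in> {0..T} \<times> unit_cell \<Longrightarrow> 0 \<le> g x" for f g
    by (rule add[OF that(1,2) ext[OF that(1,3)] ext[OF that(2,4)]])
  show "0 \<le> I f" if "f \<in> C_st T" "\<And>x. x \<in> {0..T} \<times> unit_cell \<Longrightarrow> 0 \<le> f x" for f
    by (rule nonneg[OF that(1) ext[OF that]])
  show "I (\<lambda>x. c * f x) = c * I f" if "f \<in> C_st T" "\<And>x. x \<in> {0..T} \<times> unit_cell \<Longrightarrow> 0 \<le> f x" "0 \<le> c" for f c
    by (rule cmult[OF that(1) ext[OF that(1,2)] that(3)])
  show "\<exists>K. \<forall>x\<in>{0..T} \<times> unit_cell. f x \<le> K" if fC: "f \<in> C_st T" for f :: "real \<times> (real^'d) \<Rightarrow> real"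
  proof -
    obtain K where K: "K > 0" "\<And>z. z \<in> slab T \<Longrightarrow> norm (f z) \<le> K" using C_st_bounded[OF fC] by blast
    have "f z \<le> K" if "z \<in> {0..T} \<times> unit_cell" for z using K(2)[of z] that by auto
    then show ?thesis by blast
  qed
qed (rule C_st_const C_st_add C_st_mult C_st_max C_st_Dini; assumption | auto intro: C_st_add C_st_mult)+

text \<open>
  The generated \<open>\<sigma>\<close>-algebra is that of the functions which are periodic in space, while Borel sets of the
  cell are described by the coordinates, which are not periodic.  The function
  \<open>sin(\<pi> x\<^sub>j) sin(\<pi>(a - x\<^sub>j))\<close> is periodic, since both factors change sign under \<open>x\<^sub>j \<mapsto> x\<^sub>j + 1\<close>, and on the cell it
  is positive exactly for \<open>0 < x\<^sub>j < a\<close>; together with the face \<open>x\<^sub>j = 0\<close> this gives the half-spaces.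
\<close>

lemma riesz_borel:
  fixes I :: "(real \<times> (real^'d) \<Rightarrow> real) \<Rightarrow> real"
  assumes "positive_functional ({0..T} \<times> unit_cell) (C_st T) I"
  shows "st_borel T (positive_functional.riesz ({0..T} \<times> unit_cell) (C_st T) I)"
proof -
  interpret positive_functional "{0..T} \<times> unit_cell" "C_st T" I by fact
  let ?X = "{0..T} \<times> (unit_cell :: (real^'d) set)"
  have gen: "{z \<in> ?X. 0 < g z} \<in> sets riesz" if "g \<in> C_st T" for g :: "real \<times> (real^'d) \<Rightarrow> real"
    unfolding sets_riesz generators_def
    by (intro sigma_sets.Basic CollectI exI[of _ g] conjI refl that)
  have "(\<lambda>z. z) \<in> borel_measurable riesz"
    unfolding borel_measurable_iff_halfspace_less space_riesz
  proof (intro ballI allI)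
    fix i :: "real \<times> (real^'d)" and a :: real assume "i \<in> Basis"
    then consider "i = (1, 0)" | j where "i = (0, axis j 1)"
      by (auto simp: Basis_prod_def Basis_vec_def)
    then show "{w \<in> ?X. w \<bullet> i < a} \<in> sets riesz"
    proof cases
      case 1
      have "(\<lambda>z :: real \<times> (real^'d). a - fst z) \<in> C_st T" by (rule C_st_time[of T "\<lambda>t. a - t"]) (intro continuous_intros)
      from gen[OF this] show ?thesis by (simp add: 1 inner_prod_def)
    next
      case (2 j)
      have eq: "{w \<in> ?X. w \<bullet> i < a} = {w \<in> ?X. snd w $ j < a}"
        by (simp add: 2 inner_prod_def inner_axis)
      define g where "g b x = sin (pi * (x $ j)) * sin (pi * (b - x $ j))" for b and x :: "real^'d"
      have per: "g b (x + axis k 1) = g b x" for b x k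
      proof (cases "k = j")
        case True
        have "sin (pi * (x $ j + 1)) = - sin (pi * (x $ j))" by (simp add: distrib_left)
        moreover have "sin (pi * (b - (x $ j + 1))) = - sin (pi * (b - x $ j))"
          using sin_minus_pi[of "pi * (b - x $ j)"] by (simp add: algebra_simps)
        ultimately show ?thesis unfolding g_def using True by simp
      qed (simp add: g_def axis_def)
      have gC: "(\<lambda>z. g b (snd z)) \<in> C_st T" for b
      proof (rule C_st_of_torus)
        have "continuous_on UNIV (g b)" unfolding g_def by (intro continuous_intros)
        then show "g b \<in> C_torus" by (simp add: C_torus_def per)
      qed
      have pos: "0 < sin (pi * s) \<longleftrightarrow> 0 < s" if "-1 < s" "s < 1" for s :: real
      proof
        assume "0 < sin (pi * s)"
        show "0 < s"
        proof (rule ccontr)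
          assume "\<not> 0 < s"
          then have "0 \<le> pi * (- s)" by (intro mult_nonneg_nonneg) auto
          moreover have "pi * (- s) \<le> pi" using mult_left_mono[of "- s" 1 pi] that by simp
          ultimately have "0 \<le> sin (pi * (- s))" by (rule sin_ge_zero)
          then show False using \<open>0 < sin (pi * s)\<close> by simp
        qed
      next
        assume "0 < s"
        then show "0 < sin (pi * s)" using that by (intro sin_gt_zero) auto
      qed
      have interior: "0 < g b x \<longleftrightarrow> 0 < x $ j \<and> x $ j < b" if "x \<in> unit_cell" "0 < b" "b \<le> 1" for b x
      proof -
        have x: "0 \<le> x $ j" "x $ j < 1" using that by (auto simp: unit_cell_def)
        show ?thesis
        proof (cases "x $ j = 0")
          case False
          then have x0: "0 < x $ j" using x by simp
          have "0 < sin (pi * (x $ j))" using pos[of "x $ j"] x x0 by simp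
          then show ?thesis using pos[of "b - x $ j"] x0 x that by (auto simp: g_def zero_less_mult_iff)
        qed (simp add: g_def)
      qed
      have zero: "{w \<in> ?X. snd w $ j = 0} \<in> sets riesz"
      proof -
        have int1: "x $ j = 0 \<longleftrightarrow> \<not> 0 < g 1 x" if x: "x \<in> unit_cell" for x
        proof -
          have "0 \<le> x $ j" "x $ j < 1" using x by (auto simp: unit_cell_def)
          then show ?thesis using interior[OF x, of 1] by auto
        qed
        have "{w \<in> ?X. snd w $ j = 0} = space riesz - {w \<in> ?X. 0 < g 1 (snd w)}"
          unfolding space_riesz using int1 by auto
        then show ?thesis using gen[OF gC] by (simp only:) (rule sets.compl_sets)
      qed
      have cellj: "0 \<le> x $ j \<and> x $ j < 1" if "x \<in> unit_cell" for x :: "real^'d"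
        using that by (simp add: unit_cell_def)
      consider "a \<le> 0" | "0 < a" "a \<le> 1" | "1 < a" by linarith
      then show ?thesis unfolding eq
      proof cases
        case 1
        then have "{w \<in> ?X. snd w $ j < a} = {}" using cellj by fastforce
        then show "{w \<in> ?X. snd w $ j < a} \<in> sets riesz" by (simp only: sets.empty_sets)
      next
        case 2
        have "x $ j < a \<longleftrightarrow> 0 < g a x \<or> x $ j = 0" if x: "x \<in> unit_cell" for x
          using interior[OF x 2] cellj[OF x] 2 by auto
        then have "{w \<in> ?X. snd w $ j < a} = {w \<in> ?X. 0 < g a (snd w)} \<union> {w \<in> ?X. snd w $ j = 0}"
          using 2 by auto
        then show "{w \<in> ?X. snd w $ j < a} \<in> sets riesz" using gen[OF gC] zero by (simp only:) (rule sets.Un)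
      next
        case 3
        then have "{w \<in> ?X. snd w $ j < a} = ?X" using cellj by fastforce
        then show "{w \<in> ?X. snd w $ j < a} \<in> sets riesz" using sets.top[of riesz] by (simp only: space_riesz)
      qed
    qed
  qed
  then have id: "S \<inter> ?X \<in> sets riesz" if "S \<in> sets borel" for S
    using measurable_sets[of "\<lambda>z. z" riesz borel S] that by (simp add: space_riesz)
  have "sets riesz \<subseteq> sets (restrict_space borel ?X)"
    unfolding sets_riesz
  proof (rule sets.sigma_sets_subset')
    show "generators \<subseteq> sets (restrict_space borel ?X)"
    proof
      fix S assume "S \<in> generators"
      then obtain g :: "real \<times> (real^'d) \<Rightarrow> real" where S: "S = {z \<in> ?X. 0 < g z}" and g: "g \<in> C_st T"
        unfolding generators_def by blast
      have [measurable]: "g \<in> borel_measurable (restrict_space borel ?X)"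
        by (rule borel_measurable_continuous_on_restrict[OF continuous_on_subset[OF C_stD[OF g]]]) auto
      have "{z \<in> space (restrict_space borel ?X). 0 < g z} \<in> sets (restrict_space borel ?X)" by measurable
      then show "S \<in> sets (restrict_space borel ?X)" by (simp add: S space_restrict_space)
    qed
    show "?X \<in> sets (restrict_space borel ?X)" using sets.top[of "restrict_space borel ?X"] by (simp add: space_restrict_space)
  qed
  moreover have "sets (restrict_space borel ?X) \<subseteq> sets riesz"
    using id by (auto simp: sets_restrict_space Int_commute)
  ultimately show ?thesis using finite_riesz by (simp add: st_borel_def)
qed

section \<open>Riesz representation of space-time measures\<close>

text \<open>
  On nonnegative functions this is the positive part of \<open>L\<close> in its Jordan decomposition.
\<close>

definition upper_variation :: "real \<Rightarrow> ((real \<times> (real^'d) \<Rightarrow> real) \<Rightarrow> real) \<Rightarrow> (real \<times> (real^'d) \<Rightarrow> real) \<Rightarrow> real" where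
  "upper_variation T L f = Sup {L g | g. g \<in> C_st T \<and> (\<forall>z\<in>slab T. 0 \<le> g z \<and> g z \<le> f z)}"

context
  fixes T :: real and L :: "(real \<times> (real^'d) \<Rightarrow> real) \<Rightarrow> real"
  assumes L: "st_measure T L"
begin

lemma L_add: "f \<in> C_st T \<Longrightarrow> g \<in> C_st T \<Longrightarrow> L (\<lambda>z. f z + g z) = L f + L g"
  by (rule in_dual_add[OF L])

lemma L_cmult: "f \<in> C_st T \<Longrightarrow> L (\<lambda>z. c * f z) = c * L f"
  using in_dual_scale[OF L, of f c] by simp

lemma L_zero: "L (\<lambda>_. 0) = 0"
  using L_cmult[OF C_st_const, of 0] by simp

lemma upper_variation_ge:
  assumes f: "f \<in> C_st T" and g: "g \<in> C_st T" "\<forall>z\<in>slab T. 0 \<le> g z \<and> g z \<le> f z"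
  shows "L g \<le> upper_variation T L f"
  unfolding upper_variation_def
proof (rule cSup_upper)
  obtain M where M: "\<And>f N. f \<in> C_st T \<Longrightarrow> \<forall>z\<in>slab T. norm (f z) \<le> N \<Longrightarrow> \<bar>L f\<bar> \<le> M * N"
    using in_dual_bound[OF L] by blast
  obtain K where K: "K > 0" "\<And>z. z \<in> slab T \<Longrightarrow> norm (f z) \<le> K" using C_st_bounded[OF f] by blast
  show "bdd_above {L g | g. g \<in> C_st T \<and> (\<forall>z\<in>slab T. 0 \<le> g z \<and> g z \<le> f z)}"
  proof (rule bdd_aboveI, clarify)
    fix g assume g: "g \<in> C_st T" "\<forall>z\<in>slab T. 0 \<le> g z \<and> g z \<le> f z"
    have "norm (g z) \<le> K" if "z \<in> slab T" for z
      using K(2)[OF that] bspec[OF g(2) that] by simp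
    then show "L g \<le> M * K" using M[OF g(1)] by fastforce
  qed
qed (use g in blast)

lemma upper_variation_le:
  assumes f: "\<forall>z\<in>slab T. 0 \<le> f z" 
    and le: "\<And>g. g \<in> C_st T \<Longrightarrow> \<forall>z\<in>slab T. 0 \<le> g z \<and> g z \<le> f z \<Longrightarrow> L g \<le> c"
  shows "upper_variation T L f \<le> c"
  unfolding upper_variation_def
proof (rule cSup_least)
  have "L (\<lambda>_. 0) \<in> {L g | g. g \<in> C_st T \<and> (\<forall>z\<in>slab T. 0 \<le> g z \<and> g z \<le> f z)}"
    using f C_st_const[of 0 T] by blast
  then show "{L g | g. g \<in> C_st T \<and> (\<forall>z\<in>slab T. 0 \<le> g z \<and> g z \<le> f z)} \<noteq> {}" by blast
qed (use le in blast)

text \<open>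
  A function between \<open>0\<close> and \<open>f + g\<close> is the sum of its minimum with \<open>f\<close> and a function between \<open>0\<close> and \<open>g\<close>
  (Riesz decomposition).
\<close>

lemma upper_variation_add:
  assumes f: "f \<in> C_st T" "\<forall>z\<in>slab T. 0 \<le> f z" and g: "g \<in> C_st T" "\<forall>z\<in>slab T. 0 \<le> g z"
  shows "upper_variation T L (\<lambda>z. f z + g z) = upper_variation T L f + upper_variation T L g"
proof (rule antisym)
  have fg: "(\<lambda>z. f z + g z) \<in> C_st T" using f g by (simp add: C_st_add)
  show "upper_variation T L (\<lambda>z. f z + g z) \<le> upper_variation T L f + upper_variation T L g"
  proof (rule upper_variation_le)
    fix h assume h: "h \<in> C_st T" "\<forall>z\<in>slab T. 0 \<le> h z \<and> h z \<le> f z + g z"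
    \<comment> \<open>Riesz decomposition of \<open>h\<close>.\<close>
    define h1 where "h1 z = min (h z) (f z)" for z
    define h2 where "h2 z = h z - h1 z" for z
    have C: "h1 \<in> C_st T" "h2 \<in> C_st T"
      unfolding h1_def[abs_def] h2_def[abs_def] by (intro C_st_diff C_st_min h f)+
    have "L h1 \<le> upper_variation T L f"
      by (rule upper_variation_ge[OF f(1) C(1)]) (use f(2) h(2) in \<open>auto simp: h1_def\<close>)
    moreover have "L h2 \<le> upper_variation T L g"
    proof (rule upper_variation_ge[OF g(1) C(2)], intro ballI)
      fix z :: "real \<times> (real^'d)" assume z: "z \<in> slab T"
      show "0 \<le> h2 z \<and> h2 z \<le> g z"
        using bspec[OF g(2) z] bspec[OF h(2) z] by (auto simp: h2_def h1_def min_def)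
    qed
    moreover have "L h = L h1 + L h2" using L_add[OF C] by (simp add: h2_def)
    ultimately show "L h \<le> upper_variation T L f + upper_variation T L g" by simp
  qed (use f(2) g(2) in simp)
  have "upper_variation T L f \<le> upper_variation T L (\<lambda>z. f z + g z) - upper_variation T L g"
  proof (rule upper_variation_le[OF f(2)])
    fix h1 assume h1: "h1 \<in> C_st T" "\<forall>z\<in>slab T. 0 \<le> h1 z \<and> h1 z \<le> f z"
    have "upper_variation T L g \<le> upper_variation T L (\<lambda>z. f z + g z) - L h1"
    proof (rule upper_variation_le[OF g(2)])
      fix h2 assume h2: "h2 \<in> C_st T" "\<forall>z\<in>slab T. 0 \<le> h2 z \<and> h2 z \<le> g z"
      have "L (\<lambda>z. h1 z + h2 z) \<le> upper_variation T L (\<lambda>z. f z + g z)"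
        by (rule upper_variation_ge[OF fg C_st_add[OF h1(1) h2(1)]]) (use h1(2) h2(2) in \<open>auto intro: add_mono\<close>)
      then show "L h2 \<le> upper_variation T L (\<lambda>z. f z + g z) - L h1" using L_add[OF h1(1) h2(1)] by simp
    qed
    then show "L h1 \<le> upper_variation T L (\<lambda>z. f z + g z) - upper_variation T L g" by simp
  qed
  then show "upper_variation T L f + upper_variation T L g \<le> upper_variation T L (\<lambda>z. f z + g z)" by simp
qed

lemma upper_variation_nonneg:
  assumes f: "f \<in> C_st T" "\<forall>z\<in>slab T. 0 \<le> f z"
  shows "0 \<le> upper_variation T L f"
  using upper_variation_ge[OF f(1) C_st_const[of 0]] f(2) L_zero by simp

lemma upper_variation_cmult_le:
  assumes f: "f \<in> C_st T" "\<forall>z\<in>slab T. 0 \<le> f z" and c: "0 < c"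
  shows "upper_variation T L (\<lambda>z. c * f z) \<le> c * upper_variation T L f"
proof (rule upper_variation_le)
  fix g assume g: "g \<in> C_st T" "\<forall>z\<in>slab T. 0 \<le> g z \<and> g z \<le> c * f z"
  have "(\<lambda>z. (1 / c) * g z) \<in> C_st T" by (intro C_st_mult C_st_const g)
  then have "L (\<lambda>z. (1 / c) * g z) \<le> upper_variation T L f"
    by (rule upper_variation_ge[OF f(1)]) (use g(2) c in \<open>auto simp: field_simps\<close>)
  then have "L g / c \<le> upper_variation T L f" using L_cmult[OF g(1), of "1 / c"] by simp
  then show "L g \<le> c * upper_variation T L f" using c by (simp add: pos_divide_le_eq mult.commute)
qed (use f(2) c in simp)

lemma upper_variation_cmult:
  assumes f: "f \<in> C_st T" "\<forall>z\<in>slab T. 0 \<le> f z" and c: "0 \<le> c"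
  shows "upper_variation T L (\<lambda>z. c * f z) = c * upper_variation T L f"
proof (cases "c = 0")
  case True
  have "upper_variation T L (\<lambda>_. 0) = 0"
    using upper_variation_add[OF C_st_const[of 0] _ C_st_const[of 0]] by simp
  then show ?thesis using True by simp
next
  case False
  then have c: "0 < c" "0 < 1 / c" using c by simp_all
  have "(\<lambda>z. c * f z) \<in> C_st T" by (intro C_st_mult C_st_const f)
  from upper_variation_cmult_le[OF this _ c(2)] 
  have "upper_variation T L f \<le> (1 / c) * upper_variation T L (\<lambda>z. c * f z)" using f(2) c by simp
  then show ?thesis using upper_variation_cmult_le[OF f c(1)] c by (simp add: field_simps)
qed

lemma positive_functional_upper: "positive_functional ({0..T} \<times> unit_cell) (C_st T) (upper_variation T L)"
  by (rule C_st_positive_functional) (blast intro: upper_variation_add upper_variation_nonneg upper_variation_cmult)+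

lemma positive_functional_lower:
  "positive_functional ({0..T} \<times> unit_cell) (C_st T) (\<lambda>f. upper_variation T L f - L f)"
proof (rule C_st_positive_functional)
  show "0 \<le> upper_variation T L f - L f" if "f \<in> C_st T" "\<forall>z\<in>slab T. 0 \<le> f z" for f
    using upper_variation_ge[OF that(1,1)] that(2) by simp
qed (simp_all add: upper_variation_add upper_variation_cmult L_add L_cmult right_diff_distrib)

end

lemma riesz_mono:
  assumes I: "positive_functional X C I" and J: "positive_functional X C J"
    and le: "\<And>f. f \<in> C \<Longrightarrow> \<forall>x\<in>X. 0 \<le> f x \<Longrightarrow> I f \<le> J f"
    and A: "A \<in> sets (positive_functional.riesz X C J)"
  shows "emeasure (positive_functional.riesz X C I) A \<le> emeasure (positive_functional.riesz X C J) A"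
proof -
  interpret I: positive_functional X C I by fact
  interpret J: positive_functional X C J by fact
  have "emeasure I.riesz A = I.outer A" using A by (intro I.emeasure_riesz) (simp add: I.sets_riesz J.sets_riesz)
  also have "\<dots> \<le> J.outer A"
    unfolding I.outer_def J.outer_def
    by (intro INF_mono) (auto simp: I.Cp_def intro!: suminf_le ennreal_leI le)
  also have "\<dots> = emeasure J.riesz A" using J.emeasure_riesz[OF A] by simp
  finally show ?thesis .
qed

text \<open>
  Domination of the functionals passes to the outer measures, so the smaller measure is absolutely
  continuous and the Radon--Nikodym theorem applies.
\<close>

lemma riesz_density:
  assumes I: "positive_functional X C I" and J: "positive_functional X C J"
    and le: "\<And>f. f \<in> C \<Longrightarrow> \<forall>x\<in>X. 0 \<le> f x \<Longrightarrow> I f \<le> J f"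
  obtains D where "integrable (positive_functional.riesz X C J) D"
    "\<And>f. f \<in> C \<Longrightarrow> \<forall>x\<in>X. 0 \<le> f x \<Longrightarrow> I f = (\<integral>x. f x * D x \<partial>positive_functional.riesz X C J)"
proof -
  interpret I: positive_functional X C I by fact
  interpret J: positive_functional X C J by fact
  interpret fI: finite_measure I.riesz by (rule I.finite_riesz)
  interpret fJ: finite_measure J.riesz by (rule J.finite_riesz)
  have se: "sets I.riesz = sets J.riesz" by (simp add: I.sets_riesz J.sets_riesz)
  have ac: "absolutely_continuous J.riesz I.riesz"
    unfolding absolutely_continuous_def null_sets_def
    using riesz_mono[OF I J le] by (fastforce simp: se)
  obtain D where D: "D \<in> borel_measurable J.riesz" "AE x in J.riesz. RN_deriv J.riesz I.riesz x = ennreal (D x)"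
     "\<And>x. 0 \<le> D x"
    using fJ.real_RN_deriv[OF I.finite_riesz ac se] by blast
  have dens: "I.riesz = density J.riesz (\<lambda>x. ennreal (D x))"
    using fJ.density_RN_deriv[OF ac se] density_cong[OF _ _ D(2)] D(1) by simp
  have D0: "AE x in J.riesz. 0 \<le> D x" using D(3) by simp
  have "integrable I.riesz (\<lambda>_. 1 :: real)" by simp
  then have "integrable J.riesz D"
    unfolding dens using integrable_density[of "\<lambda>_. 1 :: real", OF _ D(1) D0] by simp
  moreover have "I f = (\<integral>x. f x * D x \<partial>J.riesz)" if f: "f \<in> C" "\<forall>x\<in>X. 0 \<le> f x" for f
  proof -
    have "I f = integral\<^sup>L I.riesz f" using f by (intro I.integral_riesz[symmetric]) (auto intro: I.CpI)
    also have "\<dots> = (\<integral>x. D x *\<^sub>R f x \<partial>J.riesz)"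
      unfolding dens by (rule integral_density[OF J.C_measurable[OF f(1)] D(1) D0])
    finally show ?thesis by (simp add: mult.commute)
  qed
  ultimately show ?thesis using that by blast
qed

lemma integrable_C_st_mult:
  fixes \<psi> D :: "real \<times> (real^'d) \<Rightarrow> real"
  assumes \<mu>: "st_borel T \<mu>" and \<psi>: "\<psi> \<in> C_st T" and D: "integrable \<mu> D"
  shows "integrable \<mu> (\<lambda>z. \<psi> z * D z)"
proof -
  have sp: "space \<mu> \<subseteq> slab T" using st_borel_space[OF \<mu>] by auto
  obtain K where K: "K > 0" "\<And>z. z \<in> slab T \<Longrightarrow> norm (\<psi> z) \<le> K" using C_st_bounded[OF \<psi>] by blast
  have [measurable]: "\<psi> \<in> borel_measurable \<mu>" "D \<in> borel_measurable \<mu>" using C_st_measurable[OF \<psi> \<mu>] D by auto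
  show ?thesis
  proof (rule Bochner_Integration.integrable_bound[of \<mu> "\<lambda>z. K * D z"])
    show "AE z in \<mu>. norm (\<psi> z * D z) \<le> norm (K * D z)"
      using K sp by (intro AE_I2) (auto simp: abs_mult intro!: mult_right_mono)
  qed (use D in auto)
qed

text \<open>
  The positive and negative parts of all components are dominated by their sum \<open>J\<close>.  The measure of \<open>J\<close>
  represents all of them by densities, from which the vector density is assembled.
\<close>

theorem st_measure_representation:
  fixes L :: "('d::finite, 'b::euclidean_space) st_functional"
  assumes L: "st_measure T L"
  obtains \<mu> f where "st_borel T \<mu>" "integrable \<mu> f" "\<forall>\<phi>\<in>C_st T. L \<phi> = (\<integral>z. \<phi> z \<bullet> f z \<partial>\<mu>)"
proof -
  define Lc where "Lc i \<psi> = L (\<lambda>z. \<psi> z *\<^sub>R i)" for i and \<psi> :: "real \<times> (real^'d) \<Rightarrow> real"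
  have Cs: "(\<lambda>z. \<psi> z *\<^sub>R i) \<in> C_st T" if "\<psi> \<in> C_st T" for \<psi> and i :: 'b using that C_st_const by (rule C_st_scaleR)
  have Lc: "st_measure T (Lc i)" if i: "i \<in> Basis" for i
    unfolding in_dual_def
  proof (intro conjI ballI allI)
    show "Lc i (\<lambda>z. f z + g z) = Lc i f + Lc i g" if "f \<in> C_st T" "g \<in> C_st T" for f g
      using in_dual_add[OF L Cs[OF that(1)] Cs[OF that(2)], of i i] by (simp add: Lc_def scaleR_add_left)
    show "Lc i (\<lambda>z. c *\<^sub>R f z) = c * Lc i f" if "f \<in> C_st T" for c f
      using in_dual_scale[OF L Cs[OF that], of c i] by (simp add: Lc_def)
    obtain M where M: "\<And>f N. f \<in> C_st T \<Longrightarrow> \<forall>z\<in>slab T. norm (f z) \<le> N \<Longrightarrow> \<bar>L f\<bar> \<le> M * N"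
      using in_dual_bound[OF L] by blast
    show "\<exists>M. \<forall>f\<in>C_st T. \<forall>N. (\<forall>z\<in>slab T. norm (f z) \<le> N) \<longrightarrow> \<bar>Lc i f\<bar> \<le> M * N"
      using M[OF Cs] i by (auto simp: Lc_def intro!: exI[of _ M])
  qed
  define I1 where "I1 i = upper_variation T (Lc i)" for i
  define I2 where "I2 i \<psi> = upper_variation T (Lc i) \<psi> - Lc i \<psi>" for i \<psi>
  define J where "J \<psi> = (\<Sum>i\<in>(Basis::'b set). I1 i \<psi> + I2 i \<psi>)" for \<psi>
  let ?X = "{0..T} \<times> (unit_cell :: (real^'d) set)"
  have p1: "positive_functional ?X (C_st T) (I1 i)" and p2: "positive_functional ?X (C_st T) (I2 i)"
    if "i \<in> Basis" for i
    using positive_functional_upper[OF Lc[OF that]] positive_functional_lower[OF Lc[OF that]]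
    unfolding I1_def I2_def[abs_def] by auto
  have nn1: "0 \<le> I1 i \<psi>" and nn2: "0 \<le> I2 i \<psi>" if "i \<in> Basis" "\<psi> \<in> C_st T" "\<forall>z\<in>?X. 0 \<le> \<psi> z" for i \<psi>
    using positive_functional.I_nonneg[OF p1[OF that(1)] that(2)] positive_functional.I_nonneg[OF p2[OF that(1)] that(2)] that(3)
    by blast+
  have pJ: "positive_functional ?X (C_st T) J"
  proof (rule C_st_positive_functional)
    have r: "\<And>z. z \<in> ?X \<Longrightarrow> 0 \<le> f z" if "\<forall>z\<in>slab T. 0 \<le> f z" for f :: "real \<times> (real^'d) \<Rightarrow> real"
      using that by auto
    fix f g :: "real \<times> (real^'d) \<Rightarrow> real" and c :: real
    assume f: "f \<in> C_st T" "\<forall>z\<in>slab T. 0 \<le> f z"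
    show "0 \<le> J f" unfolding J_def using nn1 nn2 f(1) r[OF f(2)] by (intro sum_nonneg add_nonneg_nonneg) auto
    show "J (\<lambda>z. c * f z) = c * J f" if "0 \<le> c"
      unfolding J_def sum_distrib_left
      by (intro sum.cong refl)
         (simp add: positive_functional.I_cmult[OF p1 f(1) r[OF f(2)] that] positive_functional.I_cmult[OF p2 f(1) r[OF f(2)] that] distrib_left)
    assume g: "g \<in> C_st T" "\<forall>z\<in>slab T. 0 \<le> g z"
    show "J (\<lambda>z. f z + g z) = J f + J g"
      unfolding J_def sum.distrib[symmetric]
      by (intro sum.cong refl)
         (simp add: positive_functional.I_add[OF p1 f(1) g(1) r[OF f(2)] r[OF g(2)]] positive_functional.I_add[OF p2 f(1) g(1) r[OF f(2)] r[OF g(2)]])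
  qed
  define \<mu> where "\<mu> = positive_functional.riesz ?X (C_st T) J"
  have \<mu>: "st_borel T \<mu>" unfolding \<mu>_def by (rule riesz_borel[OF pJ])
  have sp: "space \<mu> \<subseteq> slab T" using st_borel_space[OF \<mu>] by auto
  have le: "I1 i \<psi> \<le> J \<psi>" "I2 i \<psi> \<le> J \<psi>" if "i \<in> Basis" "\<psi> \<in> C_st T" "\<forall>z\<in>?X. 0 \<le> \<psi> z" for i \<psi>
  proof -
    have "I1 i \<psi> + I2 i \<psi> \<le> J \<psi>" unfolding J_def
      using nn1[OF _ that(2,3)] nn2[OF _ that(2,3)] that(1) 
      by (intro member_le_sum[where f = "\<lambda>i. I1 i \<psi> + I2 i \<psi>"]) auto
    then show "I1 i \<psi> \<le> J \<psi>" "I2 i \<psi> \<le> J \<psi>" using nn1[OF that] nn2[OF that] by linarith+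
  qed
  have "\<exists>D. integrable \<mu> D \<and> (\<forall>\<psi>\<in>C_st T. Lc i \<psi> = (\<integral>z. \<psi> z * D z \<partial>\<mu>))" if i: "i \<in> Basis" for i
  proof -
    obtain D1 where D1: "integrable \<mu> D1" "\<And>f. f \<in> C_st T \<Longrightarrow> \<forall>x\<in>?X. 0 \<le> f x \<Longrightarrow> I1 i f = (\<integral>x. f x * D1 x \<partial>\<mu>)"
      unfolding \<mu>_def using riesz_density[OF p1[OF i] pJ le(1)[OF i]] by blast
    obtain D2 where D2: "integrable \<mu> D2" "\<And>f. f \<in> C_st T \<Longrightarrow> \<forall>x\<in>?X. 0 \<le> f x \<Longrightarrow> I2 i f = (\<integral>x. f x * D2 x \<partial>\<mu>)"
      unfolding \<mu>_def using riesz_density[OF p2[OF i] pJ le(2)[OF i]] by blast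
    note int = integrable_C_st_mult[OF \<mu>]
    have pos: "Lc i \<psi> = (\<integral>z. \<psi> z * (D1 z - D2 z) \<partial>\<mu>)" if "\<psi> \<in> C_st T" "\<forall>x\<in>?X. 0 \<le> \<psi> x" for \<psi>
    proof -
      have "Lc i \<psi> = I1 i \<psi> - I2 i \<psi>" by (simp add: I1_def I2_def)
      also have "\<dots> = (\<integral>z. \<psi> z * (D1 z - D2 z) \<partial>\<mu>)"
        using D1(2)[OF that] D2(2)[OF that] int[OF that(1) D1(1)] int[OF that(1) D2(1)]
        by (simp add: right_diff_distrib)
      finally show ?thesis .
    qed
    have D: "integrable \<mu> (\<lambda>z. D1 z - D2 z)" using D1(1) D2(1) by simp
    have "Lc i \<psi> = (\<integral>z. \<psi> z * (D1 z - D2 z) \<partial>\<mu>)" if \<psi>: "\<psi> \<in> C_st T" for \<psi>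
    proof -
      have C: "(\<lambda>z. max 0 (\<psi> z)) \<in> C_st T" "(\<lambda>z. max 0 (- \<psi> z)) \<in> C_st T"
        by (intro C_st_max C_st_minus \<psi>)+
      have eq: "max 0 (\<psi> z) = \<psi> z + max 0 (- \<psi> z)" for z by auto
      have "Lc i \<psi> + Lc i (\<lambda>z. max 0 (- \<psi> z)) = Lc i (\<lambda>z. max 0 (\<psi> z))"
        using L_add[OF Lc[OF i] \<psi> C(2)] by (simp add: eq)
      also have "\<dots> = (\<integral>z. max 0 (\<psi> z) * (D1 z - D2 z) \<partial>\<mu>)" by (rule pos[OF C(1)]) simp
      also have "\<dots> = (\<integral>z. \<psi> z * (D1 z - D2 z) + max 0 (- \<psi> z) * (D1 z - D2 z) \<partial>\<mu>)"
        by (simp only: eq distrib_right)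
      also have "\<dots> = (\<integral>z. \<psi> z * (D1 z - D2 z) \<partial>\<mu>) + (\<integral>z. max 0 (- \<psi> z) * (D1 z - D2 z) \<partial>\<mu>)"
        by (rule Bochner_Integration.integral_add[OF int[OF \<psi> D] int[OF C(2) D]])
      also have "(\<integral>z. max 0 (- \<psi> z) * (D1 z - D2 z) \<partial>\<mu>) = Lc i (\<lambda>z. max 0 (- \<psi> z))"
        by (rule pos[OF C(2), symmetric]) simp
      finally show ?thesis by simp
    qed
    then show ?thesis using D by blast
  qed
  then obtain D where D: "\<And>i. i \<in> Basis \<Longrightarrow> integrable \<mu> (D i)"
      "\<And>i \<psi>. i \<in> Basis \<Longrightarrow> \<psi> \<in> C_st T \<Longrightarrow> Lc i \<psi> = (\<integral>z. \<psi> z * D i z \<partial>\<mu>)" by metis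
  define f where "f z = (\<Sum>i\<in>Basis. D i z *\<^sub>R i)" for z
  have f: "integrable \<mu> f" unfolding f_def using D(1) by (intro Bochner_Integration.integrable_sum) auto
  have fi: "f z \<bullet> i = D i z" if "i \<in> Basis" for i z
    using that by (simp add: f_def inner_sum_left inner_Basis if_distrib sum.delta' cong: if_cong)
  have "L \<phi> = (\<integral>z. \<phi> z \<bullet> f z \<partial>\<mu>)" if \<phi>: "\<phi> \<in> C_st T" for \<phi>
  proof -
    have \<phi>i: "(\<lambda>z. \<phi> z \<bullet> i) \<in> C_st T" for i by (intro C_st_inner \<phi> C_st_const)
    have sum: "L (\<lambda>z. \<Sum>i\<in>A. (\<phi> z \<bullet> i) *\<^sub>R i) = (\<Sum>i\<in>A. Lc i (\<lambda>z. \<phi> z \<bullet> i))" if "finite A" for A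
      using that
    proof (induction A)
      case empty
      show ?case using in_dual_scale[OF L C_st_const[of 0], of 0] by simp
    next
      case (insert i A)
      have "L (\<lambda>z. (\<phi> z \<bullet> i) *\<^sub>R i + (\<Sum>i\<in>A. (\<phi> z \<bullet> i) *\<^sub>R i))
          = L (\<lambda>z. (\<phi> z \<bullet> i) *\<^sub>R i) + L (\<lambda>z. \<Sum>i\<in>A. (\<phi> z \<bullet> i) *\<^sub>R i)"
        by (rule in_dual_add[OF L Cs[OF \<phi>i] C_st_sum[OF Cs[OF \<phi>i]]])
      then show ?case using insert by (simp add: Lc_def)
    qed
    have int: "integrable \<mu> (\<lambda>z. (\<phi> z \<bullet> i) * D i z)" if "i \<in> Basis" for i
      by (rule integrable_C_st_mult[OF \<mu> \<phi>i D(1)[OF that]])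
    have "L \<phi> = (\<Sum>i\<in>Basis. Lc i (\<lambda>z. \<phi> z \<bullet> i))" using sum[OF finite_Basis] by (simp add: euclidean_representation)
    also have "\<dots> = (\<Sum>i\<in>Basis. \<integral>z. (\<phi> z \<bullet> i) * D i z \<partial>\<mu>)" by (intro sum.cong refl D(2) \<phi>i)
    also have "\<dots> = (\<integral>z. (\<Sum>i\<in>Basis. (\<phi> z \<bullet> i) * D i z) \<partial>\<mu>)" using int by (intro Bochner_Integration.integral_sum[symmetric]) auto
    also have "\<dots> = (\<integral>z. \<phi> z \<bullet> f z \<partial>\<mu>)" by (simp add: euclidean_inner[of "\<phi> _" "f _"] fi)
    finally show ?thesis .
  qed
  then show ?thesis using that \<mu> f by blast
qed

section \<open>Smooth functions of time\<close>

text \<open>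
  Smoothness of any order follows by induction when the function belongs to a class that is closed under
  differentiation; the class \<open>\<F>\<close> is instantiated by \<open>smooth_class\<close> with one antiderivative added.
\<close>

lemma Ck_time_function:
  assumes "F \<in> \<F>" and "\<And>F. F \<in> \<F> \<Longrightarrow> \<exists>F'\<in>\<F>. \<forall>s. (F has_real_derivative F' s) (at s)"
  shows "Ck n (\<lambda>z :: real \<times> (real^'d). c * F (fst z))"
  using assms(1)
proof (induction n arbitrary: F c)
  case 0
  then obtain F' where F': "\<forall>s. (F has_real_derivative F' s) (at s)" using assms(2) by blast
  then have "continuous_on UNIV F" by (meson DERIV_isCont continuous_at_imp_continuous_on)
  then have "continuous_on UNIV (\<lambda>z :: real \<times> (real^'d). F (fst z))"
    by (rule continuous_on_compose2) (auto intro: continuous_intros)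
  then show ?case by (simp add: continuous_on_mult_left)
next
  case (Suc n)
  then obtain F' where F': "\<forall>s. (F has_real_derivative F' s) (at s)" "F' \<in> \<F>" using assms(2) by blast
  have D: "((\<lambda>z :: real \<times> (real^'d). c * F (fst z)) has_derivative (\<lambda>h. c * (F' (fst z) * fst h))) (at z)" for z
    using has_derivative_mult_right[OF has_derivative_compose[OF has_derivative_fst[OF has_derivative_ident]
        F'(1)[rule_format, of "fst z", unfolded has_field_derivative_def]]] .
  have "frechet_derivative (\<lambda>z :: real \<times> (real^'d). c * F (fst z)) (at z) v = (c * fst v) * F' (fst z)" for z v
    using frechet_derivative_at[OF D[of z]] by (metis mult.assoc mult.commute)
  moreover have "(\<lambda>z :: real \<times> (real^'d). c * F (fst z)) differentiable (at z)" for z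
    using D[of z] unfolding differentiable_def by blast
  ultimately show ?case using Suc.IH[OF F'(2)] by (simp only: Ck.simps) blast
qed

text \<open>
  The family \<open>x\<^sup>-\<^sup>k exp(-1/x)\<close>, extended by \<open>0\<close>: the derivative of a member is a combination of members, at
  \<open>x = 0\<close> as well.
\<close>

definition flat_exp :: "nat \<Rightarrow> real \<Rightarrow> real" where
  "flat_exp k x = (if x > 0 then (1 / x) ^ k * exp (- (1 / x)) else 0)"

lemma flat_exp_deriv:
  "(flat_exp k has_real_derivative flat_exp (k + 2) x - real k * flat_exp (k + 1) x) (at x)"
proof -
  consider "x > 0" | "x < 0" | "x = 0" by linarith
  then show ?thesis
  proof cases
    case 1
    have "((\<lambda>x. (1 / x) ^ k * exp (- (1 / x))) has_real_derivative
        flat_exp (k + 2) x - real k * flat_exp (k + 1) x) (at x)"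
    proof -
      have y: "((\<lambda>x. 1 / x) has_real_derivative - ((1 / x) * (1 / x))) (at x)"
        using 1 by (auto intro!: derivative_eq_intros simp: power2_eq_square)
      have e: "((\<lambda>x. exp (- (1 / x))) has_real_derivative exp (- (1 / x)) * ((1 / x) * (1 / x))) (at x)"
        using DERIV_chain2[OF DERIV_exp DERIV_minus[OF y]] by simp
      have "((\<lambda>x. (1 / x) ^ k * exp (- (1 / x))) has_real_derivative
          real k * (- ((1 / x) * (1 / x)) * (1 / x) ^ (k - Suc 0)) * exp (- (1 / x))
          + exp (- (1 / x)) * ((1 / x) * (1 / x)) * (1 / x) ^ k) (at x)"
        by (rule DERIV_mult[OF DERIV_power[OF y] e])
      moreover have "real k * (- ((1 / x) * (1 / x)) * (1 / x) ^ (k - Suc 0)) * exp (- (1 / x))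
          + exp (- (1 / x)) * ((1 / x) * (1 / x)) * (1 / x) ^ k = flat_exp (k + 2) x - real k * flat_exp (k + 1) x"
        using 1 by (cases k) (simp_all add: flat_exp_def algebra_simps del: divide_self_if power_divide)
      ultimately show ?thesis by simp
    qed
    then show ?thesis
      by (rule has_field_derivative_transform_within_open[of _ _ _ "{0<..}"]) (use 1 in \<open>auto simp: flat_exp_def\<close>)
  next
    case 2
    have "((\<lambda>x. 0) has_real_derivative 0) (at x)" by simp
    then have "(flat_exp k has_real_derivative 0) (at x)"
      by (rule has_field_derivative_transform_within_open[of _ _ _ "{..<0}"]) (use 2 in \<open>auto simp: flat_exp_def\<close>)
    then show ?thesis using 2 by (simp add: flat_exp_def)
  next
    case 3
    have "((\<lambda>y::real. y ^ (k + 1) / exp y) \<longlongrightarrow> 0) at_top" by (rule tendsto_power_div_exp_0)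
    then have "((\<lambda>h. inverse h ^ (k + 1) / exp (inverse h)) \<longlongrightarrow> (0::real)) (at_right 0)"
      by (rule filterlim_compose[OF _ filterlim_inverse_at_top_right])
    then have r: "((\<lambda>h. flat_exp k h / h) \<longlongrightarrow> 0) (at_right 0)"
      by (rule Lim_transform_eventually)
         (auto simp: flat_exp_def eventually_at_right_field field_simps exp_minus intro!: exI[of _ 1])
    have "((\<lambda>h. 0) \<longlongrightarrow> (0::real)) (at_left 0)" by simp
    then have l: "((\<lambda>h. flat_exp k h / h) \<longlongrightarrow> 0) (at_left 0)"
      by (rule Lim_transform_eventually) (auto simp: flat_exp_def eventually_at_left_field intro!: exI[of _ "-1"])
    have "((\<lambda>h. flat_exp k h / h) \<longlongrightarrow> 0) (at 0)" using l r by (simp add: filterlim_split_at)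
    then show ?thesis using 3 by (simp add: has_field_derivative_iff flat_exp_def)
  qed
qed

inductive_set smooth_class :: "(real \<Rightarrow> real) set" where
  flat: "(\<lambda>x. flat_exp k (c * x + a)) \<in> smooth_class"
| const: "(\<lambda>_. c) \<in> smooth_class"
| add: "f \<in> smooth_class \<Longrightarrow> g \<in> smooth_class \<Longrightarrow> (\<lambda>x. f x + g x) \<in> smooth_class"
| mult: "f \<in> smooth_class \<Longrightarrow> g \<in> smooth_class \<Longrightarrow> (\<lambda>x. f x * g x) \<in> smooth_class"

lemma smooth_class_deriv:
  "F \<in> smooth_class \<Longrightarrow> \<exists>F'\<in>smooth_class. \<forall>s. (F has_real_derivative F' s) (at s)"
proof (induction rule: smooth_class.induct)
  case (flat k c a)
  have "((\<lambda>x. flat_exp k (c * x + a)) has_real_derivative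
      c * (flat_exp (k + 2) (c * s + a) + (- real k) * flat_exp (k + 1) (c * s + a))) (at s)" for s
  proof -
    have "((\<lambda>x. c * x + a) has_real_derivative c) (at s)" by (auto intro!: derivative_eq_intros)
    from DERIV_chain2[where f = "flat_exp k" and g = "\<lambda>x. c * x + a", OF flat_exp_deriv this]
    show ?thesis by (simp add: mult.commute)
  qed
  moreover have "(\<lambda>s. c * (flat_exp (k + 2) (c * s + a) + (- real k) * flat_exp (k + 1) (c * s + a))) \<in> smooth_class"
    by (intro smooth_class.intros)
  ultimately show ?case
    by (intro bexI[of _ "\<lambda>s. c * (flat_exp (k + 2) (c * s + a) + (- real k) * flat_exp (k + 1) (c * s + a))"] allI)
next
  case (const c)
  show ?case using smooth_class.const[of 0] by (intro bexI[of _ "\<lambda>_. 0"]) auto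
next
  case (add f g)
  then obtain f' g' where "f' \<in> smooth_class" "g' \<in> smooth_class"
    "\<forall>s. (f has_real_derivative f' s) (at s)" "\<forall>s. (g has_real_derivative g' s) (at s)" by blast
  then show ?case by (intro bexI[of _ "\<lambda>x. f' x + g' x"]) (auto intro!: derivative_intros smooth_class.add)
next
  case (mult f g)
  then obtain f' g' where *: "f' \<in> smooth_class" "g' \<in> smooth_class"
    "\<forall>s. (f has_real_derivative f' s) (at s)" "\<forall>s. (g has_real_derivative g' s) (at s)" by blast
  then have "\<forall>s. ((\<lambda>x. f x * g x) has_real_derivative f' s * g s + g' s * f s) (at s)" by (auto intro: DERIV_mult)
  moreover have "(\<lambda>s. f' s * g s + g' s * f s) \<in> smooth_class" using * mult by (intro smooth_class.intros)
  ultimately show ?case by (intro bexI[of _ "\<lambda>s. f' s * g s + g' s * f s"])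
qed

text \<open>
  \<open>\<psi>\<close> is the product of two flat exponentials vanishing on either side of \<open>[-h,h]\<close>, and \<open>\<Psi>\<close> is an
  antiderivative.
\<close>

lemma smooth_step:
  fixes h :: real
  assumes h: "h > 0"
  obtains \<Psi> \<psi> where "\<forall>a. (\<lambda>x. \<psi> (x - a)) \<in> smooth_class" "\<forall>x. (\<Psi> has_real_derivative \<psi> x) (at x)"
    "\<forall>x. 0 \<le> \<psi> x" "\<forall>x. \<bar>x\<bar> \<ge> h \<longrightarrow> \<psi> x = 0"
    "\<forall>x. x \<le> - h \<longrightarrow> \<Psi> x = \<Psi> (- h)" "\<forall>x. x \<ge> h \<longrightarrow> \<Psi> x = \<Psi> h" "\<Psi> (- h) < \<Psi> h"
proof -
  define \<psi> where "\<psi> x = flat_exp 0 (1 * x + h) * flat_exp 0 (- 1 * x + h)" for x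
  have sm: "(\<lambda>x. \<psi> (x - a)) \<in> smooth_class" for a
  proof -
    have "(\<lambda>x. flat_exp 0 (1 * x + (h - a)) * flat_exp 0 (- 1 * x + (h + a))) \<in> smooth_class"
      by (intro smooth_class.intros)
    moreover have "\<psi> (x - a) = flat_exp 0 (1 * x + (h - a)) * flat_exp 0 (- 1 * x + (h + a))" for x
      by (simp add: \<psi>_def algebra_simps)
    ultimately show ?thesis by (simp only:)
  qed
  have "\<psi> \<in> smooth_class" using sm[of 0] by simp
  then have "\<And>x. isCont \<psi> x" using smooth_class_deriv DERIV_isCont by blast
  then obtain \<Psi> where "\<forall>x. - \<infinity> < ereal x \<longrightarrow> ereal x < \<infinity> \<longrightarrow> (\<Psi> has_vector_derivative \<psi> x) (at x)"
    using einterval_antiderivative[of "- \<infinity>" \<infinity> \<psi>] by auto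
  then have \<Psi>: "(\<Psi> has_real_derivative \<psi> x) (at x)" for x
    by (simp add: has_real_derivative_iff_has_vector_derivative)
  have nn: "0 \<le> \<psi> x" for x by (simp add: \<psi>_def flat_exp_def)
  have z: "\<psi> x = 0" if "\<bar>x\<bar> \<ge> h" for x using that by (auto simp: \<psi>_def flat_exp_def)
  have p: "0 < \<psi> x" if "- h < x" "x < h" for x using that by (auto simp: \<psi>_def flat_exp_def)
  have const: "\<Psi> x = \<Psi> y" if S: "convex S" "\<And>s. s \<in> S \<Longrightarrow> \<bar>s\<bar> \<ge> h" "x \<in> S" "y \<in> S" for S x y
  proof -
    have "(\<Psi> has_field_derivative 0) (at s within S)" if "s \<in> S" for s
      using \<Psi>[of s] z[of s] S(2)[OF that] by (simp add: has_field_derivative_at_within)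
    then obtain c where "\<forall>x\<in>S. \<Psi> x = c"
      using has_field_derivative_zero_constant[OF S(1), of \<Psi>] by blast
    then show ?thesis using S by simp
  qed
  have "\<Psi> (- h) < \<Psi> h"
  proof (rule DERIV_pos_imp_increasing_open[of "- h" h \<Psi>])
    show "- h < h" using h by simp
    show "\<exists>y. (\<Psi> has_real_derivative y) (at x) \<and> 0 < y" if "- h < x" "x < h" for x
      using \<Psi> p[OF that] by blast
    show "continuous_on {- h..h} \<Psi>"
      using \<Psi> DERIV_isCont by (intro continuous_at_imp_continuous_on) blast
  qed
  moreover have "\<Psi> x = \<Psi> (- h)" if "x \<le> - h" for x
    by (rule const[of "{..- h}"]) (use that h in auto)
  moreover have "\<Psi> x = \<Psi> h" if "x \<ge> h" for x
    by (rule const[of "{h..}"]) (use that h in auto)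
  ultimately show ?thesis using that sm \<Psi> nn z by blast
qed

lemma LINT_eq_integral:
  fixes k :: "real \<Rightarrow> real"
  assumes "continuous_on {a..b} k"
  shows "(LINT s:{a..b}|lborel. k s) = integral {a..b} k"
proof (rule set_borel_integral_eq_integral(2))
  show "set_integrable lborel {a..b} k" unfolding set_integrable_def
    by (rule borel_integrable_compact[OF compact_Icc assms])
qed

text \<open>
  The difference of two smooth steps at \<open>t1\<close> and \<open>t2\<close> vanishes near both ends of the interval, and its derivative compares
  the averages of \<open>m\<close> around the two points.  Shrinking the width gives \<open>m t1 = m t2\<close> for interior points;
  continuity does the rest.
\<close>

lemma constant_of_weak_derivative_zero:
  fixes m :: "real \<Rightarrow> real"
  assumes T: "T > 0" and m: "continuous_on {0..T} m"
    and weak: "\<And>\<kappa> \<kappa>' \<epsilon>. (\<And>s. (\<kappa> has_real_derivative \<kappa>' s) (at s)) \<Longrightarrow> \<kappa>' \<in> smooth_class \<Longrightarrow> \<epsilon> > 0 \<Longrightarrow>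
        (\<And>s. \<kappa> s \<noteq> 0 \<Longrightarrow> \<epsilon> \<le> s \<and> s \<le> T - \<epsilon>) \<Longrightarrow> integral {0..T} (\<lambda>s. m s * \<kappa>' s) = 0"
    and t: "t \<in> {0..T}"
  shows "m t = m 0"
proof -
  have interior: "m t1 = m t2" if t12: "0 < t1" "t1 < T" "0 < t2" "t2 < T" for t1 t2
  proof (rule ccontr)
    assume ne: "m t1 \<noteq> m t2"
    define \<delta> where "\<delta> = \<bar>m t1 - m t2\<bar> / 3"
    have \<delta>: "\<delta> > 0" using ne by (simp add: \<delta>_def)
    have cont: "\<exists>e>0. \<forall>s\<in>{0..T}. \<bar>s - t\<bar> < e \<longrightarrow> \<bar>m s - m t\<bar> < \<delta>" if "t \<in> {0..T}" for t
      using m that \<delta> unfolding continuous_on_iff dist_real_def by blast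
    obtain e1 e2 where e: "e1 > 0" "e2 > 0" "\<And>s. s \<in> {0..T} \<Longrightarrow> \<bar>s - t1\<bar> < e1 \<Longrightarrow> \<bar>m s - m t1\<bar> < \<delta>"
       "\<And>s. s \<in> {0..T} \<Longrightarrow> \<bar>s - t2\<bar> < e2 \<Longrightarrow> \<bar>m s - m t2\<bar> < \<delta>"
      using cont[of t1] cont[of t2] t12 by auto
    \<comment> \<open>Small enough for \<open>m\<close> to be nearly constant around both points and for the steps to stay away from \<open>0\<close> and \<open>T\<close>.\<close>
    define M where "M = Min {e1, e2, t1, t2, T - t1, T - t2}"
    have M0: "0 < M" unfolding M_def using e(1,2) t12 by (subst Min_gr_iff) auto
    have M: "M \<le> e1" "M \<le> e2" "M \<le> t1" "M \<le> t2" "M \<le> T - t1" "M \<le> T - t2"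
      unfolding M_def by (rule Min_le; simp)+
    define h where "h = M / 2"
    have h: "h > 0" "h < e1" "h < e2" "2 * h \<le> t1" "2 * h \<le> t2" "2 * h \<le> T - t1" "2 * h \<le> T - t2"
      using M0 M unfolding h_def by linarith+
    obtain \<Psi> \<psi> where all: "\<forall>a. (\<lambda>x. \<psi> (x - a)) \<in> smooth_class" "\<forall>x. (\<Psi> has_real_derivative \<psi> x) (at x)"
      "\<forall>x. 0 \<le> \<psi> x" "\<forall>x. \<bar>x\<bar> \<ge> h \<longrightarrow> \<psi> x = 0"
      "\<forall>x. x \<le> - h \<longrightarrow> \<Psi> x = \<Psi> (- h)" "\<forall>x. x \<ge> h \<longrightarrow> \<Psi> x = \<Psi> h" and lt: "\<Psi> (- h) < \<Psi> h"
      by (rule smooth_step[OF h(1)])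
    note \<psi> = all(1)[rule_format] and \<Psi> = all(2)[rule_format] and nn = all(3)[rule_format]
      and z = all(4)[rule_format] and lo = all(5)[rule_format] and hi = all(6)[rule_format]
    define c where "c = \<Psi> h - \<Psi> (- h)"
    have c: "c > 0" using lt by (simp add: c_def)
    have \<psi>c: "continuous_on S (\<lambda>x. \<psi> (x - a))" for S a
      using smooth_class_deriv[OF \<psi>[of a]] by (meson DERIV_isCont continuous_at_imp_continuous_on)
    have sh: "((\<lambda>s. \<Psi> (s - a)) has_real_derivative \<psi> (s - a)) (at s)" for a s
    proof -
      have "((\<lambda>s. s - a) has_real_derivative 1) (at s)" by (auto intro!: derivative_eq_intros)
      from DERIV_chain2[where f = \<Psi> and g = "\<lambda>s. s - a", OF \<Psi> this] show ?thesis by simp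
    qed
    have mi: "continuous_on {0..T} (\<lambda>s. m s * \<psi> (s - a))" for a by (intro continuous_on_mult m \<psi>c)
    have "integral {0..T} (\<lambda>s. m s * (\<psi> (s - t1) + (- 1) * \<psi> (s - t2))) = 0"
    proof (rule weak[of "\<lambda>s. \<Psi> (s - t1) + (- 1) * \<Psi> (s - t2)" _ h])
      show "((\<lambda>s. \<Psi> (s - t1) + (- 1) * \<Psi> (s - t2)) has_real_derivative \<psi> (s - t1) + (- 1) * \<psi> (s - t2)) (at s)" for s
        by (intro derivative_intros DERIV_cmult sh)
      show "(\<lambda>s. \<psi> (s - t1) + (- 1) * \<psi> (s - t2)) \<in> smooth_class" by (intro smooth_class.intros \<psi>)
      show "h > 0" by fact
      fix s assume ns: "\<Psi> (s - t1) + (- 1) * \<Psi> (s - t2) \<noteq> 0"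
      show "h \<le> s \<and> s \<le> T - h"
      proof (rule ccontr)
        assume "\<not> ?thesis"
        then consider "s < h" | "s > T - h" by linarith
        then show False
        proof cases
          case 1 then show False using ns lo[of "s - t1"] lo[of "s - t2"] h by simp
        next
          case 2 then show False using ns hi[of "s - t1"] hi[of "s - t2"] h by simp
        qed
      qed
    qed
    then have eq: "integral {0..T} (\<lambda>s. m s * \<psi> (s - t1)) = integral {0..T} (\<lambda>s. m s * \<psi> (s - t2))"
      using integral_diff[OF integrable_continuous_interval[OF mi[of t1]] integrable_continuous_interval[OF mi[of t2]]]
      by (simp add: algebra_simps)
    have near: "\<bar>integral {0..T} (\<lambda>s. m s * \<psi> (s - a)) - m a * c\<bar> \<le> \<delta> * c"
      if a: "2 * h \<le> a" "2 * h \<le> T - a" and close: "\<And>s. s \<in> {0..T} \<Longrightarrow> \<bar>s - a\<bar> < h \<Longrightarrow> \<bar>m s - m a\<bar> < \<delta>" for a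
    proof -
      have "((\<lambda>s. \<psi> (s - a)) has_integral \<Psi> (T - a) - \<Psi> (0 - a)) {0..T}"
        by (rule fundamental_theorem_of_calculus)
           (use T sh in \<open>auto simp: has_real_derivative_iff_has_vector_derivative[symmetric] intro: has_field_derivative_at_within\<close>)
      moreover have "\<Psi> (T - a) - \<Psi> (0 - a) = c"
        using hi[of "T - a"] lo[of "0 - a"] a h by (simp add: c_def)
      ultimately have I: "((\<lambda>s. \<psi> (s - a)) has_integral c) {0..T}" by simp
      have "((\<lambda>s. m s * \<psi> (s - a) - m a * \<psi> (s - a)) has_integral integral {0..T} (\<lambda>s. m s * \<psi> (s - a)) - m a * c) {0..T}"
        by (intro has_integral_diff has_integral_mult_right I integrable_integral integrable_continuous_interval mi)
      moreover have "((\<lambda>s. \<delta> * \<psi> (s - a)) has_integral \<delta> * c) {0..T}" by (intro has_integral_mult_right I)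
      moreover have "norm (m s * \<psi> (s - a) - m a * \<psi> (s - a)) \<le> \<delta> * \<psi> (s - a)" if "s \<in> {0..T}" for s
      proof (cases "\<bar>s - a\<bar> < h")
        case True
        then show ?thesis using close[OF that] nn[of "s - a"]
          by (simp add: left_diff_distrib[symmetric] abs_mult mult_right_mono less_imp_le)
      qed (simp add: z)
      ultimately show ?thesis
        using integral_norm_bound_integral[of "\<lambda>s. m s * \<psi> (s - a) - m a * \<psi> (s - a)" "{0..T}" "\<lambda>s. \<delta> * \<psi> (s - a)"]
        using integral_unique[OF I] by (simp add: integral_unique has_integral_integrable)
    qed
    have "\<bar>integral {0..T} (\<lambda>s. m s * \<psi> (s - t1)) - m t1 * c\<bar> \<le> \<delta> * c"
      by (rule near) (use h e in auto)
    moreover have "\<bar>integral {0..T} (\<lambda>s. m s * \<psi> (s - t2)) - m t2 * c\<bar> \<le> \<delta> * c"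
      by (rule near) (use h e in auto)
    ultimately have "\<bar>m t1 * c - m t2 * c\<bar> \<le> 2 * (\<delta> * c)" using eq by linarith
    then have "\<bar>m t1 - m t2\<bar> * c \<le> (2 * \<delta>) * c" using c by (simp add: left_diff_distrib[symmetric] abs_mult)
    then have "\<bar>m t1 - m t2\<bar> \<le> 2 * \<delta>" using c by (simp only: mult_le_cancel_right_pos)
    then show False using \<delta> by (simp add: \<delta>_def)
  qed
  have cl: "closure {0<..<T} = {0..T}" using T by (rule closure_greaterThanLessThan)
  have "m s = m (T / 2)" if "s \<in> {0..T}" for s
  proof (rule continuous_constant_on_closure[of "{0<..<T}" m])
    show "continuous_on (closure {0<..<T}) m" "s \<in> closure {0<..<T}" unfolding cl using m that .
    show "m x = m (T / 2)" if "x \<in> {0<..<T}" for x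
      by (rule interior) (use that T in auto)
  qed
  from this[OF t] this[of 0] show ?thesis using T by simp
qed

section \<open>Paths of nonnegative measures and coercive quadratic forms\<close>

lemma slab_equicontinuous:
  fixes \<phi> :: "real \<times> (real^'d) \<Rightarrow> 'b::real_normed_vector"
  assumes \<phi>: "\<phi> \<in> C_st t" and \<epsilon>: "\<epsilon> > 0"
  obtains \<delta> where "\<delta> > 0" "\<And>s a x. s \<in> {0..t} \<Longrightarrow> a \<in> {0..t} \<Longrightarrow> \<bar>s - a\<bar> < \<delta> \<Longrightarrow> norm (\<phi> (s, x) - \<phi> (a, x)) < \<epsilon>"
proof -
  let ?K = "{0..t} \<times> (cbox 0 1 :: (real^'d) set)"
  have "uniformly_continuous_on ?K \<phi>"
    by (intro compact_uniformly_continuous continuous_on_subset[OF C_stD[OF \<phi>]] compact_Times) auto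
  then obtain \<delta> where \<delta>: "\<delta> > 0" "\<And>z z'. z \<in> ?K \<Longrightarrow> z' \<in> ?K \<Longrightarrow> dist z' z < \<delta> \<Longrightarrow> dist (\<phi> z') (\<phi> z) < \<epsilon>"
    unfolding uniformly_continuous_on_def using \<epsilon> by blast
  have "norm (\<phi> (s, x) - \<phi> (a, x)) < \<epsilon>" if sa: "s \<in> {0..t}" "a \<in> {0..t}" "\<bar>s - a\<bar> < \<delta>" for s a x
  proof -
    have c: "cell_rep x \<in> cbox 0 1" using cell_rep_in unit_cell_subset by blast
    have "dist (\<phi> (s, cell_rep x)) (\<phi> (a, cell_rep x)) < \<epsilon>"
      by (rule \<delta>(2)) (use sa c in \<open>auto simp: dist_Pair_Pair dist_real_def\<close>)
    then show ?thesis
      using slab_representative(1)[OF \<phi>, of "(s, x)"] slab_representative(1)[OF \<phi>, of "(a, x)"] sa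
      by (simp add: dist_norm)
  qed
  then show ?thesis using \<delta>(1) that by blast
qed

locale nonneg_path =
  fixes T :: real and \<rho> :: "real \<Rightarrow> ('d::finite, real) torus_functional"
  assumes T: "T > 0" and wc: "weak_star_continuous T \<rho>" and nn: "\<And>t. t \<in> {0..T} \<Longrightarrow> nonneg_measure (\<rho> t)"
begin

lemma tm: "t \<in> {0..T} \<Longrightarrow> torus_measure (\<rho> t)" using wc by (simp add: weak_star_continuous_def)

abbreviation mass where "mass t \<equiv> \<rho> t (\<lambda>_. 1)"

lemma mass_nonneg: "t \<in> {0..T} \<Longrightarrow> 0 \<le> mass t"
  using bspec[OF nn[of t] C_torus_const[of 1]] by simp

lemma abs_le:
  assumes t: "t \<in> {0..T}" and f: "f \<in> C_torus" and K: "\<And>x. \<bar>f x\<bar> \<le> K"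
  shows "\<bar>\<rho> t f\<bar> \<le> K * mass t"
proof -
  have c: "\<rho> t (\<lambda>_. K) = K * mass t" "\<rho> t (\<lambda>_. - K) = - K * mass t"
    using torus_measure_cmult[OF tm[OF t] C_torus_const[of 1], of K] torus_measure_cmult[OF tm[OF t] C_torus_const[of 1], of "- K"]
    by simp_all
  have "\<rho> t f \<le> \<rho> t (\<lambda>_. K)" "\<rho> t (\<lambda>_. - K) \<le> \<rho> t f"
    using K by (auto intro!: nonneg_measure_mono[OF tm[OF t] nn[OF t]] f C_torus_const simp: abs_le_iff minus_le_iff)
  then show ?thesis unfolding c by (simp add: abs_le_iff)
qed

lemma mass_continuous: "continuous_on {0..T} mass"
  using wc C_torus_const[of "1::real"] unfolding weak_star_continuous_def by blast

lemma mass_bound: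
  obtains m where "m > 0" "\<And>t. t \<in> {0..T} \<Longrightarrow> mass t \<le> m"
proof -
  have "compact (mass ` {0..T})" by (intro compact_continuous_image mass_continuous) simp
  then have "\<exists>m>0. \<forall>y\<in>mass ` {0..T}. norm y \<le> m" using compact_imp_bounded bounded_pos by metis
  then obtain m where m: "m > 0" "\<forall>y\<in>mass ` {0..T}. norm y \<le> m" by blast
  have "mass t \<le> m" if "t \<in> {0..T}" for t using bspec[OF m(2) imageI[OF that]] by simp
  then show ?thesis using m(1) that by blast
qed

text \<open>
  Weak-* continuity is for a fixed test function; since all masses are bounded, a test function that varies
  uniformly continuously in time is allowed.
\<close>

lemma slice_continuous:
  assumes \<phi>: "\<phi> \<in> C_st t" and t: "t \<in> {0..T}"
  shows "continuous_on {0..t} (\<lambda>s. \<rho> s (\<lambda>x. \<phi> (s, x)))"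
  unfolding continuous_on_iff dist_real_def
proof (intro ballI allI impI)
  fix a e :: real assume a: "a \<in> {0..t}" and e: "0 < e"
  obtain m where m: "m > 0" "\<And>t. t \<in> {0..T} \<Longrightarrow> mass t \<le> m" using mass_bound by blast
  have "e / (2 * m) > 0" using e m by simp
  then obtain d1 where d1: "d1 > 0" "\<And>s a x. s \<in> {0..t} \<Longrightarrow> a \<in> {0..t} \<Longrightarrow> \<bar>s - a\<bar> < d1 \<Longrightarrow> norm (\<phi> (s, x) - \<phi> (a, x)) < e / (2 * m)"
    using slab_equicontinuous[OF \<phi>] by blast
  have aT: "a \<in> {0..T}" using a t by auto
  have \<phi>a: "(\<lambda>x. \<phi> (a, x)) \<in> C_torus" by (rule C_st_slice[OF \<phi> a])
  then have "continuous_on {0..T} (\<lambda>s. \<rho> s (\<lambda>x. \<phi> (a, x)))" using wc unfolding weak_star_continuous_def by blast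
  then obtain d2 where d2: "d2 > 0" "\<And>s. s \<in> {0..T} \<Longrightarrow> \<bar>s - a\<bar> < d2 \<Longrightarrow> \<bar>\<rho> s (\<lambda>x. \<phi> (a, x)) - \<rho> a (\<lambda>x. \<phi> (a, x))\<bar> < e / 2"
    using aT e unfolding continuous_on_iff dist_real_def by (meson half_gt_zero)
  show "\<exists>d>0. \<forall>s\<in>{0..t}. \<bar>s - a\<bar> < d \<longrightarrow> \<bar>\<rho> s (\<lambda>x. \<phi> (s, x)) - \<rho> a (\<lambda>x. \<phi> (a, x))\<bar> < e"
  proof (intro exI[of _ "min d1 d2"] conjI ballI impI)
    fix s assume s: "s \<in> {0..t}" "\<bar>s - a\<bar> < min d1 d2"
    have sT: "s \<in> {0..T}" using s t by auto
    have \<phi>s: "(\<lambda>x. \<phi> (s, x)) \<in> C_torus" by (rule C_st_slice[OF \<phi> s(1)])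
    have "\<bar>\<rho> s (\<lambda>x. \<phi> (s, x) - \<phi> (a, x))\<bar> \<le> e / (2 * m) * mass s"
      using d1(2)[OF s(1) a] s(2) by (intro abs_le sT C_torus_diff \<phi>s \<phi>a) (auto intro: less_imp_le)
    also have "\<dots> \<le> e / (2 * m) * m" using m sT e by (intro mult_left_mono) auto
    finally have "\<bar>\<rho> s (\<lambda>x. \<phi> (s, x)) - \<rho> s (\<lambda>x. \<phi> (a, x))\<bar> \<le> e / 2"
      using m torus_measure_diff[OF tm[OF sT] \<phi>s \<phi>a] by simp
    moreover have "\<bar>\<rho> s (\<lambda>x. \<phi> (a, x)) - \<rho> a (\<lambda>x. \<phi> (a, x))\<bar> < e / 2" using d2(2)[OF sT] s(2) by simp
    ultimately show "\<bar>\<rho> s (\<lambda>x. \<phi> (s, x)) - \<rho> a (\<lambda>x. \<phi> (a, x))\<bar> < e" by linarith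
  qed (use d1 d2 in auto)
qed

lemma lift_eq:
  assumes "\<phi> \<in> C_st t" "t \<in> {0..T}"
  shows "st_lift t \<rho> \<phi> = integral {0..t} (\<lambda>s. \<rho> s (\<lambda>x. \<phi> (s, x)))"
  unfolding st_lift_def by (rule LINT_eq_integral[OF slice_continuous[OF assms]])

lemma lift_integrable:
  assumes "\<phi> \<in> C_st t" "t \<in> {0..T}"
  shows "(\<lambda>s. \<rho> s (\<lambda>x. \<phi> (s, x))) integrable_on {0..t}"
  by (rule integrable_continuous_interval[OF slice_continuous[OF assms]])

lemma lift_cong:
  assumes "\<And>z. z \<in> slab t \<Longrightarrow> \<phi> z = \<psi> z"
  shows "st_lift t \<rho> \<phi> = st_lift t \<rho> \<psi>"
  unfolding st_lift_def by (rule set_lebesgue_integral_cong) (use assms in auto)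

lemma lift_add:
  assumes "\<phi> \<in> C_st t" "\<psi> \<in> C_st t" "t \<in> {0..T}"
  shows "st_lift t \<rho> (\<lambda>z. \<phi> z + \<psi> z) = st_lift t \<rho> \<phi> + st_lift t \<rho> \<psi>"
proof -
  have "st_lift t \<rho> (\<lambda>z. \<phi> z + \<psi> z) = integral {0..t} (\<lambda>s. \<rho> s (\<lambda>x. \<phi> (s, x)) + \<rho> s (\<lambda>x. \<psi> (s, x)))"
    unfolding lift_eq[OF C_st_add[OF assms(1,2)] assms(3)]
    by (rule integral_cong) (use torus_measure_add[OF tm C_st_slice[OF assms(1)] C_st_slice[OF assms(2)]] assms(3) in auto)
  then show ?thesis unfolding lift_eq[OF assms(1,3)] lift_eq[OF assms(2,3)]
    by (rule trans[OF _ integral_add[OF lift_integrable[OF assms(1,3)] lift_integrable[OF assms(2,3)]]])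
qed

lemma lift_cmult:
  assumes "\<phi> \<in> C_st t" "t \<in> {0..T}"
  shows "st_lift t \<rho> (\<lambda>z. c * \<phi> z) = c * st_lift t \<rho> \<phi>"
proof -
  have "st_lift t \<rho> (\<lambda>z. c * \<phi> z) = integral {0..t} (\<lambda>s. c * \<rho> s (\<lambda>x. \<phi> (s, x)))"
    unfolding lift_eq[OF C_st_mult[OF C_st_const assms(1)] assms(2)]
    by (rule integral_cong) (use torus_measure_cmult[OF tm C_st_slice[OF assms(1)]] assms(2) in auto)
  then show ?thesis unfolding lift_eq[OF assms] by simp
qed

lemma lift_diff:
  assumes "\<phi> \<in> C_st t" "\<psi> \<in> C_st t" "t \<in> {0..T}"
  shows "st_lift t \<rho> (\<lambda>z. \<phi> z - \<psi> z) = st_lift t \<rho> \<phi> - st_lift t \<rho> \<psi>"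
  using lift_add[OF C_st_diff[OF assms(1,2)] assms(2,3)] by simp

end

lemma deriv_bound:
  fixes f :: "real \<times> (real^'d) \<Rightarrow> 'b::real_normed_vector"
  assumes T: "T > 0" and f: "st_deriv T f f'"
  obtains M where "M \<ge> 0" "\<And>z s h. z \<in> slab T \<Longrightarrow> norm (f' z (s, h)) \<le> M * (\<bar>s\<bar> + norm h)"
proof -
  have "\<forall>k. \<exists>K. K > 0 \<and> (\<forall>z\<in>slab T. norm (f' z k) \<le> K)"
  proof
    fix k
    obtain K where "K > 0" "\<And>z. z \<in> slab T \<Longrightarrow> norm (f' z k) \<le> K"
      using C_st_bounded[OF st_deriv_C_st[OF T f, of k]] by blast
    then show "\<exists>K. K > 0 \<and> (\<forall>z\<in>slab T. norm (f' z k) \<le> K)" by blast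
  qed
  from choice[OF this] obtain K where K': "\<forall>k. K k > 0 \<and> (\<forall>z\<in>slab T. norm (f' z k) \<le> K k)" ..
  have K: "K k > 0" "z \<in> slab T \<Longrightarrow> norm (f' z k) \<le> K k" for k z
    using spec[OF K', of k] by (rule conjunct1) (use spec[OF K', of k] in blast)
  define M where "M = K (1, 0) + (\<Sum>i\<in>UNIV. K (0, axis i 1))"
  have nn: "0 \<le> (\<Sum>i\<in>(UNIV::'d set). K (0, axis i 1))" using K(1) by (intro sum_nonneg) (simp add: less_imp_le)
  have "norm (f' z (s, h)) \<le> M * (\<bar>s\<bar> + norm h)" if z: "z \<in> slab T" for z s h
  proof -
    have "norm (f' z (s, h)) \<le> norm (s *\<^sub>R f' z (1, 0)) + norm (\<Sum>i\<in>UNIV. (h $ i) *\<^sub>R f' z (0, axis i 1))"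
      unfolding linear_Pair_basis[OF st_derivD(5)[OF f z], of s h] by (rule norm_triangle_ineq)
    also have "norm (s *\<^sub>R f' z (1, 0)) \<le> \<bar>s\<bar> * K (1, 0)" using K(2)[OF z] by (simp add: mult_left_mono)
    also have "norm (\<Sum>i\<in>UNIV. (h $ i) *\<^sub>R f' z (0, axis i 1)) \<le> (\<Sum>i\<in>UNIV. norm h * K (0, axis i 1))"
      using K(2)[OF z] by (intro sum_norm_le) (auto simp: component_le_norm_cart intro!: mult_mono)
    also have "\<bar>s\<bar> * K (1, 0) + (\<Sum>i\<in>UNIV. norm h * K (0, axis i 1)) \<le> M * (\<bar>s\<bar> + norm h)"
      using nn K(1)[of "(1, 0)"] by (simp add: M_def sum_distrib_left[symmetric] algebra_simps)
    finally show ?thesis by simp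
  qed
  moreover have "M \<ge> 0" using nn K(1)[of "(1, 0)"] by (simp add: M_def)
  ultimately show ?thesis using that by blast
qed

text \<open>
  The mixed terms are absorbed by \<open>4N|\<xi>||\<eta>| \<le> 4N\<^sup>2|\<xi>|\<^sup>2 + |\<eta>|\<^sup>2\<close>.  The threshold for \<open>r\<close> depends only on bounds of the
  gradients, hence one \<open>r\<close> serves for a whole family of perturbations of \<open>b\<close>.
\<close>

lemma Qr_coercive:
  fixes \<beta> w :: "real \<times> (real^'d) \<Rightarrow> real^'d"
  assumes \<beta>: "st_deriv T \<beta> \<beta>'" and w: "st_deriv T w w'" and z: "z \<in> slab T"
    and M: "\<And>h. norm (w' z (0, h)) \<le> M * norm h" and N: "\<And>h. norm (\<beta>' z (0, h)) \<le> N * norm h"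
    and r: "r \<ge> 2 * M + 4 * N\<^sup>2 + 1"
  shows "\<zeta> \<bullet> \<zeta> \<le> \<zeta> \<bullet> Qr \<beta> w r z \<zeta>"
proof -
  obtain \<xi> \<eta> where \<zeta>: "\<zeta> = (\<xi>, \<eta>)" by force
  obtain t x where tx: "z = (t, x)" "t \<in> {0..T}" using z by auto
  let ?x = "norm \<xi>" and ?y = "norm \<eta>"
  have 1: "\<xi> \<bullet> w' z (0, \<xi>) \<le> ?x * (M * ?x)"
    by (rule order_trans[OF norm_cauchy_schwarz mult_left_mono[OF M]]) simp
  have 2: "- (\<xi> \<bullet> \<beta>' z (0, \<eta>)) \<le> ?x * (N * ?y)"
    using order_trans[OF norm_cauchy_schwarz mult_left_mono[OF N], of "- \<xi>" \<eta>] by simp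
  have 3: "\<eta> \<bullet> \<beta>' z (0, \<xi>) \<le> ?y * (N * ?x)"
    by (rule order_trans[OF norm_cauchy_schwarz mult_left_mono[OF N]]) simp
  have 4: "4 * N * ?x * ?y \<le> 4 * N\<^sup>2 * ?x\<^sup>2 + ?y\<^sup>2"
    using zero_le_power2[of "2 * N * ?x - ?y"] by (simp add: power2_diff power_mult_distrib algebra_simps)
  have 5: "(2 * M + 4 * N\<^sup>2 + 1) * ?x\<^sup>2 \<le> r * ?x\<^sup>2" using r by (rule mult_right_mono) simp
  have "\<zeta> \<bullet> Qr \<beta> w r z \<zeta> = r * ?x\<^sup>2 - 2 * (\<xi> \<bullet> w' z (0, \<xi>)) + 2 * (\<xi> \<bullet> \<beta>' z (0, \<eta>))
     - 2 * (\<eta> \<bullet> \<beta>' z (0, \<xi>)) + 2 * ?y\<^sup>2"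
    unfolding \<zeta> tx(1) Qr_quadratic Jac_mult[OF \<beta> tx(2)] Jac_mult[OF w tx(2)] power2_norm_eq_inner ..
  also have "\<dots> \<ge> ?x\<^sup>2 + ?y\<^sup>2"
    using 1 2 3 4 5 by (simp add: power2_eq_square algebra_simps)
  finally show ?thesis by (simp add: \<zeta> power2_norm_eq_inner)
qed

lemma Qr_linear: "linear (Qr b v r z)"
  unfolding Qr_def
  by (rule linearI) (auto simp: matrix_vector_right_distrib matrix_vector_mult_scaleR scaleR_add_right split: prod.splits)

text \<open>
  The abstract form of \<open>exp(-rt) Q\<^sub>r\<close> for \<open>r \<ge> r\<^sub>0\<close>: a symmetric, uniformly positive matrix field with continuous coefficients.
\<close>

locale st_form =
  fixes t :: real and A :: "real \<times> (real^'d) \<Rightarrow> 'b::euclidean_space \<Rightarrow> 'b" and c :: real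
  assumes lin: "\<And>z. linear (A z)" and sym: "\<And>z \<zeta> \<zeta>'. \<zeta>' \<bullet> A z \<zeta> = \<zeta> \<bullet> A z \<zeta>'"
    and coeff: "\<And>i j. i \<in> Basis \<Longrightarrow> j \<in> Basis \<Longrightarrow> (\<lambda>z. j \<bullet> A z i) \<in> C_st t"
    and c: "c > 0" and coercive: "\<And>z \<zeta>. z \<in> slab t \<Longrightarrow> c * (\<zeta> \<bullet> \<zeta>) \<le> \<zeta> \<bullet> A z \<zeta>"
begin

lemma form_expand: "\<zeta>' \<bullet> A z \<zeta> = (\<Sum>i\<in>Basis. \<Sum>j\<in>Basis. (j \<bullet> A z i) * ((\<zeta> \<bullet> i) * (\<zeta>' \<bullet> j)))"
proof -
  have "A z \<zeta> = A z (\<Sum>i\<in>Basis. (\<zeta> \<bullet> i) *\<^sub>R i)" by (simp add: euclidean_representation)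
  also have "\<dots> = (\<Sum>i\<in>Basis. (\<zeta> \<bullet> i) *\<^sub>R A z i)" by (simp add: linear_sum[OF lin] linear_scale[OF lin])
  finally have "\<zeta>' \<bullet> A z \<zeta> = (\<Sum>i\<in>Basis. (\<zeta> \<bullet> i) * (\<zeta>' \<bullet> A z i))" by (simp add: inner_sum_right)
  also have "\<dots> = (\<Sum>i\<in>Basis. \<Sum>j\<in>Basis. (j \<bullet> A z i) * ((\<zeta> \<bullet> i) * (\<zeta>' \<bullet> j)))"
    by (subst euclidean_inner) (simp add: sum_distrib_left mult_ac inner_commute)
  finally show ?thesis .
qed

lemma A_C_st:
  assumes u: "u \<in> C_st t"
  shows "(\<lambda>z. A z (u z)) \<in> C_st t"
proof -
  have "(\<lambda>z. \<Sum>j\<in>Basis. (\<Sum>i\<in>Basis. (j \<bullet> A z i) * (u z \<bullet> i)) *\<^sub>R j) \<in> C_st t"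
    by (intro C_st_sum C_st_scaleR C_st_mult C_st_inner u C_st_const coeff)
  moreover have "A z (u z) = (\<Sum>j\<in>Basis. (\<Sum>i\<in>Basis. (j \<bullet> A z i) * (u z \<bullet> i)) *\<^sub>R j)" for z
  proof -
    have "A z (u z) \<bullet> j = (\<Sum>i\<in>Basis. (j \<bullet> A z i) * (u z \<bullet> i))" if "j \<in> Basis" for j
    proof -
      have "A z (u z) = A z (\<Sum>i\<in>Basis. (u z \<bullet> i) *\<^sub>R i)" by (simp add: euclidean_representation)
      also have "\<dots> = (\<Sum>i\<in>Basis. (u z \<bullet> i) *\<^sub>R A z i)" by (simp add: linear_sum[OF lin] linear_scale[OF lin])
      finally show ?thesis by (simp add: inner_sum_right inner_commute[of _ j] mult.commute)
    qed
    then have "(\<Sum>j\<in>Basis. (A z (u z) \<bullet> j) *\<^sub>R j) = (\<Sum>j\<in>Basis. (\<Sum>i\<in>Basis. (j \<bullet> A z i) * (u z \<bullet> i)) *\<^sub>R j)"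
      by (intro sum.cong refl) simp
    then show ?thesis by (simp only: euclidean_representation)
  qed
  ultimately show ?thesis by (simp only:)
qed

context
  fixes \<mu> and u :: "real \<times> (real^'d) \<Rightarrow> 'b"
  assumes \<mu>: "st_borel t \<mu>" and u: "u \<in> borel_measurable \<mu>" and u2: "integrable \<mu> (\<lambda>z. (norm (u z))\<^sup>2)"
begin

lemma space_slab: "z \<in> space \<mu> \<Longrightarrow> z \<in> slab t" using st_borel_space[OF \<mu>] by auto

lemma form_integrable: "integrable \<mu> (\<lambda>z. u z \<bullet> A z (u z))"
proof -
  have eq: "(\<lambda>z. u z \<bullet> A z (u z)) = (\<lambda>z. \<Sum>i\<in>Basis. \<Sum>j\<in>Basis. (j \<bullet> A z i) * ((u z \<bullet> i) * (u z \<bullet> j)))"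
    by (rule ext) (rule form_expand)
  show ?thesis unfolding eq
proof (rule Bochner_Integration.integrable_sum, rule Bochner_Integration.integrable_sum,
     rule integrable_C_st_mult[OF \<mu> coeff], assumption, assumption)
  fix i j :: 'b assume ij: "i \<in> Basis" "j \<in> Basis"
  show "integrable \<mu> (\<lambda>z. (u z \<bullet> i) * (u z \<bullet> j))"
  proof (rule Bochner_Integration.integrable_bound[OF u2])
    show "(\<lambda>z. (u z \<bullet> i) * (u z \<bullet> j)) \<in> borel_measurable \<mu>" using u by measurable
    have "\<bar>a \<bullet> i\<bar> * \<bar>a \<bullet> j\<bar> \<le> (norm a)\<^sup>2" for a :: 'b
      using mult_mono[OF Basis_le_norm[OF ij(1), of a] Basis_le_norm[OF ij(2), of a]] by (simp add: power2_eq_square)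
    then show "AE z in \<mu>. norm ((u z \<bullet> i) * (u z \<bullet> j)) \<le> norm ((norm (u z))\<^sup>2)" by (simp add: abs_mult)
  qed
qed
qed

lemma pairing_integrable:
  assumes \<Theta>: "\<Theta> \<in> C_st t"
  shows "integrable \<mu> (\<lambda>z. \<Theta> z \<bullet> u z)"
proof -
  interpret finite_measure \<mu> using \<mu> by (simp add: st_borel_def)
  have \<Theta>m: "\<Theta> \<in> borel_measurable \<mu>" by (rule C_st_measurable[OF \<Theta> \<mu>])
  obtain K where K: "K > 0" "\<And>z. z \<in> slab t \<Longrightarrow> norm (\<Theta> z) \<le> K" using C_st_bounded[OF \<Theta>] by blast
  show ?thesis
  proof (rule Bochner_Integration.integrable_bound[of \<mu> "\<lambda>z. K * (1 + (norm (u z))\<^sup>2)"])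
    show "integrable \<mu> (\<lambda>z. K * (1 + (norm (u z))\<^sup>2))" using u2 by simp
    show "(\<lambda>z. \<Theta> z \<bullet> u z) \<in> borel_measurable \<mu>" using u \<Theta>m by measurable
    show "AE z in \<mu>. norm (\<Theta> z \<bullet> u z) \<le> norm (K * (1 + (norm (u z))\<^sup>2))"
    proof (rule AE_I2)
      fix z assume "z \<in> space \<mu>"
      then have "norm (\<Theta> z) \<le> K" using K(2) space_slab by blast
      moreover have "norm (u z) \<le> 1 + (norm (u z))\<^sup>2"
        using zero_le_power2[of "norm (u z) - 1/2"] by (simp add: power2_eq_square algebra_simps)
      ultimately have "norm (\<Theta> z) * norm (u z) \<le> K * (1 + (norm (u z))\<^sup>2)" using K(1) by (intro mult_mono) auto
      then show "norm (\<Theta> z \<bullet> u z) \<le> norm (K * (1 + (norm (u z))\<^sup>2))"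
        using Cauchy_Schwarz_ineq2[of "\<Theta> z" "u z"] by (simp add: order_trans[OF _ abs_ge_self])
    qed
  qed
qed

end

text \<open>
  Completing the square: \<open>0 \<le> (u - u0)\<cdot>A(u - u0)\<close> integrates to a lower bound for every competitor \<open>u\<close> of the
  infimum, in which the mixed term is \<open>U(A u0)\<close> and is known.
\<close>

lemma quad_lower:
  assumes u0: "u0 \<in> C_st t" and U: "U (\<lambda>z. A z (u0 z)) = L (\<lambda>z. u0 z \<bullet> A z (u0 z))"
  shows "ereal (1/2 * L (\<lambda>z. u0 z \<bullet> A z (u0 z))) \<le> st_quad_energy t A L U"
  unfolding st_quad_energy_def
proof (rule Inf_greatest, clarify)
  fix \<mu> u assume \<mu>: "st_borel t \<mu>" and L: "\<forall>\<theta>\<in>C_st t. L \<theta> = integral\<^sup>L \<mu> \<theta>"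
    and u: "u \<in> borel_measurable \<mu>" and u2: "integrable \<mu> (\<lambda>z. (norm (u z))\<^sup>2)"
    and Uu: "\<forall>\<Theta>\<in>C_st t. U \<Theta> = (\<integral>z. \<Theta> z \<bullet> u z \<partial>\<mu>)"
  have Au0: "(\<lambda>z. A z (u0 z)) \<in> C_st t" by (rule A_C_st[OF u0])
  have q0: "(\<lambda>z. u0 z \<bullet> A z (u0 z)) \<in> C_st t" by (intro C_st_inner u0 Au0)
  have i0: "integrable \<mu> (\<lambda>z. u0 z \<bullet> A z (u0 z))"
    using integrable_C_st_mult[OF \<mu> q0, of "\<lambda>_. 1"] \<mu> by (simp add: st_borel_def finite_measure.integrable_const)
  note i1 = form_integrable[OF \<mu> u u2] and i2 = pairing_integrable[OF \<mu> u u2 Au0]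
  have "0 \<le> (\<integral>z. u z \<bullet> A z (u z) - 2 * (A z (u0 z) \<bullet> u z) + u0 z \<bullet> A z (u0 z) \<partial>\<mu>)"
  proof (rule integral_nonneg_AE, rule AE_I2)
    fix z assume "z \<in> space \<mu>"
    then have "c * ((u z - u0 z) \<bullet> (u z - u0 z)) \<le> (u z - u0 z) \<bullet> A z (u z - u0 z)"
      by (intro coercive space_slab[OF \<mu> u u2])
    moreover have "0 \<le> c * ((u z - u0 z) \<bullet> (u z - u0 z))" using c by simp
    ultimately have "0 \<le> (u z - u0 z) \<bullet> A z (u z - u0 z)" by linarith
    then show "0 \<le> u z \<bullet> A z (u z) - 2 * (A z (u0 z) \<bullet> u z) + u0 z \<bullet> A z (u0 z)"
      using sym[of "u0 z" z "u z"] by (simp add: linear_diff[OF lin] inner_diff_left inner_diff_right inner_commute)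
  qed
  also have "\<dots> = (\<integral>z. u z \<bullet> A z (u z) \<partial>\<mu>) - 2 * (\<integral>z. A z (u0 z) \<bullet> u z \<partial>\<mu>) + (\<integral>z. u0 z \<bullet> A z (u0 z) \<partial>\<mu>)"
    using i0 i1 i2 by simp
  finally have "0 \<le> (\<integral>z. u z \<bullet> A z (u z) \<partial>\<mu>) - 2 * L (\<lambda>z. u0 z \<bullet> A z (u0 z)) + L (\<lambda>z. u0 z \<bullet> A z (u0 z))"
    using L q0 Uu Au0 U by auto
  then show "ereal (1/2 * L (\<lambda>z. u0 z \<bullet> A z (u0 z))) \<le> ereal (1/2 * (\<integral>z. u z \<bullet> A z (u z) \<partial>\<mu>))" by simp
qed

text \<open>
  Competitors of arbitrarily small energy have arbitrarily small norm in \<open>L\<^sup>2\<close> by coercivity, and Young's inequality with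
  weight \<open>\<delta>\<close> bounds the pairing with a fixed \<open>\<Theta>\<close>.
\<close>

lemma quad_zero:
  assumes q: "st_quad_energy t A L U \<le> 0" and \<Theta>: "\<Theta> \<in> C_st t"
  shows "U \<Theta> = 0"
proof -
  \<comment> \<open>The constant that results from the weight \<open>\<delta>\<close> and competitors of energy below \<open>\<delta>\<^sup>2\<close>.\<close>
  define C where "C = 1/2 * \<bar>L (\<lambda>z. (norm (\<Theta> z))\<^sup>2)\<bar> + 1 / c"
  have C: "C > 0" using c by (simp add: C_def add_nonneg_pos)
  have small: "\<bar>U \<Theta>\<bar> \<le> \<delta> * C" if \<delta>: "\<delta> > 0" for \<delta> :: real
  proof -
    have "st_quad_energy t A L U < ereal (\<delta>\<^sup>2)" using q \<delta> by (simp add: order_le_less_trans)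
    then obtain \<mu> u where lt: "1/2 * (\<integral>z. u z \<bullet> A z (u z) \<partial>\<mu>) < \<delta>\<^sup>2" and \<mu>: "st_borel t \<mu>" 
      and L: "\<forall>\<theta>\<in>C_st t. L \<theta> = integral\<^sup>L \<mu> \<theta>"
      and u: "u \<in> borel_measurable \<mu>" and u2: "integrable \<mu> (\<lambda>z. (norm (u z))\<^sup>2)"
      and Uu: "\<forall>\<Theta>\<in>C_st t. U \<Theta> = (\<integral>z. \<Theta> z \<bullet> u z \<partial>\<mu>)"
      unfolding st_quad_energy_def Inf_less_iff by auto
    have "c * (\<integral>z. (norm (u z))\<^sup>2 \<partial>\<mu>) = (\<integral>z. c * (norm (u z))\<^sup>2 \<partial>\<mu>)" by simp
    also have "\<dots> \<le> (\<integral>z. u z \<bullet> A z (u z) \<partial>\<mu>)"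
      by (rule integral_mono) (use u2 form_integrable[OF \<mu> u u2] coercive space_slab[OF \<mu> u u2] in \<open>auto simp: power2_norm_eq_inner\<close>)
    finally have u2le: "(\<integral>z. (norm (u z))\<^sup>2 \<partial>\<mu>) \<le> 2 * \<delta>\<^sup>2 / c" using lt c by (simp add: field_simps)
    have \<Theta>2: "(\<lambda>z. (norm (\<Theta> z))\<^sup>2) \<in> C_st t" by (intro C_st_power C_st_norm \<Theta>)
    have i0: "integrable \<mu> (\<lambda>z. (norm (\<Theta> z))\<^sup>2)"
      using integrable_C_st_mult[OF \<mu> \<Theta>2, of "\<lambda>_. 1"] \<mu> by (simp add: st_borel_def finite_measure.integrable_const)
    have "\<bar>U \<Theta>\<bar> \<le> (\<integral>z. \<bar>\<Theta> z \<bullet> u z\<bar> \<partial>\<mu>)"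
      using Uu \<Theta> integral_abs_bound[of \<mu> "\<lambda>z. \<Theta> z \<bullet> u z"] by simp
    also have "\<dots> \<le> (\<integral>z. \<delta> / 2 * (norm (\<Theta> z))\<^sup>2 + 1 / (2 * \<delta>) * (norm (u z))\<^sup>2 \<partial>\<mu>)"
    proof (rule integral_mono)
      show "integrable \<mu> (\<lambda>z. \<bar>\<Theta> z \<bullet> u z\<bar>)" using pairing_integrable[OF \<mu> u u2 \<Theta>] by simp
      show "integrable \<mu> (\<lambda>z. \<delta> / 2 * (norm (\<Theta> z))\<^sup>2 + 1 / (2 * \<delta>) * (norm (u z))\<^sup>2)" using i0 u2 by simp
      fix z
      have "0 \<le> (\<delta> * norm (\<Theta> z) - norm (u z))\<^sup>2 / (2 * \<delta>)" using \<delta> by simp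
      also have "\<dots> = \<delta> / 2 * (norm (\<Theta> z))\<^sup>2 + 1 / (2 * \<delta>) * (norm (u z))\<^sup>2 - norm (\<Theta> z) * norm (u z)"
        using \<delta> by (simp add: power2_diff power_mult_distrib field_simps power2_eq_square)
      finally show "\<bar>\<Theta> z \<bullet> u z\<bar> \<le> \<delta> / 2 * (norm (\<Theta> z))\<^sup>2 + 1 / (2 * \<delta>) * (norm (u z))\<^sup>2"
        using Cauchy_Schwarz_ineq2[of "\<Theta> z" "u z"] by linarith
    qed
    also have "\<dots> = \<delta> / 2 * L (\<lambda>z. (norm (\<Theta> z))\<^sup>2) + 1 / (2 * \<delta>) * (\<integral>z. (norm (u z))\<^sup>2 \<partial>\<mu>)"
      using i0 u2 L \<Theta>2 by simp
    also have "\<dots> \<le> \<delta> / 2 * \<bar>L (\<lambda>z. (norm (\<Theta> z))\<^sup>2)\<bar> + 1 / (2 * \<delta>) * (2 * \<delta>\<^sup>2 / c)"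
      using u2le \<delta> by (intro add_mono mult_left_mono) auto
    also have "\<dots> = \<delta> * C" using \<delta> by (simp add: C_def power2_eq_square field_simps)
    finally show ?thesis .
  qed
  have "\<bar>U \<Theta>\<bar> \<le> 0 + e" if "e > 0" for e using small[of "e / C"] that C by simp
  then have "\<bar>U \<Theta>\<bar> \<le> 0" by (rule field_le_epsilon)
  then show ?thesis by simp
qed

end

section \<open>Vanishing of the relative energy\<close>

lemma st_form_Qr:
  fixes \<beta> w :: "real \<times> (real^'d) \<Rightarrow> real^'d"
  assumes T: "T > 0" and \<beta>: "st_deriv T \<beta> \<beta>'" and w: "st_deriv T w w'" and t: "t \<in> {0..T}"
    and co: "\<And>z \<zeta>. z \<in> slab T \<Longrightarrow> \<zeta> \<bullet> \<zeta> \<le> \<zeta> \<bullet> Qr \<beta> w r z \<zeta>"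
  shows "st_form t (\<lambda>z \<zeta>. exp (- r * fst z) *\<^sub>R Qr \<beta> w r z \<zeta>) (exp (- \<bar>r\<bar> * T))"
proof (rule st_form.intro)
  show "linear (\<lambda>\<zeta>. exp (- r * fst z) *\<^sub>R Qr \<beta> w r z \<zeta>)" for z
    using linear_compose[OF Qr_linear[of \<beta> w r z] linear_scale_self[of "exp (- r * fst z)"]] by (simp add: o_def)
  show "\<zeta>' \<bullet> (exp (- r * fst z) *\<^sub>R Qr \<beta> w r z \<zeta>) = \<zeta> \<bullet> (exp (- r * fst z) *\<^sub>R Qr \<beta> w r z \<zeta>')" for z \<zeta> \<zeta>'
    using Qr_symmetric[of \<zeta>' \<beta> w r z \<zeta>] by simp
  show "(\<lambda>z. j \<bullet> (exp (- r * fst z) *\<^sub>R Qr \<beta> w r z i)) \<in> C_st t" for i j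
  proof -
    have "(\<lambda>z :: real \<times> (real^'d). exp (- r * fst z)) \<in> C_st T" by (rule C_st_time) (intro continuous_intros)
    moreover have "(\<lambda>z. (fst j, snd j) \<bullet> Qr \<beta> w r z (fst i, snd i)) \<in> C_st T"
      by (rule Qr_inner_C_st[OF T \<beta> w C_st_const C_st_const C_st_const C_st_const])
    ultimately have "(\<lambda>z. exp (- r * fst z) * ((fst j, snd j) \<bullet> Qr \<beta> w r z (fst i, snd i))) \<in> C_st T" by (rule C_st_mult)
    then show ?thesis using C_st_mono t by auto
  qed
  show "exp (- \<bar>r\<bar> * T) > 0" by simp
  fix z :: "real \<times> (real^'d)" and \<zeta> assume "z \<in> slab t"
  then have z: "z \<in> slab T" and s: "0 \<le> fst z" "fst z \<le> T" using t by auto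
  have "r * fst z \<le> \<bar>r\<bar> * T" using s by (intro mult_mono) auto
  then have "exp (- \<bar>r\<bar> * T) * (\<zeta> \<bullet> \<zeta>) \<le> exp (- r * fst z) * (\<zeta> \<bullet> Qr \<beta> w r z \<zeta>)"
    using co[OF z, of \<zeta>] by (intro mult_mono) auto
  then show "exp (- \<bar>r\<bar> * T) * (\<zeta> \<bullet> \<zeta>) \<le> \<zeta> \<bullet> (exp (- r * fst z) *\<^sub>R Qr \<beta> w r z \<zeta>)" by simp
qed

lemma st_lift_zero:
  assumes t: "t \<in> {0..T}" and L: "\<And>s. s \<in> {0..T} \<Longrightarrow> torus_measure (L s)"
    and z: "\<And>z. z \<in> slab t \<Longrightarrow> \<phi> z = 0"
  shows "st_lift t L \<phi> = 0"
proof -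
  have "L s (\<lambda>x. \<phi> (s, x)) = 0" if "s \<in> {0..t}" for s
    using in_dual_scale[OF L[of s] C_torus_const[of 0], of 0] that t z[of "(s, _)"] by simp
  then have "st_lift t L \<phi> = (LINT s:{0..t}|lborel. 0)"
    unfolding st_lift_def by (intro set_lebesgue_integral_cong) auto
  then show ?thesis by (simp add: set_lebesgue_integral_def)
qed

lemma kinetic_nonneg: "\<rho> (\<lambda>_. 0) = 0 \<Longrightarrow> U (\<lambda>_. 0) = 0 \<Longrightarrow> 0 \<le> kinetic \<rho> U"
  unfolding kinetic_def
  by (rule Sup_upper, rule CollectI, rule exI[of _ "\<lambda>_. 0"], rule exI[of _ "\<lambda>_. 0"])
     (simp add: C_torus_const zero_ereal_def)

text \<open>
  The choice \<open>\<theta> = - \<phi>\<close>, \<open>\<Theta> = 0\<close> gives positivity of \<open>\<rho>\<close>; the choice \<open>\<theta> = - c\<^sup>2|\<Theta>|\<^sup>2/2\<close> with \<open>c\<Theta>\<close> gives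
  \<open>c U(\<Theta>) \<le> O(c\<^sup>2)\<close> for both signs of \<open>c\<close>.
\<close>

lemma kinetic_nonpos:
  fixes U :: "('d::finite, real^'d) torus_functional"
  assumes \<rho>: "torus_measure \<rho>" and k: "kinetic \<rho> U \<le> 0" and U0: "U (\<lambda>_. 0) = 0"
    and Us: "\<And>c \<Theta>. \<Theta> \<in> C_torus \<Longrightarrow> U (\<lambda>x. c *\<^sub>R \<Theta> x) = c * U \<Theta>"
  shows "nonneg_measure \<rho>" and "\<And>\<Theta>. \<Theta> \<in> C_torus \<Longrightarrow> U \<Theta> = 0"
proof -
  have le: "\<rho> \<theta> + U \<Theta> \<le> 0" if "\<theta> \<in> C_torus" "\<Theta> \<in> C_torus" "\<forall>x. \<theta> x + 1/2 * (norm (\<Theta> x))\<^sup>2 \<le> 0" for \<theta> \<Theta>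
  proof -
    have "ereal (\<rho> \<theta> + U \<Theta>) \<le> kinetic \<rho> U" unfolding kinetic_def by (rule Sup_upper) (use that in blast)
    then show ?thesis using k by (metis order_trans ereal_less_eq(3) zero_ereal_def)
  qed
  show "nonneg_measure \<rho>"
  proof (intro ballI impI)
    fix \<phi> :: "real^'d \<Rightarrow> real" assume \<phi>: "\<phi> \<in> C_torus" "\<forall>x. 0 \<le> \<phi> x"
    have "\<rho> (\<lambda>x. (- 1) * \<phi> x) + U (\<lambda>_. 0) \<le> 0"
      by (rule le) (use \<phi> in \<open>auto intro: C_torus_minus C_torus_const\<close>)
    then show "0 \<le> \<rho> \<phi>" using torus_measure_cmult[OF \<rho> \<phi>(1), of "-1"] U0 by simp
  qed
  fix \<Theta> :: "real^'d \<Rightarrow> real^'d" assume \<Theta>: "\<Theta> \<in> C_torus"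
  define N where "N = \<rho> (\<lambda>x. 1/2 * (norm (\<Theta> x))\<^sup>2)"
  have NC: "(\<lambda>x. 1/2 * (norm (\<Theta> x))\<^sup>2) \<in> C_torus"
    unfolding power2_norm_eq_inner by (intro C_torus_mult C_torus_inner C_torus_const \<Theta>)
  have q: "c * U \<Theta> \<le> c\<^sup>2 * N" for c
  proof -
    have "\<rho> (\<lambda>x. (- (c\<^sup>2)) * (1/2 * (norm (\<Theta> x))\<^sup>2)) + U (\<lambda>x. c *\<^sub>R \<Theta> x) \<le> 0"
    proof (rule le)
      show "(\<lambda>x. (- (c\<^sup>2)) * (1/2 * (norm (\<Theta> x))\<^sup>2)) \<in> C_torus" by (rule C_torus_mult[OF C_torus_const NC])
      show "(\<lambda>x. c *\<^sub>R \<Theta> x) \<in> C_torus" by (rule C_torus_scaleR[OF C_torus_const \<Theta>])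
    qed (simp add: power_mult_distrib)
    then show ?thesis using torus_measure_cmult[OF \<rho> NC, of "- (c\<^sup>2)"] Us[OF \<Theta>, of c] by (simp add: N_def)
  qed
  have lim: "((\<lambda>c. c * N) \<longlongrightarrow> 0) (at_right 0)" by (auto intro!: tendsto_eq_intros)
  have pos: "U \<Theta> \<le> c * N \<and> - U \<Theta> \<le> c * N" if c: "0 < c" for c
  proof -
    have "c * U \<Theta> \<le> c * (c * N)" "c * (- U \<Theta>) \<le> c * (c * N)"
      using q[of c] q[of "- c"] by (simp_all add: power2_eq_square mult.assoc)
    then show ?thesis using c by (simp only: mult_le_cancel_left_pos)
  qed
  have ev: "\<forall>\<^sub>F c in at_right (0::real). 0 < c" by (simp add: eventually_at_right_less)
  have "U \<Theta> \<le> 0"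
    by (rule tendsto_lowerbound[OF lim eventually_mono[OF ev]]) (use pos in auto)
  moreover have "- U \<Theta> \<le> 0"
    by (rule tendsto_lowerbound[OF lim eventually_mono[OF ev]]) (use pos in auto)
  ultimately show "U \<Theta> = 0" by simp
qed

text \<open>
  A dissipative solution compared with the velocities \<open>b\<close>, \<open>v\<close> of a classical one.  Of the classical
  solution only the two equations for \<open>b\<close> and \<open>v\<close> and the initial data enter.
\<close>

locale weak_strong =
  fixes T :: real and b v :: "real \<times> (real^'d) \<Rightarrow> real^'d" and b' v'
    and B\<^sub>0 :: "('d::finite, real^'d) torus_functional" and \<rho>\<^sub>0 :: "('d, real) torus_functional"
    and B :: "real \<Rightarrow> ('d, real^'d) torus_functional" and \<rho> :: "real \<Rightarrow> ('d, real) torus_functional"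
    and P :: "('d, real^'d) st_functional"
  assumes T: "T > 0" and b: "st_deriv T b b'" and v: "st_deriv T v v'"
    and vb: "\<And>z. z \<in> slab T \<Longrightarrow> v z = b' z (0, b z)"
    and bv: "\<And>z. z \<in> slab T \<Longrightarrow> b' z (1, v z) = v' z (0, b z)"
    and ds: "dissipative_solution T B\<^sub>0 \<rho>\<^sub>0 B \<rho> P"
    and init: "\<And>\<Theta>. \<Theta> \<in> C_torus \<Longrightarrow> B\<^sub>0 \<Theta> = \<rho>\<^sub>0 (\<lambda>x. b (0, x) \<bullet> \<Theta> x)"
begin

lemma bC: "b \<in> C_st T" and vC: "v \<in> C_st T" and bC1: "b \<in> C1_st T" and vC1: "v \<in> C1_st T"
  using st_derivD[OF b] st_derivD[OF v] by blast+

lemma T0: "0 \<in> {0..T}" and TT: "T \<in> {0..T}" using T by auto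

lemma tmB: "t \<in> {0..T} \<Longrightarrow> torus_measure (B t)" and tm\<rho>: "t \<in> {0..T} \<Longrightarrow> torus_measure (\<rho> t)"
  and wc: "weak_star_continuous T \<rho>" and stP: "st_measure T P"
  and \<rho>0: "\<theta> \<in> C_torus \<Longrightarrow> \<rho> 0 \<theta> = \<rho>\<^sub>0 \<theta>" and B0: "\<Theta> \<in> C_torus \<Longrightarrow> B 0 \<Theta> = B\<^sub>0 \<Theta>"
  and nn0: "nonneg_measure \<rho>\<^sub>0"
  and continuity: "\<phi> \<in> test_functions T \<Longrightarrow> st_lift T \<rho> (dt T \<phi>) + P (grad \<phi>) = 0"
  using ds unfolding dissipative_solution_def weak_star_continuous_def by blast+

lemma dissipation:
  assumes "\<beta> \<in> C1_st T" "w \<in> C1_st T" "\<And>z \<zeta>. z \<in> slab T \<Longrightarrow> \<zeta> \<bullet> \<zeta> \<le> \<zeta> \<bullet> Qr \<beta> w r z \<zeta>" "t \<in> {0..T}"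
  shows "dissipation_inequality T \<beta> w B \<rho> P r t"
  using ds assms unfolding dissipative_solution_def by blast

lemma B_b_0: "\<Theta> \<in> C_torus \<Longrightarrow> B 0 \<Theta> = \<rho> 0 (\<lambda>x. b (0, x) \<bullet> \<Theta> x)"
  using init B0 \<rho>0 C_torus_inner[OF C_st_slice[OF bC T0]] by simp

lemma nn_0: "nonneg_measure (\<rho> 0)" using nn0 \<rho>0 by simp

lemma torus_zero: "torus_measure L \<Longrightarrow> L (\<lambda>_. 0) = 0"
  using in_dual_scale[of UNIV C_torus L "\<lambda>_. 0" 0] C_torus_const[of 0] by simp

lemma lift_\<rho>_zero: "t \<in> {0..T} \<Longrightarrow> (\<And>z. z \<in> slab t \<Longrightarrow> \<phi> z = 0) \<Longrightarrow> st_lift t \<rho> \<phi> = 0"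
  by (rule st_lift_zero[OF _ tm\<rho>])

lemma lift_B_zero: "t \<in> {0..T} \<Longrightarrow> (\<And>z. z \<in> slab t \<Longrightarrow> \<phi> z = 0) \<Longrightarrow> st_lift t B \<phi> = 0"
  by (rule st_lift_zero[OF _ tmB])

lemma integral_upto_zero:
  assumes t: "t \<in> {0..T}" and z: "\<And>z. z \<in> slab t \<Longrightarrow> \<phi> z = 0"
  shows "integral_upto T t P \<phi> = 0"
proof -
  obtain \<mu> f where \<mu>: "st_borel T \<mu>" "integrable \<mu> f" "\<forall>\<phi>\<in>C_st T. P \<phi> = (\<integral>z. \<phi> z \<bullet> f z \<partial>\<mu>)"
    using st_measure_representation[OF stP] by blast
  have "\<phi> \<in> C_st t" by (rule C_st_cong[OF C_st_const[of 0]]) (use z in auto)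
  then have "integral_upto T t P \<phi> = (\<integral>z. (indicator ({0..t} \<times> UNIV) z *\<^sub>R \<phi> z) \<bullet> f z \<partial>\<mu>)"
    using \<mu> by (intro integral_upto_eq[OF t]) auto
  also have "\<dots> = (\<integral>z. 0 \<partial>\<mu>)"
    by (intro Bochner_Integration.integral_cong refl) (use z in \<open>auto simp: indicator_def\<close>)
  finally show ?thesis by simp
qed

lemma integral_upto_T:
  assumes \<phi>: "\<phi> \<in> C_st T"
  shows "integral_upto T T P \<phi> = P \<phi>"
proof -
  obtain \<mu> f where \<mu>: "st_borel T \<mu>" "integrable \<mu> f" "\<forall>\<phi>\<in>C_st T. P \<phi> = (\<integral>z. \<phi> z \<bullet> f z \<partial>\<mu>)"
    using st_measure_representation[OF stP] by blast
  have "integral_upto T T P \<phi> = (\<integral>z. (indicator ({0..T} \<times> UNIV) z *\<^sub>R \<phi> z) \<bullet> f z \<partial>\<mu>)"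
    using \<mu> \<phi> by (intro integral_upto_eq[OF TT]) auto
  also have "\<dots> = (\<integral>z. \<phi> z \<bullet> f z \<partial>\<mu>)"
    by (intro Bochner_Integration.integral_cong refl) (auto simp: st_borel_space[OF \<mu>(1)])
  finally show ?thesis using \<mu>(3) \<phi> by simp
qed

text \<open>
  For \<open>L\<^sub>1\<close>, note that \<open>D\<^sub>t(|b|\<^sup>2/2) = b\<cdot>(b\<cdot>\<nabla>)v\<close> and \<open>(b\<cdot>\<nabla>)(b\<cdot>v) = b\<cdot>(b\<cdot>\<nabla>)v + |v|\<^sup>2\<close>.
\<close>

lemma L_vanish:
  assumes z: "z \<in> slab T"
  shows "L1 T b v z = 0" "L2 T b v z = 0" "L3 b v z = 0"
proof -
  obtain t x where tx: "z = (t, x)" "t \<in> {0..T}" using z by auto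
  have l: "b' z (1, v z) = b' z (1, 0) + b' z (0, v z)" by (rule linear_diff_Pair(2)[OF st_derivD(5)[OF b z]])
  show "L2 T b v z = 0" "L3 b v z = 0"
    using L2_eq[OF T b v tx(2), of x] L3_eq[OF T b v tx(2), of x] vb[OF z] bv[OF z] l by (simp_all add: tx(1))
  have "b z \<bullet> b' z (1, 0) + b z \<bullet> b' z (0, v z) = b z \<bullet> v' z (0, b z)"
    using bv[OF z] l by (simp add: inner_add_right[symmetric])
  moreover have "b' z (0, b z) \<bullet> v z = v z \<bullet> v z" using vb[OF z] by simp
  ultimately show "L1 T b v z = 0"
    using L1_eq[OF T b v tx(2), of x] by (simp add: tx(1))
qed

lemma coercive_r: "\<exists>r. \<forall>z\<in>slab T. \<forall>\<zeta>. \<zeta> \<bullet> \<zeta> \<le> \<zeta> \<bullet> Qr b v r z \<zeta>"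
proof -
  obtain N where N: "N \<ge> 0" "\<And>z s h. z \<in> slab T \<Longrightarrow> norm (b' z (s, h)) \<le> N * (\<bar>s\<bar> + norm h)" using deriv_bound[OF T b] by blast
  obtain M where M: "M \<ge> 0" "\<And>z s h. z \<in> slab T \<Longrightarrow> norm (v' z (s, h)) \<le> M * (\<bar>s\<bar> + norm h)" using deriv_bound[OF T v] by blast
  have "\<zeta> \<bullet> \<zeta> \<le> \<zeta> \<bullet> Qr b v (2 * M + 4 * N\<^sup>2 + 1) z \<zeta>" if z: "z \<in> slab T" for z \<zeta>
    by (rule Qr_coercive[OF b v z, of M N]) (use M(2)[OF z, of 0] N(2)[OF z, of 0] in auto)
  then show ?thesis by blast
qed

text \<open>
  With \<open>b\<^sup>* = b\<close> and \<open>v\<^sup>* = v\<close> the dissipation inequality states that the sum of two nonnegative terms is at most the initial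
  relative energy, which is zero.
\<close>

lemma zero_energy:
  assumes t: "t \<in> {0..T}"
  shows "nonneg_measure (\<rho> t)" "\<And>\<Theta>. \<Theta> \<in> C_torus \<Longrightarrow> B t \<Theta> = \<rho> t (\<lambda>x. b (t, x) \<bullet> \<Theta> x)"
    "\<And>\<Theta>. \<Theta> \<in> C_st t \<Longrightarrow> U_tilde T b v B \<rho> P t \<Theta> = 0"
proof -
  obtain r where co: "\<And>z \<zeta>. z \<in> slab T \<Longrightarrow> \<zeta> \<bullet> \<zeta> \<le> \<zeta> \<bullet> Qr b v r z \<zeta>" using coercive_r by blast
  have tT: "z \<in> slab t \<Longrightarrow> z \<in> slab T" for z using t by auto
  interpret st_form t "\<lambda>z \<zeta>. exp (- r * fst z) *\<^sub>R Qr b v r z \<zeta>" "exp (- \<bar>r\<bar> * T)"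
    by (rule st_form_Qr[OF T b v t co])
  let ?Q = "st_quad_energy t (\<lambda>z \<zeta>. exp (- r * fst z) *\<^sub>R Qr b v r z \<zeta>) (st_lift t \<rho>) (U_tilde T b v B \<rho> P t)"
  have R0: "R_term T b v B \<rho> P r t = 0"
    unfolding R_term_def
    using lift_\<rho>_zero[OF t] lift_B_zero[OF t] integral_upto_zero[OF t] L_vanish[OF tT] by simp
  have "energy b B \<rho> 0 = ereal (\<rho> 0 (\<lambda>x. 1/2 * ((b (0, x) - b (0, x)) \<bullet> (b (0, x) - b (0, x)))))"
    by (rule energy_eq[where \<rho> = \<rho> and B = B and t = 0 and T = T, OF tm\<rho>[OF T0] nn_0 bC bC T0 B_b_0])
  then have E0: "energy b B \<rho> 0 = 0" using torus_zero[OF tm\<rho>[OF T0]] by (simp add: zero_ereal_def)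
  have U0: "B t (\<lambda>_. 0) - \<rho> t (\<lambda>x. b (t, x) \<bullet> 0) = 0" using torus_zero[OF tm\<rho>[OF t]] torus_zero[OF tmB[OF t]] by simp
  have Et: "0 \<le> energy b B \<rho> t" unfolding energy_def
    by (rule kinetic_nonneg) (use U0 torus_zero[OF tm\<rho>[OF t]] in auto)
  have "U_tilde T b v B \<rho> P t (\<lambda>_. 0) = 0" unfolding U_tilde_def
    using lift_\<rho>_zero[OF t] lift_B_zero[OF t] integral_upto_zero[OF t] by simp
  then have "ereal (1/2 * st_lift t \<rho> (\<lambda>z. 0 \<bullet> (exp (- r * fst z) *\<^sub>R Qr b v r z 0))) \<le> ?Q"
    by (intro quad_lower C_st_const) (simp add: linear_0[OF Qr_linear] lift_\<rho>_zero[OF t, of "\<lambda>_. 0"])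
  moreover have "st_lift t \<rho> (\<lambda>z. 0 \<bullet> (exp (- r * fst z) *\<^sub>R Qr b v r z 0)) = 0" by (rule lift_\<rho>_zero[OF t]) simp
  ultimately have Q0: "0 \<le> ?Q" by (simp only: mult_zero_right zero_ereal_def)
  have "dissipation_inequality T b v B \<rho> P r t" by (rule dissipation[OF bC1 vC1 co t])
  then have ineq: "energy b B \<rho> t * ereal (exp (- r * t)) + ?Q \<le> 0"
    unfolding dissipation_inequality_def R0 E0 by (simp add: zero_ereal_def[symmetric])
  have Ee: "0 \<le> energy b B \<rho> t * ereal (exp (- r * t))" using Et by simp
  have "energy b B \<rho> t * ereal (exp (- r * t)) \<le> 0" using ineq Q0 add_increasing2[OF Q0 order_refl] order_trans by blast
  then have Et0: "energy b B \<rho> t \<le> 0" by (simp add: ereal_mult_le_0_iff)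
  have Q1: "?Q \<le> 0" using ineq add_increasing[OF Ee order_refl] order_trans by blast
  show "U_tilde T b v B \<rho> P t \<Theta> = 0" if "\<Theta> \<in> C_st t" for \<Theta> by (rule quad_zero[OF Q1 that])
  have Us: "B t (\<lambda>x. c *\<^sub>R \<Theta> x) - \<rho> t (\<lambda>x. b (t, x) \<bullet> (c *\<^sub>R \<Theta> x)) = c * (B t \<Theta> - \<rho> t (\<lambda>x. b (t, x) \<bullet> \<Theta> x))"
    if "\<Theta> \<in> C_torus" for c \<Theta>
    using in_dual_scale[OF tmB[OF t] that, of c] 
      torus_measure_cmult[OF tm\<rho>[OF t] C_torus_inner[OF C_st_slice[OF bC t] that], of c]
    by (simp add: right_diff_distrib)
  note kp = kinetic_nonpos[OF tm\<rho>[OF t] Et0[unfolded energy_def] U0 Us]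
  show "nonneg_measure (\<rho> t)" by (rule kp(1)) assumption
  show "B t \<Theta> = \<rho> t (\<lambda>x. b (t, x) \<bullet> \<Theta> x)" if "\<Theta> \<in> C_torus" for \<Theta> using kp(2)[OF _ that] by simp
qed

sublocale nonneg_path T \<rho>
  by unfold_locales (rule T wc zero_energy; assumption)+

lemma P_upto:
  assumes t: "t \<in> {0..T}" and \<phi>: "\<phi> \<in> C_st t"
  shows "integral_upto T t P \<phi> = st_lift t \<rho> (\<lambda>z. v z \<bullet> \<phi> z)"
  using zero_energy(3)[OF t C_st_Pair[OF C_st_const[of 0] \<phi>]] lift_\<rho>_zero[OF t] lift_B_zero[OF t]
  unfolding U_tilde_def by simp

lemma P_eq: "\<phi> \<in> C_st T \<Longrightarrow> P \<phi> = st_lift T \<rho> (\<lambda>z. v z \<bullet> \<phi> z)"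
  using P_upto[OF TT] integral_upto_T by simp

lemma B_lift:
  assumes t: "t \<in> {0..T}" and \<phi>: "\<phi> \<in> C_st t"
  shows "st_lift t B \<phi> = st_lift t \<rho> (\<lambda>z. b z \<bullet> \<phi> z)"
  unfolding st_lift_def
  by (rule set_lebesgue_integral_cong) (use zero_energy(2) C_st_slice[OF \<phi>] t in auto)

text \<open>
  The admissible test functions that depend on time alone see only the mass.
\<close>

lemma mass_conserved:
  assumes t: "t \<in> {0..T}"
  shows "mass t = mass 0"
proof (rule constant_of_weak_derivative_zero[OF T mass_continuous _ t])
  fix \<kappa> \<kappa>' :: "real \<Rightarrow> real" and \<epsilon> :: real
  assume \<kappa>: "\<And>s. (\<kappa> has_real_derivative \<kappa>' s) (at s)" and sm: "\<kappa>' \<in> smooth_class" and \<epsilon>: "\<epsilon> > 0"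
    and supp: "\<And>s. \<kappa> s \<noteq> 0 \<Longrightarrow> \<epsilon> \<le> s \<and> s \<le> T - \<epsilon>"
  define \<phi> where "\<phi> z = \<kappa> (fst z)" for z :: "real \<times> (real^'d)"
  have \<kappa>c: "continuous_on S \<kappa>'" for S
    using smooth_class_deriv[OF sm] by (meson DERIV_isCont continuous_at_imp_continuous_on)
  have \<phi>d: "st_deriv T \<phi> (\<lambda>z h. \<kappa>' (fst z) * fst h)" unfolding \<phi>_def by (rule st_deriv_time_fun[OF \<kappa> \<kappa>c])
  have "Ck n (\<lambda>z :: real \<times> (real^'d). 1 * \<kappa> (fst z))" for n
    by (rule Ck_time_function[of \<kappa> "insert \<kappa> smooth_class"]) (use smooth_class_deriv \<kappa> sm in auto)
  then have "\<phi> \<in> test_functions T" unfolding test_functions_def using supp \<epsilon> by (auto simp: \<phi>_def[abs_def])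
  from continuity[OF this] have e: "st_lift T \<rho> (dt T \<phi>) + P (grad \<phi>) = 0" .
  have "grad \<phi> = (\<lambda>_. 0)"
    by (auto simp: grad_def[abs_def] pd_def advect_def \<phi>_def vec_eq_iff fun_eq_iff)
  then have "P (grad \<phi>) = 0" using in_dual_scale[OF stP C_st_const[of 0], of 0] by simp
  moreover have "st_lift T \<rho> (dt T \<phi>) = st_lift T \<rho> (\<lambda>z. \<kappa>' (fst z))"
    by (rule lift_cong) (use dt_eq[OF T \<phi>d] in auto)
  moreover have "st_lift T \<rho> (\<lambda>z. \<kappa>' (fst z)) = integral {0..T} (\<lambda>s. \<rho> s (\<lambda>x. \<kappa>' s))"
    using lift_eq[OF C_st_time[OF \<kappa>c] TT] by simp
  moreover have "integral {0..T} (\<lambda>s. \<rho> s (\<lambda>x. \<kappa>' s)) = integral {0..T} (\<lambda>s. mass s * \<kappa>' s)"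
  proof (rule integral_cong)
    fix s assume "s \<in> {0..T}"
    from torus_measure_cmult[OF tm\<rho>[OF this] C_torus_const[of 1], of "\<kappa>' s"]
    show "\<rho> s (\<lambda>x. \<kappa>' s) = mass s * \<kappa>' s" by (simp add: mult.commute)
  qed
  ultimately show "integral {0..T} (\<lambda>s. mass s * \<kappa>' s) = 0" using e by simp
qed

end

section \<open>The transport equation\<close>

context weak_strong
begin

text \<open>
  Test field \<open>\<beta> = b - exp(rt/2) \<psi> e\<close> with a constant unit vector \<open>e\<close>, and \<open>w = v\<close>.  Then \<open>D = exp(rt/2) \<psi> e\<close> and
  \<open>V = 0\<close>, the weight \<open>exp(-rt)\<close> cancels \<open>|exp(rt/2)|\<^sup>2\<close>, and the right-hand side of the relative energy identity
  reduces to \<open>- \<psi> D\<^sub>t\<psi>\<close>.  The quadratic term is bounded from below by its value at the known field \<open>(D, 0)\<close>.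
\<close>

lemma weighted_inequality:
  assumes \<psi>: "st_deriv T \<psi> \<psi>'" and t: "t \<in> {0..T}"
    and co: "\<And>z \<zeta>. z \<in> slab T \<Longrightarrow> \<zeta> \<bullet> \<zeta> \<le> \<zeta> \<bullet> Qr (\<lambda>z. b z - (exp (r / 2 * fst z) * \<psi> z) *\<^sub>R axis k 1) v r z \<zeta>"
  shows "\<rho> t (\<lambda>x. 1/2 * (\<psi> (t, x))\<^sup>2) - \<rho> 0 (\<lambda>x. 1/2 * (\<psi> (0, x))\<^sup>2)
     \<le> st_lift t \<rho> (\<lambda>z. \<psi> z * \<psi>' z (1, v z))"
proof -
  define e where "e = (axis k 1 :: real^'d)"
  have ee: "e \<bullet> e = 1" by (simp add: e_def inner_axis_axis)
  define a where "a z = exp (r / 2 * fst z)" for z :: "real \<times> (real^'d)"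
  have a: "st_deriv T a (\<lambda>z h. (r / 2 * exp (r / 2 * fst z)) * fst h)"
    unfolding a_def by (rule st_deriv_time_fun) (auto intro!: derivative_eq_intros continuous_intros)
  define d where "d z = a z * \<psi> z" for z
  define d' where "d' z h = a z * \<psi>' z h + (r / 2 * exp (r / 2 * fst z)) * fst h * \<psi> z" for z h
  have d: "st_deriv T d d'" unfolding d_def d'_def by (rule st_deriv_mult[OF a \<psi>])
  define \<beta> where "\<beta> z = b z - d z *\<^sub>R e" for z
  define \<beta>' where "\<beta>' z h = b' z h - d' z h *\<^sub>R e" for z h
  have de: "st_deriv T (\<lambda>z. d z *\<^sub>R e) (\<lambda>z h. d' z h *\<^sub>R e)"
    using st_deriv_scaleR[OF d st_deriv_const[of T e]] by simp
  have \<beta>: "st_deriv T \<beta> \<beta>'" unfolding \<beta>_def \<beta>'_def by (rule st_deriv_diff[OF b de])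
  have \<beta>C: "\<beta> \<in> C_st T" and \<beta>C1: "\<beta> \<in> C1_st T" using st_derivD[OF \<beta>] by blast+
  have co\<beta>: "\<zeta> \<bullet> \<zeta> \<le> \<zeta> \<bullet> Qr \<beta> v r z \<zeta>" if "z \<in> slab T" for z \<zeta>
    using co[OF that, of \<zeta>] by (simp add: \<beta>_def[abs_def] d_def a_def e_def)
  have tT: "t \<le> T" and sub: "z \<in> slab t \<Longrightarrow> z \<in> slab T" for z using t by auto
  note Ct = C_st_mono[OF _ tT]
  define \<kappa> where "\<kappa> z = exp (- r * fst z)" for z :: "real \<times> (real^'d)"
  have \<kappa>C: "\<kappa> \<in> C_st T" unfolding \<kappa>_def by (rule C_st_time) (intro continuous_intros)
  \<comment> \<open>The reason for the factor \<open>exp(rt/2)\<close> in the test field.\<close>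
  have a2: "\<kappa> z * (a z * a z) = 1" for z by (simp add: \<kappa>_def a_def exp_add[symmetric] mult_exp_exp)
  have en: "energy \<beta> B \<rho> s = ereal (\<rho> s (\<lambda>x. 1/2 * (d (s, x))\<^sup>2))" if s: "s \<in> {0..T}" for s
  proof -
    have "energy \<beta> B \<rho> s = ereal (\<rho> s (\<lambda>x. 1/2 * ((b (s, x) - \<beta> (s, x)) \<bullet> (b (s, x) - \<beta> (s, x)))))"
      by (rule energy_eq[where \<rho> = \<rho> and B = B and t = s and T = T, OF tm\<rho>[OF s] zero_energy(1)[OF s] bC \<beta>C s zero_energy(2)[OF s]])
    then show ?thesis by (simp add: \<beta>_def ee power2_eq_square)
  qed
  define u0 where "u0 z = (d z *\<^sub>R e, 0 :: real^'d)" for z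
  have u0C: "u0 \<in> C_st T" unfolding u0_def by (rule C_st_Pair[OF st_derivD(1)[OF de] C_st_const])
  define q where "q z = u0 z \<bullet> Qr \<beta> v r z (u0 z)" for z
  have qC: "q \<in> C_st T" unfolding q_def u0_def
    by (rule Qr_inner_C_st[OF T \<beta> v st_derivD(1)[OF de] C_st_const st_derivD(1)[OF de] C_st_const])
  define S where "S z = L1 T \<beta> v z + b z \<bullet> L2 T \<beta> v z + v z \<bullet> L3 \<beta> v z" for z
  note LC = L_C_st[OF T \<beta> v]
  have SC: "S \<in> C_st T" unfolding S_def by (intro C_st_add C_st_inner LC bC vC)
  have \<psi>C: "(\<lambda>z. \<psi> z * \<psi>' z (1, v z)) \<in> C_st T"
    by (rule C_st_mult[OF st_derivD(1)[OF \<psi>] st_deriv_C_st_apply[OF T \<psi> C_st_const vC]])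
  interpret form: st_form t "\<lambda>z \<zeta>. exp (- r * fst z) *\<^sub>R Qr \<beta> v r z \<zeta>" "exp (- \<bar>r\<bar> * T)"
    by (rule st_form_Qr[OF T \<beta> v t co\<beta>])
  let ?A = "\<lambda>z \<zeta>. exp (- r * fst z) *\<^sub>R Qr \<beta> v r z \<zeta>"
  let ?Q = "st_quad_energy t ?A (st_lift t \<rho>) (U_tilde T \<beta> v B \<rho> P t)"
  have U: "U_tilde T \<beta> v B \<rho> P t \<Theta> = st_lift t \<rho> (\<lambda>z. u0 z \<bullet> \<Theta> z)" if \<Theta>: "\<Theta> \<in> C_st t" for \<Theta>
  proof -
    have C: "(\<lambda>z. b z \<bullet> fst (\<Theta> z)) \<in> C_st t" "(\<lambda>z. \<beta> z \<bullet> fst (\<Theta> z)) \<in> C_st t"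
      by (intro C_st_inner Ct[OF bC] Ct[OF \<beta>C] C_st_fst[OF \<Theta>])+
    have "U_tilde T \<beta> v B \<rho> P t \<Theta> = st_lift t \<rho> (\<lambda>z. b z \<bullet> fst (\<Theta> z)) - st_lift t \<rho> (\<lambda>z. \<beta> z \<bullet> fst (\<Theta> z))"
      unfolding U_tilde_def by (simp add: B_lift[OF t C_st_fst[OF \<Theta>]] P_upto[OF t C_st_snd[OF \<Theta>]])
    also have "\<dots> = st_lift t \<rho> (\<lambda>z. b z \<bullet> fst (\<Theta> z) - \<beta> z \<bullet> fst (\<Theta> z))" by (rule lift_diff[OF C t, symmetric])
    also have "\<dots> = st_lift t \<rho> (\<lambda>z. u0 z \<bullet> \<Theta> z)"
      by (rule lift_cong) (simp add: \<beta>_def u0_def inner_prod_def inner_diff_left)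
    finally show ?thesis .
  qed
  have Q: "ereal (1/2 * st_lift t \<rho> (\<lambda>z. \<kappa> z * q z)) \<le> ?Q"
    using form.quad_lower[where U = "U_tilde T \<beta> v B \<rho> P t" and L = "st_lift t \<rho>" and ?u0.0 = u0,
        OF Ct[OF u0C] U[OF form.A_C_st[OF Ct[OF u0C]]]]
    by (simp add: \<kappa>_def q_def)
  have R: "R_term T \<beta> v B \<rho> P r t = st_lift t \<rho> (\<lambda>z. \<kappa> z * S z)"
  proof -
    have C: "(\<lambda>z. \<kappa> z * L1 T \<beta> v z) \<in> C_st t" "(\<lambda>z. \<kappa> z *\<^sub>R L2 T \<beta> v z) \<in> C_st t" "(\<lambda>z. \<kappa> z *\<^sub>R L3 \<beta> v z) \<in> C_st t"
      by (intro C_st_mult C_st_scaleR Ct \<kappa>C LC)+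
    note Cb = C_st_inner[OF Ct[OF bC] C(2)] and Cv = C_st_inner[OF Ct[OF vC] C(3)]
    have "R_term T \<beta> v B \<rho> P r t = st_lift t \<rho> (\<lambda>z. \<kappa> z * L1 T \<beta> v z) + st_lift t \<rho> (\<lambda>z. b z \<bullet> (\<kappa> z *\<^sub>R L2 T \<beta> v z))
       + st_lift t \<rho> (\<lambda>z. v z \<bullet> (\<kappa> z *\<^sub>R L3 \<beta> v z))"
      unfolding R_term_def \<kappa>_def[symmetric] by (simp only: B_lift[OF t C(2)] P_upto[OF t C(3)])
    also have "\<dots> = st_lift t \<rho> (\<lambda>z. \<kappa> z * L1 T \<beta> v z + b z \<bullet> (\<kappa> z *\<^sub>R L2 T \<beta> v z) + v z \<bullet> (\<kappa> z *\<^sub>R L3 \<beta> v z))"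
      by (simp only: lift_add[OF C_st_add[OF C(1) Cb] Cv t] lift_add[OF C(1) Cb t])
    also have "\<dots> = st_lift t \<rho> (\<lambda>z. \<kappa> z * S z)"
      by (rule lift_cong) (simp add: S_def algebra_simps)
    finally show ?thesis .
  qed
  have id: "\<kappa> z * (1/2 * q z - S z) = - (\<psi> z * \<psi>' z (1, v z))" if zt: "z \<in> slab t" for z
  proof -
    have z: "z \<in> slab T" by (rule sub[OF zt])
    obtain s x where sx: "z = (s, x)" "s \<in> {0..T}" using z by auto
    have D: "b z - \<beta> z = d z *\<^sub>R e" by (simp add: \<beta>_def)
    have D': "b' z (1, v z) - \<beta>' z (1, v z) = d' z (1, v z) *\<^sub>R e" by (simp add: \<beta>'_def)
    have "1/2 * q z - S z = r * (1/2 * (d z * d z)) - d z * d' z (1, v z)"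
      using relative_energy_identity[OF T \<beta> v sx(2) st_derivD(5)[OF b z] st_derivD(5)[OF v z], of v x b r]
        vb[OF z] bv[OF z] D D' ee
      unfolding q_def S_def u0_def sx(1) by simp
    also have "\<dots> = - (a z * a z) * (\<psi> z * \<psi>' z (1, v z))"
      by (simp add: d_def d'_def a_def algebra_simps)
    finally have "\<kappa> z * (1/2 * q z - S z) = - (\<kappa> z * (a z * a z)) * (\<psi> z * \<psi>' z (1, v z))" by simp
    then show ?thesis by (simp add: a2)
  qed
  have "1/2 * st_lift t \<rho> (\<lambda>z. \<kappa> z * q z) - st_lift t \<rho> (\<lambda>z. \<kappa> z * S z)
      = st_lift t \<rho> (\<lambda>z. 1/2 * (\<kappa> z * q z) - \<kappa> z * S z)"
    using lift_cmult[OF Ct[OF C_st_mult[OF \<kappa>C qC]] t, of "1/2"]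
      lift_diff[OF C_st_mult[OF C_st_const Ct[OF C_st_mult[OF \<kappa>C qC]]] Ct[OF C_st_mult[OF \<kappa>C SC]] t, of "1/2"] by simp
  also have "\<dots> = st_lift t \<rho> (\<lambda>z. (- 1) * (\<psi> z * \<psi>' z (1, v z)))"
    by (rule lift_cong) (use id in \<open>simp add: algebra_simps\<close>)
  also have "\<dots> = - st_lift t \<rho> (\<lambda>z. \<psi> z * \<psi>' z (1, v z))"
    using lift_cmult[OF Ct[OF \<psi>C] t, of "- 1"] by simp
  finally have comb: "1/2 * st_lift t \<rho> (\<lambda>z. \<kappa> z * q z) - st_lift t \<rho> (\<lambda>z. \<kappa> z * S z)
      = - st_lift t \<rho> (\<lambda>z. \<psi> z * \<psi>' z (1, v z))" .
  have \<psi>2: "(\<lambda>x. 1/2 * (\<psi> (s, x))\<^sup>2) \<in> C_torus" if "s \<in> {0..T}" for s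
    unfolding power2_eq_square
    by (intro C_torus_mult C_torus_const C_st_slice[OF st_derivD(1)[OF \<psi>] that])
  have Es: "\<rho> s (\<lambda>x. 1/2 * (d (s, x))\<^sup>2) = exp (r * s) * \<rho> s (\<lambda>x. 1/2 * (\<psi> (s, x))\<^sup>2)" if "s \<in> {0..T}" for s
  proof -
    have "(\<lambda>x. 1/2 * (d (s, x))\<^sup>2) = (\<lambda>x. exp (r * s) * (1/2 * (\<psi> (s, x))\<^sup>2))"
      by (rule ext) (simp add: d_def a_def power_mult_distrib power2_eq_square mult_exp_exp)
    then show ?thesis using torus_measure_cmult[OF tm\<rho>[OF that] \<psi>2[OF that], of "exp (r * s)"] by simp
  qed
  have "dissipation_inequality T \<beta> v B \<rho> P r t" by (rule dissipation[OF \<beta>C1 vC1 co\<beta> t])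
  then have "ereal (exp (r * t) * \<rho> t (\<lambda>x. 1/2 * (\<psi> (t, x))\<^sup>2)) * ereal (exp (- r * t))
      + (?Q - ereal (st_lift t \<rho> (\<lambda>z. \<kappa> z * S z))) \<le> ereal (\<rho> 0 (\<lambda>x. 1/2 * (\<psi> (0, x))\<^sup>2))"
    unfolding dissipation_inequality_def en[OF t] en[OF T0] R Es[OF t] Es[OF T0] by simp
  moreover have "ereal (1/2 * st_lift t \<rho> (\<lambda>z. \<kappa> z * q z)) - ereal (st_lift t \<rho> (\<lambda>z. \<kappa> z * S z))
      \<le> ?Q - ereal (st_lift t \<rho> (\<lambda>z. \<kappa> z * S z))"
    using Q by (intro ereal_minus_mono) simp_all
  ultimately have "ereal (exp (r * t) * \<rho> t (\<lambda>x. 1/2 * (\<psi> (t, x))\<^sup>2)) * ereal (exp (- r * t))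
      + (ereal (1/2 * st_lift t \<rho> (\<lambda>z. \<kappa> z * q z)) - ereal (st_lift t \<rho> (\<lambda>z. \<kappa> z * S z)))
      \<le> ereal (\<rho> 0 (\<lambda>x. 1/2 * (\<psi> (0, x))\<^sup>2))"
    using add_left_mono order_trans by blast
  then have "exp (r * t) * \<rho> t (\<lambda>x. 1/2 * (\<psi> (t, x))\<^sup>2) * exp (- r * t)
      + (1/2 * st_lift t \<rho> (\<lambda>z. \<kappa> z * q z) - st_lift t \<rho> (\<lambda>z. \<kappa> z * S z)) \<le> \<rho> 0 (\<lambda>x. 1/2 * (\<psi> (0, x))\<^sup>2)"
    by simp
  moreover have "exp (r * t) * \<rho> t (\<lambda>x. 1/2 * (\<psi> (t, x))\<^sup>2) * exp (- r * t) = \<rho> t (\<lambda>x. 1/2 * (\<psi> (t, x))\<^sup>2)"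
    by (simp add: exp_minus field_simps)
  ultimately show ?thesis unfolding comb by linarith
qed

lemma quadratic_nonpos_imp_zero:
  fixes A C \<epsilon>0 :: real
  assumes "\<epsilon>0 > 0" and q: "\<And>\<epsilon>. \<bar>\<epsilon>\<bar> \<le> \<epsilon>0 \<Longrightarrow> \<epsilon> * A + \<epsilon>\<^sup>2 * C \<le> 0"
  shows "A = 0"
proof (rule ccontr)
  assume A: "A \<noteq> 0"
  \<comment> \<open>So small that the quadratic term is at most half of the linear one.\<close>
  define \<epsilon> where "\<epsilon> = min \<epsilon>0 (\<bar>A\<bar> / (2 * (\<bar>C\<bar> + 1)))"
  have \<epsilon>: "\<epsilon> > 0" "\<epsilon> \<le> \<epsilon>0" "\<epsilon> \<le> \<bar>A\<bar> / (2 * (\<bar>C\<bar> + 1))" using A assms(1) by (auto simp: \<epsilon>_def)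
  have "\<epsilon> * (2 * (\<bar>C\<bar> + 1)) \<le> \<bar>A\<bar>" using \<epsilon>(3) by (simp add: pos_le_divide_eq)
  then have small: "\<epsilon> * \<bar>C\<bar> < \<bar>A\<bar>" using \<epsilon>(1) mult_nonneg_nonneg[of \<epsilon> "\<bar>C\<bar>"] by (simp add: distrib_left)
  have "(sgn A * \<epsilon>) * A + (sgn A * \<epsilon>)\<^sup>2 * C \<le> 0"
    using \<epsilon> A by (intro q) (simp add: abs_mult abs_sgn_eq)
  then have "\<epsilon> * \<bar>A\<bar> + \<epsilon> * (\<epsilon> * C) \<le> 0"
    using A by (simp add: power_mult_distrib sgn_if power2_eq_square split: if_splits) 
  then have "\<epsilon> * (\<bar>A\<bar> + \<epsilon> * C) \<le> 0" by (simp add: distrib_left)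
  then have "\<bar>A\<bar> + \<epsilon> * C \<le> 0" using \<epsilon>(1) by (simp add: mult_le_0_iff)
  moreover have "- (\<epsilon> * \<bar>C\<bar>) \<le> \<epsilon> * C" using \<epsilon>(1) by (simp add: abs_if)
  ultimately show False using small by linarith
qed

text \<open>
  For \<open>\<psi> = 1 + \<epsilon>\<phi>\<close> the terms of order zero cancel by conservation of mass, those of order one are the
  transport equation, and \<open>\<epsilon>\<close> may have either sign.
\<close>

theorem transport:
  assumes \<phi>: "st_deriv T \<phi> \<phi>'" and t: "t \<in> {0..T}"
  shows "\<rho> t (\<lambda>x. \<phi> (t, x)) - \<rho> 0 (\<lambda>x. \<phi> (0, x)) = st_lift t \<rho> (\<lambda>z. \<phi>' z (1, v z))"
proof -
  obtain N where N: "N \<ge> 0" "\<And>z s h. z \<in> slab T \<Longrightarrow> norm (b' z (s, h)) \<le> N * (\<bar>s\<bar> + norm h)" using deriv_bound[OF T b] by blast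
  obtain M where M: "M \<ge> 0" "\<And>z s h. z \<in> slab T \<Longrightarrow> norm (v' z (s, h)) \<le> M * (\<bar>s\<bar> + norm h)" using deriv_bound[OF T v] by blast
  obtain K where K: "K \<ge> 0" "\<And>z s h. z \<in> slab T \<Longrightarrow> norm (\<phi>' z (s, h)) \<le> K * (\<bar>s\<bar> + norm h)" using deriv_bound[OF T \<phi>] by blast
  \<comment> \<open>One unit above the bound \<open>N\<close> for the gradient of \<open>b\<close> is reserved for the perturbation, and \<open>\<epsilon>0\<close> keeps it within.\<close>
  define r where "r = 2 * M + 4 * (N + 1)\<^sup>2 + 1"
  have r0: "r \<ge> 0" using M(1) by (simp add: r_def)
  define \<epsilon>0 where "\<epsilon>0 = 1 / (exp (r / 2 * T) * (K + 1))"
  have \<epsilon>0: "\<epsilon>0 > 0" using K(1) by (simp add: \<epsilon>0_def)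
  note \<phi>C = st_derivD(1)[OF \<phi>]
  have sC: "(\<lambda>x. \<phi> (s, x)) \<in> C_torus" "(\<lambda>x. (\<phi> (s, x))\<^sup>2) \<in> C_torus" if "s \<in> {0..T}" for s
    unfolding power2_eq_square by (intro C_torus_mult C_st_slice[OF \<phi>C that])+
  have \<phi>'C: "(\<lambda>z. \<phi>' z (1, v z)) \<in> C_st t" "(\<lambda>z. \<phi> z * \<phi>' z (1, v z)) \<in> C_st t"
    using C_st_mono[OF st_deriv_C_st_apply[OF T \<phi> C_st_const vC], of t] C_st_mono[OF C_st_mult[OF \<phi>C st_deriv_C_st_apply[OF T \<phi> C_st_const vC]], of t] t by auto
  define A where "A = \<rho> t (\<lambda>x. \<phi> (t, x)) - \<rho> 0 (\<lambda>x. \<phi> (0, x)) - st_lift t \<rho> (\<lambda>z. \<phi>' z (1, v z))"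
  define C where "C = 1/2 * \<rho> t (\<lambda>x. (\<phi> (t, x))\<^sup>2) - 1/2 * \<rho> 0 (\<lambda>x. (\<phi> (0, x))\<^sup>2) - st_lift t \<rho> (\<lambda>z. \<phi> z * \<phi>' z (1, v z))"
  have "\<epsilon> * A + \<epsilon>\<^sup>2 * C \<le> 0" if \<epsilon>: "\<bar>\<epsilon>\<bar> \<le> \<epsilon>0" for \<epsilon>
  proof -
    define \<psi> where "\<psi> z = 1 + \<epsilon> * \<phi> z" for z
    have \<psi>: "st_deriv T \<psi> (\<lambda>z h. \<epsilon> * \<phi>' z h)"
      using st_deriv_add[OF st_deriv_const[of T 1] st_deriv_bounded_linear[OF bounded_linear_mult_right[of \<epsilon>] \<phi>]]
      by (simp add: \<psi>_def[abs_def])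
    have a: "st_deriv T (\<lambda>z::real \<times> (real^'d). exp (r / 2 * fst z)) (\<lambda>z h. (r / 2 * exp (r / 2 * fst z)) * fst h)"
      by (rule st_deriv_time_fun) (auto intro!: derivative_eq_intros continuous_intros)
    \<comment> \<open>Any coordinate direction will do.\<close>
    define k where "k = (undefined :: 'd)"
    have \<beta>: "st_deriv T (\<lambda>z. b z - (exp (r / 2 * fst z) * \<psi> z) *\<^sub>R axis k 1)
       (\<lambda>z h. b' z h - (exp (r / 2 * fst z) * (\<epsilon> * \<phi>' z h) + (r / 2 * exp (r / 2 * fst z)) * fst h * \<psi> z) *\<^sub>R axis k 1)"
      using st_deriv_diff[OF b st_deriv_scaleR[OF st_deriv_mult[OF a \<psi>] st_deriv_const[of T "axis k 1"]]] by simp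
    have co: "\<zeta> \<bullet> \<zeta> \<le> \<zeta> \<bullet> Qr (\<lambda>z. b z - (exp (r / 2 * fst z) * \<psi> z) *\<^sub>R axis k 1) v r z \<zeta>" if z: "z \<in> slab T" for z \<zeta>
    proof (rule Qr_coercive[OF \<beta> v z, of M "N + 1"])
      show "norm (v' z (0, h)) \<le> M * norm h" for h using M(2)[OF z, of 0 h] by simp
      show "2 * M + 4 * (N + 1)\<^sup>2 + 1 \<le> r" by (simp add: r_def)
      fix h
      have "r / 2 * fst z \<le> r / 2 * T" using z r0 by (intro mult_left_mono) auto
      then have ex: "exp (r / 2 * fst z) \<le> exp (r / 2 * T)" by simp
      have "\<bar>exp (r / 2 * fst z) * (\<epsilon> * \<phi>' z (0, h))\<bar> \<le> exp (r / 2 * T) * (\<epsilon>0 * (K * norm h))"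
        unfolding abs_mult using ex \<epsilon> K(2)[OF z, of 0 h] \<epsilon>0 K(1) by (intro mult_mono) auto
      also have "\<dots> = K / (K + 1) * norm h" by (simp add: \<epsilon>0_def)
      also have "\<dots> \<le> 1 * norm h" using K(1) by (intro mult_right_mono) auto
      finally have "norm ((exp (r / 2 * fst z) * (\<epsilon> * \<phi>' z (0, h))) *\<^sub>R (axis k 1 :: real^'d)) \<le> norm h" by (simp add: norm_axis_1)
      moreover have "norm (b' z (0, h)) \<le> N * norm h" using N(2)[OF z, of 0 h] by simp
      ultimately show "norm (b' z (0, h) - (exp (r / 2 * fst z) * (\<epsilon> * \<phi>' z (0, h)) + (r / 2 * exp (r / 2 * fst z)) * fst (0, h) * \<psi> z) *\<^sub>R axis k 1)
          \<le> (N + 1) * norm h"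
        using norm_triangle_ineq4[of "b' z (0, h)" "(exp (r / 2 * fst z) * (\<epsilon> * \<phi>' z (0, h))) *\<^sub>R (axis k 1 :: real^'d)"]
        by (simp add: distrib_right)
    qed
    have exp1: "\<rho> s (\<lambda>x. 1/2 * (\<psi> (s, x))\<^sup>2) = 1/2 * mass 0 + \<epsilon> * \<rho> s (\<lambda>x. \<phi> (s, x)) + \<epsilon>\<^sup>2 * (1/2 * \<rho> s (\<lambda>x. (\<phi> (s, x))\<^sup>2))"
      if s: "s \<in> {0..T}" for s
    proof -
      note m = tm\<rho>[OF s]
      have eq: "(\<lambda>x. 1/2 * (\<psi> (s, x))\<^sup>2) = (\<lambda>x. (1/2 * 1 + \<epsilon> * \<phi> (s, x)) + (\<epsilon>\<^sup>2 * (1/2)) * (\<phi> (s, x))\<^sup>2)"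
        by (rule ext) (simp add: \<psi>_def power2_eq_square algebra_simps)
      have C: "(\<lambda>x. 1/2 * 1 :: real) \<in> C_torus" "(\<lambda>x. \<epsilon> * \<phi> (s, x)) \<in> C_torus" "(\<lambda>x. (\<epsilon>\<^sup>2 * (1/2)) * (\<phi> (s, x))\<^sup>2) \<in> C_torus"
        by (intro C_torus_const C_torus_mult sC[OF s])+
      show ?thesis unfolding eq torus_measure_add[OF m C_torus_add[OF C(1,2)] C(3)] torus_measure_add[OF m C(1,2)]
          torus_measure_cmult[OF m sC(1)[OF s]] torus_measure_cmult[OF m sC(2)[OF s]]
          torus_measure_cmult[OF m C_torus_const[of 1], of "1/2"] mass_conserved[OF s] by simp
    qed
    have exp2: "st_lift t \<rho> (\<lambda>z. \<psi> z * (\<epsilon> * \<phi>' z (1, v z))) = \<epsilon> * st_lift t \<rho> (\<lambda>z. \<phi>' z (1, v z)) + \<epsilon>\<^sup>2 * st_lift t \<rho> (\<lambda>z. \<phi> z * \<phi>' z (1, v z))"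
    proof -
      have eq: "(\<lambda>z. \<psi> z * (\<epsilon> * \<phi>' z (1, v z))) = (\<lambda>z. \<epsilon> * \<phi>' z (1, v z) + \<epsilon>\<^sup>2 * (\<phi> z * \<phi>' z (1, v z)))"
        by (rule ext) (simp add: \<psi>_def power2_eq_square algebra_simps)
      show ?thesis unfolding eq lift_add[OF C_st_mult[OF C_st_const \<phi>'C(1)] C_st_mult[OF C_st_const \<phi>'C(2)] t]
          lift_cmult[OF \<phi>'C(1) t] lift_cmult[OF \<phi>'C(2) t] ..
    qed
    from weighted_inequality[OF \<psi> t co]
    show ?thesis unfolding exp1[OF t] exp1[OF T0] exp2 A_def C_def by (simp add: algebra_simps)
  qed
  then have "A = 0" by (rule quadratic_nonpos_imp_zero[OF \<epsilon>0])
  then show ?thesis by (simp add: A_def)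
qed

end

section \<open>Uniqueness for the transport equation\<close>

text \<open>
  The constant is part of the predicate, because its growth along the scheme below has to be followed.
\<close>

definition C1_torus :: "real \<Rightarrow> (real^'d \<Rightarrow> real) \<Rightarrow> bool" where
  "C1_torus K g \<longleftrightarrow> g \<in> C_torus \<and> (\<exists>g'. (\<forall>x. (g has_derivative g' x) (at x)) \<and>
     (\<forall>h. continuous_on UNIV (\<lambda>x. g' x h)) \<and> (\<forall>x h. \<bar>g' x h\<bar> \<le> K * norm h))"

lemma linear_basis_expand:
  fixes l :: "real^'d \<Rightarrow> real"
  assumes "linear l"
  shows "l h = (\<Sum>i\<in>UNIV. (h $ i) * l (axis i 1))"
proof -
  have "l h = l (\<Sum>i\<in>UNIV. (h $ i) *\<^sub>R axis i 1)" by (simp only: vec_scaleR_basis)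
  then show ?thesis by (simp add: linear_sum[OF assms] linear_scale[OF assms])
qed

locale transported = nonneg_path T \<rho>
  for T :: real and \<rho> :: "real \<Rightarrow> ('d::finite, real) torus_functional" +
  fixes v :: "real \<times> (real^'d) \<Rightarrow> real^'d" and v'
  assumes v: "st_deriv T v v'"
    and transport: "\<And>\<phi> \<phi>' t. st_deriv T \<phi> \<phi>' \<Longrightarrow> t \<in> {0..T} \<Longrightarrow>
      \<rho> t (\<lambda>x. \<phi> (t, x)) - \<rho> 0 (\<lambda>x. \<phi> (0, x)) = st_lift t \<rho> (\<lambda>z. \<phi>' z (1, v z))"
begin

text \<open>
  The transport equation between two times, for a test function that is transported by \<open>v\<close> up to an error \<open>K\<close>.
\<close>

lemma transport_interval:
  assumes \<phi>: "st_deriv T \<phi> \<phi>'" and st: "0 \<le> s" "s \<le> t" "t \<le> T"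
    and K: "\<And>\<tau> x. \<tau> \<in> {s..t} \<Longrightarrow> \<bar>\<phi>' (\<tau>, x) (1, v (\<tau>, x))\<bar> \<le> K" and m: "\<And>t. t \<in> {0..T} \<Longrightarrow> mass t \<le> m"
  shows "\<bar>\<rho> t (\<lambda>x. \<phi> (t, x)) - \<rho> s (\<lambda>x. \<phi> (s, x))\<bar> \<le> (t - s) * (K * m)"
proof -
  have tT: "t \<in> {0..T}" and sT: "s \<in> {0..T}" using st by auto
  have C: "(\<lambda>z. \<phi>' z (1, v z)) \<in> C_st T" by (rule st_deriv_C_st_apply[OF T \<phi> C_st_const st_derivD(1)[OF v]])
  have Ct: "(\<lambda>z. \<phi>' z (1, v z)) \<in> C_st t" and Cs: "(\<lambda>z. \<phi>' z (1, v z)) \<in> C_st s"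
    using C_st_mono[OF C] st by auto
  let ?k = "\<lambda>s. \<rho> s (\<lambda>x. \<phi>' (s, x) (1, v (s, x)))"
  have it: "?k integrable_on {0..t}" by (rule lift_integrable[OF Ct tT])
  have "integral {0..s} ?k + integral {s..t} ?k = integral {0..t} ?k"
    by (rule Henstock_Kurzweil_Integration.integral_combine[OF st(1,2) it])
  then have eq: "\<rho> t (\<lambda>x. \<phi> (t, x)) - \<rho> s (\<lambda>x. \<phi> (s, x)) = integral {s..t} ?k"
    using transport[OF \<phi> tT] transport[OF \<phi> sT] lift_eq[OF Ct tT] lift_eq[OF Cs sT] by linarith
  have "norm (integral {s..t} ?k) \<le> integral {s..t} (\<lambda>_. K * m)"
  proof (rule integral_norm_bound_integral)
    show "?k integrable_on {s..t}" by (rule integrable_on_subinterval[OF it]) (use st in auto)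
    fix \<tau> assume \<tau>: "\<tau> \<in> {s..t}"
    then have \<tau>T: "\<tau> \<in> {0..T}" using st by auto
    have "K \<ge> 0" using K[OF \<tau>, of 0] by linarith
    have "\<bar>?k \<tau>\<bar> \<le> K * mass \<tau>" by (rule abs_le[OF \<tau>T C_st_slice[OF C \<tau>T] K[OF \<tau>]])
    also have "\<dots> \<le> K * m" using m[OF \<tau>T] \<open>K \<ge> 0\<close> by (rule mult_left_mono)
    finally show "norm (?k \<tau>) \<le> K * m" by simp
  next
    show "(\<lambda>_. K * m) integrable_on {s..t}" by (rule integrable_continuous_interval) simp
  qed
  also have "integral {s..t} (\<lambda>_. K * m) = (t - s) * (K * m)" using st by simp
  finally show ?thesis by (simp only: eq real_norm_def)
qed

end

text \<open>
  The function \<open>g\<close> transported backwards from time \<open>t\<close> along straight lines with the velocity frozen at time \<open>s\<close>.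
  It is continuously differentiable when \<open>g\<close> and \<open>v\<close> are.
\<close>

lemma dual_test_function:
  fixes v :: "real \<times> (real^'d) \<Rightarrow> real^'d" and g :: "real^'d \<Rightarrow> real"
  assumes T: "T > 0" and v: "st_deriv T v v'" and s: "s \<in> {0..T}"
    and gC: "g \<in> C_torus" and g: "\<And>x. (g has_derivative g' x) (at x)" and g'c: "\<And>h. continuous_on UNIV (\<lambda>x. g' x h)"
  shows "st_deriv T (\<lambda>z. g (snd z + (t - fst z) *\<^sub>R v (s, snd z)))
     (\<lambda>z h. g' (snd z + (t - fst z) *\<^sub>R v (s, snd z))
        (snd h + ((t - fst z) *\<^sub>R v' (s, snd z) (0, snd h) - fst h *\<^sub>R v (s, snd z))))"
proof (rule st_derivI)
  let ?Y = "\<lambda>z :: real \<times> (real^'d). snd z + (t - fst z) *\<^sub>R v (s, snd z)"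
  have vs: "continuous_on UNIV (\<lambda>x. v (s, x))" using C_st_slice[OF st_derivD(1)[OF v] s] by (simp add: C_torus_def)
  have vs': "continuous_on UNIV (\<lambda>x. v' (s, x) (0, h))" for h
    using C_st_slice[OF st_deriv_C_st[OF T v, of "(0, h)"] s] by (simp add: C_torus_def)
  have gc: "continuous_on UNIV g" using gC by (simp add: C_torus_def)
  have Yc: "continuous_on S ?Y" for S
    by (intro continuous_intros continuous_on_compose2[OF vs]) auto
  have per: "v (s, x + axis i 1) = v (s, x)" for x i
    using C_st_slice[OF st_derivD(1)[OF v] s] by (simp add: C_torus_def)
  show "(\<lambda>z. g (?Y z)) \<in> C_st T"
    unfolding C_st_def
  proof (intro CollectI conjI ballI allI)
    show "continuous_on (slab T) (\<lambda>z. g (?Y z))" by (rule continuous_on_compose2[OF gc Yc]) simp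
    fix \<tau> x i
    have "g ((x + (t - \<tau>) *\<^sub>R v (s, x)) + axis i 1) = g (x + (t - \<tau>) *\<^sub>R v (s, x))" using gC by (simp add: C_torus_def)
    then show "g (?Y (\<tau>, x + axis i 1)) = g (?Y (\<tau>, x))" by (simp add: per algebra_simps)
  qed
  show "((\<lambda>z. g (?Y z)) has_derivative (\<lambda>h. g' (?Y z) (snd h + ((t - fst z) *\<^sub>R v' (s, snd z) (0, snd h) - fst h *\<^sub>R v (s, snd z)))))
      (at z within slab T)" for z
  proof -
    have "((\<lambda>z. v (s, snd z)) has_derivative (\<lambda>h. v' (s, snd z) (0, snd h))) (at z within slab T)"
      by (rule has_derivative_compose[OF has_derivative_snd[OF has_derivative_ident] st_deriv_space[OF v s]])
    moreover have "((\<lambda>z. t - fst z) has_derivative (\<lambda>h. - fst h)) (at z within slab T)"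
      by (auto intro!: derivative_eq_intros)
    ultimately have "((\<lambda>z. (t - fst z) *\<^sub>R v (s, snd z)) has_derivative
        (\<lambda>h. (t - fst z) *\<^sub>R v' (s, snd z) (0, snd h) + (- fst h) *\<^sub>R v (s, snd z))) (at z within slab T)"
      using bounded_bilinear.FDERIV[OF bounded_bilinear_scaleR] by blast
    from has_derivative_add[OF has_derivative_snd[OF has_derivative_ident] this]
    have "(?Y has_derivative (\<lambda>h. snd h + ((t - fst z) *\<^sub>R v' (s, snd z) (0, snd h) - fst h *\<^sub>R v (s, snd z)))) (at z within slab T)"
      by simp
    from has_derivative_compose[OF this g] show ?thesis .
  qed
  fix h :: "real \<times> (real^'d)"
  have lin: "linear (g' x)" for x using has_derivative_linear[OF g] .
  show "continuous_on (slab T) (\<lambda>z. g' (?Y z) (snd h + ((t - fst z) *\<^sub>R v' (s, snd z) (0, snd h) - fst h *\<^sub>R v (s, snd z))))"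
  proof -
    let ?W = "\<lambda>z. snd h + ((t - fst z) *\<^sub>R v' (s, snd z) (0, snd h) - fst h *\<^sub>R v (s, snd z))"
    have eq: "(\<lambda>z. g' (?Y z) (?W z)) = (\<lambda>z. \<Sum>i\<in>UNIV. (?W z $ i) * g' (?Y z) (axis i 1))"
      by (rule ext) (rule linear_basis_expand[OF lin])
    show ?thesis unfolding eq
    by (intro continuous_intros continuous_on_compose2[OF g'c Yc] continuous_on_compose2[OF vs] continuous_on_compose2[OF vs']) auto
  qed
qed

lemma time_lipschitz:
  fixes v :: "real \<times> (real^'d) \<Rightarrow> real^'d"
  assumes v: "st_deriv T v v'" and M: "\<And>z. z \<in> slab T \<Longrightarrow> norm (v' z (1, 0)) \<le> M" and st: "s \<in> {0..T}" "t \<in> {0..T}"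
  shows "norm (v (t, x) - v (s, x)) \<le> M * \<bar>t - s\<bar>"
proof -
  have "norm (v (t, x) - v (s, x)) \<le> M * norm (t - s)"
  proof (rule differentiable_bound[of "{0..T}" "\<lambda>s. v (s, x)" "\<lambda>s h. h *\<^sub>R v' (s, x) (1, 0)"])
    show "((\<lambda>s. v (s, x)) has_derivative (\<lambda>h. h *\<^sub>R v' (\<tau>, x) (1, 0))) (at \<tau> within {0..T})" if "\<tau> \<in> {0..T}" for \<tau>
      using st_deriv_time[OF v that] by (simp add: has_vector_derivative_def)
    show "onorm (\<lambda>h. h *\<^sub>R v' (\<tau>, x) (1, 0)) \<le> M" if "\<tau> \<in> {0..T}" for \<tau>
    proof (rule onorm_le)
      fix h :: real
      have "norm (v' (\<tau>, x) (1, 0)) \<le> M" using M[of "(\<tau>, x)"] that by auto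
      from mult_left_mono[OF this, of "\<bar>h\<bar>"]
      show "norm (h *\<^sub>R v' (\<tau>, x) (1, 0)) \<le> M * norm h" by (simp add: mult.commute[of M])
    qed
  qed (use st in auto)
  then show ?thesis by simp
qed

lemma scheme_step:
  fixes g :: "real^'d \<Rightarrow> real"
  assumes T: "T > 0" and v: "st_deriv T v v'" and s: "s \<in> {0..T}" and h: "0 \<le> h"
    and M: "\<And>z k. z \<in> slab T \<Longrightarrow> norm (v' z (0, k)) \<le> M * norm k" and K: "0 \<le> K" and g: "C1_torus K g"
  shows "C1_torus (K * (1 + h * M)) (\<lambda>x. g (x + h *\<^sub>R v (s, x)))"
proof -
  obtain g' where gC: "g \<in> C_torus" and g': "\<And>x. (g has_derivative g' x) (at x)" "\<And>h. continuous_on UNIV (\<lambda>x. g' x h)"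
     "\<And>x h. \<bar>g' x h\<bar> \<le> K * norm h" using g unfolding C1_torus_def by blast
  let ?\<phi> = "\<lambda>z. g (snd z + (s + h - fst z) *\<^sub>R v (s, snd z))"
  note D = dual_test_function[OF T v s gC g'(1,2), of "s + h"]
  let ?G' = "\<lambda>x k. g' (x + h *\<^sub>R v (s, x)) (k + h *\<^sub>R v' (s, x) (0, k))"
  have "((\<lambda>x. ?\<phi> (s, x)) has_derivative ?G' x) (at x)" for x
    using st_deriv_space[OF D s, of x] by simp
  then have 1: "((\<lambda>x. g (x + h *\<^sub>R v (s, x))) has_derivative ?G' x) (at x)" for x by simp
  have 2: "continuous_on UNIV (\<lambda>x. ?G' x k)" for k
    using C_st_slice[OF st_deriv_C_st[OF T D, of "(0, k)"] s] by (simp add: C_torus_def)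
  have 3: "(\<lambda>x. g (x + h *\<^sub>R v (s, x))) \<in> C_torus" using C_st_slice[OF st_derivD(1)[OF D] s] by simp
  have 4: "\<bar>?G' x k\<bar> \<le> K * (1 + h * M) * norm k" for x k
  proof -
    have "norm (k + h *\<^sub>R v' (s, x) (0, k)) \<le> norm k + h * (M * norm k)"
      using M[of "(s, x)" k] s h by (intro order_trans[OF norm_triangle_ineq]) (auto intro: mult_left_mono)
    then have "K * norm (k + h *\<^sub>R v' (s, x) (0, k)) \<le> K * (norm k + h * (M * norm k))" using K by (rule mult_left_mono)
    then show ?thesis using order_trans[OF g'(3)] by (simp add: algebra_simps)
  qed
  show ?thesis unfolding C1_torus_def
    by (intro conjI exI[of _ ?G'] allI 1 2 3 4)
qed

context transported
begin

text \<open>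
  On the interval \<open>[s,t]\<close> the frozen and the true velocity differ by \<open>O(t - s)\<close>, which is therefore the size
  of \<open>D\<^sub>t\<close> of the dual test function; one further factor comes from the integration over time.
\<close>

lemma scheme_error:
  fixes g :: "real^'d \<Rightarrow> real"
  assumes st: "0 \<le> s" "s \<le> t" "t \<le> T" and g: "C1_torus K g" and K: "0 \<le> K"
    and M: "M \<ge> 0" "\<And>z s h. z \<in> slab T \<Longrightarrow> norm (v' z (s, h)) \<le> M * (\<bar>s\<bar> + norm h)"
    and V: "V \<ge> 0" "\<And>z. z \<in> slab T \<Longrightarrow> norm (v z) \<le> V" and m: "\<And>t. t \<in> {0..T} \<Longrightarrow> mass t \<le> m"
  shows "\<bar>\<rho> t g - \<rho> s (\<lambda>x. g (x + (t - s) *\<^sub>R v (s, x)))\<bar> \<le> K * (M * (1 + V) * m) * (t - s)\<^sup>2"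
proof -
  obtain g' where gC: "g \<in> C_torus" and g': "\<And>x. (g has_derivative g' x) (at x)" "\<And>h. continuous_on UNIV (\<lambda>x. g' x h)"
     "\<And>x h. \<bar>g' x h\<bar> \<le> K * norm h" using g unfolding C1_torus_def by blast
  have s: "s \<in> {0..T}" using st by auto
  note D = dual_test_function[OF T v s gC g'(1,2), of t]
  have "\<bar>g' (x + (t - \<tau>) *\<^sub>R v (s, x)) (v (\<tau>, x) + ((t - \<tau>) *\<^sub>R v' (s, x) (0, v (\<tau>, x)) - 1 *\<^sub>R v (s, x)))\<bar>
      \<le> K * (M * (1 + V) * (t - s))" if \<tau>: "\<tau> \<in> {s..t}" for \<tau> x
  proof -
    have \<tau>T: "\<tau> \<in> {0..T}" using \<tau> st by auto
    have "norm (v (\<tau>, x) - v (s, x)) \<le> M * \<bar>\<tau> - s\<bar>"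
      by (rule time_lipschitz[OF v _ s \<tau>T]) (use M(2)[of _ 1 0] in auto)
    also have "\<dots> \<le> M * (t - s)" using \<tau> M(1) by (intro mult_left_mono) auto
    finally have a: "norm (v (\<tau>, x) - v (s, x)) \<le> M * (t - s)" .
    have "norm ((t - \<tau>) *\<^sub>R v' (s, x) (0, v (\<tau>, x))) \<le> (t - s) * (M * V)"
    proof -
      have "norm (v' (s, x) (0, v (\<tau>, x))) \<le> M * norm (v (\<tau>, x))" using M(2)[of "(s, x)" 0 "v (\<tau>, x)"] s by simp
      also have "\<dots> \<le> M * V" using V(2)[of "(\<tau>, x)"] \<tau>T M(1) by (intro mult_left_mono) auto
      finally show ?thesis using \<tau> M(1) V(1) by (simp add: mult_mono)
    qed
    then have "norm (v (\<tau>, x) + ((t - \<tau>) *\<^sub>R v' (s, x) (0, v (\<tau>, x)) - 1 *\<^sub>R v (s, x))) \<le> M * (t - s) + (t - s) * (M * V)"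
      using norm_triangle_ineq[of "v (\<tau>, x) - v (s, x)" "(t - \<tau>) *\<^sub>R v' (s, x) (0, v (\<tau>, x))"] a
      by (simp add: algebra_simps)
    then have *: "K * norm (v (\<tau>, x) + ((t - \<tau>) *\<^sub>R v' (s, x) (0, v (\<tau>, x)) - 1 *\<^sub>R v (s, x))) \<le> K * (M * (t - s) + (t - s) * (M * V))"
      using K by (rule mult_left_mono)
    have eq: "K * (M * (1 + V) * (t - s)) = K * (M * (t - s) + (t - s) * (M * V))" by (simp add: algebra_simps)
    show ?thesis unfolding eq by (rule order_trans[OF g'(3) *])
  qed
  from transport_interval[OF D st, of "K * (M * (1 + V) * (t - s))" m] this m
  have "\<bar>\<rho> t g - \<rho> s (\<lambda>x. g (x + (t - s) *\<^sub>R v (s, x)))\<bar> \<le> (t - s) * (K * (M * (1 + V) * (t - s)) * m)" by simp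
  then show ?thesis by (simp add: power2_eq_square mult_ac)
qed

end

text \<open>
  Running the scheme from \<open>t\<close> down to \<open>0\<close> in \<open>N\<close> steps of size \<open>h = t/N\<close> accumulates an error
  \<open>N O(h\<^sup>2) (1 + hM)\<^sup>N\<close> for either solution, while the data at time \<open>0\<close> agree.
\<close>

theorem transport_unique:
  fixes g :: "real^'d \<Rightarrow> real"
  assumes 1: "transported T \<rho>1 v v'" and 2: "transported T \<rho>2 v v'"
    and init: "\<And>\<phi>. \<phi> \<in> C_torus \<Longrightarrow> \<rho>1 0 \<phi> = \<rho>2 0 \<phi>" and t: "t \<in> {0..T}" and K: "0 \<le> K" and g: "C1_torus K g"
  shows "\<rho>1 t g = \<rho>2 t g"
proof -
  interpret r1: transported T \<rho>1 v v' by fact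
  interpret r2: transported T \<rho>2 v v' by fact
  note T = r1.T and v = r1.v
  obtain M where M: "M \<ge> 0" "\<And>z s h. z \<in> slab T \<Longrightarrow> norm (v' z (s, h)) \<le> M * (\<bar>s\<bar> + norm h)" using deriv_bound[OF T v] by blast
  obtain V where V: "V > 0" "\<And>z. z \<in> slab T \<Longrightarrow> norm (v z) \<le> V" using C_st_bounded[OF st_derivD(1)[OF v]] by blast
  obtain m1 where m1: "m1 > 0" "\<And>t. t \<in> {0..T} \<Longrightarrow> r1.mass t \<le> m1" using r1.mass_bound by blast
  obtain m2 where m2: "m2 > 0" "\<And>t. t \<in> {0..T} \<Longrightarrow> r2.mass t \<le> m2" using r2.mass_bound by blast
  define C where "C = M * (1 + V) * m1 + M * (1 + V) * m2"
  have C: "C \<ge> 0" using M V m1 m2 by (simp add: C_def)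
  have est: "\<bar>\<rho>1 t g - \<rho>2 t g\<bar> \<le> K * C * exp (M * t) * t\<^sup>2 / real (Suc n)" for n
  proof -
    define N where "N = real (Suc n)"
    have N: "N > 0" by (simp add: N_def)
    define h where "h = t / N"
    have h: "h \<ge> 0" using t N by (simp add: h_def)
    have hM: "1 \<le> 1 + h * M" using h M(1) by simp
    have "\<bar>\<rho>1 (real k * h) g - \<rho>2 (real k * h) g\<bar> \<le> K * C * h\<^sup>2 * real k * (1 + h * M) ^ k"
      if "k \<le> Suc n" "0 \<le> K" "C1_torus K g" for k K and g :: "real^'d \<Rightarrow> real"
      using that
    proof (induction k arbitrary: K g)
      case 0
      then show ?case using init by (simp add: C1_torus_def)
    next
      case (Suc k)
      have le: "real (Suc k) * h \<le> t"
      proof -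
        have "real (Suc k) * h \<le> N * h" using Suc.prems(1) h unfolding N_def by (intro mult_right_mono) auto
        then show ?thesis using N by (simp add: h_def)
      qed
      have st: "0 \<le> real k * h" "real k * h \<le> real (Suc k) * h" "real (Suc k) * h \<le> T"
        using h le t by (auto intro: mult_right_mono)
      have d: "real (Suc k) * h - real k * h = h" by (simp add: algebra_simps)
      let ?G = "\<lambda>x. g (x + h *\<^sub>R v (real k * h, x))"
      have sT: "real k * h \<in> {0..T}" using st by auto
      have G: "C1_torus (K * (1 + h * M)) ?G"
        by (rule scheme_step[OF T v sT h _ Suc.prems(2,3)]) (use M(2)[of _ 0] in auto)
      have V0: "V \<ge> 0" using V by simp
      have e1: "\<bar>\<rho>1 (real (Suc k) * h) g - \<rho>1 (real k * h) ?G\<bar> \<le> K * (M * (1 + V) * m1) * h\<^sup>2"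
        using r1.scheme_error[OF st Suc.prems(3,2) M V0 V(2) m1(2)] unfolding d .
      have e2: "\<bar>\<rho>2 (real (Suc k) * h) g - \<rho>2 (real k * h) ?G\<bar> \<le> K * (M * (1 + V) * m2) * h\<^sup>2"
        using r2.scheme_error[OF st Suc.prems(3,2) M V0 V(2) m2(2)] unfolding d .
      have "\<bar>\<rho>1 (real k * h) ?G - \<rho>2 (real k * h) ?G\<bar> \<le> K * (1 + h * M) * C * h\<^sup>2 * real k * (1 + h * M) ^ k"
        using Suc.prems hM by (intro Suc.IH G) auto
      then have "\<bar>\<rho>1 (real (Suc k) * h) g - \<rho>2 (real (Suc k) * h) g\<bar>
          \<le> K * (1 + h * M) * C * h\<^sup>2 * real k * (1 + h * M) ^ k + (K * (M * (1 + V) * m1) * h\<^sup>2 + K * (M * (1 + V) * m2) * h\<^sup>2)"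
        using e1 e2 by linarith
      also have "\<dots> = K * C * h\<^sup>2 * real k * (1 + h * M) ^ Suc k + K * C * h\<^sup>2 * 1" by (simp add: C_def algebra_simps)
      also have "\<dots> \<le> K * C * h\<^sup>2 * real k * (1 + h * M) ^ Suc k + K * C * h\<^sup>2 * (1 + h * M) ^ Suc k"
        using C Suc.prems(2) one_le_power[OF hM, of "Suc k"]
        by (intro add_left_mono mult_left_mono) (auto simp del: power_Suc)
      also have "\<dots> = K * C * h\<^sup>2 * real (Suc k) * (1 + h * M) ^ Suc k" by (simp add: algebra_simps)
      finally show ?case .
    qed
    from this[of "Suc n" K g] K g
    have "\<bar>\<rho>1 (N * h) g - \<rho>2 (N * h) g\<bar> \<le> K * C * h\<^sup>2 * N * (1 + h * M) ^ Suc n" unfolding N_def by simp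
    also have "N * h = t" using N by (simp add: h_def)
    also have "K * C * h\<^sup>2 * N * (1 + h * M) ^ Suc n \<le> K * C * h\<^sup>2 * N * exp (M * t)"
    proof (rule mult_left_mono)
    show "(1 + h * M) ^ Suc n \<le> exp (M * t)"
    proof -
      have "(1 + h * M) ^ Suc n \<le> exp (h * M) ^ Suc n" using hM exp_ge_add_one_self[of "h * M"] by (intro power_mono) auto
      also have "\<dots> = exp (N * (h * M))" by (simp add: exp_of_nat_mult[symmetric] N_def del: power_Suc)
      also have "N * (h * M) = M * t" using N by (simp add: h_def)
      finally show ?thesis .
    qed
    qed (use K C N in simp)
    also have "K * C * h\<^sup>2 * N * exp (M * t) = K * C * exp (M * t) * t\<^sup>2 / N"
      using N by (simp add: h_def power2_eq_square)
    finally show ?thesis by (simp only: N_def)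
  qed
  have "(\<lambda>n. K * C * exp (M * t) * t\<^sup>2 / real (Suc n)) \<longlonglongrightarrow> 0"
    using LIMSEQ_Suc[OF lim_const_over_n[of "K * C * exp (M * t) * t\<^sup>2"]] by simp
  then have "\<bar>\<rho>1 t g - \<rho>2 t g\<bar> \<le> 0" by (rule LIMSEQ_le_const) (use est in blast)
  then show ?thesis by simp
qed

section \<open>Density of continuously differentiable functions\<close>

text \<open>
  The embedding of the torus into a Euclidean space, on whose image polynomials are dense in the continuous functions by the
  Stone--Weierstrass theorem.
\<close>

definition torus_embedding :: "real^'d \<Rightarrow> (real^'d) \<times> (real^'d)" where
  "torus_embedding x = ((\<chi> i. cos (2 * pi * x $ i)), (\<chi> i. sin (2 * pi * x $ i)))"

lemma torus_embedding_continuous: "continuous_on S torus_embedding"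
  unfolding torus_embedding_def by (intro continuous_intros continuous_on_vec_lambda)

lemma torus_embedding_eq:
  fixes f :: "real^'d \<Rightarrow> 'b"
  assumes eq: "torus_embedding x = torus_embedding y" and p: "\<And>x i. f (x + axis i 1) = f x"
  shows "f x = f y"
proof -
  have "\<exists>n::int. y $ i = x $ i + of_int n" for i
  proof -
    have "sin (2 * pi * y $ i) = sin (2 * pi * x $ i) \<and> cos (2 * pi * y $ i) = cos (2 * pi * x $ i)"
      using eq by (simp add: torus_embedding_def vec_eq_iff)
    then obtain n :: int where "2 * pi * y $ i = 2 * pi * x $ i + 2 * pi * n" unfolding sin_cos_eq_iff by blast
    then have "(2 * pi) * (y $ i) = (2 * pi) * (x $ i + n)" by (simp add: distrib_left)
    then have "y $ i = x $ i + of_int n" by simp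
    then show ?thesis by blast
  qed
  then obtain n :: "'d \<Rightarrow> int" where n: "\<And>i. y $ i = x $ i + of_int (n i)" by metis
  have "y = x + (\<Sum>i\<in>UNIV. of_int (n i) *\<^sub>R axis i 1)"
    using vec_scaleR_basis[of "\<chi> i. of_int (n i)"] by (simp add: vec_eq_iff n)
  then have "f y = f (x + (\<Sum>i\<in>UNIV. of_int (n i) *\<^sub>R axis i 1))" by (rule arg_cong)
  also have "\<dots> = f x" using periodic_int_shift[where f = f and I = UNIV and n = n, OF p] .
  finally show ?thesis ..
qed

text \<open>
  The composition of a polynomial with the embedding is a trigonometric polynomial; the induction
  follows the generation of polynomials by linear functions, constants, sums and products.
\<close>

lemma torus_polynomial_deriv:
  fixes p :: "(real^'d) \<times> (real^'d) \<Rightarrow> real"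
  assumes "real_polynomial_function p"
  shows "\<exists>G. (\<forall>x. ((\<lambda>x. p (torus_embedding x)) has_derivative G x) (at x)) \<and> (\<forall>h. continuous_on UNIV (\<lambda>x. G x h))"
  using assms
proof (induction rule: real_polynomial_function.induct)
  case (linear f)
  define c where "c i = f (axis i 1, 0)" for i :: 'd
  define s where "s i = f (0, axis i 1)" for i :: 'd
  have lf: "linear f" using linear by (rule bounded_linear.linear)
  have "f (a, a') = (\<Sum>i\<in>UNIV. a $ i * c i + a' $ i * s i)" for a a'
  proof -
    have "(a, a') = (\<Sum>i\<in>UNIV. a $ i *\<^sub>R axis i 1, \<Sum>i\<in>UNIV. a' $ i *\<^sub>R axis i 1)" by (simp only: vec_scaleR_basis)
    also have "\<dots> = (\<Sum>i\<in>UNIV. a $ i *\<^sub>R (axis i 1, 0) + a' $ i *\<^sub>R (0, axis i 1))"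
      by (rule prod_eqI) (simp_all add: fst_sum snd_sum)
    finally have "f (a, a') = f (\<Sum>i\<in>UNIV. a $ i *\<^sub>R (axis i 1, 0) + a' $ i *\<^sub>R (0, axis i 1))" by (rule arg_cong)
    then show ?thesis unfolding c_def s_def by (simp only: linear_sum[OF lf] linear_add[OF lf] linear_scale[OF lf] real_scaleR_def)
  qed
  then have eq: "(\<lambda>x. f (torus_embedding x)) = (\<lambda>x. \<Sum>i\<in>UNIV. cos (2 * pi * x $ i) * c i + sin (2 * pi * x $ i) * s i)"
    by (simp add: torus_embedding_def)
  let ?G = "\<lambda>x h :: real^'d. \<Sum>i\<in>UNIV. (- sin (2 * pi * x $ i) * (2 * pi * h $ i)) * c i + (cos (2 * pi * x $ i) * (2 * pi * h $ i)) * s i"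
  have "((\<lambda>x. \<Sum>i\<in>UNIV. cos (2 * pi * x $ i) * c i + sin (2 * pi * x $ i) * s i) has_derivative ?G x) (at x)" for x
    by (intro has_derivative_sum has_derivative_add has_derivative_mult_left)
       (auto intro!: derivative_eq_intros bounded_linear.has_derivative[OF bounded_linear_vec_nth] simp: mult_ac)
  moreover have "continuous_on UNIV (\<lambda>x. ?G x h)" for h by (intro continuous_intros)
  ultimately show ?case unfolding eq by (intro exI[of _ ?G]) blast
next
  case (const c)
  show ?case by (intro exI[of _ "\<lambda>_ _. 0"]) auto
next
  case (add f g)
  then obtain F G where F: "\<forall>x. ((\<lambda>x. f (torus_embedding x)) has_derivative F x) (at x)" "\<forall>h. continuous_on UNIV (\<lambda>x. F x h)"
    and G: "\<forall>x. ((\<lambda>x. g (torus_embedding x)) has_derivative G x) (at x)" "\<forall>h. continuous_on UNIV (\<lambda>x. G x h)" by (elim exE conjE)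
  have "((\<lambda>x. f (torus_embedding x) + g (torus_embedding x)) has_derivative (\<lambda>h. F x h + G x h)) (at x)" for x
    by (rule has_derivative_add[OF F(1)[rule_format] G(1)[rule_format]])
  moreover have "continuous_on UNIV (\<lambda>x. F x h + G x h)" for h
    by (rule continuous_on_add[OF F(2)[rule_format] G(2)[rule_format]])
  ultimately show ?case by (intro exI[of _ "\<lambda>x h. F x h + G x h"] conjI allI)
next
  case (mult f g)
  then obtain F G where F: "\<forall>x. ((\<lambda>x. f (torus_embedding x)) has_derivative F x) (at x)" "\<forall>h. continuous_on UNIV (\<lambda>x. F x h)"
    and G: "\<forall>x. ((\<lambda>x. g (torus_embedding x)) has_derivative G x) (at x)" "\<forall>h. continuous_on UNIV (\<lambda>x. G x h)" by (elim exE conjE)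
  have f: "continuous_on UNIV (\<lambda>x. f (torus_embedding x))"
    by (intro continuous_at_imp_continuous_on ballI) (rule has_derivative_continuous[OF F(1)[rule_format]])
  have g: "continuous_on UNIV (\<lambda>x. g (torus_embedding x))"
    by (intro continuous_at_imp_continuous_on ballI) (rule has_derivative_continuous[OF G(1)[rule_format]])
  have "((\<lambda>x. f (torus_embedding x) * g (torus_embedding x)) has_derivative
      (\<lambda>h. f (torus_embedding x) * G x h + F x h * g (torus_embedding x))) (at x)" for x
    by (rule has_derivative_mult[OF F(1)[rule_format] G(1)[rule_format]])
  moreover have "continuous_on UNIV (\<lambda>x. f (torus_embedding x) * G x h + F x h * g (torus_embedding x))" for h
    by (rule continuous_on_add[OF continuous_on_mult[OF f G(2)[rule_format]] continuous_on_mult[OF F(2)[rule_format] g]])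
  ultimately show ?case
    by (intro exI[of _ "\<lambda>x h. f (torus_embedding x) * G x h + F x h * g (torus_embedding x)"] conjI allI)
qed

text \<open>
  A periodic function factors through the embedding, and the factor is continuous on the compact
  image because the embedding maps the closed subsets of the closed cell to closed sets.
\<close>

lemma C1_torus_dense:
  fixes f :: "real^'d \<Rightarrow> real"
  assumes f: "f \<in> C_torus" and e: "e > 0"
  obtains g K where "K \<ge> 0" "C1_torus K g" "\<And>x. \<bar>f x - g x\<bar> \<le> e"
proof -
  let ?Q = "cbox 0 1 :: (real^'d) set"
  have fc: "continuous_on UNIV f" and fp: "\<And>x i. f (x + axis i 1) = f x" using f by (auto simp: C_torus_def)
  define S where "S = torus_embedding ` ?Q"
  define F where "F y = f (inv_into ?Q torus_embedding y)" for y
  have S: "compact S" unfolding S_def by (intro compact_continuous_image torus_embedding_continuous compact_cbox)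
  have F: "F (torus_embedding x) = f x" if "x \<in> ?Q" for x
    unfolding F_def by (rule torus_embedding_eq[OF _ fp]) (use that in \<open>simp add: f_inv_into_f\<close>)
  have "continuous_on S F"
    unfolding continuous_on_closed_vimage[OF compact_imp_closed[OF S]]
  proof (intro allI impI)
    fix C :: "real set" assume C: "closed C"
    have "F -` C \<inter> S = torus_embedding ` (?Q \<inter> f -` C)" using F by (force simp: S_def)
    moreover have "closed (f -` C)"
      by (rule continuous_closed_vimage[OF C]) (use fc in \<open>simp add: continuous_on_eq_continuous_at\<close>)
    then have "compact (?Q \<inter> f -` C)" by (intro compact_Int_closed compact_cbox)
    ultimately show "closed (F -` C \<inter> S)"
      using compact_continuous_image[OF torus_embedding_continuous] compact_imp_closed by metis
  qed
  from Stone_Weierstrass_polynomial_function[OF S this e]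
  obtain p where p: "polynomial_function p" "\<forall>y\<in>S. norm (F y - p y) < e" by blast
  define g where "g x = p (torus_embedding x)" for x
  obtain G where G: "\<forall>x. (g has_derivative G x) (at x)" "\<forall>h. continuous_on UNIV (\<lambda>x. G x h)"
    using torus_polynomial_deriv[OF p(1)[folded real_polynomial_function_eq]] unfolding g_def by (elim exE conjE)
  have tp: "torus_embedding (x + axis i 1) = torus_embedding x" for x :: "real^'d" and i
    by (auto simp: torus_embedding_def vec_eq_iff axis_def distrib_left)
  have gc: "continuous_on UNIV g"
    by (intro continuous_at_imp_continuous_on ballI) (rule has_derivative_continuous[OF G(1)[rule_format]])
  have gC: "g \<in> C_torus" using gc by (simp add: C_torus_def g_def tp)
  \<comment> \<open>A function of space alone is bounded together with its derivative as a function on a slab.\<close>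
  have D: "st_deriv 1 (\<lambda>z. g (snd z)) (\<lambda>z h. G (snd z) (snd h))"
  proof (rule st_derivI)
    show "(\<lambda>z. g (snd z)) \<in> C_st 1" by (rule C_st_of_torus[OF gC])
    show "((\<lambda>z. g (snd z)) has_derivative (\<lambda>h. G (snd z) (snd h))) (at z within slab 1)" for z
      by (rule has_derivative_compose[OF has_derivative_snd[OF has_derivative_ident] G(1)[rule_format]])
    show "continuous_on (slab 1) (\<lambda>z. G (snd z) (snd h))" for h :: "real \<times> (real^'d)"
      by (rule continuous_on_compose2[OF G(2)[rule_format]]) (auto intro: continuous_intros)
  qed
  obtain K where K: "K \<ge> 0" "\<And>z s h. z \<in> slab 1 \<Longrightarrow> norm (G (snd z) (snd (s, h))) \<le> K * (\<bar>s :: real\<bar> + norm h)"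
    by (rule deriv_bound[OF _ D]) simp_all
  have "\<bar>G x h\<bar> \<le> K * norm h" for x h using K(2)[of "(0, x)" 0 h] by simp
  then have "C1_torus K g" unfolding C1_torus_def by (intro conjI gC exI[of _ G] G allI)
  moreover have "\<bar>f x - g x\<bar> \<le> e" for x
  proof -
    have c: "cell_rep x \<in> ?Q" using cell_rep_in unit_cell_subset by blast
    have "\<bar>f (cell_rep x) - g (cell_rep x)\<bar> < e"
      using bspec[OF p(2), of "torus_embedding (cell_rep x)"] c F[OF c] by (simp add: S_def g_def)
    moreover have "f (cell_rep x) = f x" by (rule periodic_cell_rep[of f x, OF fp])
    moreover have "g (cell_rep x) = g x" using periodic_cell_rep[of g x] gC by (simp add: C_torus_def)
    ultimately show ?thesis by simp
  qed
  ultimately show ?thesis using that K(1) by blast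
qed

theorem transport_unique_measure:
  fixes \<phi> :: "real^'d \<Rightarrow> real"
  assumes 1: "transported T \<rho>1 v v'" and 2: "transported T \<rho>2 v v'"
    and init: "\<And>\<phi>. \<phi> \<in> C_torus \<Longrightarrow> \<rho>1 0 \<phi> = \<rho>2 0 \<phi>" and t: "t \<in> {0..T}" and \<phi>: "\<phi> \<in> C_torus"
  shows "\<rho>1 t \<phi> = \<rho>2 t \<phi>"
proof -
  interpret r1: transported T \<rho>1 v v' by fact
  interpret r2: transported T \<rho>2 v v' by fact
  define m where "m = r1.mass t + r2.mass t"
  have m: "m \<ge> 0" using r1.mass_nonneg[OF t] r2.mass_nonneg[OF t] by (simp add: m_def)
  have "\<bar>\<rho>1 t \<phi> - \<rho>2 t \<phi>\<bar> \<le> 0 + \<epsilon>" if \<epsilon>: "\<epsilon> > 0" for \<epsilon>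
  proof -
    define e where "e = \<epsilon> / (m + 1)"
    have e: "e > 0" "e * m \<le> \<epsilon>" using \<epsilon> m by (auto simp: e_def field_simps)
    obtain g K where g: "K \<ge> 0" "C1_torus K g" and d: "\<And>x. \<bar>\<phi> x - g x\<bar> \<le> e" using C1_torus_dense[OF \<phi> e(1)] by blast
    have gC: "g \<in> C_torus" using g(2) by (simp add: C1_torus_def)
    have "\<bar>\<rho>1 t \<phi> - \<rho>1 t g\<bar> \<le> e * r1.mass t"
      using r1.abs_le[OF t C_torus_diff[OF \<phi> gC] d] torus_measure_diff[OF r1.tm[OF t] \<phi> gC] by simp
    moreover have "\<bar>\<rho>2 t \<phi> - \<rho>2 t g\<bar> \<le> e * r2.mass t"
      using r2.abs_le[OF t C_torus_diff[OF \<phi> gC] d] torus_measure_diff[OF r2.tm[OF t] \<phi> gC] by simp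
    moreover have "\<rho>1 t g = \<rho>2 t g" by (rule transport_unique[OF 1 2 init t g])
    ultimately have "\<bar>\<rho>1 t \<phi> - \<rho>2 t \<phi>\<bar> \<le> e * r1.mass t + e * r2.mass t" by linarith
    then show ?thesis using e(2) by (simp add: m_def distrib_left)
  qed
  then have "\<bar>\<rho>1 t \<phi> - \<rho>2 t \<phi>\<bar> \<le> 0" by (rule field_le_epsilon)
  then show ?thesis by simp
qed

section \<open>Weak-strong uniqueness\<close>

context weak_strong
begin

lemma transported: "transported T \<rho> v v'"
  by unfold_locales (rule v, rule transport)

end

theorem theorem0p3:
  fixes T :: real
    and B :: "real \<times> (real^'d) \<Rightarrow> real^'d"
    and \<rho> :: "real \<times> (real^'d) \<Rightarrow> real"
    and P :: "real \<times> (real^'d) \<Rightarrow> real^'d"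
  assumes "T > 0" and "classical_solution T B \<rho> P"
  shows "dissipative_solution T
           (torus_density (\<lambda>x. B (0, x))) (torus_density (\<lambda>x. \<rho> (0, x)))
           (\<lambda>t. torus_density (\<lambda>x. B (t, x))) (\<lambda>t. torus_density (\<lambda>x. \<rho> (t, x)))
           (st_density T P)
       \<and> (\<forall>B' \<rho>' P'. dissipative_solution T
              (torus_density (\<lambda>x. B (0, x))) (torus_density (\<lambda>x. \<rho> (0, x))) B' \<rho>' P' \<longrightarrow>
            (\<forall>t\<in>{0..T}. (\<forall>\<phi>\<in>C_torus. B' t \<phi> = torus_density (\<lambda>x. B (t, x)) \<phi>) \<and>
                        (\<forall>\<phi>\<in>C_torus. \<rho>' t \<phi> = torus_density (\<lambda>x. \<rho> (t, x)) \<phi>)) \<and>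
            (\<forall>\<phi>\<in>C_st T. P' \<phi> = st_density T P \<phi>))"
proof (intro conjI allI impI)
  show ds: "dissipative_solution T
           (torus_density (\<lambda>x. B (0, x))) (torus_density (\<lambda>x. \<rho> (0, x)))
           (\<lambda>t. torus_density (\<lambda>x. B (t, x))) (\<lambda>t. torus_density (\<lambda>x. \<rho> (t, x)))
           (st_density T P)"
    by (rule classical_imp_dissipative[OF assms])
  fix B' :: "real \<Rightarrow> ('d, real^'d) torus_functional" and \<rho>' :: "real \<Rightarrow> ('d, real) torus_functional"
    and P' :: "('d, real^'d) st_functional"
  assume ds': "dissipative_solution T (torus_density (\<lambda>x. B (0, x))) (torus_density (\<lambda>x. \<rho> (0, x))) B' \<rho>' P'"
  obtain b v b' v' R' where b: "st_deriv T b b'" and v: "st_deriv T v v'" and "st_deriv T \<rho> R'"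
    and "st_deriv T B (\<lambda>z h. \<rho> z *\<^sub>R b' z h + R' z h *\<^sub>R b z)"
    and "st_deriv T P (\<lambda>z h. \<rho> z *\<^sub>R v' z h + R' z h *\<^sub>R v z)"
    and "\<forall>z\<in>slab T. \<rho> z > 0"
    and Bb: "\<forall>z\<in>slab T. B z = \<rho> z *\<^sub>R b z"
    and "\<forall>z\<in>slab T. P z = \<rho> z *\<^sub>R v z"
    and vb: "\<forall>z\<in>slab T. v z = b' z (0, b z)"
    and bv: "\<forall>z\<in>slab T. b' z (1, v z) = v' z (0, b z)"
    and "\<forall>z\<in>slab T. (\<Sum>j\<in>UNIV. pd j (\<lambda>y. B y $ j) z) = 0"
    and "\<forall>z\<in>slab T. dt T \<rho> z + (\<Sum>j\<in>UNIV. pd j (\<lambda>y. P y $ j) z) = 0"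
    by (rule classical_velocity[OF assms])
  have init: "torus_density (\<lambda>x. B (0, x)) \<Theta> = torus_density (\<lambda>x. \<rho> (0, x)) (\<lambda>x. b (0, x) \<bullet> \<Theta> x)" for \<Theta>
    unfolding torus_density_def
    by (rule cell_integral_cong) (use bspec[OF Bb, of "(0, _)"] assms(1) in \<open>simp add: inner_commute mult.commute\<close>)
  interpret c: weak_strong T b v b' v' "torus_density (\<lambda>x. B (0, x))" "torus_density (\<lambda>x. \<rho> (0, x))"
      "\<lambda>t. torus_density (\<lambda>x. B (t, x))" "\<lambda>t. torus_density (\<lambda>x. \<rho> (t, x))" "st_density T P"
    by (rule weak_strong.intro[OF assms(1) b v bspec[OF vb] bspec[OF bv] ds init])
  interpret d: weak_strong T b v b' v' "torus_density (\<lambda>x. B (0, x))" "torus_density (\<lambda>x. \<rho> (0, x))" B' \<rho>' P'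
    by (rule weak_strong.intro[OF assms(1) b v bspec[OF vb] bspec[OF bv] ds' init])
  have \<rho>eq: "\<rho>' t \<phi> = torus_density (\<lambda>x. \<rho> (t, x)) \<phi>" if "t \<in> {0..T}" "\<phi> \<in> C_torus" for t \<phi>
    by (rule transport_unique_measure[OF d.transported c.transported _ that]) (rule d.\<rho>0)
  then show "\<forall>t\<in>{0..T}. (\<forall>\<phi>\<in>C_torus. B' t \<phi> = torus_density (\<lambda>x. B (t, x)) \<phi>) \<and>
                        (\<forall>\<phi>\<in>C_torus. \<rho>' t \<phi> = torus_density (\<lambda>x. \<rho> (t, x)) \<phi>)"
    using d.zero_energy(2) c.zero_energy(2) C_torus_inner[OF C_st_slice[OF c.bC]] by simp
  show "\<forall>\<phi>\<in>C_st T. P' \<phi> = st_density T P \<phi>"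
  proof
    fix \<phi> :: "real \<times> (real^'d) \<Rightarrow> real^'d" assume \<phi>: "\<phi> \<in> C_st T"
    have "st_lift T \<rho>' (\<lambda>z. v z \<bullet> \<phi> z) = st_lift T (\<lambda>t. torus_density (\<lambda>x. \<rho> (t, x))) (\<lambda>z. v z \<bullet> \<phi> z)"
      unfolding st_lift_def
      by (rule set_lebesgue_integral_cong) (use \<rho>eq C_st_slice[OF C_st_inner[OF c.vC \<phi>]] in auto)
    then show "P' \<phi> = st_density T P \<phi>" unfolding d.P_eq[OF \<phi>] c.P_eq[OF \<phi>] .
  qed
qed

end
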